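(* Let $q\in(0,1)$, $\tau,\sigma\in\mathbb R$, $x\in\mathbb T=\{x\in\mathbb C:|x|=1\}$, $y\in -q^{2\mathbb Z}\cup q^{2\sigma+2\mathbb Z}$, $\lambda,\nu,\xi\in\{-1,q^{2\tau}\}$, and $z=\xi q^{2k}$ with $k\in\mathbb Z$. Let $S^{\tau,\sigma}_{x;y,z}=\big((S^{\tau,\sigma}_{x;y,z})_{\nu,\lambda}\big)_{\nu,\lambda\in\{-1,q^{2\tau}\}}$ be the $2\times2$-matrix valued coupling coefficients between the generalized eigenvectors $U^{\tau,\sigma;\nu}_{x,z}$ and $V^{\tau,\sigma;\lambda}_{x,y}$, defined in the context. (i) If $\xi\neq\lambda$, then $\big(S^{\tau,\sigma}_{x;y,z}\big)_{\nu,\lambda}=0$. (ii) If $\xi=\lambda$, then $$\big(S^{\tau,\sigma}_{x;y,z}\big)_{\nu,\lambda}=\begin{cases}\displaystyle(\mathrm{sgn}(\nu))^k\sqrt{\frac{|y|\,w(y;c,d;q^2)}{h^P_k(c,d;z_-,z_+;q^2)}}\;P_k(y;c,d;q^2),&\text{if }\nu\neq\lambda,\\[4mm]\displaystyle(\mathrm{sgn}(\nu))^k\sqrt{\frac{|y|\,w(y;c,d;q^2)}{h^Q_k(c,d;z_-,z_+;q^2)}}\;Q_k(y;c,d;z_-,z_+;q^2),&\text{if }\nu=\lambda,\end{cases}$$ with $$(c,d,z_-,z_+)=\begin{cases}(-\nu q^{1-\tau-\sigma}/x,\ -\nu xq^{1-\tau-\sigma},\ -1,\ q^{2\sigma}),&\text{if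 }\nu\neq\lambda,\\ (xq^{1+\tau-\sigma}/\nu,\ q^{1+\tau-\sigma}/(\nu x),\ -1,\ q^{2\sigma}),&\text{if }\nu=\lambda.\end{cases}$$ (For $\nu\neq\lambda$ and $k<0$ one has $P_k=0$ and the coefficient is $0$.)
   Context: Notation. $\mathbb N=\{0,1,2,\dots\}$, $\mu_x=\frac12(x+x^{-1})$; $(a;q)_\infty=\prod_{j\ge0}(1-aq^j)$, $(a;q)_n=(a;q)_\infty/(aq^n;q)_\infty$, $(a_1,\dots,a_r;q)_n=\prod_i(a_i;q)_n$, $(ax^{\pm1};q)_n=(ax,a/x;q)_n$, $\theta(a;q)=(a;q)_\infty(q/a;q)_\infty$, $\theta(a_1,\dots,a_r;q)=\prod_i\theta(a_i;q)$, and ${}_r\varphi_s(a_1,\dots,a_r;b_1,\dots,b_s;q,z)=\sum_{n\ge0}\frac{(a_1,\dots,a_r;q)_n}{(q,b_1,\dots,b_s;q)_n}\big((-1)^nq^{n(n-1)/2}\big)^{1+s-r}z^n$. All functions below are defined for a base $q$ and used with base $q^2$. Functions in the answer. $P_n(x;c,d;q)=(-c)^nq^{-n(n-1)/2}\,{}_2\varphi_0(q^{-n},cx;-;q,dq^n/c)$ for $n\in\mathbb N$, $P_n=0$ for $n<0$. $Q_n(x;c,d;z_-,z_+;q)=(-d)^nq^{-n(n+1)/2}\dfrac{(cx;q)_\infty\theta(dz_-,dz_+;q)}{(q/(dx),q^{n+1}x/(dz_-z_+);q)_\infty}\,{}_1\varphi_1\big(q/(cx);dz_-z_+q^{-n}/x;q,cz_-z_+q^{-n}/x\big)$,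 $n\in\mathbb Z$. $w(x;c,d;q)=1/(cx,dx;q)_\infty$. $h_n^P(c,d;z_-,z_+;q)=z_+(q;q)_n(cd)^nq^{-n^2}\dfrac{(q;q)_\infty\theta(z_-/z_+,cdz_-z_+;q)}{\theta(cz_-,dz_-,cz_+,dz_+;q)}$ for $n\ge0$, and $h_n^P=0$ for $n<0$. $h_n^Q(c,d;z_-,z_+;q)=z_+(-z_-z_+)^{-n}q^{-n(n+1)/2}(cdz_-z_+q^{-n-1};q)_\infty(q;q)_\infty^2\,\theta(z_-/z_+;q)$. Bases. Let $\{e_n\}_{n\in\mathbb N}$ be the standard orthonormal basis of $\ell^2(\mathbb N)$ and let $U_n^{(a)}(x;q)=(-a)^nq^{n(n-1)/2}{}_2\varphi_1(q^{-n},x^{-1};0;q,qx/a)$ be the Al-Salam–Carlitz polynomials. For $\kappa\in\mathbb R$ put $$m_{x,n}^{\kappa}=i^n\sqrt{\frac{q^{-n(n-1)}\,|x|\,(-q^2x,xq^{2-2\kappa};q^2)_\infty}{q^{2\kappa n}(q^2;q^2)_n(q^2;q^2)_\infty\,\theta(-q^{2\kappa};q^2)}}\;U_n^{(-q^{2\kappa})}(-x;q^2).$$ Put $v_x^{\tau,\infty}=\sum_{n\in\mathbb N}m^{\tau}_{x,n}e_n$ for $x\in-q^{2\mathbb N}\cup q^{2\tau+2\mathbb N}$ and $v_x^{\infty,\sigma}=\sum_{n\in\mathbb N}m^{\sigma}_{x,n}e_n$ for $x\in-q^{2\mathbb N}\cup q^{2\sigma+2\mathbb N}$; each family is an orthonormal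 basis of $\ell^2(\mathbb N)$. By convention $v^{\tau,\infty}_{\lambda q^{-2n}}=0$ for $\lambda\in\{-1,q^{2\tau}\}$ and $v^{\infty,\sigma}_{\zeta q^{-2n}}=0$ for $\zeta\in\{-1,q^{2\sigma}\}$, $n\ge1$. Continuous dual $q$-Hahn functions: $p_n(\mu_x;a,b,c|q)=a^{-n}(ab,ac;q)_n\,{}_3\varphi_2(q^{-n},ax,a/x;ab,ac;q,q)$ (a polynomial in $\mu_x$, symmetric in $a,b,c$); for $x\in\mathbb T$, $w(\mu_x;a,b,c|q)=\dfrac{1}{2\pi\sqrt{1-\mu_x^2}}\dfrac{(x^{\pm2};q)_\infty}{(ax^{\pm1},bx^{\pm1},cx^{\pm1};q)_\infty}$ and $\bar p_n(\mu_x;a,b,c|q)=\sqrt{w(\mu_x;a,b,c|q)\,(q^{n+1},abq^n,acq^n,bcq^n;q)_\infty}\;p_n(\mu_x;a,b,c|q)$; $\bar q_n(\mu_x;a,b|q)=\bar p_n(\mu_x;a,b,0|q)$ (Al-Salam–Chihara case). For $\lambda\in\{-1,q^{2\tau}\}$, $n\in\mathbb N$, $y\in-q^{2\mathbb Z}\cup q^{2\sigma+2\mathbb Z}$ set $m^{\tau,\sigma}_{x,\lambda q^{2n}}=\bar q_n(\mu_x;-\lambda q^{\sigma-\tau+1},\lambda q^{1-\sigma-\tau}|q^2)$ and $c^{\tau,\sigma}_{x,\lambda q^{2n},y}=\bar p_n(\mu_x;-\lambda q^{1-\tau+\sigma},\lambda q^{1-\tau-\sigma},yq^{1+\tau-\sigma}/\lambda\,|q^2)$.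 Big $q$-Laguerre functions: $L_n(x;a,b;q)={}_3\varphi_2(q^{-n},0,x;aq,bq;q,q)$, $$\bar L_n(x;a,b;q)=(-abq^2)^{-n/2}q^{-\frac14n(n-1)}\sqrt{\frac{|x|(x/a,x/b,aq,bq;q)_\infty(aq,bq;q)_n}{|aq|(q,x;q)_\infty\theta(b/a;q)(q;q)_n}}\;L_n(x;a,b;q).$$ For $X\in-q^{2\mathbb N}\cup q^{2\tau+2\mathbb N}$, $Y\in-q^{2\mathbb Z}\cup q^{2\tau+2\mathbb Z}$, $n\in\mathbb N$ set $c^{\tau,\infty}_{X,Y,n}=(\mathrm{sgn}(Y)i)^n\,\bar L_n(-XYq^{2-2\tau};-Y,Yq^{-2\tau};q^2)$; when $Y=\lambda q^{2j}$ with $\lambda\in\{-1,q^{2\tau}\}$ and $j<0$ (degenerate parameters), $\bar L_n(\cdots)$ is read as $\bar L_{n+j}(-\lambda Xq^{2-2\tau};q^{-2j},-\lambda^2q^{-2\tau};q^2)$ for $n\ge-j$ and as $0$ for $n<-j$. Generalized eigenvectors (formal vectors in $\ell^2(\mathbb N)\otimes\ell^2(\mathbb N)$; they arise as generalized eigenvectors, with eigenvalue $\mu_x$, of a self-adjoint element of the quantum $SU(2)$ function algebra in a two-fold tensor product representation, which is not needed to read the statement): $V^{\tau,\infty}_{X,Y}=\sum_{n\in\mathbb N}c^{\tau,\infty}_{X,Y,n}\,v^{\tau,\infty}_{Yq^{2n}}\otimes e_n$; $U^{\tau,\sigma;\nu}_{x,z}=\sum_{n\in\mathbb N}m^{\tau,\sigma}_{x,\nu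 q^{2n}}V^{\tau,\infty}_{\nu q^{2n},zq^{-2n}}$ for $z\in-q^{2\mathbb Z}\cup q^{2\tau+2\mathbb Z}$; $V^{\tau,\sigma;\lambda}_{x,y}=\sum_{n\in\mathbb N}c^{\tau,\sigma}_{x,\lambda q^{2n},y}\,v^{\tau,\infty}_{\lambda q^{2n}}\otimes v^{\infty,\sigma}_{yq^{2n}}$. Coupling coefficients. $S^{\tau,\sigma}_{x;y,z}$ is defined by the (formal) expansion $$U^{\tau,\sigma;\nu}_{x,z}=\sum_{y\in-q^{2\mathbb Z}\cup q^{2\sigma+2\mathbb Z}}\ \sum_{\lambda\in\{-1,q^{2\tau}\}}\big(S^{\tau,\sigma}_{x;y,z}\big)_{\nu,\lambda}V^{\tau,\sigma;\lambda}_{x,y},\qquad\nu\in\{-1,q^{2\tau}\},$$ (tested by taking inner products with the orthonormal basis vectors $v^{\tau,\infty}_{\lambda q^{2n}}\otimes e_m$), and it is the kernel of a unitary operator, i.e. $\sum_yS^{\tau,\sigma}_{x;y,z_1}(S^{\tau,\sigma}_{x;y,z_2})^*=\delta_{z_1z_2}I$ and $\sum_z(S^{\tau,\sigma}_{x;y_1,z})^*S^{\tau,\sigma}_{x;y_2,z}=\delta_{y_1y_2}I$.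
   Formalization: Sign for ν=λ corrected to (-sgn ν)^k; degenerate L̄ in c^{τ,∞} (j<0) gets a factor (-1)^j; at x=±1 the 0/0 weight factor common to U and V is replaced by 1; excluded, as undefined: x=1 with τ-σ an odd integer and x=-1 with τ+σ an odd integer. *)

theory Defs
  imports "HOL-Analysis.Analysis"
begin

section \<open>Basic hypergeometric notation\<close>

definition qpoch_inf :: "'a::real_normed_field \<Rightarrow> 'a \<Rightarrow> 'a" where
  "qpoch_inf a q = (\<Prod>j. 1 - a * q ^ j)"

text \<open>The finite product, since the quotient \<open>(a;q)\<^sub>\<infinity> / (aq\<^sup>n;q)\<^sub>\<infinity>\<close> is \<open>0/0\<close> for
  \<open>a = q\<^sup>-\<^sup>m\<close>, \<open>m \<ge> n\<close>.\<close>

definition qpoch :: "'a::real_normed_field \<Rightarrow> 'a \<Rightarrow> nat \<Rightarrow> 'a" where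
  "qpoch a q n = (\<Prod>j<n. 1 - a * q ^ j)"

definition qtheta :: "'a::real_normed_field \<Rightarrow> 'a \<Rightarrow> 'a" where
  "qtheta a q = qpoch_inf a q * qpoch_inf (q / a) q"

definition qhyp :: "'a::real_normed_field list \<Rightarrow> 'a list \<Rightarrow> 'a \<Rightarrow> 'a \<Rightarrow> 'a" where
  "qhyp as bs q z = (\<Sum>n. (\<Prod>a\<leftarrow>as. qpoch a q n) / (qpoch q q n * (\<Prod>b\<leftarrow>bs. qpoch b q n))
      * ((-1) ^ n * q ^ (n * (n - 1) div 2)) powi (1 + int (length bs) - int (length as)) * z ^ n)"


section \<open>The functions in the coupling coefficients\<close>

definition P_fun :: "int \<Rightarrow> complex \<Rightarrow> complex \<Rightarrow> complex \<Rightarrow> complex \<Rightarrow> complex" where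
  "P_fun n x c d q = (if n < 0 then 0
     else (- c) powi n * q powi (- (n * (n - 1) div 2))
          * qhyp [q powi (- n), c * x] [] q (d * q powi n / c))"

definition Q_fun :: "int \<Rightarrow> complex \<Rightarrow> complex \<Rightarrow> complex \<Rightarrow> complex \<Rightarrow> complex \<Rightarrow> complex \<Rightarrow> complex" where
  "Q_fun n x c d zm zp q =
     (- d) powi n * q powi (- (n * (n + 1) div 2))
     * (qpoch_inf (c * x) q * (qtheta (d * zm) q * qtheta (d * zp) q)
        / (qpoch_inf (q / (d * x)) q * qpoch_inf (q powi (n + 1) * x / (d * zm * zp)) q))
     * qhyp [q / (c * x)] [d * zm * zp * q powi (- n) / x] q (c * zm * zp * q powi (- n) / x)"

definition w_fun :: "complex \<Rightarrow> complex \<Rightarrow> complex \<Rightarrow> complex \<Rightarrow> complex" where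
  "w_fun x c d q = 1 / (qpoch_inf (c * x) q * qpoch_inf (d * x) q)"

definition hP :: "int \<Rightarrow> complex \<Rightarrow> complex \<Rightarrow> complex \<Rightarrow> complex \<Rightarrow> complex \<Rightarrow> complex" where
  "hP n c d zm zp q = (if n < 0 then 0
     else zp * qpoch q q (nat n) * (c * d) powi n * q powi (- (n\<^sup>2))
          * (qpoch_inf q q * (qtheta (zm / zp) q * qtheta (c * d * zm * zp) q)
             / (qtheta (c * zm) q * qtheta (d * zm) q * qtheta (c * zp) q * qtheta (d * zp) q)))"

definition hQ :: "int \<Rightarrow> complex \<Rightarrow> complex \<Rightarrow> complex \<Rightarrow> complex \<Rightarrow> complex \<Rightarrow> complex" where
  "hQ n c d zm zp q =
     zp * (- (zm * zp)) powi (- n) * q powi (- (n * (n + 1) div 2))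
     * qpoch_inf (c * d * zm * zp * q powi (- n - 1)) q * (qpoch_inf q q)\<^sup>2 * qtheta (zm / zp) q"


section \<open>Orthonormal bases\<close>

definition half_lattice :: "real \<Rightarrow> real \<Rightarrow> real set" where
  "half_lattice q \<kappa> = range (\<lambda>n::nat. - (q ^ (2 * n))) \<union> range (\<lambda>n::nat. q powr (2 * \<kappa>) * q ^ (2 * n))"

definition lattice :: "real \<Rightarrow> real \<Rightarrow> real set" where
  "lattice q \<kappa> = range (\<lambda>n::int. - (q powi (2 * n))) \<union> range (\<lambda>n::int. q powr (2 * \<kappa>) * q powi (2 * n))"

definition al_salam_carlitz :: "nat \<Rightarrow> real \<Rightarrow> real \<Rightarrow> real \<Rightarrow> real" where
  "al_salam_carlitz n a x q =
     (- a) ^ n * q ^ (n * (n - 1) div 2) * qhyp [q powi (- int n), inverse x] [0] q (q * x / a)"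

definition m_coeff :: "real \<Rightarrow> real \<Rightarrow> real \<Rightarrow> nat \<Rightarrow> complex" where
  "m_coeff q \<kappa> x n = \<i> ^ n * complex_of_real (
     sqrt (inverse q ^ (n * (n - 1)) * \<bar>x\<bar>
             * (qpoch_inf (- (q\<^sup>2) * x) (q\<^sup>2) * qpoch_inf (x * q powr (2 - 2 * \<kappa>)) (q\<^sup>2))
           / (q powr (2 * \<kappa> * n) * qpoch (q\<^sup>2) (q\<^sup>2) n * qpoch_inf (q\<^sup>2) (q\<^sup>2)
             * qtheta (- (q powr (2 * \<kappa>))) (q\<^sup>2)))
     * al_salam_carlitz n (- (q powr (2 * \<kappa>))) (- x) (q\<^sup>2))"

definition e_vec :: "nat \<Rightarrow> nat \<Rightarrow> complex" where
  "e_vec m = (\<lambda>n. if n = m then 1 else 0)"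

text \<open>\<open>v_vec q \<tau>\<close> is \<open>v\<^bsup>\<tau>,\<infinity>\<^esup>\<close> and \<open>v_vec q \<sigma>\<close> is \<open>v\<^bsup>\<infinity>,\<sigma>\<^esup>\<close>; the value \<open>0\<close> off the
  half lattice is the convention for \<open>\<lambda>q\<^sup>-\<^sup>2\<^sup>n\<close> with \<open>n \<ge> 1\<close>.\<close>

definition v_vec :: "real \<Rightarrow> real \<Rightarrow> real \<Rightarrow> nat \<Rightarrow> complex" where
  "v_vec q \<kappa> x = (\<lambda>n. if x \<in> half_lattice q \<kappa> then m_coeff q \<kappa> x n else 0)"


section \<open>Continuous dual \<open>q\<close>-Hahn functions\<close>

text \<open>As a function of \<open>x\<close> instead of \<open>\<mu>\<^sub>x = (x + x\<^sup>-\<^sup>1)/2\<close>. The factor \<open>(ab,ac;q)\<^sub>n\<close> is multiplied into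
  the series, \<open>(ab;q)\<^sub>n / (ab;q)\<^sub>k = (abq\<^sup>k;q)\<^sub>n\<^sub>-\<^sub>k\<close>, so that this is the polynomial in \<open>\<mu>\<^sub>x\<close> also where
  the \<open>3\<phi>2\<close> has vanishing denominators; this occurs below, for \<open>ac \<in> q\<^sup>-\<^sup>\<nat>\<close>.\<close>

definition cdqH_poly :: "nat \<Rightarrow> complex \<Rightarrow> complex \<Rightarrow> complex \<Rightarrow> complex \<Rightarrow> complex \<Rightarrow> complex" where
  "cdqH_poly n x a b c q = inverse a ^ n *
     (\<Sum>k\<le>n. qpoch (q powi (- int n)) q k * qpoch (a * x) q k * qpoch (a / x) q k / qpoch q q k * q ^ k
            * qpoch (a * b * q ^ k) q (n - k) * qpoch (a * c * q ^ k) q (n - k))"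

text \<open>The parameter-independent factor \<open>(x\<^sup>\<plusminus>\<^sup>2;q)\<^sub>\<infinity> / (2\<pi> sqrt (1 - \<mu>\<^sub>x\<^sup>2))\<close> of the weights. At
  \<open>x = \<plusminus>1\<close> it reads \<open>0/0\<close> and tends to \<open>0\<close>, so all generalized eigenvectors below would vanish and
  determine no coupling coefficients. It multiplies both sides of the expansion defining the coupling
  coefficients; at \<open>x = \<plusminus>1\<close> it is cancelled there by taking it to be \<open>1\<close>.\<close>

definition weight_factor :: "complex \<Rightarrow> complex \<Rightarrow> complex" where
  "weight_factor x q = (if x\<^sup>2 = 1 then 1
     else qpoch_inf (x\<^sup>2) q * qpoch_inf (inverse (x\<^sup>2)) q
          / (2 * complex_of_real pi * csqrt (1 - ((x + inverse x) / 2)\<^sup>2)))"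

definition cdqH_weight :: "complex \<Rightarrow> complex \<Rightarrow> complex \<Rightarrow> complex \<Rightarrow> complex \<Rightarrow> complex" where
  "cdqH_weight x a b c q = weight_factor x q
     / ((qpoch_inf (a * x) q * qpoch_inf (a / x) q) * (qpoch_inf (b * x) q * qpoch_inf (b / x) q)
        * (qpoch_inf (c * x) q * qpoch_inf (c / x) q))"

definition p_bar :: "nat \<Rightarrow> complex \<Rightarrow> complex \<Rightarrow> complex \<Rightarrow> complex \<Rightarrow> complex \<Rightarrow> complex" where
  "p_bar n x a b c q =
     csqrt (cdqH_weight x a b c q
            * (qpoch_inf (q ^ (n + 1)) q * qpoch_inf (a * b * q ^ n) q
               * qpoch_inf (a * c * q ^ n) q * qpoch_inf (b * c * q ^ n) q))
     * cdqH_poly n x a b c q"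

definition q_bar :: "nat \<Rightarrow> complex \<Rightarrow> complex \<Rightarrow> complex \<Rightarrow> complex \<Rightarrow> complex" where
  "q_bar n x a b q = p_bar n x a b 0 q"

text \<open>\<open>m_ts q \<tau> \<sigma> x lam n\<close> is \<open>m\<^bsup>\<tau>,\<sigma>\<^esup>\<close> and \<open>c_ts q \<tau> \<sigma> x lam n y\<close> is \<open>c\<^bsup>\<tau>,\<sigma>\<^esup>\<close> at the point \<open>\<lambda>q\<^sup>2\<^sup>n\<close>.\<close>

definition m_ts :: "real \<Rightarrow> real \<Rightarrow> real \<Rightarrow> complex \<Rightarrow> real \<Rightarrow> nat \<Rightarrow> complex" where
  "m_ts q \<tau> \<sigma> x lam n = q_bar n x
     (complex_of_real (- lam * q powr (\<sigma> - \<tau> + 1))) (complex_of_real (lam * q powr (1 - \<sigma> - \<tau>)))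
     (complex_of_real (q\<^sup>2))"

definition c_ts :: "real \<Rightarrow> real \<Rightarrow> real \<Rightarrow> complex \<Rightarrow> real \<Rightarrow> nat \<Rightarrow> real \<Rightarrow> complex" where
  "c_ts q \<tau> \<sigma> x lam n y = p_bar n x
     (complex_of_real (- lam * q powr (1 - \<tau> + \<sigma>))) (complex_of_real (lam * q powr (1 - \<tau> - \<sigma>)))
     (complex_of_real (y * q powr (1 + \<tau> - \<sigma>) / lam)) (complex_of_real (q\<^sup>2))"


section \<open>Big \<open>q\<close>-Laguerre functions\<close>

definition big_q_laguerre :: "nat \<Rightarrow> real \<Rightarrow> real \<Rightarrow> real \<Rightarrow> real \<Rightarrow> real" where
  "big_q_laguerre n x a b q = qhyp [q powi (- int n), 0, x] [a * q, b * q] q q"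

definition L_bar :: "nat \<Rightarrow> real \<Rightarrow> real \<Rightarrow> real \<Rightarrow> real \<Rightarrow> real" where
  "L_bar n x a b q =
     (- (a * b * q\<^sup>2)) powr (- (real n / 2)) * q powr (- (real n * (real n - 1) / 4))
     * sqrt (\<bar>x\<bar> * (qpoch_inf (x / a) q * qpoch_inf (x / b) q * qpoch_inf (a * q) q * qpoch_inf (b * q) q)
               * (qpoch (a * q) q n * qpoch (b * q) q n)
             / (\<bar>a * q\<bar> * (qpoch_inf q q * qpoch_inf x q) * qtheta (b / a) q * qpoch q q n))
     * big_q_laguerre n x a b q"

text \<open>\<open>c_inf q \<tau> X lam j n\<close> is \<open>c\<^bsup>\<tau>,\<infinity>\<^esup>\<close> at \<open>(X, Y, n)\<close> for \<open>Y = \<lambda>q\<^sup>2\<^sup>j\<close>, \<open>\<lambda> \<in> {-1, q\<^sup>2\<^sup>\<tau>}\<close>.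

  For \<open>j < 0\<close> the parameter \<open>a\<close> (if \<open>\<lambda> = -1\<close>) or \<open>b\<close> (if \<open>\<lambda> = q\<^sup>2\<^sup>\<tau>\<close>) of \<open>L_bar\<close> is \<open>q\<^sup>2\<^sup>j\<close>, and \<open>L_bar\<close>
  is understood by cancelling its zeros and poles: by symmetry let \<open>a\<close> be this parameter, and in base \<open>q\<close>
  combine the part \<open>sqrt ((aq;q)\<^sub>\<infinity> (aq;q)\<^sub>n)\<close> of the prefactor with the denominators \<open>(aq;q)\<^sub>k\<close> of the
  series to \<open>(aq\<^sup>k\<^sup>+\<^sup>1;q)\<^sub>\<infinity> / sqrt ((aq\<^sup>n\<^sup>+\<^sup>1;q)\<^sub>\<infinity>)\<close>. At \<open>a = q\<^sup>j\<close> this vanishes for \<open>n < -j\<close> or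
  \<open>k < -j\<close>, and the remaining series starts at \<open>k = -j\<close>, where \<open>(q\<^sup>-\<^sup>n;q)\<^sub>k\<close> has the sign \<open>(-1)\<^sup>j\<close>. This
  sign is part of the value: without it the vectors \<open>U\<close> below have no expansion in the vectors \<open>V\<close>.\<close>

definition c_inf :: "real \<Rightarrow> real \<Rightarrow> real \<Rightarrow> real \<Rightarrow> int \<Rightarrow> nat \<Rightarrow> complex" where
  "c_inf q \<tau> X lam j n =
     (let Y = lam * q powi (2 * j) in
      (complex_of_real (sgn Y) * \<i>) ^ n * complex_of_real (
        if j \<ge> 0 then L_bar n (- X * Y * q powr (2 - 2 * \<tau>)) (- Y) (Y * q powr (- 2 * \<tau>)) (q\<^sup>2)
        else if int n < - j then 0
        else (- 1) powi j
             * L_bar (nat (int n + j)) (- lam * X * q powr (2 - 2 * \<tau>))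
                 (q powi (- 2 * j)) (- (lam\<^sup>2) * q powr (- 2 * \<tau>)) (q\<^sup>2)))"


section \<open>Generalized eigenvectors and coupling coefficients\<close>

definition l2_inner :: "('i \<Rightarrow> complex) \<Rightarrow> ('i \<Rightarrow> complex) \<Rightarrow> complex" where
  "l2_inner u v = (\<Sum>\<^sub>\<infinity>i. u i * cnj (v i))"

definition tensor :: "(nat \<Rightarrow> complex) \<Rightarrow> (nat \<Rightarrow> complex) \<Rightarrow> nat \<times> nat \<Rightarrow> complex" where
  "tensor u v = (\<lambda>(i, j). u i * v j)"

text \<open>A formal vector in \<open>\<ell>\<^sup>2(\<nat>) \<otimes> \<ell>\<^sup>2(\<nat>)\<close>, a formal series of elementary tensors, is represented by
  the functional \<open>t \<mapsto> \<langle>vector, t\<rangle>\<close> on test vectors \<open>t\<close>, taken term by term.\<close>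

type_synonym formal_vector = "(nat \<times> nat \<Rightarrow> complex) \<Rightarrow> complex"

text \<open>\<open>V\<^bsup>\<tau>,\<infinity>\<^esup>\<close> at \<open>(X, \<lambda>q\<^sup>2\<^sup>j)\<close>\<close>

definition V_inf :: "real \<Rightarrow> real \<Rightarrow> real \<Rightarrow> real \<Rightarrow> int \<Rightarrow> formal_vector" where
  "V_inf q \<tau> X lam j = (\<lambda>t. \<Sum>\<^sub>\<infinity>n::nat. c_inf q \<tau> X lam j n
      * l2_inner (tensor (v_vec q \<tau> (lam * q powi (2 * j) * q ^ (2 * n))) (e_vec n)) t)"

text \<open>\<open>U\<^bsup>\<tau>,\<sigma>;\<nu>\<^esup>\<close> at \<open>(x, z)\<close> for \<open>z = \<xi>q\<^sup>2\<^sup>k\<close>\<close>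

definition U_ts :: "real \<Rightarrow> real \<Rightarrow> real \<Rightarrow> real \<Rightarrow> complex \<Rightarrow> real \<Rightarrow> int \<Rightarrow> formal_vector" where
  "U_ts q \<tau> \<sigma> \<nu> x \<xi> k =
     (\<lambda>t. \<Sum>\<^sub>\<infinity>n::nat. m_ts q \<tau> \<sigma> x \<nu> n * V_inf q \<tau> (\<nu> * q ^ (2 * n)) \<xi> (k - int n) t)"

definition V_ts :: "real \<Rightarrow> real \<Rightarrow> real \<Rightarrow> real \<Rightarrow> complex \<Rightarrow> real \<Rightarrow> formal_vector" where
  "V_ts q \<tau> \<sigma> lam x y = (\<lambda>t. \<Sum>\<^sub>\<infinity>n::nat. c_ts q \<tau> \<sigma> x lam n y
      * l2_inner (tensor (v_vec q \<tau> (lam * q ^ (2 * n))) (v_vec q \<sigma> (y * q ^ (2 * n)))) t)"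

text \<open>\<open>S y z \<nu> lam\<close> is the \<open>(\<nu>,\<lambda>)\<close> entry of the matrix \<open>S\<^sub>x\<^sub>;\<^sub>y\<^sub>,\<^sub>z\<close>, for fixed \<open>x\<close>.\<close>

definition is_coupling_coefficients ::
    "real \<Rightarrow> real \<Rightarrow> real \<Rightarrow> complex \<Rightarrow> (real \<Rightarrow> real \<Rightarrow> real \<Rightarrow> real \<Rightarrow> complex) \<Rightarrow> bool" where
  "is_coupling_coefficients q \<tau> \<sigma> x S \<longleftrightarrow>
     (\<forall>\<nu>\<in>{-1, q powr (2 * \<tau>)}. \<forall>\<xi>\<in>{-1, q powr (2 * \<tau>)}. \<forall>k::int. \<forall>p\<in>half_lattice q \<tau>. \<forall>m::nat.
        ((\<lambda>y. \<Sum>lam\<in>{-1, q powr (2 * \<tau>)}.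
             S y (\<xi> * q powi (2 * k)) \<nu> lam * V_ts q \<tau> \<sigma> lam x y (tensor (v_vec q \<tau> p) (e_vec m)))
         has_sum U_ts q \<tau> \<sigma> \<nu> x \<xi> k (tensor (v_vec q \<tau> p) (e_vec m))) (lattice q \<sigma>))"

end

(* Test the expansion against v_p (x) e_m with p = lambda q^(2n) and m running over the naturals. It
   becomes an expansion of a known sequence in the Al-Salam-Carlitz polynomials, which the
   orthogonality relation inverts; convergence is only that of the stated sums, and the inversion uses
   the Gaussian decay of the polynomials on their support. This writes S_y p_n(y), with p_n a continuous
   dual q-Hahn polynomial in y, as an explicit series, for every n for which y q^(2n) lies in the
   half lattice. Contiguous relations of p_n and of the series cancel the dependence on n and leave two
   relations between S at y, at q^2 y and at neighbouring k. They determine S from its values at the top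
   points y = -1 and y = q^(2 sigma), where the series can be summed, and P_k and Q_k satisfy the same
   relations. *)

theory Submission
  imports Defs "HOL-Computational_Algebra.Formal_Power_Series"
begin

section \<open>Infinite products\<close>

text \<open>The obstacle is division by p_n(y), which may vanish. A lattice point has several
  representations y = -w/r^n, so n is chosen afresh at each point: n = 0 inside the support,
  otherwise w a top point, where the 3phi2 collapses to a single product. That product vanishes only
  at resonances t x^(+-1) \<kappa> r^i = 1; for |x| = 1 these force x = 1 or x = -1 together with an
  odd integer \<tau> - \<sigma> or \<tau> + \<sigma>, which explains the hypotheses at x = 1 and x =
  -1.

  The cases \<nu> \<noteq> \<lambda> and \<nu> = \<lambda> differ only in how (1 - r^(m+1))(1 - a b
  r^m) is split as (1 - A r^m)(1 - B r^(m+1)). For B = 1 the recurrence in k stops at k = 0 and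
  yields the polynomials P_k; for A = r it runs over all integers and yields Q_k. One locale
  therefore serves both. Degenerate big q-Laguerre parameters need no separate relations there:
  1/(q;q)_j is read as 0 for j < 0, and the contiguous relations hold for all integer
  indices.\<close>

lemma qpoch_0 [simp]: "qpoch a q 0 = 1"
  by (simp add: qpoch_def)

lemma qpoch_Suc: "qpoch a q (Suc n) = qpoch a q n * (1 - a * q ^ n)"
  by (simp add: qpoch_def)

lemma qpoch_Suc': "qpoch a q (Suc n) = (1 - a) * qpoch (a * q) q n"
  unfolding qpoch_def by (subst prod.lessThan_Suc_shift) (simp add: mult.assoc)

lemma qpoch_zero_left [simp]: "qpoch 0 q n = 1"
  by (simp add: qpoch_def)

lemma qpoch_add: "qpoch a q (m + n) = qpoch a q m * qpoch (a * q ^ m) q n"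
  by (induction n) (simp_all add: qpoch_Suc power_add mult.assoc)

lemma qpoch_eq_0_iff: "qpoch a q n = 0 \<longleftrightarrow> (\<exists>j<n. a * q ^ j = 1)"
  by (auto simp: qpoch_def)

lemma qpoch_of_real: "qpoch (of_real a) (of_real q) n = of_real (qpoch a q n)"
  by (simp add: qpoch_def)

lemma norm_qpoch_le:
  assumes "norm a \<le> c" "norm q \<le> 1"
  shows "norm (qpoch a q n) \<le> (1 + c) ^ n"
proof (induction n)
  case (Suc n)
  have c: "c \<ge> 0" using norm_ge_zero assms(1) order_trans by blast
  have "norm (1 - a * q ^ n) \<le> 1 + norm a * norm q ^ n"
    by (metis norm_triangle_ineq4 norm_one norm_mult norm_power)
  also have "\<dots> \<le> 1 + c * 1"
    using assms c by (intro add_left_mono mult_mono power_le_one) auto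
  finally have "norm (1 - a * q ^ n) \<le> 1 + c" by simp
  then show ?case
    using mult_mono[OF _ Suc, of "norm (1 - a * q ^ n)" "1 + c"] c by (simp add: qpoch_Suc norm_mult mult.commute)
qed simp

context
  fixes q :: "'a :: {real_normed_field, banach}"
  assumes q: "norm q < 1"
begin

lemma convergent_prod_qpoch: "convergent_prod (\<lambda>j. 1 - a * q ^ j)"
proof -
  have "summable (\<lambda>j. norm ((1 - a * q ^ j) - 1))"
    using q by (simp add: norm_mult norm_power summable_mult summable_geometric)
  then show ?thesis
    by (intro abs_convergent_prod_imp_convergent_prod summable_imp_abs_convergent_prod)
qed

lemma qpoch_inf_has_prod: "(\<lambda>j. 1 - a * q ^ j) has_prod qpoch_inf a q"
  unfolding qpoch_inf_def using convergent_prod_qpoch by blast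

lemma qpoch_tendsto: "(\<lambda>n. qpoch a q n) \<longlonglongrightarrow> qpoch_inf a q"
proof -
  have "(\<lambda>n. \<Prod>i\<le>n. 1 - a * q ^ i) \<longlonglongrightarrow> qpoch_inf a q"
    using convergent_prod_LIMSEQ[OF convergent_prod_qpoch] by (simp add: qpoch_inf_def)
  then have "(\<lambda>n. qpoch a q (Suc n)) \<longlonglongrightarrow> qpoch_inf a q"
    by (simp add: qpoch_def lessThan_Suc_atMost)
  then show ?thesis
    by (rule LIMSEQ_imp_Suc)
qed

lemma qpoch_inf_split: "qpoch_inf a q = qpoch a q n * qpoch_inf (a * q ^ n) q"
proof -
  have "(\<lambda>m. qpoch a q n * qpoch (a * q ^ n) q m) \<longlonglongrightarrow> qpoch a q n * qpoch_inf (a * q ^ n) q"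
    by (intro tendsto_intros qpoch_tendsto)
  moreover have "(\<lambda>m. qpoch a q n * qpoch (a * q ^ n) q m) = (\<lambda>m. qpoch a q (m + n))"
    by (simp add: qpoch_add add.commute[of _ n])
  ultimately show ?thesis
    using LIMSEQ_ignore_initial_segment[OF qpoch_tendsto[of a], of n] LIMSEQ_unique by force
qed

lemma qpoch_inf_rec: "qpoch_inf a q = (1 - a) * qpoch_inf (a * q) q"
  using qpoch_inf_split[of a 1] by (simp add: qpoch_Suc)

lemma qpoch_inf_zero_left [simp]: "qpoch_inf 0 q = 1"
  by (simp add: qpoch_inf_def)

lemma qpoch_inf_eq_0_iff: "qpoch_inf a q = 0 \<longleftrightarrow> (\<exists>j. a * q ^ j = 1)"
  using has_prod_eq_0_iff[OF qpoch_inf_has_prod[of a]] by force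

lemma q_power_neq_1: "n > 0 \<Longrightarrow> q ^ n \<noteq> 1"
  using q by (metis norm_one norm_power power_less_one_iff norm_ge_zero less_irrefl)

lemma qpoch_inf_q_nz [simp]: "qpoch_inf q q \<noteq> 0"
  using q_power_neq_1[of "Suc _"] by (simp add: qpoch_inf_eq_0_iff)

lemma qpoch_q_nz [simp]: "qpoch q q n \<noteq> 0"
  using q_power_neq_1[of "Suc _"] by (auto simp: qpoch_eq_0_iff)

text \<open>The finite products converge to a nonzero limit, so their reciprocals are bounded. This
  supplies the constants of the later majorants.\<close>

lemma inverse_qpoch_Bseq:
  assumes "\<And>j. a * q ^ j \<noteq> 1"
  shows "\<exists>C>0. \<forall>n. norm (1 / qpoch a q n) \<le> C"
proof -
  have "(\<lambda>n. 1 / qpoch a q n) \<longlonglongrightarrow> 1 / qpoch_inf a q"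
    using assms by (intro tendsto_intros qpoch_tendsto) (auto simp: qpoch_inf_eq_0_iff)
  from convergent_imp_Bseq[OF convergentI[OF this]] show ?thesis by (auto simp: Bseq_def)
qed

lemma inverse_qpoch_q_Bseq: "\<exists>C>0. \<forall>n. norm (1 / qpoch q q n) \<le> C"
  using q_power_neq_1[of "Suc _"] by (intro inverse_qpoch_Bseq) auto

end

lemma qpoch_inf_of_real:
  fixes a q :: real
  assumes "\<bar>q\<bar> < 1"
  shows "qpoch_inf (complex_of_real a) (of_real q) = of_real (qpoch_inf a q)"
proof -
  have "(\<lambda>n. complex_of_real (qpoch a q n)) \<longlonglongrightarrow> of_real (qpoch_inf a q)"
    using assms by (intro tendsto_intros qpoch_tendsto) auto
  moreover have "(\<lambda>n. complex_of_real (qpoch a q n)) \<longlonglongrightarrow> qpoch_inf (of_real a) (of_real q)"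
    using assms qpoch_tendsto[of "complex_of_real q" "of_real a"] by (simp add: qpoch_of_real)
  ultimately show ?thesis using LIMSEQ_unique by blast
qed

lemma cnj_qpoch_inf:
  assumes "norm q < 1"
  shows "cnj (qpoch_inf a q) = qpoch_inf (cnj a) (cnj q)"
proof -
  have "(\<lambda>n. cnj (qpoch a q n)) \<longlonglongrightarrow> cnj (qpoch_inf a q)"
    using assms by (intro tendsto_intros qpoch_tendsto) auto
  moreover have "cnj (qpoch a q n) = qpoch (cnj a) (cnj q) n" for n
    by (simp add: qpoch_def)
  ultimately show ?thesis
    using assms qpoch_tendsto[of "cnj q" "cnj a"] LIMSEQ_unique by (metis (no_types, lifting) complex_mod_cnj ext)
qed

lemma qpoch_pos: 
  fixes a q :: real
  assumes "0 < q" "q < 1" "a < 1"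
  shows "qpoch a q n > 0"
proof -
  have "a * q ^ j < 1" for j
  proof (cases "a \<le> 0")
    case True
    have "a * q ^ j \<le> 0" using True assms by (intro mult_nonpos_nonneg) auto
    then show ?thesis by simp
  next
    case False
    have "a * q ^ j \<le> a * 1" using False assms by (intro mult_left_mono power_le_one) auto
    then show ?thesis using assms by simp
  qed
  then show ?thesis by (auto simp: qpoch_def intro!: prod_pos)
qed

lemma qpoch_inf_pos:
  fixes a q :: real
  assumes "0 < q" "q < 1" "a < 1"
  shows "qpoch_inf a q > 0"
proof -
  have "0 \<le> qpoch_inf a q"
    using assms qpoch_pos[OF assms] qpoch_tendsto[of q a]
    by (intro LIMSEQ_le_const[OF qpoch_tendsto]) (auto intro!: less_imp_le)
  moreover have "qpoch_inf a q \<noteq> 0"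
  proof -
    have "a * q ^ j \<noteq> 1" for j
    proof -
      have "qpoch a q (Suc j) > 0" using qpoch_pos[OF assms] .
      then show ?thesis by (auto simp: qpoch_Suc)
    qed
    then show ?thesis using assms by (subst qpoch_inf_eq_0_iff) auto
  qed
  ultimately show ?thesis by simp
qed

text \<open>One product gains the factor 1 - a/q, the other loses 1 - q/a, and the quotient of the
  two is -a/q.\<close>

lemma qtheta_shift:
  fixes a q :: "'a :: {real_normed_field, banach}"
  assumes "norm q < 1" "a \<noteq> 0" "q \<noteq> 0"
  shows "qtheta (a / q) q = - (a / q) * qtheta a q"
proof -
  have 1: "qpoch_inf (a / q) q = (1 - a / q) * qpoch_inf a q"
    using qpoch_inf_rec[OF assms(1), of "a / q"] assms by simp
  have 2: "qpoch_inf (q / a) q = (1 - q / a) * qpoch_inf (q / (a / q)) q"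
    using qpoch_inf_rec[OF assms(1), of "q / a"] assms by (simp add: mult.commute)
  show ?thesis
    unfolding qtheta_def 1 2 using assms by (simp add: divide_simps) (simp add: algebra_simps)
qed

lemma choose2_Suc: "Suc n * (Suc n - 1) div 2 = n * (n - 1) div 2 + n"
  by (cases n) (auto simp: algebra_simps)

lemma qtheta_shift_power:
  fixes a q :: "'a :: {real_normed_field, banach}"
  assumes "norm q < 1" "a \<noteq> 0" "q \<noteq> 0"
  shows "qtheta (a / q ^ n) q = (- a) ^ n / q ^ (n * (n + 1) div 2) * qtheta a q"
proof (induction n)
  case (Suc n)
  have "qtheta (a / q ^ Suc n) q = qtheta (a / q ^ n / q) q"
    by (simp add: field_simps)
  also have "\<dots> = - (a / q ^ n / q) * qtheta (a / q ^ n) q"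
    using assms by (intro qtheta_shift) auto
  also have "Suc n * (Suc n + 1) div 2 = n * (n + 1) div 2 + Suc n"
    by simp
  then have "- (a / q ^ n / q) * qtheta (a / q ^ n) q
      = (- a) ^ Suc n / q ^ (Suc n * (Suc n + 1) div 2) * qtheta a q"
    using assms by (simp only: Suc power_add) (simp add: divide_simps)
  finally show ?case .
qed simp


text \<open>The ratio of consecutive terms of (2c)^m r^(m(m-1)/2) is 2 c r^m, which is below 1 from
  some \<open>M\<close> on. Gaussian factors thus absorb any geometric growth; nearly all
  convergence below rests on this.\<close>

lemma gauss_bound:
  fixes r c :: real
  assumes "0 \<le> r" "r < 1" "0 \<le> c"
  shows "\<exists>C>0. \<forall>m. c ^ m * r ^ (m * (m - 1) div 2) \<le> C * (1/2) ^ m"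
proof -
  have "(\<lambda>n. 2 * c * r ^ n) \<longlonglongrightarrow> 2 * c * 0"
    using assms by (intro tendsto_intros LIMSEQ_power_zero) auto
  then have "eventually (\<lambda>n. 2 * c * r ^ n < 1) sequentially"
    by (simp add: order_tendsto_iff)
  then obtain M where M: "\<And>n. n \<ge> M \<Longrightarrow> 2 * c * r ^ n < 1"
    by (auto simp: eventually_sequentially)
  define f where "f m = (2 * c) ^ m * r ^ (m * (m - 1) div 2)" for m
  have f_Suc: "f (Suc m) = f m * (2 * c * r ^ m)" for m
    unfolding f_def by (subst choose2_Suc) (simp add: power_add)
  have f0: "f m \<ge> 0" for m using assms by (simp add: f_def)
  have dec: "f (M + k) \<le> f M" for k
  proof (induction k)
    case (Suc k)
    have "f (M + k) * (2 * c * r ^ (M + k)) \<le> f (M + k) * 1"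
      using M[of "M + k"] f0[of "M+k"] by (intro mult_left_mono) auto
    then show ?case using Suc by (simp add: f_Suc)
  qed simp
  define C where "C = Max (f ` {..M}) + 1"
  have le: "f m \<le> C" for m
  proof (cases "m \<le> M")
    case True
    then show ?thesis unfolding C_def by (intro order_trans[OF Max_ge[of "f ` {..M}" "f m"]]) auto
  next
    case False
    have "f m \<le> f M" using dec[of "m - M"] False by simp
    also have "f M \<le> C" unfolding C_def by (intro order_trans[OF Max_ge[of "f ` {..M}" "f M"]]) auto
    finally show ?thesis .
  qed
  have "C > 0" using le[of 0] f0[of 0] Max_ge[of "f ` {..M}" "f 0"] f0[of 0] by (auto simp: C_def f_def)
  moreover have "c ^ m * r ^ (m * (m - 1) div 2) \<le> C * (1/2) ^ m" for m
    using le[of m] by (simp add: f_def field_simps power_mult_distrib)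
  ultimately show ?thesis by blast
qed

section \<open>Al-Salam--Carlitz polynomials\<close>

text \<open>The substitution X -> q X, done coefficientwise.\<close>

definition fps_qscale :: "'a::comm_ring_1 \<Rightarrow> 'a fps \<Rightarrow> 'a fps" where
  "fps_qscale q A = Abs_fps (\<lambda>n. q ^ n * fps_nth A n)"

lemma fps_qscale_mult: "fps_qscale q (A * B) = fps_qscale q A * fps_qscale q B"
proof (rule fps_ext)
  fix n
  have "q ^ n * (\<Sum>i=0..n. fps_nth A i * fps_nth B (n - i))
      = (\<Sum>i=0..n. (q ^ i * fps_nth A i) * (q ^ (n - i) * fps_nth B (n - i)))"
    unfolding sum_distrib_left
  proof (rule sum.cong)
    fix i assume "i \<in> {0..n}"
    then have "q ^ n = q ^ i * q ^ (n - i)" by (simp flip: power_add)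
    then show "q ^ n * (fps_nth A i * fps_nth B (n - i))
        = (q ^ i * fps_nth A i) * (q ^ (n - i) * fps_nth B (n - i))" by simp
  qed simp
  then show "fps_nth (fps_qscale q (A * B)) n = fps_nth (fps_qscale q A * fps_qscale q B) n"
    by (simp add: fps_qscale_def fps_mult_nth)
qed

text \<open>The hypotheses say (1 - p X) F(X) = (1 - s X) F(q X) for each generating function.
  Multiplying both equations gives a second order q-difference equation for the product, whose
  coefficients are the convolution. It is used for Al-Salam-Carlitz and for Al-Salam-Chihara
  polynomials.\<close>

lemma convolution_recurrence:
  fixes f g :: "nat \<Rightarrow> 'a::field"
  assumes f: "\<And>n. (1 - q ^ Suc n) * f (Suc n) = (p1 - s1 * q ^ n) * f n"
    and g: "\<And>n. (1 - q ^ Suc n) * g (Suc n) = (p2 - s2 * q ^ n) * g n"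
  defines "h \<equiv> \<lambda>n. \<Sum>i\<le>n. f i * g (n - i)"
  shows "(1 - q ^ Suc (Suc n)) * h (Suc (Suc n))
      = (p1 + p2 - (s1 + s2) * q ^ Suc n) * h (Suc n) - (p1 * p2 - s1 * s2 * q ^ n) * h n"
    and "(1 - q) * h 1 = (p1 + p2 - (s1 + s2)) * h 0"
proof -
  define F where "F = Abs_fps f"
  define G where "G = Abs_fps g"
  define lin where "lin c = (1 - fps_const c * fps_X :: 'a fps)" for c
  have F: "lin p1 * F = lin s1 * fps_qscale q F"
  proof (rule fps_ext)
    fix n show "fps_nth (lin p1 * F) n = fps_nth (lin s1 * fps_qscale q F) n"
      using f[of "n - 1"]
      by (cases n) (auto simp: lin_def F_def fps_qscale_def left_diff_distrib mult.assoc algebra_simps)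
  qed
  have G: "lin p2 * G = lin s2 * fps_qscale q G"
  proof (rule fps_ext)
    fix n show "fps_nth (lin p2 * G) n = fps_nth (lin s2 * fps_qscale q G) n"
      using g[of "n - 1"]
      by (cases n) (auto simp: lin_def G_def fps_qscale_def left_diff_distrib mult.assoc algebra_simps)
  qed
  define H where "H = F * G"
  have H_nth: "fps_nth H n = h n" for n
    by (simp add: H_def fps_mult_nth F_def G_def h_def atMost_atLeast0)
  have "(lin p1 * lin p2) * H = (lin p1 * F) * (lin p2 * G)"
    by (simp add: H_def mult_ac)
  also have "\<dots> = (lin s1 * lin s2) * fps_qscale q H"
    unfolding F G H_def fps_qscale_mult by (simp add: mult_ac)
  finally have eq: "(lin p1 * lin p2) * H = (lin s1 * lin s2) * fps_qscale q H" .
  have lin2: "lin c * lin d = 1 - fps_const (c + d) * fps_X + fps_const (c * d) * (fps_X * fps_X)" for c d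
    unfolding lin_def fps_const_add[symmetric] fps_const_mult[symmetric] by (simp only: algebra_simps mult_1_left mult_1_right)
  have eq': "H - fps_const (p1 + p2) * (fps_X * H) + fps_const (p1 * p2) * (fps_X * (fps_X * H))
     = fps_qscale q H - fps_const (s1 + s2) * (fps_X * fps_qscale q H)
        + fps_const (s1 * s2) * (fps_X * (fps_X * fps_qscale q H))"
    using eq unfolding lin2 by (simp only: algebra_simps mult_1_left)
  have "fps_nth (H - fps_const (p1 + p2) * (fps_X * H) + fps_const (p1 * p2) * (fps_X * (fps_X * H))) m
     = fps_nth (fps_qscale q H - fps_const (s1 + s2) * (fps_X * fps_qscale q H)
        + fps_const (s1 * s2) * (fps_X * (fps_X * fps_qscale q H))) m" for m
    using eq' by simp
  from this[of "Suc (Suc n)"] this[of 1]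
  show "(1 - q ^ Suc (Suc n)) * h (Suc (Suc n))
      = (p1 + p2 - (s1 + s2) * q ^ Suc n) * h (Suc n) - (p1 * p2 - s1 * s2 * q ^ n) * h n"
    and "(1 - q) * h 1 = (p1 + p2 - (s1 + s2)) * h 0"
    by (simp_all add: H_nth fps_qscale_def algebra_simps)
qed

text \<open>The monic Al-Salam-Carlitz polynomials by their three-term recurrence. Unlike the 2phi1
  with its argument 1/w, this form also makes sense at w = 0, the accumulation point of the
  support.\<close>

fun ascU :: "'a::real_normed_field \<Rightarrow> 'a \<Rightarrow> nat \<Rightarrow> 'a \<Rightarrow> 'a" where
  "ascU \<alpha> q 0 w = 1"
| "ascU \<alpha> q (Suc 0) w = w - (1 + \<alpha>)"
| "ascU \<alpha> q (Suc (Suc m)) w =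
     (w - (1 + \<alpha>) * q ^ Suc m) * ascU \<alpha> q (Suc m) w + \<alpha> * q ^ m * (1 - q ^ Suc m) * ascU \<alpha> q m w"

lemma ascU_rec:
  "ascU \<alpha> q (Suc m) w = (w - (1 + \<alpha>) * q ^ m) * ascU \<alpha> q m w
     + \<alpha> * q ^ (m - 1) * (1 - q ^ m) * ascU \<alpha> q (m - 1) w"
  by (cases m) simp_all

text \<open>The lowering operator: the q-derivative sends U_m to a multiple of U_(m-1). Induction
  along the recurrence.\<close>

lemma ascU_qdiff: "ascU \<alpha> q m w - ascU \<alpha> q m (q * w) = (1 - q ^ m) * w * ascU \<alpha> q (m - 1) w"
proof (induction \<alpha> q m w rule: ascU.induct)
  case (3 \<alpha> q m w)
  have 1: "ascU \<alpha> q (Suc m) (q * w) = ascU \<alpha> q (Suc m) w - (1 - q ^ Suc m) * w * ascU \<alpha> q m w"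
    using 3(1) by (simp add: algebra_simps)
  have 2: "ascU \<alpha> q m (q * w) = ascU \<alpha> q m w - (1 - q ^ m) * w * ascU \<alpha> q (m - 1) w"
    using 3(2) by (simp add: algebra_simps)
  show ?case
  proof (cases m)
    case 0
    then show ?thesis using 1 by (simp add: algebra_simps power2_eq_square)
  next
    case (Suc m')
    show ?thesis
      unfolding ascU.simps(3)[of \<alpha> q m] 1 2 unfolding ascU_rec[of \<alpha> q m w]
      by (simp add: Suc) algebra
  qed
qed (simp_all add: algebra_simps)

text \<open>The raising operator adjoint to \<open>ascU_qdiff\<close>; combined with the q-Pearson
  equation of the weight it turns sums against U_(m+1) into telescoping ones.\<close>

lemma ascU_raise:
  "(1 - q * v) * (\<alpha> - q * v) * q ^ m * ascU \<alpha> q m v - \<alpha> * q ^ m * ascU \<alpha> q m (q * v)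
     = q * v * ascU \<alpha> q (Suc m) (q * v)"
proof -
  have 1: "ascU \<alpha> q (Suc m) (q * v) = ascU \<alpha> q (Suc m) v - (1 - q ^ Suc m) * v * ascU \<alpha> q m v"
    using ascU_qdiff[of \<alpha> q "Suc m" v] by (simp add: algebra_simps)
  have 2: "ascU \<alpha> q m (q * v) = ascU \<alpha> q m v - (1 - q ^ m) * v * ascU \<alpha> q (m - 1) v"
    using ascU_qdiff[of \<alpha> q m v] by (simp add: algebra_simps)
  show ?thesis
    unfolding 1 2 unfolding ascU_rec[of \<alpha> q m v]
    by (cases m) (simp_all add: algebra_simps)
qed

text \<open>Rescaling by \<alpha> exchanges the two branches q^i and \<alpha> q^i of the support, so
  that estimates at the points q^i suffice.\<close>

lemma ascU_sym:
  assumes "\<alpha> \<noteq> 0"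
  shows "ascU \<alpha> q m (\<alpha> * w) = \<alpha> ^ m * ascU (1 / \<alpha>) q m w"
proof (induction m rule: induct_nat_012)
  case (ge2 n)
  show ?case
    unfolding ascU.simps(3) ge2 using assms by (simp add: field_simps)
qed (use assms in \<open>simp_all add: field_simps\<close>)

lemma ascU_one: "ascU \<alpha> q m 1 = (- \<alpha>) ^ m * q ^ (m * (m - 1) div 2)"
proof -
  \<comment> \<open>The rule \<open>ascU.induct\<close> needs a variable argument, hence
    \<open>v\<close> with the premise v = 1.\<close>
  have "ascU \<alpha> q m v = (- \<alpha>) ^ m * q ^ (m * (m - 1) div 2)" if "v = 1" for v
    using that
  proof (induction \<alpha> q m v rule: ascU.induct)
    case (3 \<alpha> q m w)
    note [simp] = choose2_Suc power_add
    have e: "Suc (Suc m) * (Suc (Suc m) - 1) div 2 = m * (m - 1) div 2 + m + Suc m"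
      by (simp only: choose2_Suc)
    have e1: "Suc m * (Suc m - 1) div 2 = m * (m - 1) div 2 + m"
      by (simp only: choose2_Suc)
    have 1: "ascU \<alpha> q (Suc m) w = (- \<alpha>) ^ Suc m * (q ^ (m * (m - 1) div 2) * q ^ m)"
      using 3 by (simp only: e1 power_add)
    have 2: "ascU \<alpha> q m w = (- \<alpha>) ^ m * q ^ (m * (m - 1) div 2)"
      using 3 by blast
    show ?case
      unfolding ascU.simps(3) 1 2 e power_add using 3(3) by (simp add: algebra_simps)
  qed simp_all
  then show ?thesis by simp
qed

text \<open>This is w^j (1/w;q)_j without the division by w. At w = q^i it vanishes for j >
  i.\<close>

definition ascU_node :: "'a::real_normed_field \<Rightarrow> 'a \<Rightarrow> nat \<Rightarrow> 'a" where
  "ascU_node q w j = (\<Prod>l<j. w - q ^ l)"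

text \<open>U_m/(q;q)_m is the convolution of two sequences with first order recurrences, (p,s) =
  (w,1) and (0,\<alpha>); \<open>convolution_recurrence\<close> then gives the recurrence of
  \<open>ascU\<close>.\<close>

lemma ascU_explicit:
  fixes q :: "'a :: {real_normed_field, banach}"
  assumes q: "norm q < 1"
  shows "ascU \<alpha> q m w = qpoch q q m * (\<Sum>j\<le>m. ascU_node q w j / qpoch q q j
      * ((- \<alpha>) ^ (m - j) * q ^ ((m - j) * (m - j - 1) div 2) / qpoch q q (m - j)))"
proof -
  note nz = qpoch_q_nz[OF q]
  define f where "f j = ascU_node q w j / qpoch q q j" for j
  define g where "g i = (- \<alpha>) ^ i * q ^ (i * (i - 1) div 2) / qpoch q q i" for i
  define h where "h n = (\<Sum>i\<le>n. f i * g (n - i))" for n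
  have one_nz: "1 - q * q ^ n \<noteq> 0" for n
    using q_power_neq_1[OF q, of "Suc n"] by simp
  have f: "(1 - q ^ Suc n) * f (Suc n) = (w - 1 * q ^ n) * f n" for n
    using nz one_nz by (simp add: f_def ascU_node_def qpoch_Suc field_simps)
  have g: "(1 - q ^ Suc n) * g (Suc n) = (0 - \<alpha> * q ^ n) * g n" for n
    unfolding g_def choose2_Suc power_add using nz one_nz by (simp add: qpoch_Suc field_simps)
  note rec = convolution_recurrence[where f = f and g = g, OF f g, folded h_def]
  have "qpoch q q n * h n = ascU \<alpha> q n w" for n
  proof (induction n rule: induct_nat_012)
    case 0
    show ?case by (simp add: h_def f_def g_def ascU_node_def)
  next
    case 1
    show ?case using rec(2) by (simp add: qpoch_Suc h_def f_def g_def ascU_node_def)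
  next
    case (ge2 n)
    have "qpoch q q (Suc (Suc n)) * h (Suc (Suc n))
        = qpoch q q (Suc n) * ((1 - q ^ Suc (Suc n)) * h (Suc (Suc n)))"
      by (simp add: qpoch_Suc)
    also have "\<dots> = (w - (1 + \<alpha>) * q ^ Suc n) * (qpoch q q (Suc n) * h (Suc n))
        + \<alpha> * q ^ n * (1 - q ^ Suc n) * (qpoch q q n * h n)"
      unfolding rec(1) by (simp add: qpoch_Suc algebra_simps)
    finally show ?case using ge2 by simp
  qed
  from this[of m] show ?thesis by (simp add: h_def f_def g_def)
qed



text \<open>Reversal of (q^(-n);q)_l, kept free of negative powers by multiplying with q^(n
  l).\<close>

lemma qpoch_neg_power:
  fixes q :: "'a :: real_normed_field"
  assumes "l \<le> n" "q \<noteq> 0"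
  shows "qpoch (q powi (- int n)) q l * qpoch q q (n - l) * q ^ (n * l)
      = (-1) ^ l * q ^ (l * (l - 1) div 2) * qpoch q q n"
  using assms(1)
proof (induction l)
  case (Suc l)
  have nl: "n - l = Suc (n - Suc l)" using Suc by simp
  have "qpoch q q (n - l) = qpoch q q (n - Suc l) * (1 - q ^ (n - l))"
    unfolding nl qpoch_Suc by simp
  moreover have "(1 - q powi (- int n) * q ^ l) * q ^ n = - (q ^ l) * (1 - q ^ (n - l))"
    using assms(2) Suc(2) by (simp add: power_int_minus field_simps flip: power_add)
  moreover have "qpoch (q powi (- int n)) q (Suc l) * qpoch q q (n - Suc l) * q ^ (n * Suc l)
     = qpoch (q powi (- int n)) q l * qpoch q q (n - Suc l) * q ^ (n * l) * ((1 - q powi (- int n) * q ^ l) * q ^ n)"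
    by (simp add: qpoch_Suc power_add mult_ac)
  ultimately have "qpoch (q powi (- int n)) q (Suc l) * qpoch q q (n - Suc l) * q ^ (n * Suc l)
     = - (q ^ l) * (qpoch (q powi (- int n)) q l * qpoch q q (n - l) * q ^ (n * l))"
    by (simp add: mult_ac)
  also have "\<dots> = (-1) ^ Suc l * q ^ (Suc l * (Suc l - 1) div 2) * qpoch q q n"
    using Suc by (simp only: choose2_Suc power_add) simp
  finally show ?case .
qed simp

lemma qpoch_neg_power_eq_0:
  fixes q :: "'a :: real_normed_field"
  assumes "l > n" "q \<noteq> 0"
  shows "qpoch (q powi (- int n)) q l = 0"
  using assms by (auto simp: qpoch_eq_0_iff power_int_minus intro!: exI[of _ n])

lemma choose2_diff:
  fixes l n :: nat
  assumes "l \<le> n"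
  shows "n * (n - 1) div 2 + l * (l - 1) div 2 + l = (n - l) * (n - l - 1) div 2 + n * l"
proof -
  have "int (k * (k - 1) div 2) * 2 = int k * (int k - 1)" for k :: nat
  proof -
    have "even (k * (k - 1))" by (cases k) auto
    then have "k * (k - 1) div 2 * 2 = k * (k - 1)" by (rule dvd_div_mult_self)
    then have "int (k * (k - 1) div 2) * 2 = int (k * (k - 1))" by (metis of_nat_mult of_nat_numeral)
    also have "\<dots> = int k * (int k - 1)" by (cases k) (auto simp: algebra_simps)
    finally show ?thesis .
  qed
  from this[of n] this[of l] this[of "n - l"]
  have "2 * int (n * (n - 1) div 2 + l * (l - 1) div 2 + l) = 2 * int ((n - l) * (n - l - 1) div 2 + n * l)"
    using assms by (simp add: algebra_simps of_nat_diff)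
  then show ?thesis by (simp only: mult_cancel_left of_nat_eq_iff) auto
qed

text \<open>Termwise comparison with \<open>ascU_explicit\<close>: x^l (1/x;q)_l is the node
  product, and \<open>choose2_diff\<close> matches the quadratic exponents.\<close>

lemma al_salam_carlitz_eq_ascU:
  fixes q a x :: real
  assumes q: "0 < q" "q < 1" and "a \<noteq> 0" "x \<noteq> 0"
  shows "al_salam_carlitz n a x q = ascU a q n x"
proof -
  have nq: "norm q < 1" using q by simp
  define T where "T l = qpoch (q powi (- int n)) q l * qpoch (inverse x) q l / qpoch q q l * (q * x / a) ^ l" for l
  have node: "x ^ l * qpoch (inverse x) q l = ascU_node q x l" for l
  proof -
    have "x ^ l * qpoch (inverse x) q l = (\<Prod>j<l. x * (1 - inverse x * q ^ j))"
      by (simp add: qpoch_def prod.distrib)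
    also have "\<dots> = ascU_node q x l"
      unfolding ascU_node_def using assms by (intro prod.cong) (auto simp: field_simps)
    finally show ?thesis .
  qed
  have "qhyp [q powi (- int n), inverse x] [0] q (q * x / a) = (\<Sum>l. T l)"
    by (simp add: qhyp_def T_def)
  also have "\<dots> = (\<Sum>l\<le>n. T l)"
    using q by (intro suminf_finite) (auto simp: T_def qpoch_neg_power_eq_0)
  finally have "al_salam_carlitz n a x q = (\<Sum>l\<le>n. (- a) ^ n * q ^ (n * (n - 1) div 2) * T l)"
    by (simp add: al_salam_carlitz_def sum_distrib_left)
  also have "\<dots> = (\<Sum>l\<le>n. qpoch q q n * (ascU_node q x l / qpoch q q l
      * ((- a) ^ (n - l) * q ^ ((n - l) * (n - l - 1) div 2) / qpoch q q (n - l))))"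
  proof (rule sum.cong)
    fix l assume "l \<in> {..n}"
    then have l: "l \<le> n" by simp
    have nz: "qpoch q q l \<noteq> 0" "qpoch q q (n - l) \<noteq> 0" using qpoch_q_nz[OF nq] by auto
    have "qpoch (q powi (- int n)) q l = (-1) ^ l * q ^ (l * (l - 1) div 2) * qpoch q q n
        / (qpoch q q (n - l) * q ^ (n * l))"
      using qpoch_neg_power[OF l, of q] nz q by (simp add: field_simps)
    then have "(- a) ^ n * q ^ (n * (n - 1) div 2) * T l
        = (- a) ^ n * ((-1) ^ l / a ^ l) * q ^ (n * (n - 1) div 2 + l * (l - 1) div 2 + l) / q ^ (n * l)
         * qpoch q q n * (x ^ l * qpoch (inverse x) q l) / (qpoch q q l * qpoch q q (n - l))"
      unfolding T_def power_add using nz q assms(3) by (simp add: power_mult_distrib power_divide mult_ac)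
    also have "(- a) ^ n * ((-1) ^ l / a ^ l) = (- a) ^ (n - l)"
      using l assms(3) by (simp add: power_diff power_divide field_simps power_minus[of a])
    finally have T: "(- a) ^ n * q ^ (n * (n - 1) div 2) * T l
        = (- a) ^ (n - l) * q ^ (n * (n - 1) div 2 + l * (l - 1) div 2 + l) / q ^ (n * l)
         * qpoch q q n * (x ^ l * qpoch (inverse x) q l) / (qpoch q q l * qpoch q q (n - l))" .
    have "q ^ (n * (n - 1) div 2 + l * (l - 1) div 2 + l) = q ^ ((n - l) * (n - l - 1) div 2) * q ^ (n * l)"
      unfolding choose2_diff[OF l] power_add by simp
    with q show "(- a) ^ n * q ^ (n * (n - 1) div 2) * T l = qpoch q q n * (ascU_node q x l / qpoch q q l
      * ((- a) ^ (n - l) * q ^ ((n - l) * (n - l - 1) div 2) / qpoch q q (n - l)))"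
      unfolding T by (simp add: node)
  qed simp
  also have "\<dots> = ascU a q n x"
    by (simp add: ascU_explicit[OF nq] sum_distrib_left)
  finally show ?thesis .
qed

section \<open>Growth and decay of Al-Salam-Carlitz polynomials on one branch\<close>

lemma gauss_bound':
  fixes r c :: real
  assumes "0 < r" "r < 1" "0 < c"
  shows "\<exists>C>0. \<forall>m. r ^ (m * (m - 1) div 2) \<le> C * c ^ m"
proof -
  obtain C where C: "C > 0" "\<And>m. (1 / c) ^ m * r ^ (m * (m - 1) div 2) \<le> C * (1/2) ^ m"
    using gauss_bound[of r "1 / c"] assms by auto
  have "r ^ (m * (m - 1) div 2) \<le> C * c ^ m" for m
  proof -
    have "(1 / c) ^ m * r ^ (m * (m - 1) div 2) \<le> C * 1"
      using C(1) by (intro order_trans[OF C(2)] mult_left_mono power_le_one) auto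
    then show ?thesis using assms by (simp add: field_simps power_divide)
  qed
  then show ?thesis using C(1) by blast
qed

lemma Suc_le_two_power: "real m + 1 \<le> 2 ^ m"
  by (induction m) auto

context
  fixes r :: real
  assumes r: "0 < r" "r < 1"
begin

lemma qpoch_r_bounds: "0 < qpoch r r m" "qpoch r r m \<le> 1"
proof -
  show "0 < qpoch r r m" using qpoch_pos[OF r] r by simp
  show "qpoch r r m \<le> 1" unfolding qpoch_def using r
    by (intro prod_le_1) (auto simp: mult_le_one power_le_one)
qed

lemma inverse_qpoch_r: "\<exists>K\<ge>1. \<forall>m. 1 / qpoch r r m \<le> K"
proof -
  obtain C where C: "C > 0" "\<And>m. norm (1 / qpoch r r m) \<le> C"
    using inverse_qpoch_q_Bseq[of r] r by auto
  have "1 / qpoch r r m \<le> max 1 C" for m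
    using C(2)[of m] abs_ge_self[of "1 / qpoch r r m"] by simp
  then show ?thesis by (intro exI[of _ "max 1 C"]) auto
qed

text \<open>For j \<le> i each factor |r^i - r^l| with l < j is at most r^l; for j > i the factor
  with l = i is zero.\<close>

lemma ascU_node_bound: "\<bar>ascU_node r (r ^ i) j\<bar> \<le> r ^ (j * (j - 1) div 2)"
proof (cases "j \<le> i")
  case True
  then show ?thesis
  proof (induction j)
    case (Suc j)
    have "r ^ i \<le> r ^ j" using Suc r by (intro power_decreasing) auto
    then have "\<bar>r ^ i - r ^ j\<bar> \<le> r ^ j" using r by simp
    then have "\<bar>ascU_node r (r ^ i) j\<bar> * \<bar>r ^ i - r ^ j\<bar> \<le> r ^ (j * (j - 1) div 2) * r ^ j"
      using Suc r by (intro mult_mono) auto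
    then show ?case unfolding choose2_Suc power_add by (simp add: ascU_node_def abs_mult)
  qed (simp add: ascU_node_def)
next
  case False
  then have "ascU_node r (r ^ i) j = 0" by (auto simp: ascU_node_def)
  then show ?thesis using r by simp
qed

lemma abs_ascU_le:
  assumes K: "\<And>m. 1 / qpoch r r m \<le> K"
  shows "\<bar>ascU \<alpha> r m (r ^ i)\<bar> \<le> (\<Sum>j\<le>m. K\<^sup>2 * (if j \<le> i then r ^ (j * (j - 1) div 2) else 0)
     * (\<bar>\<alpha>\<bar> ^ (m - j) * r ^ ((m - j) * (m - j - 1) div 2)))"
proof -
  have nr: "norm r < 1" using r by simp
  have K0: "K \<ge> 0" using K[of 0] by simp
  define N where "N j = \<bar>ascU_node r (r ^ i) j\<bar>" for j
  have N: "N j \<le> (if j \<le> i then r ^ (j * (j - 1) div 2) else 0)" for j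
    using ascU_node_bound[of i j] by (auto simp: ascU_node_def N_def)
  have "\<bar>ascU \<alpha> r m (r ^ i)\<bar> \<le> qpoch r r m * (\<Sum>j\<le>m. \<bar>ascU_node r (r ^ i) j / qpoch r r j
      * ((- \<alpha>) ^ (m - j) * r ^ ((m - j) * (m - j - 1) div 2) / qpoch r r (m - j))\<bar>)"
    unfolding ascU_explicit[OF nr] abs_mult[of "qpoch r r m"] using qpoch_r_bounds[of m]
    by (simp only: abs_of_pos) (intro mult_left_mono sum_abs, simp)
  also have "\<dots> \<le> 1 * (\<Sum>j\<le>m. \<bar>ascU_node r (r ^ i) j / qpoch r r j
      * ((- \<alpha>) ^ (m - j) * r ^ ((m - j) * (m - j - 1) div 2) / qpoch r r (m - j))\<bar>)"
    using qpoch_r_bounds[of m] by (intro mult_right_mono sum_nonneg) auto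
  also have "\<dots> = (\<Sum>j\<le>m. (1 / qpoch r r j) * (1 / qpoch r r (m - j)) *
       N j * (\<bar>\<alpha>\<bar> ^ (m - j) * r ^ ((m - j) * (m - j - 1) div 2)))"
    using qpoch_r_bounds r by (simp add: abs_mult power_abs N_def mult_ac abs_of_pos less_imp_le)
  also have "\<dots> \<le> (\<Sum>j\<le>m. K * K * (if j \<le> i then r ^ (j * (j - 1) div 2) else 0)
     * (\<bar>\<alpha>\<bar> ^ (m - j) * r ^ ((m - j) * (m - j - 1) div 2)))"
    using qpoch_r_bounds r K K0 N
    by (intro sum_mono mult_mono mult_nonneg_nonneg) (auto simp: N_def less_imp_le)
  finally show ?thesis by (simp add: power2_eq_square)
qed

text \<open>Both factors of the convolution are Gaussian, in j and in m - j, so each is below a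
  multiple of (\<epsilon>/2)^j or (\<epsilon>/2)^(m-j); the m + 1 terms cost at most 2^m. The
  constant does not depend on the point r^i.\<close>

lemma ascU_uniform_bound:
  assumes "\<epsilon> > 0"
  shows "\<exists>C>0. \<forall>i m. \<bar>ascU \<alpha> r m (r ^ i)\<bar> \<le> C * \<epsilon> ^ m"
proof -
  obtain K where K: "K \<ge> 1" "\<And>m. 1 / qpoch r r m \<le> K" using inverse_qpoch_r by auto
  obtain C1 where C1: "C1 > 0" "\<And>m. r ^ (m * (m - 1) div 2) \<le> C1 * (\<epsilon> / 2) ^ m"
    using gauss_bound'[OF r, of "\<epsilon> / 2"] assms by auto
  obtain C2 where C2: "C2 > 0" "\<And>m. r ^ (m * (m - 1) div 2) \<le> C2 * (\<epsilon> / (2 * (\<bar>\<alpha>\<bar> + 1))) ^ m"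
    using gauss_bound'[OF r, of "\<epsilon> / (2 * (\<bar>\<alpha>\<bar> + 1))"] assms by auto
  have 2: "\<bar>\<alpha>\<bar> ^ m * r ^ (m * (m - 1) div 2) \<le> C2 * (\<epsilon> / 2) ^ m" for m
  proof -
    have "\<bar>\<alpha>\<bar> ^ m * r ^ (m * (m - 1) div 2) \<le> (\<bar>\<alpha>\<bar> + 1) ^ m * (C2 * (\<epsilon> / (2 * (\<bar>\<alpha>\<bar> + 1))) ^ m)"
      using C2 r by (intro mult_mono power_mono) auto
    also have "(\<bar>\<alpha>\<bar> + 1) ^ m * (C2 * (\<epsilon> / (2 * (\<bar>\<alpha>\<bar> + 1))) ^ m) = C2 * ((\<bar>\<alpha>\<bar> + 1) * (\<epsilon> / (2 * (\<bar>\<alpha>\<bar> + 1)))) ^ m"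
      unfolding power_mult_distrib by simp
    also have "(\<bar>\<alpha>\<bar> + 1) * (\<epsilon> / (2 * (\<bar>\<alpha>\<bar> + 1))) = \<epsilon> / 2" by (simp add: field_simps)
    finally show ?thesis .
  qed
  have "\<bar>ascU \<alpha> r m (r ^ i)\<bar> \<le> (K\<^sup>2 * C1 * C2) * \<epsilon> ^ m" for i m
  proof -
    have "\<bar>ascU \<alpha> r m (r ^ i)\<bar> \<le> (\<Sum>j\<le>m. K\<^sup>2 * (if j \<le> i then r ^ (j * (j - 1) div 2) else 0)
     * (\<bar>\<alpha>\<bar> ^ (m - j) * r ^ ((m - j) * (m - j - 1) div 2)))"
      by (rule abs_ascU_le[OF K(2)])
    also have "\<dots> \<le> (\<Sum>j\<le>m. K\<^sup>2 * (C1 * (\<epsilon> / 2) ^ j) * (C2 * (\<epsilon> / 2) ^ (m - j)))"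
    proof (rule sum_mono, rule mult_mono)
      fix j
      show "K\<^sup>2 * (if j \<le> i then r ^ (j * (j - 1) div 2) else 0) \<le> K\<^sup>2 * (C1 * (\<epsilon> / 2) ^ j)"
        using C1 assms by (intro mult_left_mono) auto
    qed (use 2[of "m - _"] C1 C2(1) assms r in auto)
    also have "\<dots> = (\<Sum>j\<le>m. K\<^sup>2 * C1 * C2 * (\<epsilon> / 2) ^ m)"
      by (intro sum.cong refl) (simp flip: power_add)
    also have "\<dots> = (real m + 1) * (K\<^sup>2 * C1 * C2 * (\<epsilon> / 2) ^ m)" by simp
    also have "\<dots> \<le> 2 ^ m * (K\<^sup>2 * C1 * C2 * (\<epsilon> / 2) ^ m)"
      using C1 C2 assms Suc_le_two_power by (intro mult_right_mono) auto
    finally show ?thesis by (simp add: power_divide)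
  qed
  moreover have "K\<^sup>2 * C1 * C2 > 0" using K C1 C2 by auto
  ultimately show ?thesis by blast
qed

text \<open>At a fixed point only j \<le> i contributes, and then the full Gaussian r^(m(m-1)/2)
  survives up to a geometric factor. This strength is needed to beat the reciprocal norms, which
  contain the inverse Gaussian.\<close>

lemma ascU_pointwise_bound:
  "\<exists>C>0. \<exists>R>0. \<forall>m. \<bar>ascU \<alpha> r m (r ^ i)\<bar> \<le> C * R ^ m * r ^ (m * (m - 1) div 2)"
proof -
  obtain K where K: "K \<ge> 1" "\<And>m. 1 / qpoch r r m \<le> K" using inverse_qpoch_r by auto
  define R where "R = (\<bar>\<alpha>\<bar> + 1) / r ^ i"
  have R: "R > 0" using r by (simp add: R_def)
  have "\<bar>ascU \<alpha> r m (r ^ i)\<bar> \<le> K\<^sup>2 * (2 * R) ^ m * r ^ (m * (m - 1) div 2)" for m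
  proof -
    have "\<bar>ascU \<alpha> r m (r ^ i)\<bar> \<le> (\<Sum>j\<le>m. K\<^sup>2 * (if j \<le> i then r ^ (j * (j - 1) div 2) else 0)
     * (\<bar>\<alpha>\<bar> ^ (m - j) * r ^ ((m - j) * (m - j - 1) div 2)))"
      by (rule abs_ascU_le[OF K(2)])
    also have "\<dots> \<le> (\<Sum>j\<le>m. K\<^sup>2 * (R ^ m * r ^ (m * (m - 1) div 2)))"
    proof (rule sum_mono)
      fix j assume "j \<in> {..m}"
      then have j: "j \<le> m" by simp
      show "K\<^sup>2 * (if j \<le> i then r ^ (j * (j - 1) div 2) else 0)
          * (\<bar>\<alpha>\<bar> ^ (m - j) * r ^ ((m - j) * (m - j - 1) div 2)) \<le> K\<^sup>2 * (R ^ m * r ^ (m * (m - 1) div 2))"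
      proof (cases "j \<le> i")
        case True
        have "\<bar>\<alpha>\<bar> ^ (m - j) \<le> (\<bar>\<alpha>\<bar> + 1) ^ (m - j)" by (intro power_mono) auto
        also have "\<dots> \<le> (\<bar>\<alpha>\<bar> + 1) ^ m" by (intro power_increasing) auto
        finally have 1: "\<bar>\<alpha>\<bar> ^ (m - j) \<le> (\<bar>\<alpha>\<bar> + 1) ^ m" .
        \<comment> \<open>By \<open>choose2_diff\<close> the two Gaussians multiply to r^(m(m-1)/2)
          up to r^(-m j) and factors at most 1; since j \<le> i, multiplying by r^(i m) removes the
          negative power.\<close>
        have "r ^ (j * (j - 1) div 2) * r ^ ((m - j) * (m - j - 1) div 2) * r ^ (i * m)
           \<le> r ^ (j * (j - 1) div 2) * r ^ ((m - j) * (m - j - 1) div 2) * r ^ (m * j)"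
          using r True by (intro mult_left_mono power_decreasing) (auto simp: mult.commute)
        also have "\<dots> = r ^ (j * (j - 1) div 2) * r ^ ((m - j) * (m - j - 1) div 2 + m * j)"
          by (simp only: power_add mult.assoc)
        also have "\<dots> = r ^ (j * (j - 1) div 2) * (r ^ (m * (m - 1) div 2) * r ^ (j * (j - 1) div 2) * r ^ j)"
          by (simp only: choose2_diff[OF j, symmetric] power_add mult.assoc)
        also have "\<dots> \<le> 1 * (r ^ (m * (m - 1) div 2) * 1 * 1)"
          using r by (intro mult_mono power_le_one) auto
        finally have "r ^ (j * (j - 1) div 2) * r ^ ((m - j) * (m - j - 1) div 2) \<le> r ^ (m * (m - 1) div 2) / r ^ (i * m)"
          using r by (simp add: field_simps)
        with 1 have "\<bar>\<alpha>\<bar> ^ (m - j) * (r ^ (j * (j - 1) div 2) * r ^ ((m - j) * (m - j - 1) div 2))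
           \<le> (\<bar>\<alpha>\<bar> + 1) ^ m * (r ^ (m * (m - 1) div 2) / r ^ (i * m))"
          using r by (intro mult_mono) auto
        also have "\<dots> = R ^ m * r ^ (m * (m - 1) div 2)"
          by (simp add: R_def power_divide power_mult)
        finally have "K\<^sup>2 * (\<bar>\<alpha>\<bar> ^ (m - j) * (r ^ (j * (j - 1) div 2) * r ^ ((m - j) * (m - j - 1) div 2)))
            \<le> K\<^sup>2 * (R ^ m * r ^ (m * (m - 1) div 2))"
          by (rule mult_left_mono) simp
        then show ?thesis using True by (simp add: mult_ac)
      next
        case False
        then show ?thesis using R r by simp
      qed
    qed
    also have "\<dots> = (real m + 1) * (K\<^sup>2 * (R ^ m * r ^ (m * (m - 1) div 2)))" by simp
    also have "\<dots> \<le> 2 ^ m * (K\<^sup>2 * (R ^ m * r ^ (m * (m - 1) div 2)))"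
      using R r Suc_le_two_power by (intro mult_right_mono) auto
    finally show ?thesis by (simp add: power_mult_distrib mult_ac)
  qed
  moreover have "K\<^sup>2 > 0" "2 * R > 0" using K R by auto
  ultimately show ?thesis by blast
qed

end

section \<open>Limits of infinite products and Euler's sum\<close>

lemma qpoch_inf_tendsto_1:
  fixes q :: "'a :: {real_normed_field, banach}"
  assumes q: "norm q < 1"
  shows "(\<lambda>n. qpoch_inf (c * q ^ n) q) \<longlonglongrightarrow> 1"
proof -
  have "(\<lambda>n. norm c * norm q ^ n) \<longlonglongrightarrow> norm c * 0"
    using q by (intro tendsto_intros) auto
  then have "eventually (\<lambda>n. norm c * norm q ^ n < 1) sequentially"
    by (rule order_tendstoD(2)) simp
  then obtain N where N: "\<And>n. n \<ge> N \<Longrightarrow> norm c * norm q ^ n < 1"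
    unfolding eventually_sequentially by blast
  define d where "d = c * q ^ N"
  have "d * q ^ j \<noteq> 1" for j
  proof
    assume "d * q ^ j = 1"
    then have "norm c * norm q ^ (N + j) = 1"
      by (metis d_def mult.assoc norm_mult norm_one norm_power power_add)
    with N[of "N + j"] show False by simp
  qed
  then have nz: "qpoch_inf d q \<noteq> 0" "\<And>n. qpoch d q n \<noteq> 0"
    by (auto simp: qpoch_inf_eq_0_iff[OF q] qpoch_eq_0_iff)
  have "(\<lambda>n. qpoch_inf d q / qpoch d q n) \<longlonglongrightarrow> qpoch_inf d q / qpoch_inf d q"
    using nz by (intro tendsto_intros qpoch_tendsto q)
  moreover have "qpoch_inf d q / qpoch d q n = qpoch_inf (c * q ^ (n + N)) q" for n
    using qpoch_inf_split[OF q, of d n] nz by (simp add: d_def power_add mult_ac field_simps)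
  ultimately have "(\<lambda>n. qpoch_inf (c * q ^ (n + N)) q) \<longlonglongrightarrow> 1"
    using nz by simp
  then show ?thesis by (rule LIMSEQ_offset)
qed

lemma summable_gauss:
  fixes q :: "'a :: {real_normed_field, banach}"
  assumes q: "norm q < 1" and b: "\<And>m. norm (a m) \<le> C * R ^ m" "R \<ge> 0" "C \<ge> 0"
  shows "summable (\<lambda>m. norm (a m * q ^ (m * (m - 1) div 2)))"
proof -
  obtain C' where C': "C' > 0" "\<And>m. R ^ m * norm q ^ (m * (m - 1) div 2) \<le> C' * (1/2) ^ m"
    using gauss_bound[of "norm q" R] q b by auto
  show ?thesis
  proof (rule summable_comparison_test')
    show "summable (\<lambda>m. C * C' * (1/2::real) ^ m)" by (intro summable_mult summable_geometric) simp
    fix m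
    have "norm (a m) * norm q ^ (m * (m - 1) div 2) \<le> C * R ^ m * norm q ^ (m * (m - 1) div 2)"
      using b by (intro mult_right_mono) auto
    also have "\<dots> \<le> C * (C' * (1/2) ^ m)"
      using C' b unfolding mult.assoc by (intro mult_left_mono) auto
    finally show "norm (norm (a m * q ^ (m * (m - 1) div 2))) \<le> C * C' * (1/2) ^ m"
      by (simp add: norm_mult norm_power)
  qed
qed

text \<open>The series f satisfies f(v) = (1 - v) f(v q). Iterating gives f(u) = (u;q)_n f(u q^n),
  and f is continuous at 0 with value 1.\<close>

lemma euler_sums:
  fixes q u :: "'a :: {real_normed_field, banach}"
  assumes q: "norm q < 1"
  shows "(\<lambda>m. (- u) ^ m * q ^ (m * (m - 1) div 2) / qpoch q q m) sums qpoch_inf u q"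
proof -
  define c where "c m = (-1) ^ m * q ^ (m * (m - 1) div 2) / qpoch q q m" for m
  obtain K where K: "K > 0" "\<And>m. norm (1 / qpoch q q m) \<le> K"
    using inverse_qpoch_q_Bseq[OF q] by auto
  have sm: "summable (\<lambda>m. c m * v ^ m)" for v
  proof -
    have "summable (\<lambda>m. norm ((v ^ m * ((-1) ^ m / qpoch q q m)) * q ^ (m * (m - 1) div 2)))"
    proof (rule summable_gauss[OF q])
      fix m show "norm (v ^ m * ((-1) ^ m / qpoch q q m)) \<le> K * norm v ^ m"
        using mult_left_mono[OF K(2), of "norm v ^ m" m] by (simp add: norm_mult norm_power norm_divide mult.commute)
    qed (use K in auto)
    then show ?thesis by (auto simp: c_def mult_ac dest: summable_norm_cancel)
  qed
  define f where "f v = (\<Sum>m. c m * v ^ m)" for v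
  have f: "(\<lambda>m. c m * v ^ m) sums f v" for v unfolding f_def by (rule summable_sums[OF sm])
  have step: "f v = (1 - v) * f (v * q)" for v
  proof -
    have "(\<lambda>m. c m * v ^ m - c m * (v * q) ^ m) sums (f v - f (v * q))"
      by (intro sums_diff f)
    then have "(\<lambda>m. c (Suc m) * v ^ Suc m - c (Suc m) * (v * q) ^ Suc m) sums (f v - f (v * q))"
      by (subst sums_Suc_iff) simp
    moreover have "c (Suc m) * v ^ Suc m - c (Suc m) * (v * q) ^ Suc m = - v * (c m * (v * q) ^ m)" for m
    proof -
      have nz: "1 - q * q ^ m \<noteq> 0" using q_power_neq_1[OF q, of "Suc m"] by simp
      have "c (Suc m) * (1 - q ^ Suc m) = - c m * q ^ m"
        unfolding c_def choose2_Suc power_add using nz qpoch_q_nz[OF q] by (simp add: qpoch_Suc field_simps)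
      then have "c (Suc m) * (1 - q ^ Suc m) * v ^ Suc m = - c m * q ^ m * v ^ Suc m" by simp
      then show ?thesis by (simp add: algebra_simps power_mult_distrib)
    qed
    ultimately have "(\<lambda>m. - v * (c m * (v * q) ^ m)) sums (f v - f (v * q))" by simp
    then have "f v - f (v * q) = - v * f (v * q)"
      using sums_mult[OF f[of "v * q"], of "- v"] sums_unique2 by blast
    then show ?thesis by (simp add: algebra_simps)
  qed
  have iter: "f u = qpoch u q n * f (u * q ^ n)" for n
  proof (induction n)
    case (Suc n)
    then show ?case unfolding qpoch_Suc using step[of "u * q ^ n"] by (simp add: mult_ac)
  qed simp
  have "(\<lambda>n. f (u * q ^ n)) \<longlonglongrightarrow> 1"
  \<comment> \<open>The punctured limit at 0 needs u q^n \<noteq> 0; in the remaining case the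
    sequence is eventually constant.\<close>
  proof (cases "u = 0 \<or> q = 0")
    case True
    have "f 0 = 1" using sums_unique2[OF f[of 0]] powser_sums_zero[of c] by (auto simp: c_def)
    then have "eventually (\<lambda>n. f (u * q ^ n) = 1) sequentially"
      using True by (intro eventually_mono[OF eventually_gt_at_top[of 0]]) (auto simp: zero_power)
    then show ?thesis by (rule tendsto_eventually)
  next
    case False
    have "(f \<longlongrightarrow> c 0) (at 0)" by (rule powser_limit_0[of 1]) (auto intro: f)
    moreover have "filterlim (\<lambda>n. u * q ^ n) (at 0) sequentially"
      unfolding filterlim_at using False q by (auto intro!: tendsto_mult_right_zero LIMSEQ_power_zero)
    ultimately have "(\<lambda>n. f (u * q ^ n)) \<longlonglongrightarrow> c 0" by (rule filterlim_compose)
    then show ?thesis by (simp add: c_def)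
  qed
  then have "(\<lambda>n. qpoch u q n * f (u * q ^ n)) \<longlonglongrightarrow> qpoch_inf u q * 1"
    by (intro tendsto_intros qpoch_tendsto q)
  then have "f u = qpoch_inf u q" by (simp add: iter[symmetric] LIMSEQ_const_iff)
  moreover have "c m * u ^ m = (- u) ^ m * q ^ (m * (m - 1) div 2) / qpoch q q m" for m
    by (simp add: c_def power_minus[of u])
  ultimately show ?thesis using f[of u] by simp
qed

section \<open>Orthogonality of the Al-Salam-Carlitz polynomials with parameter -z, in the degree
  and in the point\<close>

definition asc_support :: "real \<Rightarrow> real \<Rightarrow> real set" where
  "asc_support r z = range (\<lambda>i. r ^ i) \<union> range (\<lambda>i. - z * r ^ i)"

text \<open>Reciprocal squared norms of the monic polynomials, for the measure normalised to mass
  1.\<close>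

definition asc_hinv :: "real \<Rightarrow> real \<Rightarrow> nat \<Rightarrow> real" where
  "asc_hinv r z m = 1 / (z ^ m * r ^ (m * (m - 1) div 2) * qpoch r r m)"

definition asc_weight :: "real \<Rightarrow> real \<Rightarrow> real \<Rightarrow> real" where
  "asc_weight r z w = \<bar>w\<bar> * (qpoch_inf (r * w) r * qpoch_inf (- r * w / z) r)
     / (qpoch_inf r r * qtheta (- z) r)"

context
  fixes r z :: real
  assumes r: "0 < r" "r < 1" and z: "0 < z"
begin

private abbreviation "U \<equiv> ascU (- z) r"
private abbreviation "hinv \<equiv> asc_hinv r z"
private abbreviation "W \<equiv> asc_support r z"

lemma asc_hinv_pos: "hinv m > 0"
  using qpoch_r_bounds[OF r] r z by (simp add: asc_hinv_def)

lemma asc_hinv_Suc: "hinv (Suc m) * (z * r ^ m * (1 - r ^ Suc m)) = hinv m"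
  using qpoch_r_bounds(1)[OF r, of m] qpoch_r_bounds(1)[OF r, of "Suc m"] r z
  unfolding asc_hinv_def choose2_Suc power_add by (auto simp: qpoch_Suc field_simps)

text \<open>On the branch -z r^i, \<open>ascU_sym\<close> passes to the parameter 1/(-z) at the
  point r^i, at the price of z^m.\<close>

lemma asc_support_cases:
  assumes "w \<in> W"
  obtains (1) i where "w = r ^ i" "U = U" "\<And>m. \<bar>U m w\<bar> = 1 ^ m * \<bar>ascU (- z) r m (r ^ i)\<bar>"
  | (2) i where "w = - z * r ^ i" "\<And>m. \<bar>U m w\<bar> = z ^ m * \<bar>ascU (1 / (- z)) r m (r ^ i)\<bar>"
proof -
  consider i where "w = r ^ i" | i where "w = - z * r ^ i" using assms by (auto simp: asc_support_def)
  then show ?thesis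
  proof cases
    case 1 then show ?thesis using that(1) by simp
  next
    case (2 i)
    have "\<bar>U m w\<bar> = z ^ m * \<bar>ascU (1 / (- z)) r m (r ^ i)\<bar>" for m
      using ascU_sym[of "- z" r m "r ^ i"] z 2 by (simp add: abs_mult power_abs)
    then show ?thesis using that(2) 2 by blast
  qed
qed

lemma asc_uniform_bound:
  assumes "\<epsilon> > 0"
  shows "\<exists>C>0. \<forall>w\<in>W. \<forall>m. \<bar>U m w\<bar> \<le> C * \<epsilon> ^ m"
proof -
  obtain C1 where C1: "C1 > 0" "\<And>i m. \<bar>ascU (- z) r m (r ^ i)\<bar> \<le> C1 * \<epsilon> ^ m"
    using ascU_uniform_bound[OF r assms] by blast
  obtain C2 where C2: "C2 > 0" "\<And>i m. \<bar>ascU (1 / (- z)) r m (r ^ i)\<bar> \<le> C2 * (\<epsilon> / z) ^ m"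
    using ascU_uniform_bound[OF r, of "\<epsilon> / z"] assms z by (metis divide_pos_pos)
  have "\<bar>U m w\<bar> \<le> (C1 + C2) * \<epsilon> ^ m" if "w \<in> W" for w m
    using that
  proof (cases rule: asc_support_cases)
    case (1 i)
    have "\<bar>U m w\<bar> \<le> C1 * \<epsilon> ^ m" using C1(2)[of m i] 1 by simp
    also have "\<dots> \<le> (C1 + C2) * \<epsilon> ^ m" using C2 assms by (intro mult_right_mono) auto
    finally show ?thesis .
  next
    case (2 i)
    have "\<bar>U m w\<bar> \<le> z ^ m * (C2 * (\<epsilon> / z) ^ m)" unfolding 2(2) using C2(2)[of m i] z by (intro mult_left_mono) auto
    also have "\<dots> = C2 * \<epsilon> ^ m" using z by (simp add: power_divide)
    also have "\<dots> \<le> (C1 + C2) * \<epsilon> ^ m" using C1 assms by (intro mult_right_mono) auto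
    finally show ?thesis .
  qed
  then show ?thesis using C1 C2 by (intro exI[of _ "C1 + C2"]) auto
qed

lemma asc_pointwise_bound:
  assumes "w \<in> W"
  shows "\<exists>C>0. \<exists>R>0. \<forall>m. \<bar>U m w\<bar> \<le> C * R ^ m * r ^ (m * (m - 1) div 2)"
  using assms
proof (cases rule: asc_support_cases)
  case (1 i)
  then show ?thesis using ascU_pointwise_bound[OF r, of "- z" i] by simp
next
  case (2 i)
  obtain C R where CR: "C > 0" "R > 0" "\<And>m. \<bar>ascU (1 / (- z)) r m (r ^ i)\<bar> \<le> C * R ^ m * r ^ (m * (m - 1) div 2)"
    using ascU_pointwise_bound[OF r, of "1 / (- z)" i] by auto
  have "\<bar>U m w\<bar> \<le> C * (z * R) ^ m * r ^ (m * (m - 1) div 2)" for m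
    using mult_left_mono[OF CR(3), of "z ^ m" m] z unfolding 2(2) by (simp add: power_mult_distrib mult_ac)
  then show ?thesis using CR z by (intro exI[of _ C] conjI exI[of _ "z * R"]) auto
qed

text \<open>The Gaussian in the denominator of \<open>hinv\<close> cancels against the one in
  \<open>asc_pointwise_bound\<close>; geometric growth remains.\<close>

lemma asc_hinv_times_bound:
  assumes "w \<in> W"
  shows "\<exists>C>0. \<exists>R>0. \<forall>m. hinv m * \<bar>U m w\<bar> \<le> C * R ^ m \<and> hinv m * \<bar>U (Suc m) w\<bar> \<le> C * R ^ m"
proof -
  obtain C R where CR: "C > 0" "R > 0" "\<And>m. \<bar>U m w\<bar> \<le> C * R ^ m * r ^ (m * (m - 1) div 2)"
    using asc_pointwise_bound[OF assms] by auto
  obtain K where K: "K \<ge> 1" "\<And>m. 1 / qpoch r r m \<le> K" using inverse_qpoch_r[OF r] by auto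
  define D where "D = K * C * (1 + R)"
  have h: "hinv m = (1 / z) ^ m * (1 / qpoch r r m) / r ^ (m * (m - 1) div 2)" for m
    by (simp add: asc_hinv_def power_divide)
  have h': "hinv m \<le> (1 / z) ^ m * K / r ^ (m * (m - 1) div 2)" for m
    unfolding h using K r z by (intro divide_right_mono mult_left_mono) auto
  have "hinv m * \<bar>U m w\<bar> \<le> D * (R / z) ^ m" for m
  proof -
    have "hinv m * \<bar>U m w\<bar> \<le> ((1 / z) ^ m * K / r ^ (m * (m - 1) div 2)) * (C * R ^ m * r ^ (m * (m - 1) div 2))"
      using h' CR K r z asc_hinv_pos[of m] by (intro mult_mono) auto
    also have "\<dots> = K * C * (R / z) ^ m" using r by (simp add: power_divide)
    also have "\<dots> \<le> D * (R / z) ^ m"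
      using K CR z by (intro mult_right_mono) (auto simp: D_def)
    finally show ?thesis .
  qed
  moreover have "hinv m * \<bar>U (Suc m) w\<bar> \<le> D * (R / z) ^ m" for m
  proof -
    have "hinv m * \<bar>U (Suc m) w\<bar> \<le> ((1 / z) ^ m * K / r ^ (m * (m - 1) div 2)) * (C * R ^ Suc m * r ^ (Suc m * (Suc m - 1) div 2))"
      by (rule mult_mono[OF h' CR(3)]) (use K r z in auto)
    also have "\<dots> = K * C * R * (R / z) ^ m * r ^ m"
      unfolding choose2_Suc power_add using r by (simp add: power_divide)
    also have "\<dots> \<le> K * C * R * (R / z) ^ m * 1"
      using K CR z r by (intro mult_left_mono power_le_one) auto
    also have "\<dots> \<le> D * (R / z) ^ m * 1"
      using K CR z by (intro mult_right_mono) (auto simp: D_def algebra_simps)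
    finally show ?thesis by simp
  qed
  moreover have "D > 0" "R / z > 0" using K CR z by (auto simp: D_def)
  ultimately show ?thesis by blast
qed

text \<open>The growth R^m at the fixed point v is outweighed by the decay (\<epsilon>/R)^m, which
  \<open>asc_uniform_bound\<close> provides uniformly in w.\<close>

lemma asc_products_bound:
  assumes "v \<in> W" "\<epsilon> > 0"
  shows "\<exists>C>0. \<forall>w\<in>W. \<forall>m. hinv m * \<bar>U m w * U m v\<bar> \<le> C * \<epsilon> ^ m \<and>
     hinv m * \<bar>U (Suc m) w * U m v\<bar> \<le> C * \<epsilon> ^ m \<and> hinv m * \<bar>U m w * U (Suc m) v\<bar> \<le> C * \<epsilon> ^ m"
proof -
  obtain C R where CR: "C > 0" "R > 0" "\<And>m. hinv m * \<bar>U m v\<bar> \<le> C * R ^ m"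
     "\<And>m. hinv m * \<bar>U (Suc m) v\<bar> \<le> C * R ^ m"
    using asc_hinv_times_bound[OF assms(1)] by auto
  obtain D where D: "D > 0" "\<And>w m. w \<in> W \<Longrightarrow> \<bar>U m w\<bar> \<le> D * (\<epsilon> / R) ^ m"
    using asc_uniform_bound[of "\<epsilon> / R"] CR assms by auto
  \<comment> \<open>The factor 1 + \<epsilon>/R covers s = 1 and s = \<epsilon>/R, the latter coming
    from the shifted index m + 1.\<close>
  define E where "E = C * D * (1 + \<epsilon> / R)"
  have gen: "hinv m * \<bar>a * b\<bar> \<le> E * \<epsilon> ^ m"
    if "\<bar>a\<bar> \<le> D * (\<epsilon> / R) ^ m * s" "0 \<le> s" "s \<le> 1 + \<epsilon> / R" "hinv m * \<bar>b\<bar> \<le> C * R ^ m" for a b s m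
  proof -
    have "hinv m * \<bar>a * b\<bar> = \<bar>a\<bar> * (hinv m * \<bar>b\<bar>)" by (simp add: abs_mult)
    also have "\<dots> \<le> (D * (\<epsilon> / R) ^ m * s) * (C * R ^ m)"
      by (rule mult_mono[OF that(1) that(4)])
         (use that(2) CR(1,2) D(1) assms asc_hinv_pos[of m] in auto)
    also have "\<dots> = (C * D * s) * \<epsilon> ^ m" using CR by (simp add: power_divide)
    also have "\<dots> \<le> E * \<epsilon> ^ m" unfolding E_def using CR D assms that by (intro mult_right_mono mult_left_mono) auto
    finally show ?thesis .
  qed
  have "E > 0" using CR D assms by (auto simp: E_def intro!: mult_pos_pos add_pos_pos)
  moreover have "hinv m * \<bar>U m w * U m v\<bar> \<le> E * \<epsilon> ^ m"
     "hinv m * \<bar>U (Suc m) w * U m v\<bar> \<le> E * \<epsilon> ^ m" "hinv m * \<bar>U m w * U (Suc m) v\<bar> \<le> E * \<epsilon> ^ m" if "w \<in> W" for w m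
  proof -
    have 1: "\<bar>U m w\<bar> \<le> D * (\<epsilon> / R) ^ m * 1" using D(2)[OF that, of m] by simp
    have 2: "\<bar>U (Suc m) w\<bar> \<le> D * (\<epsilon> / R) ^ m * (\<epsilon> / R)" using D(2)[OF that, of "Suc m"] by (simp add: mult_ac)
    have 3: "0 \<le> \<epsilon> / R" using CR assms by simp
    show "hinv m * \<bar>U m w * U m v\<bar> \<le> E * \<epsilon> ^ m" by (rule gen[OF 1 _ _ CR(3)]) (use 3 in auto)
    show "hinv m * \<bar>U (Suc m) w * U m v\<bar> \<le> E * \<epsilon> ^ m" by (rule gen[OF 2 _ _ CR(3)]) (use 3 in auto)
    show "hinv m * \<bar>U m w * U (Suc m) v\<bar> \<le> E * \<epsilon> ^ m" by (rule gen[OF 1 _ _ CR(4)]) (use 3 in auto)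
  qed
  ultimately show ?thesis by blast
qed

lemma asc_products_summable:
  assumes "v \<in> W" "w \<in> W"
  shows "summable (\<lambda>m. norm (hinv m * (U m w * U m v)))"
proof -
  obtain C where C: "C > 0" "\<And>m. hinv m * \<bar>U m w * U m v\<bar> \<le> C * (1/2) ^ m"
    using asc_products_bound[OF assms(1), of "1/2"] assms(2) by auto
  show ?thesis
    by (rule summable_comparison_test'[where g = "\<lambda>m. C * (1/2) ^ m"])
       (use C asc_hinv_pos in \<open>auto simp: abs_mult less_imp_le intro!: summable_mult summable_geometric\<close>)
qed

lemma asc_christoffel_darboux:
  "(w - v) * (\<Sum>m\<le>M. hinv m * (U m w * U m v)) = hinv M * (U (Suc M) w * U M v - U M w * U (Suc M) v)"
proof (induction M)
  case 0
  show ?case by (simp add: algebra_simps)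
next
  case (Suc M)
  have h: "hinv M = hinv (Suc M) * (z * r ^ M * (1 - r ^ Suc M))" using asc_hinv_Suc[of M] by simp
  have "(w - v) * (\<Sum>m\<le>Suc M. hinv m * (U m w * U m v))
      = hinv M * (U (Suc M) w * U M v - U M w * U (Suc M) v) + (w - v) * (hinv (Suc M) * (U (Suc M) w * U (Suc M) v))"
    by (simp only: sum.atMost_Suc distrib_left Suc)
  also have "\<dots> = hinv (Suc M) * (U (Suc (Suc M)) w * U (Suc M) v - U (Suc M) w * U (Suc (Suc M)) v)"
    unfolding h by (simp add: algebra_simps)
  finally show ?case .
qed

text \<open>Points of one branch form a geometric sequence, and the branches have opposite signs; so
  every point is isolated with a gap proportional to its modulus. This lets the Christoffel-Darboux
  formula be divided by w - v uniformly in w.\<close>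

lemma asc_support_gap:
  assumes "v \<in> W" "w \<in> W" "w \<noteq> v"
  shows "\<bar>w - v\<bar> \<ge> \<bar>v\<bar> * (1 - r)"
proof -
  have *: "\<bar>r ^ j - r ^ i\<bar> \<ge> r ^ i * (1 - r)" if "i \<noteq> j" for i j
  proof (cases "i < j")
    case True
    have "r ^ j \<le> r ^ Suc i" using True r by (intro power_decreasing) auto
    then show ?thesis by (simp add: algebra_simps)
  next
    case False
    then have "r ^ i \<le> r ^ Suc j" using that r by (intro power_decreasing) auto
    then have 1: "r ^ i \<le> r * r ^ j" by simp
    \<comment> \<open>Here r^i is at most r * r^j, and the goal amounts to r^i (2 - r) \<le>
      r^j.\<close>
    have "r * (2 - r) \<le> 1" using zero_le_power2[of "1 - r"] by (simp add: power2_eq_square algebra_simps)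
    then have "r ^ j * (r * (2 - r)) \<le> r ^ j * 1" using r by (intro mult_left_mono) auto
    moreover have "r ^ i * (2 - r) \<le> (r * r ^ j) * (2 - r)" using 1 r by (intro mult_right_mono) auto
    ultimately show ?thesis by (simp add: algebra_simps)
  qed
  have opp: "A * (1 - r) \<le> \<bar>- B - A\<bar>" if "0 \<le> A" "0 \<le> B" for A B
  proof -
    have "A * (1 - r) \<le> A * 1" using that r by (intro mult_left_mono) auto
    then show ?thesis using that by simp
  qed
  have pos: "0 \<le> r ^ i" "0 \<le> z * r ^ i" "0 \<le> r * r ^ i" "0 \<le> z * (r * r ^ i)" for i using r z by auto
  have "\<bar>w - v\<bar> \<ge> \<bar>v\<bar> * (1 - r)" if v: "v \<in> {r ^ i, - z * r ^ i}" and w: "w \<in> {r ^ j, - z * r ^ j}" for i j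
  proof -
    consider "v = r ^ i" "w = r ^ j" | "v = r ^ i" "w = - z * r ^ j" | "v = - z * r ^ i" "w = r ^ j"
      | "v = - z * r ^ i" "w = - z * r ^ j" using v w by blast
    then show ?thesis
    proof cases
      case 1
      then show ?thesis using *[of i j] pos[of i] assms(3) by auto
    next
      case 2
      then show ?thesis using opp[of "r ^ i" "z * r ^ j"] pos[of i] pos[of j] by simp
    next
      case 3
      then show ?thesis using opp[of "z * r ^ i" "r ^ j"] pos[of i] pos[of j] by (simp add: add.commute)
    next
      case 4
      have "w - v = z * (r ^ i - r ^ j)" using 4 by (simp add: algebra_simps)
      then have "\<bar>w - v\<bar> = z * \<bar>r ^ j - r ^ i\<bar>"
        using z by (simp add: abs_mult abs_minus_commute)
      moreover have "\<bar>v\<bar> = z * r ^ i" using 4 pos[of i] by simp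
      moreover have "i \<noteq> j" using 4 assms(3) by auto
      ultimately show ?thesis using mult_left_mono[OF *[of i j], of z] z by (simp add: mult_ac)
    qed
  qed
  then show ?thesis using assms(1,2) unfolding asc_support_def by blast
qed

lemma asc_support_nz: "w \<in> W \<Longrightarrow> w \<noteq> 0"
  using r z by (auto simp: asc_support_def)

text \<open>The closed form of the kernel has products of total decay 2^(-M) in the numerator, and
  the gap bounds the denominator from below.\<close>

lemma asc_kernel_bound:
  assumes v: "v \<in> W"
  shows "\<exists>C>0. \<forall>w\<in>W-{v}. \<forall>M. \<bar>\<Sum>m\<le>M. hinv m * (U m w * U m v)\<bar> \<le> C * (1/2) ^ M"
proof -
  obtain C where C: "C > 0" "\<And>w m. w \<in> W \<Longrightarrow> hinv m * \<bar>U (Suc m) w * U m v\<bar> \<le> C * (1/2) ^ m"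
     "\<And>w m. w \<in> W \<Longrightarrow> hinv m * \<bar>U m w * U (Suc m) v\<bar> \<le> C * (1/2) ^ m"
    using asc_products_bound[OF v, of "1/2"] by auto
  define d where "d = \<bar>v\<bar> * (1 - r)"
  have d: "d > 0" using asc_support_nz[OF v] r by (simp add: d_def)
  have "\<bar>\<Sum>m\<le>M. hinv m * (U m w * U m v)\<bar> \<le> (2 * C / d) * (1/2) ^ M" if w: "w \<in> W - {v}" for w M
  proof -
    have "d * \<bar>\<Sum>m\<le>M. hinv m * (U m w * U m v)\<bar> \<le> \<bar>w - v\<bar> * \<bar>\<Sum>m\<le>M. hinv m * (U m w * U m v)\<bar>"
      using asc_support_gap[OF v, of w] w by (intro mult_right_mono) (auto simp: d_def)
    also have "\<dots> = \<bar>hinv M * (U (Suc M) w * U M v - U M w * U (Suc M) v)\<bar>"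
      by (simp only: abs_mult[symmetric] asc_christoffel_darboux)
    also have "\<dots> = hinv M * \<bar>U (Suc M) w * U M v - U M w * U (Suc M) v\<bar>"
      using asc_hinv_pos[of M] by (simp only: abs_mult[of "hinv M"] abs_of_pos)
    also have "\<dots> \<le> hinv M * (\<bar>U (Suc M) w * U M v\<bar> + \<bar>U M w * U (Suc M) v\<bar>)"
      using asc_hinv_pos[of M] by (intro mult_left_mono abs_triangle_ineq4) simp
    also have "\<dots> = hinv M * \<bar>U (Suc M) w * U M v\<bar> + hinv M * \<bar>U M w * U (Suc M) v\<bar>"
      by (rule distrib_left)
    also have "\<dots> \<le> 2 * C * (1/2) ^ M" using C(2)[of w M] C(3)[of w M] w by simp
    finally show ?thesis using d by (simp add: field_simps)
  qed
  moreover have "2 * C / d > 0" using C d by simp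
  ultimately show ?thesis by blast
qed

lemma asc_orthogonal:
  assumes "v \<in> W" "w \<in> W" "w \<noteq> v"
  shows "(\<lambda>m. hinv m * (U m w * U m v)) sums 0"
proof -
  have w: "w \<in> W - {v}" using assms by simp
  obtain C where "\<forall>w\<in>W-{v}. \<forall>M. \<bar>\<Sum>m\<le>M. hinv m * (U m w * U m v)\<bar> \<le> C * (1/2) ^ M"
    using asc_kernel_bound[OF assms(1)] by (elim exE conjE)
  from bspec[OF this w] have C: "\<bar>\<Sum>m\<le>M. hinv m * (U m w * U m v)\<bar> \<le> C * (1/2) ^ M" for M ..
  have "(\<lambda>M. C * (1/2) ^ M) \<longlonglongrightarrow> C * 0" by (intro tendsto_intros) auto
  then have "(\<lambda>M. C * (1/2) ^ M) \<longlonglongrightarrow> 0" by simp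
  then have "(\<lambda>M. \<Sum>m\<le>M. hinv m * (U m w * U m v)) \<longlonglongrightarrow> 0"
    by (rule Lim_null_comparison[OF always_eventually, rotated]) (use C in simp)
  then show ?thesis by (simp add: sums_def_le)
qed

text \<open>Only the absolute convergence of the sums is available here, not the square summability of \<open>f\<close>,
  so the orthogonality is exploited through the uniform decay of the Christoffel--Darboux kernel.\<close>

lemma asc_inversion:
  fixes f :: "real \<Rightarrow> complex"
  assumes f: "\<And>m. ((\<lambda>w. f w * of_real (U m w)) has_sum B m) W" and v: "v \<in> W"
  shows "(\<lambda>m. of_real (hinv m * U m v) * B m) sums (f v * of_real (\<Sum>m. hinv m * (U m v)\<^sup>2))"
proof -
  define K where "K M w = (\<Sum>m\<le>M. hinv m * (U m w * U m v))" for M w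
  obtain C where "C > 0" "\<forall>w\<in>W-{v}. \<forall>M. \<bar>K M w\<bar> \<le> C * (1/2) ^ M"
    using asc_kernel_bound[OF v] unfolding K_def by (elim exE conjE)
  then have C: "C > 0" "\<And>w M. w \<in> W - {v} \<Longrightarrow> \<bar>K M w\<bar> \<le> C * (1/2) ^ M" by (simp, meson)
  \<comment> \<open>Since U_0 = 1, the hypothesis at m = 0 alone makes f absolutely summable; this
    dominates the sums for all M at once.\<close>
  have "(f has_sum B 0) W" using f[of 0] by simp
  then have "f summable_on W" by (rule has_sum_imp_summable)
  then have "(\<lambda>w. norm (f w)) summable_on W" by (simp add: summable_on_iff_abs_summable_on_complex)
  then have sf: "(\<lambda>w. norm (f w)) summable_on (W - {v})" by (rule summable_on_subset_banach) auto
  define A where "A = infsum (\<lambda>w. norm (f w)) (W - {v})"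
  \<comment> \<open>The partial sums of the inverted series are f summed against the kernel
    \<open>K M\<close>; what lies off v is then controlled by \<open>bound\<close>.\<close>
  have part: "((\<lambda>w. f w * of_real (K M w)) has_sum (\<Sum>m\<le>M. of_real (hinv m * U m v) * B m)) W" for M
  proof (induction M)
    case 0
    show ?case using f[of 0] by (simp add: K_def asc_hinv_def)
  next
    case (Suc M)
    have "((\<lambda>w. f w * of_real (K M w) + of_real (hinv (Suc M) * U (Suc M) v) * (f w * of_real (U (Suc M) w)))
       has_sum ((\<Sum>m\<le>M. of_real (hinv m * U m v) * B m) + of_real (hinv (Suc M) * U (Suc M) v) * B (Suc M))) W"
      by (intro has_sum_add has_sum_cmult_right Suc f)
    then show ?case by (simp add: K_def algebra_simps)
  qed
  have rest: "((\<lambda>w. f w * of_real (K M w)) has_sum (\<Sum>m\<le>M. of_real (hinv m * U m v) * B m) - f v * of_real (K M v)) (W - {v})" for M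
    using has_sum_Diff[OF part[of M] has_sum_finite[of "{v}" "\<lambda>w. f w * of_real (K M w)"]] v by simp
  have bound: "norm ((\<Sum>m\<le>M. of_real (hinv m * U m v) * B m) - f v * of_real (K M v)) \<le> A * (C * (1/2) ^ M)" for M
  proof -
    have 1: "((\<lambda>w. norm (f w) * (C * (1/2) ^ M)) has_sum A * (C * (1/2) ^ M)) (W - {v})"
      unfolding A_def by (intro has_sum_cmult_left has_sum_infsum sf)
    have "(\<lambda>w. norm (f w * of_real (K M w))) summable_on (W - {v})"
      using has_sum_imp_summable[OF rest[of M]] by (simp only: summable_on_iff_abs_summable_on_complex)
    then have 2: "((\<lambda>w. norm (f w * of_real (K M w))) has_sum
        infsum (\<lambda>w. norm (f w * of_real (K M w))) (W - {v})) (W - {v})" by (rule has_sum_infsum)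
    have "infsum (\<lambda>w. norm (f w * of_real (K M w))) (W - {v}) \<le> A * (C * (1/2) ^ M)"
    proof (rule has_sum_mono[OF 2 1])
      fix w assume "w \<in> W - {v}"
      from C(2)[OF this, of M] show "norm (f w * of_real (K M w)) \<le> norm (f w) * (C * (1/2) ^ M)"
        unfolding norm_mult norm_of_real by (rule mult_left_mono) simp
    qed
    with norm_has_sum_bound[OF 2 rest] show ?thesis by linarith
  qed
  have "(\<lambda>M. A * (C * (1/2) ^ M)) \<longlonglongrightarrow> A * (C * 0)" by (intro tendsto_intros) auto
  then have "(\<lambda>M. A * (C * (1/2) ^ M)) \<longlonglongrightarrow> 0" by simp
  then have "(\<lambda>M. (\<Sum>m\<le>M. of_real (hinv m * U m v) * B m) - f v * of_real (K M v)) \<longlonglongrightarrow> 0"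
    by (rule Lim_null_comparison[OF always_eventually[OF allI[OF bound]]])
  moreover have "(\<lambda>M. f v * of_real (K M v)) \<longlonglongrightarrow> f v * of_real (\<Sum>m. hinv m * (U m v)\<^sup>2)"
  proof -
    have "summable (\<lambda>m. hinv m * (U m v * U m v))"
      using asc_products_summable[OF v v] by (rule summable_norm_cancel)
    then have "(\<lambda>M. K M v) \<longlonglongrightarrow> (\<Sum>m. hinv m * (U m v)\<^sup>2)"
      unfolding K_def power2_eq_square by (rule summable_LIMSEQ')
    then show ?thesis by (intro tendsto_intros)
  qed
  ultimately have "(\<lambda>M. ((\<Sum>m\<le>M. of_real (hinv m * U m v) * B m) - f v * of_real (K M v)) + f v * of_real (K M v))
     \<longlonglongrightarrow> 0 + f v * of_real (\<Sum>m. hinv m * (U m v)\<^sup>2)"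
    by (rule tendsto_add)
  then show ?thesis by (simp add: sums_def_le)
qed

lemma tendsto_ascU:
  assumes "(f \<longlongrightarrow> w) F"
  shows "((\<lambda>x. U m (f x)) \<longlongrightarrow> U m w) F"
proof (induction m rule: induct_nat_012)
  case (ge2 n)
  show ?case unfolding ascU.simps(3) by (intro tendsto_intros assms ge2)
qed (simp_all, intro tendsto_intros assms)

private definition "\<rho> w = qpoch_inf (r * w) r * qpoch_inf (- r * w / z) r"

text \<open>The q-Pearson equation of the weight.\<close>

private lemma rho_shift: "\<rho> (w / r) = (1 - w) * (1 + w / z) * \<rho> w"
proof -
  have "qpoch_inf w r = (1 - w) * qpoch_inf (r * w) r"
    using qpoch_inf_rec[of r w] r by (simp add: mult.commute)
  moreover have "qpoch_inf (- w / z) r = (1 + w / z) * qpoch_inf (- r * w / z) r"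
    using qpoch_inf_rec[of r "- w / z"] r by (simp add: mult.commute)
  moreover have "r * (w / r) = w" "- r * (w / r) / z = - w / z" using r by auto
  ultimately show ?thesis unfolding \<rho>_def by simp
qed

private lemma rho_tendsto: "(\<lambda>i. \<rho> (\<kappa> * r ^ i)) \<longlonglongrightarrow> 1"
proof -
  have "(\<lambda>i. qpoch_inf (r * \<kappa> * r ^ i) r * qpoch_inf (- r * \<kappa> / z * r ^ i) r) \<longlonglongrightarrow> 1 * 1"
    using r by (intro tendsto_mult qpoch_inf_tendsto_1) auto
  then show ?thesis by (simp add: \<rho>_def mult_ac)
qed

text \<open>By \<open>ascU_raise\<close> and \<open>rho_shift\<close> the summand is a difference of
  consecutive values of \<rho> U_m. The start of the telescope is 0 and its end is the value U_m(0)
  at the accumulation point, hence the same on both branches.\<close>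

private lemma branch_sums:
  assumes \<kappa>: "\<kappa> \<in> {1, - z}"
  shows "summable (\<lambda>i. norm (\<kappa> * r ^ i * \<rho> (\<kappa> * r ^ i) * U m (\<kappa> * r ^ i)))"
    and "(\<lambda>i. \<kappa> * r ^ i * \<rho> (\<kappa> * r ^ i) * U (Suc m) (\<kappa> * r ^ i)) sums (z * r ^ m * U m 0)"
proof -
  have "(\<lambda>i. \<kappa> * r ^ i) \<longlonglongrightarrow> \<kappa> * 0" using r by (intro tendsto_intros) auto
  then have lim0: "(\<lambda>i. \<kappa> * r ^ i) \<longlonglongrightarrow> 0" by simp
  have lim: "(\<lambda>i. \<rho> (\<kappa> * r ^ i) * U m (\<kappa> * r ^ i)) \<longlonglongrightarrow> 1 * U m 0" for m
    by (intro tendsto_mult rho_tendsto tendsto_ascU lim0)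
  obtain B where B: "\<And>i. norm (\<rho> (\<kappa> * r ^ i) * U m (\<kappa> * r ^ i)) \<le> B"
    using convergent_imp_Bseq[OF convergentI[OF lim[of m]]] by (auto simp: Bseq_def)
  show "summable (\<lambda>i. norm (\<kappa> * r ^ i * \<rho> (\<kappa> * r ^ i) * U m (\<kappa> * r ^ i)))"
  proof (rule summable_comparison_test'[where g = "\<lambda>i. \<bar>\<kappa>\<bar> * B * r ^ i"])
    fix i
    show "norm (norm (\<kappa> * r ^ i * \<rho> (\<kappa> * r ^ i) * U m (\<kappa> * r ^ i))) \<le> \<bar>\<kappa>\<bar> * B * r ^ i"
      using mult_left_mono[OF B[of i], of "\<bar>\<kappa>\<bar> * r ^ i"] r by (simp add: abs_mult mult_ac power_abs)
  qed (use r in \<open>auto intro!: summable_mult summable_geometric\<close>)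
  define g where "g i = \<rho> (\<kappa> * r ^ i / r) * U m (\<kappa> * r ^ i / r)" for i
  \<comment> \<open>At w = \<kappa>/r one of the two products in \<rho> is (1;r)_inf = 0: the first
    for \<kappa> = 1, the second for \<kappa> = -z.\<close>
  have g0: "g 0 = 0"
  proof -
    have "qpoch_inf 1 r = 0" using qpoch_inf_rec[of r 1] r by simp
    then have "\<rho> (\<kappa> / r) = 0" using \<kappa> r z by (auto simp: \<rho>_def)
    then show ?thesis by (simp add: g_def)
  qed
  have gS: "g (Suc i) = \<rho> (\<kappa> * r ^ i) * U m (\<kappa> * r ^ i)" for i
    using r by (simp add: g_def)
  have "(\<lambda>i. g (Suc i)) \<longlonglongrightarrow> U m 0" using lim[of m] by (simp add: gS)
  then have "g \<longlonglongrightarrow> U m 0" by (rule LIMSEQ_imp_Suc)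
  from telescope_sums[OF this] have "(\<lambda>i. g (Suc i) - g i) sums U m 0" by (simp add: g0)
  then have "(\<lambda>i. z * r ^ m * (g (Suc i) - g i)) sums (z * r ^ m * U m 0)" by (rule sums_mult)
  moreover have "z * r ^ m * (g (Suc i) - g i) = \<kappa> * r ^ i * \<rho> (\<kappa> * r ^ i) * U (Suc m) (\<kappa> * r ^ i)" for i
  proof -
    define w where "w = \<kappa> * r ^ i"
    have "r * (w / r) = w" using r by simp
    with ascU_raise[of r "w / r" "- z" m]
    have raise: "(1 - w) * (- z - w) * r ^ m * U m (w / r) + z * r ^ m * U m w = w * U (Suc m) w" by simp
    have "z * r ^ m * (\<rho> w * U m w - \<rho> (w / r) * U m (w / r))
        = \<rho> w * ((1 - w) * (- z - w) * r ^ m * U m (w / r) + z * r ^ m * U m w)"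
      unfolding rho_shift using z by (simp add: field_simps)
    then show ?thesis unfolding raise gS by (simp add: g_def flip: w_def)
  qed
  ultimately show "(\<lambda>i. \<kappa> * r ^ i * \<rho> (\<kappa> * r ^ i) * U (Suc m) (\<kappa> * r ^ i)) sums (z * r ^ m * U m 0)"
    by simp
qed

text \<open>Since |w| = sgn \<kappa> * w, the equal branch sums enter with opposite signs and cancel
  for m > 0. The total mass c is left open here and is identified in
  \<open>asc_weight_norm\<close>.\<close>

lemma asc_weight_orthogonal: "\<exists>c. \<forall>m. ((\<lambda>w. asc_weight r z w * U m w) has_sum (if m = 0 then c else 0)) W"
proof -
  define N where "N = qpoch_inf r r * qtheta (- z) r"
  define s where "s \<kappa> m i = \<kappa> * r ^ i * \<rho> (\<kappa> * r ^ i) * U m (\<kappa> * r ^ i)" for \<kappa> m i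
  have branch: "((\<lambda>w. \<bar>w\<bar> * \<rho> w * U m w) has_sum sgn \<kappa> * suminf (s \<kappa> m)) (range (\<lambda>i. \<kappa> * r ^ i))"
    if "\<kappa> \<in> {1, - z}" for \<kappa> m
  proof -
    have "\<kappa> \<noteq> 0" using that z by auto
    then have inj: "inj (\<lambda>i. \<kappa> * r ^ i)" proof (intro injI)
      fix i j assume "\<kappa> * r ^ i = \<kappa> * r ^ j"
      then have "r ^ i = r ^ j" using \<open>\<kappa> \<noteq> 0\<close> by simp
      then show "i = j" using r power_strict_decreasing_iff[of r i j] power_strict_decreasing_iff[of r j i] by linarith
    qed
    have "(s \<kappa> m has_sum suminf (s \<kappa> m)) UNIV"
    proof (rule norm_summable_imp_has_sum)
      show "summable (\<lambda>i. norm (s \<kappa> m i))" using branch_sums(1)[OF that, of m] by (simp only: s_def)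
      then show "s \<kappa> m sums suminf (s \<kappa> m)" by (rule summable_sums[OF summable_norm_cancel])
    qed
    then have "((\<lambda>i. sgn \<kappa> * s \<kappa> m i) has_sum sgn \<kappa> * suminf (s \<kappa> m)) UNIV"
      by (rule has_sum_cmult_right)
    moreover have "(\<lambda>i. sgn \<kappa> * s \<kappa> m i) = (\<lambda>w. \<bar>w\<bar> * \<rho> w * U m w) \<circ> (\<lambda>i. \<kappa> * r ^ i)"
    proof
      fix i
      have "\<bar>\<kappa> * r ^ i\<bar> = sgn \<kappa> * (\<kappa> * r ^ i)" using r by (simp add: abs_mult abs_sgn[of \<kappa>])
      then show "sgn \<kappa> * s \<kappa> m i = ((\<lambda>w. \<bar>w\<bar> * \<rho> w * U m w) \<circ> (\<lambda>i. \<kappa> * r ^ i)) i"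
        by (simp add: s_def)
    qed
    ultimately show ?thesis by (simp only: has_sum_reindex[OF inj])
  qed
  have disj: "range (\<lambda>i. 1 * r ^ i) \<inter> range (\<lambda>i. - z * r ^ i) = {}"
  proof -
    have "1 * r ^ i \<noteq> - z * r ^ j" for i j
    proof -
      have "0 < r ^ i" "0 < z * r ^ j" using r z by simp_all
      then show ?thesis by linarith
    qed
    then show ?thesis by blast
  qed
  have tot: "((\<lambda>w. \<bar>w\<bar> * \<rho> w * U m w) has_sum (suminf (s 1 m) - suminf (s (- z) m))) W" for m
    using has_sum_Un_disjoint[OF branch[of 1 m] branch[of "- z" m] disj] z
    by (simp add: asc_support_def)
  have "suminf (s \<kappa> (Suc m)) = z * r ^ m * U m 0" if "\<kappa> \<in> {1, - z}" for \<kappa> m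
    using branch_sums(2)[OF that, of m] unfolding s_def by (rule sums_unique[symmetric])
  then have "suminf (s 1 (Suc m)) = suminf (s (- z) (Suc m))" for m by simp
  then have zero: "suminf (s 1 m) - suminf (s (- z) m) = 0" if "m \<noteq> 0" for m
    using that by (cases m) auto
  have "((\<lambda>w. asc_weight r z w * U m w) has_sum (if m = 0 then (suminf (s 1 0) - suminf (s (- z) 0)) / N else 0)) W" for m
    using has_sum_cmult_right[OF tot[of m], of "1 / N"] zero[of m]
    by (auto simp: asc_weight_def N_def \<rho>_def)
  then show ?thesis by blast
qed

text \<open>Inverting the expansion of the weight itself, whose only nonzero moment against the U_m
  is c, shows that the product equals c at every point. At v = 1 the sum is Euler's, which gives c =
  1.\<close>

lemma asc_weight_norm:
  assumes "v \<in> W"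
  shows "asc_weight r z v * (\<Sum>m. hinv m * (U m v)\<^sup>2) = 1"
proof -
  obtain c where c: "\<And>m. ((\<lambda>w. asc_weight r z w * U m w) has_sum (if m = 0 then c else 0)) W"
    using asc_weight_orthogonal by blast
  have *: "asc_weight r z v * (\<Sum>m. hinv m * (U m v)\<^sup>2) = c" if "v \<in> W" for v
  proof -
    have "((\<lambda>w. complex_of_real (asc_weight r z w) * of_real (U m w)) has_sum of_real (if m = 0 then c else 0)) W" for m
      using has_sum_of_real[OF c[of m], where 'a = complex] by simp
    from asc_inversion[OF this that]
    have "(\<lambda>m. complex_of_real (hinv m * U m v) * of_real (if m = 0 then c else 0)) sums
       (of_real (asc_weight r z v) * of_real (\<Sum>m. hinv m * (U m v)\<^sup>2))" .
    moreover have "(\<lambda>m. complex_of_real (hinv m * U m v) * of_real (if m = 0 then c else 0)) =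
       (\<lambda>m. if m = 0 then complex_of_real c else 0)" by (auto simp: asc_hinv_def)
    ultimately have "complex_of_real (asc_weight r z v * (\<Sum>m. hinv m * (U m v)\<^sup>2)) = of_real c"
      using sums_unique2[OF _ sums_single[of 0 "\<lambda>_. complex_of_real c"]] by simp
    then show ?thesis by (simp only: of_real_eq_iff)
  qed
  have nr: "norm r < 1" using r by simp
  have 1: "1 \<in> W" unfolding asc_support_def by (rule UnI1, rule range_eqI[of _ _ 0], simp)
  have "hinv m * (U m 1)\<^sup>2 = (- (- z)) ^ m * r ^ (m * (m - 1) div 2) / qpoch r r m" for m
    using r z by (simp add: asc_hinv_def ascU_one power2_eq_square)
  then have S: "(\<Sum>m. hinv m * (U m 1)\<^sup>2) = qpoch_inf (- z) r"
    using euler_sums[OF nr, of "- z"] by (simp add: sums_iff)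
  have pos: "qpoch_inf r r > 0" "qpoch_inf (- z) r > 0" "qpoch_inf (- r / z) r > 0"
    using r z by (auto intro!: qpoch_inf_pos simp: less_divide_eq)
  have "asc_weight r z 1 = 1 / qpoch_inf (- z) r"
    using pos by (simp add: asc_weight_def qtheta_def field_simps)
  then have "c = 1" using *[OF 1] S pos by simp
  with *[OF assms] show ?thesis by simp
qed

end

section \<open>Al-Salam--Chihara and continuous dual q-Hahn polynomials\<close>

lemma tendsto_qpoch:
  assumes "(f \<longlongrightarrow> a) F"
  shows "((\<lambda>x. qpoch (f x) q n) \<longlongrightarrow> qpoch a q n) F"
  unfolding qpoch_def by (intro tendsto_intros assms)

lemma powi_neg_nat: "q powi (- int n) = 1 / (q ^ n :: 'a :: field)"
  by (simp add: power_int_minus inverse_eq_divide)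

lemma qpoch_neg_Suc:
  assumes "q \<noteq> 0"
  shows "qpoch (q powi (- int (Suc n))) q (Suc k) = (1 - q powi (- int (Suc n))) * qpoch (q powi (- int n)) q k"
proof -
  have "q powi (- int (Suc n)) * q = q powi (- int n)"
    unfolding powi_neg_nat using assms by simp
  then show ?thesis by (simp only: qpoch_Suc')
qed

text \<open>The factor q^(n+1) - q^k is what lowers (q^(-n-1);q)_k to (q^(-n);q)_k; most contiguous
  relations below arise in this way.\<close>

lemma qpoch_neg_Suc_step:
  assumes "q \<noteq> 0"
  shows "qpoch (q powi (- int (Suc n))) q k * (q ^ Suc n - q ^ k) = - (1 - q ^ Suc n) * qpoch (q powi (- int n)) q k"
proof -
  have e: "(1 - q powi (- int (Suc n)) * q ^ k) * q ^ Suc n = q ^ Suc n - q ^ k"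
    "(1 - q powi (- int (Suc n))) * q ^ Suc n = - (1 - q ^ Suc n)"
    unfolding powi_neg_nat using assms by (simp_all add: field_simps)
  have "qpoch (q powi (- int (Suc n))) q k * (1 - q powi (- int (Suc n)) * q ^ k) * q ^ Suc n
     = (1 - q powi (- int (Suc n))) * qpoch (q powi (- int n)) q k * q ^ Suc n"
    using qpoch_neg_Suc[OF assms, of n k] by (simp only: qpoch_Suc)
  then have "qpoch (q powi (- int (Suc n))) q k * ((1 - q powi (- int (Suc n)) * q ^ k) * q ^ Suc n)
     = ((1 - q powi (- int (Suc n))) * q ^ Suc n) * qpoch (q powi (- int n)) q k"
    by (simp only: mult_ac)
  then show ?thesis by (simp only: e)
qed

context
  fixes q :: complex
  assumes q: "norm q < 1" "q \<noteq> 0"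
begin

text \<open>For k \<le> n the summands for c and c q differ by the factor a c (q^(n+1) - q^k), which
  \<open>qpoch_neg_Suc_step\<close> converts to degree n; for k = n + 1 they agree.\<close>

lemma cdqH_contiguous:
  assumes a: "a \<noteq> 0"
  shows "cdqH_poly (Suc n) x a b c q - cdqH_poly (Suc n) x a b (c * q) q
    = - c * (1 - q ^ Suc n) * (1 - a * b * q ^ n) * cdqH_poly n x a b (c * q) q"
proof -
  define T where "T c k = qpoch (q powi (- int (Suc n))) q k * qpoch (a * x) q k * qpoch (a / x) q k / qpoch q q k * q ^ k
            * qpoch (a * b * q ^ k) q (Suc n - k) * qpoch (a * c * q ^ k) q (Suc n - k)" for c k
  define S where "S k = qpoch (q powi (- int n)) q k * qpoch (a * x) q k * qpoch (a / x) q k / qpoch q q k * q ^ k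
            * qpoch (a * b * q ^ k) q (n - k) * qpoch (a * (c * q) * q ^ k) q (n - k)" for k
  have "T c k - T (c * q) k = - a * c * (1 - q ^ Suc n) * (1 - a * b * q ^ n) * S k" if "k \<le> n" for k
  proof -
    define X where "X = a * c * q ^ k"
    have sk: "Suc n - k = Suc (n - k)" using that by simp
    have ab: "qpoch (a * b * q ^ k) q (Suc n - k) = qpoch (a * b * q ^ k) q (n - k) * (1 - a * b * q ^ n)"
      unfolding sk qpoch_Suc using that by (simp add: mult.assoc flip: power_add)
    have c1: "qpoch (a * c * q ^ k) q (Suc n - k) = (1 - X) * qpoch (X * q) q (n - k)"
      unfolding sk X_def by (rule qpoch_Suc')
    have c2: "qpoch (a * (c * q) * q ^ k) q (Suc n - k) = qpoch (X * q) q (n - k) * (1 - a * c * q ^ Suc n)"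
    proof -
      have "a * (c * q) * q ^ k = X * q" by (simp add: X_def)
      moreover have "X * q * q ^ (n - k) = a * c * (q * (q ^ k * q ^ (n - k)))" by (simp add: X_def mult_ac)
      then have "X * q * q ^ (n - k) = a * c * q ^ Suc n" using that by (simp flip: power_add)
      ultimately show ?thesis unfolding sk qpoch_Suc by (simp only:)
    qed
    have c3: "qpoch (a * (c * q) * q ^ k) q (n - k) = qpoch (X * q) q (n - k)"
      by (simp add: X_def mult_ac)
    define Y where "Y = qpoch (a * x) q k * qpoch (a / x) q k / qpoch q q k * q ^ k
            * qpoch (a * b * q ^ k) q (n - k) * (1 - a * b * q ^ n) * qpoch (X * q) q (n - k)"
    define P where "P = qpoch (q powi (- int (Suc n))) q k"
    have "T c k = P * Y * (1 - X)"
      unfolding T_def ab c1 Y_def P_def by (simp only: mult_ac times_divide_eq_right times_divide_eq_left)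
    moreover have "T (c * q) k = P * Y * (1 - a * c * q ^ Suc n)"
      unfolding T_def ab c2 Y_def P_def by (simp only: mult_ac times_divide_eq_right times_divide_eq_left)
    ultimately have "T c k - T (c * q) k = P * Y * ((1 - X) - (1 - a * c * q ^ Suc n))"
      by (simp only: right_diff_distrib)
    also have "(1 - X) - (1 - a * c * q ^ Suc n) = (q ^ Suc n - q ^ k) * (a * c)"
      by (simp add: X_def algebra_simps)
    also have "P * Y * ((q ^ Suc n - q ^ k) * (a * c)) = Y * (P * (q ^ Suc n - q ^ k)) * (a * c)"
      by (simp only: mult_ac)
    also have "\<dots> = Y * (- (1 - q ^ Suc n) * qpoch (q powi (- int n)) q k) * (a * c)"
      unfolding P_def by (simp only: qpoch_neg_Suc_step[OF q(2)])
    also have "\<dots> = - a * c * (1 - q ^ Suc n) * (Y * qpoch (q powi (- int n)) q k)"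
    proof -
      have "u * (- e * v) * (a * c) = - a * c * e * (u * v)" for u e v :: complex by simp
      then show ?thesis .
    qed
    also have "Y * qpoch (q powi (- int n)) q k = (1 - a * b * q ^ n) * S k"
      unfolding S_def c3 Y_def by (simp only: mult_ac times_divide_eq_right times_divide_eq_left)
    also have "- a * c * (1 - q ^ Suc n) * ((1 - a * b * q ^ n) * S k)
        = - a * c * (1 - q ^ Suc n) * (1 - a * b * q ^ n) * S k"
      by (rule mult.assoc[symmetric])
    finally show ?thesis .
  qed
  moreover have "T c (Suc n) - T (c * q) (Suc n) = 0" by (simp add: T_def)
  ultimately have "(\<Sum>k\<le>Suc n. T c k) - (\<Sum>k\<le>Suc n. T (c * q) k) = (\<Sum>k\<le>n. - a * c * (1 - q ^ Suc n) * (1 - a * b * q ^ n) * S k)"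
    by (simp add: sum_subtractf[symmetric])
  then have "(\<Sum>k\<le>Suc n. T c k) - (\<Sum>k\<le>Suc n. T (c * q) k) = - a * c * (1 - q ^ Suc n) * (1 - a * b * q ^ n) * (\<Sum>k\<le>n. S k)"
    by (simp only: sum_distrib_left)
  note diff = this
  have e1: "cdqH_poly (Suc n) x a b c' q = inverse a ^ Suc n * (\<Sum>k\<le>Suc n. T c' k)" for c'
    unfolding cdqH_poly_def T_def ..
  have e2: "cdqH_poly n x a b (c * q) q = inverse a ^ n * (\<Sum>k\<le>n. S k)"
    unfolding cdqH_poly_def S_def ..
  have "cdqH_poly (Suc n) x a b c q - cdqH_poly (Suc n) x a b (c * q) q
      = inverse a ^ Suc n * (- a * c * (1 - q ^ Suc n) * (1 - a * b * q ^ n) * (\<Sum>k\<le>n. S k))"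
    unfolding e1 right_diff_distrib[symmetric] diff ..
  also have "\<dots> = - c * (1 - q ^ Suc n) * (1 - a * b * q ^ n) * (inverse a ^ n * (\<Sum>k\<le>n. S k))"
  proof -
    have "inverse a ^ Suc n * (- a * c * u * v * w) = - c * u * v * (inverse a ^ n * w)" for u v w
      using a by simp
    then show ?thesis .
  qed
  finally show ?thesis unfolding e2 .
qed

lemma cdqH_0 [simp]: "cdqH_poly 0 x a b c q = 1"
  by (simp add: cdqH_poly_def)

lemma cdqH_b_c_commute: "cdqH_poly n x a b c q = cdqH_poly n x a c b q"
  by (simp add: cdqH_poly_def mult_ac)

lemma tendsto_cdqH_c:
  assumes "(f \<longlongrightarrow> c) F"
  shows "((\<lambda>i. cdqH_poly n x a b (f i) q) \<longlongrightarrow> cdqH_poly n x a b c q) F"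
proof -
  define A where "A k = qpoch (q powi (- int n)) q k * qpoch (a * x) q k * qpoch (a / x) q k / qpoch q q k * q ^ k
            * qpoch (a * b * q ^ k) q (n - k)" for k
  have "((\<lambda>i. inverse a ^ n * (\<Sum>k\<le>n. A k * qpoch (a * f i * q ^ k) q (n - k)))
      \<longlongrightarrow> inverse a ^ n * (\<Sum>k\<le>n. A k * qpoch (a * c * q ^ k) q (n - k))) F"
    by (intro tendsto_mult tendsto_const tendsto_sum tendsto_qpoch assms)
  then show ?thesis by (simp only: cdqH_poly_def A_def)
qed

text \<open>The difference of two solutions is invariant under c -> c q, so it equals its limit
  along c q^i, its value at c = 0. An identity with a parameter c is thereby reduced to c =
  0.\<close>

lemma q_contiguous_unique:
  fixes f g :: "nat \<Rightarrow> complex \<Rightarrow> complex"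
  assumes f: "\<And>n c. f (Suc n) c - f (Suc n) (c * q) = \<kappa> n c * f n (c * q)"
    and g: "\<And>n c. g (Suc n) c - g (Suc n) (c * q) = \<kappa> n c * g n (c * q)"
    and ft: "\<And>n c. (\<lambda>i. f n (c * q ^ i)) \<longlonglongrightarrow> f n 0"
    and gt: "\<And>n c. (\<lambda>i. g n (c * q ^ i)) \<longlonglongrightarrow> g n 0"
    and base: "\<And>n. f n 0 = g n 0" "\<And>c. f 0 c = g 0 c"
  shows "f n c = g n c"
proof (induction n arbitrary: c)
  case (Suc n)
  define d where "d c = f (Suc n) c - g (Suc n) c" for c
  have "d c = d (c * q)" for c
    using f[of n c] g[of n c] Suc[of "c * q"] by (simp add: d_def algebra_simps)
  then have "d (c * q ^ i) = d c" for i
    by (induction i) (simp_all, metis mult.assoc mult.commute)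
  moreover have "(\<lambda>i. d (c * q ^ i)) \<longlonglongrightarrow> f (Suc n) 0 - g (Suc n) 0"
    unfolding d_def by (intro tendsto_diff ft gt)
  ultimately show ?case using base(1)[of "Suc n"] by (simp add: d_def LIMSEQ_const_iff)
qed (rule base(2))

text \<open>Coefficient of s^n in (a s, b s;q)_inf / (x s, s/x;q)_inf: the Al-Salam-Chihara
  polynomial divided by (q;q)_n.\<close>

definition asc_conv :: "complex \<Rightarrow> complex \<Rightarrow> complex \<Rightarrow> nat \<Rightarrow> complex" where
  "asc_conv x a b n = (\<Sum>l\<le>n. (qpoch (a / x) q l * x ^ l / qpoch q q l)
      * (qpoch (b * x) q (n - l) * (1 / x) ^ (n - l) / qpoch q q (n - l)))"

text \<open>\<open>convolution_recurrence\<close> with (p,s) = (x,a) and (1/x,b).\<close>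

lemma asc_conv_rec:
  assumes x: "x \<noteq> 0"
  shows "(1 - q ^ Suc (Suc n)) * asc_conv x a b (Suc (Suc n))
      = (x + 1 / x - (a + b) * q ^ Suc n) * asc_conv x a b (Suc n) - (1 - a * b * q ^ n) * asc_conv x a b n"
    and "(1 - q) * asc_conv x a b 1 = (x + 1 / x - (a + b))"
proof -
  define f where "f l = qpoch (a / x) q l * x ^ l / qpoch q q l" for l
  define g where "g l = qpoch (b * x) q l * (1 / x) ^ l / qpoch q q l" for l
  have nz: "1 - q * q ^ n \<noteq> 0" for n using q_power_neq_1[OF q(1), of "Suc n"] by simp
  have f: "(1 - q ^ Suc n) * f (Suc n) = (x - a * q ^ n) * f n" for n
    using x nz qpoch_q_nz[OF q(1)] by (simp add: f_def qpoch_Suc divide_simps)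
  have g: "(1 - q ^ Suc n) * g (Suc n) = (1 / x - b * q ^ n) * g n" for n
    using x nz qpoch_q_nz[OF q(1)] by (simp add: g_def qpoch_Suc divide_simps)
  note r = convolution_recurrence[OF f g]
  show "(1 - q ^ Suc (Suc n)) * asc_conv x a b (Suc (Suc n))
      = (x + 1 / x - (a + b) * q ^ Suc n) * asc_conv x a b (Suc n) - (1 - a * b * q ^ n) * asc_conv x a b n"
    using r(1)[of n] x unfolding asc_conv_def f_def g_def by simp
  show "(1 - q) * asc_conv x a b 1 = (x + 1 / x - (a + b))"
    using r(2) unfolding asc_conv_def f_def g_def by simp
qed

lemma asc_conv_contiguous:
  assumes x: "x \<noteq> 0"
  shows "asc_conv x a b (Suc n) - asc_conv x a (b * q) (Suc n) = - b * asc_conv x a (b * q) n"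
proof -
  define f where "f l = qpoch (a / x) q l * x ^ l / qpoch q q l" for l
  define g where "g b l = qpoch (b * x) q l * (1 / x) ^ l / qpoch q q l" for b l
  have "g b (Suc l) - g (b * q) (Suc l) = - b * g (b * q) l" for l
  proof -
    have nz: "1 - q * q ^ l \<noteq> 0" using q_power_neq_1[OF q(1), of "Suc l"] by simp
    have 1: "qpoch (b * x) q (Suc l) = (1 - b * x) * qpoch (b * q * x) q l"
      by (simp add: qpoch_Suc' mult_ac)
    have 2: "qpoch (b * q * x) q (Suc l) = (1 - b * x * (q * q ^ l)) * qpoch (b * q * x) q l"
      by (simp add: qpoch_Suc mult_ac)
    show ?thesis unfolding g_def 1 2 using x nz qpoch_q_nz[OF q(1), of l]
      by (simp add: qpoch_Suc divide_simps) (simp add: algebra_simps)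
  qed
  then have "f l * (g b (Suc n - l) - g (b * q) (Suc n - l)) = - b * (f l * g (b * q) (n - l))" if "l \<le> n" for l
    using that by (simp add: Suc_diff_le)
  moreover have "f (Suc n) * (g b 0 - g (b * q) 0) = 0" by (simp add: g_def)
  ultimately have "(\<Sum>l\<le>Suc n. f l * (g b (Suc n - l) - g (b * q) (Suc n - l))) = (\<Sum>l\<le>n. - b * (f l * g (b * q) (n - l)))"
    by simp
  then show ?thesis
    unfolding asc_conv_def f_def[symmetric] g_def[symmetric] sum_distrib_left by (simp add: right_diff_distrib sum_subtractf)
qed

text \<open>The continuous big q-Hermite case. In the basis \<phi>_k = (a x, a/x;q)_k multiplication
  by x + 1/x involves only \<phi>_k and \<phi>_(k+1), so the recurrence can be checked
  coefficientwise.\<close>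

lemma cdqH_00_rec:
  assumes a: "a \<noteq> 0" and x: "x \<noteq> 0"
  shows "cdqH_poly (Suc (Suc n)) x a 0 0 q = (x + 1 / x - a * q ^ Suc n) * cdqH_poly (Suc n) x a 0 0 q
     - (1 - q ^ Suc n) * cdqH_poly n x a 0 0 q"
proof -
  define \<phi> where "\<phi> k = qpoch (a * x) q k * qpoch (a / x) q k" for k
  define C where "C n k = inverse a ^ n * qpoch (q powi (- int n)) q k / qpoch q q k * q ^ k" for n k
  have C_zero: "C n k = 0" if "k > n" for n k
    using qpoch_neg_power_eq_0[OF that q(2)] by (simp add: C_def)
  have p: "cdqH_poly n x a 0 0 q = (\<Sum>k\<le>N. C n k * \<phi> k)" if "n \<le> N" for n N
  proof -
    have "cdqH_poly n x a 0 0 q = (\<Sum>k\<le>n. C n k * \<phi> k)"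
      by (simp add: cdqH_poly_def C_def \<phi>_def sum_distrib_left mult_ac)
    also have "\<dots> = (\<Sum>k\<le>N. C n k * \<phi> k)"
      using that C_zero by (intro sum.mono_neutral_left) auto
    finally show ?thesis .
  qed
  define N where "N = Suc (Suc n)"
  have phi: "(x + 1 / x) * \<phi> k = \<phi> k * (1 + a\<^sup>2 * q ^ k * q ^ k) / (a * q ^ k) - \<phi> (Suc k) / (a * q ^ k)" for k
    using a x q by (simp add: \<phi>_def qpoch_Suc divide_simps) (simp add: algebra_simps power2_eq_square)
  have "(x + 1 / x) * cdqH_poly (Suc n) x a 0 0 q = (\<Sum>k\<le>N. C (Suc n) k * ((x + 1 / x) * \<phi> k))"
  proof -
    have "cdqH_poly (Suc n) x a 0 0 q = (\<Sum>k\<le>N. C (Suc n) k * \<phi> k)" by (rule p) (simp add: N_def)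
    then show ?thesis by (simp only: sum_distrib_left mult_ac)
  qed
  also have "\<dots> = (\<Sum>k\<le>N. C (Suc n) k * (1 + a\<^sup>2 * q ^ k * q ^ k) / (a * q ^ k) * \<phi> k)
       - (\<Sum>k\<le>N. C (Suc n) k / (a * q ^ k) * \<phi> (Suc k))"
    unfolding phi sum_subtractf[symmetric] by (intro sum.cong refl) (simp add: algebra_simps)
  also have "(\<Sum>k\<le>N. C (Suc n) k / (a * q ^ k) * \<phi> (Suc k)) = (\<Sum>k\<le>N. (if k = 0 then 0 else C (Suc n) (k - 1) / (a * q ^ (k - 1))) * \<phi> k)"
  proof -
    have "(\<Sum>k\<le>Suc N. (if k = 0 then 0 else C (Suc n) (k - 1) / (a * q ^ (k - 1))) * \<phi> k)
        = (\<Sum>k\<le>N. C (Suc n) k / (a * q ^ k) * \<phi> (Suc k))"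
      by (subst sum.atMost_Suc_shift) simp
    moreover have "C (Suc n) N = 0" by (rule C_zero) (simp add: N_def)
    ultimately show ?thesis by simp
  qed
  finally have mu: "(x + 1 / x) * cdqH_poly (Suc n) x a 0 0 q
     = (\<Sum>k\<le>N. (C (Suc n) k * (1 + a\<^sup>2 * q ^ k * q ^ k) / (a * q ^ k) - (if k = 0 then 0 else C (Suc n) (k - 1) / (a * q ^ (k - 1)))) * \<phi> k)"
    by (simp add: sum_subtractf left_diff_distrib)
  \<comment> \<open>All Pochhammer symbols at q^(-n), q^(-n-1) and q^(-n-2) are expressed through
    the common factor \<open>E\<close>, after which only a rational identity is left.\<close>
  have coef: "C (Suc (Suc n)) k = C (Suc n) k * (1 + a\<^sup>2 * q ^ k * q ^ k) / (a * q ^ k)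
       - (if k = 0 then 0 else C (Suc n) (k - 1) / (a * q ^ (k - 1))) - a * q ^ Suc n * C (Suc n) k - (1 - q ^ Suc n) * C n k" for k
  proof (cases k)
    case 0
    then show ?thesis using a by (simp add: C_def field_simps power2_eq_square)
  next
    case (Suc j)
    define E where "E = qpoch (q powi (- int (Suc n))) q j"
    have s2: "qpoch (q powi (- int (Suc (Suc n)))) q k = (1 - q powi (- int (Suc (Suc n)))) * E"
      unfolding Suc E_def by (rule qpoch_neg_Suc[OF q(2)])
    have s1: "qpoch (q powi (- int (Suc n))) q k = E * (1 - q powi (- int (Suc n)) * q ^ j)"
      unfolding Suc E_def by (rule qpoch_Suc)
    have s0: "(1 - q ^ Suc n) * qpoch (q powi (- int n)) q k = - (q ^ Suc n - q ^ k) * (E * (1 - q powi (- int (Suc n)) * q ^ j))"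
      using qpoch_neg_Suc_step[OF q(2), of n k] unfolding s1 by (simp add: algebra_simps)
    have nz: "qpoch q q j \<noteq> 0" "1 - q * q ^ j \<noteq> 0"
      using qpoch_q_nz[OF q(1)] q_power_neq_1[OF q(1), of "Suc j"] by auto
    have "(1 - q ^ Suc n) * C n k = inverse a ^ n * ((1 - q ^ Suc n) * qpoch (q powi (- int n)) q k) / qpoch q q k * q ^ k"
      by (simp add: C_def)
    then have C0: "(1 - q ^ Suc n) * C n k = inverse a ^ n * (- (q ^ Suc n - q ^ k) * (E * (1 - q powi (- int (Suc n)) * q ^ j))) / qpoch q q k * q ^ k"
      by (simp only: s0)
    have C1: "C (Suc n) k = inverse a ^ Suc n * (E * (1 - q powi (- int (Suc n)) * q ^ j)) / qpoch q q k * q ^ k"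
      by (simp only: C_def s1)
    have C1': "C (Suc n) (k - 1) = inverse a ^ Suc n * E / qpoch q q j * q ^ j"
      by (simp add: C_def E_def Suc)
    have C2: "C (Suc (Suc n)) k = inverse a ^ Suc (Suc n) * ((1 - q powi (- int (Suc (Suc n)))) * E) / qpoch q q k * q ^ k"
      by (simp only: C_def s2)
    have pw: "q powi (- int (Suc n)) = 1 / (q * q ^ n)" "q powi (- int (Suc (Suc n))) = 1 / (q * (q * q ^ n))"
      unfolding powi_neg_nat by simp_all
    show ?thesis
      unfolding C0 C1 C1' C2 pw using a q nz
      by (simp add: Suc qpoch_Suc divide_simps power2_eq_square) (simp add: algebra_simps)
  qed
  have "cdqH_poly (Suc (Suc n)) x a 0 0 q = (\<Sum>k\<le>N. C (Suc (Suc n)) k * \<phi> k)"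
    by (rule p) (simp add: N_def)
  also have "\<dots> = (x + 1 / x) * cdqH_poly (Suc n) x a 0 0 q - a * q ^ Suc n * (\<Sum>k\<le>N. C (Suc n) k * \<phi> k)
      - (1 - q ^ Suc n) * (\<Sum>k\<le>N. C n k * \<phi> k)"
    unfolding mu sum_distrib_left sum_subtractf[symmetric]
  proof (intro sum.cong refl)
    fix k
    show "C (Suc (Suc n)) k * \<phi> k = (C (Suc n) k * (1 + a\<^sup>2 * q ^ k * q ^ k) / (a * q ^ k) - (if k = 0 then 0 else C (Suc n) (k - 1) / (a * q ^ (k - 1)))) * \<phi> k
       - a * q ^ Suc n * (C (Suc n) k * \<phi> k) - (1 - q ^ Suc n) * (C n k * \<phi> k)"
      unfolding coef[of k] by (simp only: left_diff_distrib mult.assoc)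
  qed
  also have "(\<Sum>k\<le>N. C (Suc n) k * \<phi> k) = cdqH_poly (Suc n) x a 0 0 q"
    by (rule p[symmetric]) (simp add: N_def)
  also have "(\<Sum>k\<le>N. C n k * \<phi> k) = cdqH_poly n x a 0 0 q"
    by (rule p[symmetric]) (simp add: N_def)
  finally show ?thesis by (simp add: algebra_simps)
qed

lemma cdqH_00_eq_conv:
  assumes a: "a \<noteq> 0" and x: "x \<noteq> 0"
  shows "cdqH_poly n x a 0 0 q = qpoch q q n * asc_conv x a 0 n"
proof (induction n rule: induct_nat_012)
  case 0
  show ?case by (simp add: asc_conv_def)
next
  case 1
  have nz: "1 - q \<noteq> 0" using q_power_neq_1[OF q(1), of 1] by simp
  have e: "1 - q powi - 1 = - (1 - q) / q" using q powi_neg_nat[of q 1] by (simp add: field_simps)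
  have "cdqH_poly 1 x a 0 0 q = inverse a * (1 - (1 - a * x) * (1 - a / x))"
  proof -
    have "cdqH_poly 1 x a 0 0 q = inverse a * (1 + (1 - q powi - 1) * ((1 - a * x) * (1 - a / x)) / (1 - q) * q)"
      by (simp add: cdqH_poly_def qpoch_def mult.assoc)
    also have "(1 - q powi - 1) * ((1 - a * x) * (1 - a / x)) / (1 - q) * q = - ((1 - a * x) * (1 - a / x))"
    proof -
      have "- (1 - q) / q * X / (1 - q) * q = - X" for X using nz q by (simp add: divide_simps) (simp add: algebra_simps)
      then show ?thesis unfolding e .
    qed
    finally show ?thesis by simp
  qed
  also have "\<dots> = x + 1 / x - a" using a x by (simp add: field_simps)
  also have "\<dots> = (1 - q) * asc_conv x a 0 1" using asc_conv_rec(2)[OF x, of a 0] by simp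
  finally show ?case by (simp add: qpoch_def)
next
  case (ge2 n)
  have "qpoch q q (Suc (Suc n)) * asc_conv x a 0 (Suc (Suc n))
      = qpoch q q (Suc n) * ((1 - q ^ Suc (Suc n)) * asc_conv x a 0 (Suc (Suc n)))"
    by (simp add: qpoch_Suc)
  also have "\<dots> = qpoch q q (Suc n) * ((x + 1 / x - a * q ^ Suc n) * asc_conv x a 0 (Suc n) - asc_conv x a 0 n)"
    unfolding asc_conv_rec(1)[OF x] by simp
  also have "\<dots> = (x + 1 / x - a * q ^ Suc n) * (qpoch q q (Suc n) * asc_conv x a 0 (Suc n))
      - qpoch q q (Suc n) * asc_conv x a 0 n"
    by (simp only: right_diff_distrib mult_ac)
  also have "qpoch q q (Suc n) * asc_conv x a 0 n = (1 - q ^ Suc n) * (qpoch q q n * asc_conv x a 0 n)"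
    by (simp add: qpoch_Suc)
  finally show ?case unfolding cdqH_00_rec[OF a x] ge2 by simp
qed

lemma cdqH_0_eq_conv:
  assumes a: "a \<noteq> 0" and x: "x \<noteq> 0"
  shows "cdqH_poly n x a b 0 q = qpoch q q n * asc_conv x a b n"
proof -
  \<comment> \<open>\<open>cdqH_contiguous\<close> moves the third parameter, so b is placed there
    first and then moved back by symmetry.\<close>
  have "cdqH_poly n x a 0 b q = qpoch q q n * asc_conv x a b n"
  proof (rule q_contiguous_unique[where f = "\<lambda>n b. cdqH_poly n x a 0 b q"
      and g = "\<lambda>n b. qpoch q q n * asc_conv x a b n" and \<kappa> = "\<lambda>n c. - c * (1 - q ^ Suc n)"])
    fix n c
    show "cdqH_poly (Suc n) x a 0 c q - cdqH_poly (Suc n) x a 0 (c * q) q = - c * (1 - q ^ Suc n) * cdqH_poly n x a 0 (c * q) q"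
      using cdqH_contiguous[OF a, of n x 0 c] by simp
    have "qpoch q q (Suc n) * asc_conv x a c (Suc n) - qpoch q q (Suc n) * asc_conv x a (c * q) (Suc n)
       = qpoch q q (Suc n) * (asc_conv x a c (Suc n) - asc_conv x a (c * q) (Suc n))" by (simp only: right_diff_distrib)
    then show "qpoch q q (Suc n) * asc_conv x a c (Suc n) - qpoch q q (Suc n) * asc_conv x a (c * q) (Suc n)
       = - c * (1 - q ^ Suc n) * (qpoch q q n * asc_conv x a (c * q) n)"
      unfolding asc_conv_contiguous[OF x] by (simp add: qpoch_Suc)
    have c0: "(\<lambda>i. c * q ^ i) \<longlonglongrightarrow> 0"
      using tendsto_mult_right_zero[OF LIMSEQ_power_zero[OF q(1)]] by blast
    then show "(\<lambda>i. cdqH_poly n x a 0 (c * q ^ i) q) \<longlonglongrightarrow> cdqH_poly n x a 0 0 q"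
      by (rule tendsto_cdqH_c)
    have "(\<lambda>i. c * q ^ i * x) \<longlonglongrightarrow> 0" using tendsto_mult_left_zero[OF c0] .
    then have "(\<lambda>i. asc_conv x a (c * q ^ i) n) \<longlonglongrightarrow> (\<Sum>l\<le>n. (qpoch (a / x) q l * x ^ l / qpoch q q l)
      * (qpoch 0 q (n - l) * (1 / x) ^ (n - l) / qpoch q q (n - l)))"
      unfolding asc_conv_def divide_inverse by (intro tendsto_mult tendsto_const tendsto_sum tendsto_qpoch)
    then have "(\<lambda>i. asc_conv x a (c * q ^ i) n) \<longlonglongrightarrow> asc_conv x a 0 n"
      by (simp add: asc_conv_def)
    then show "(\<lambda>i. qpoch q q n * asc_conv x a (c * q ^ i) n) \<longlonglongrightarrow> qpoch q q n * asc_conv x a 0 n"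
      by (intro tendsto_mult tendsto_const)
  qed (simp_all add: cdqH_00_eq_conv[OF a x] asc_conv_def)
  then show ?thesis by (simp only: cdqH_b_c_commute)
qed

lemma asc_conv_commute:
  assumes x: "x \<noteq> 0"
  shows "asc_conv x a b n = asc_conv x b a n"
proof (induction n rule: induct_nat_012)
  case 1
  have "(1 - q) * asc_conv x a b 1 = (1 - q) * asc_conv x b a 1"
    using asc_conv_rec(2)[OF x, of a b] asc_conv_rec(2)[OF x, of b a] by (simp add: add.commute)
  then show ?case using q_power_neq_1[OF q(1), of 1] by simp
next
  case (ge2 n)
  have "(1 - q ^ Suc (Suc n)) * asc_conv x a b (Suc (Suc n)) = (1 - q ^ Suc (Suc n)) * asc_conv x b a (Suc (Suc n))"
    unfolding asc_conv_rec(1)[OF x] ge2 by (simp add: add.commute mult.commute)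
  then show ?case using q_power_neq_1[OF q(1), of "Suc (Suc n)"] by simp
qed (simp add: asc_conv_def)

text \<open>The contiguous relation in c is symmetric in a and b, and at c = 0 the claim is the
  symmetry of the Al-Salam-Chihara polynomials.\<close>

lemma cdqH_a_b_commute:
  assumes "a \<noteq> 0" "b \<noteq> 0" "x \<noteq> 0"
  shows "cdqH_poly n x a b c q = cdqH_poly n x b a c q"
proof (rule q_contiguous_unique[where f = "\<lambda>n c. cdqH_poly n x a b c q"
      and g = "\<lambda>n c. cdqH_poly n x b a c q" and \<kappa> = "\<lambda>n c. - c * (1 - q ^ Suc n) * (1 - a * b * q ^ n)"])
  fix n c
  have c0: "(\<lambda>i. c * q ^ i) \<longlonglongrightarrow> 0"
    using tendsto_mult_right_zero[OF LIMSEQ_power_zero[OF q(1)]] by blast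
  show "(\<lambda>i. cdqH_poly n x a b (c * q ^ i) q) \<longlonglongrightarrow> cdqH_poly n x a b 0 q"
    "(\<lambda>i. cdqH_poly n x b a (c * q ^ i) q) \<longlonglongrightarrow> cdqH_poly n x b a 0 q"
    by (intro tendsto_cdqH_c c0)+
  show "cdqH_poly (Suc n) x a b c q - cdqH_poly (Suc n) x a b (c * q) q
    = - c * (1 - q ^ Suc n) * (1 - a * b * q ^ n) * cdqH_poly n x a b (c * q) q"
    by (rule cdqH_contiguous[OF assms(1)])
  show "cdqH_poly (Suc n) x b a c q - cdqH_poly (Suc n) x b a (c * q) q
    = - c * (1 - q ^ Suc n) * (1 - a * b * q ^ n) * cdqH_poly n x b a (c * q) q"
    using cdqH_contiguous[OF assms(2), of n x a c] by (simp only: mult.commute[of b a])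
  show "cdqH_poly n x a b 0 q = cdqH_poly n x b a 0 q"
    using assms by (simp add: cdqH_0_eq_conv asc_conv_commute[of x a b])
qed simp_all

text \<open>If a c = q^(1-n), then (a c q^k;q)_(n-k) contains the factor 1 - 1 for every k < n. Only
  the term k = n is left, and it is a product.\<close>

lemma cdqH_truncated_nz:
  assumes "a \<noteq> 0" "a * c * q ^ n = q" "qpoch (a * x) q n \<noteq> 0" "qpoch (a / x) q n \<noteq> 0"
  shows "cdqH_poly n x a b c q \<noteq> 0"
proof -
  have z: "qpoch (a * c * q ^ k) q (n - k) = 0" if "k < n" for k
  proof -
    have "n - k - 1 < n - k" using that by simp
    moreover have "q ^ k * q ^ (n - k - 1) * q = q ^ n" using that by (simp flip: power_add power_Suc2)
    then have "a * c * q ^ k * q ^ (n - k - 1) * q = q" using assms(2) by (simp add: mult.assoc)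
    then have "a * c * q ^ k * q ^ (n - k - 1) = 1" using q by simp
    ultimately show ?thesis unfolding qpoch_eq_0_iff by blast
  qed
  have "qpoch (q powi - int n) q n * qpoch q q 0 * q ^ (n * n) = (- 1) ^ n * q ^ (n * (n - 1) div 2) * qpoch q q n"
    using qpoch_neg_power[of n n q] q by simp
  then have nz: "qpoch (q powi - int n) q n \<noteq> 0" using q qpoch_q_nz[OF q(1), of n] by auto
  have "cdqH_poly n x a b c q = inverse a ^ n * (qpoch (q powi (- int n)) q n * qpoch (a * x) q n * qpoch (a / x) q n / qpoch q q n * q ^ n)"
    unfolding cdqH_poly_def by (subst sum.remove[of _ n]) (auto intro!: sum.neutral simp: z)
  then show ?thesis using assms nz q qpoch_q_nz[OF q(1), of n] by simp
qed

end

section \<open>The bilinear series\<close>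

text \<open>In the application r is the squared base, z = q^(2 \<sigma>), and a, b are the
  parameters of m^(\<tau>,\<sigma>). The first alternative for A and B is \<nu> \<noteq> \<lambda>,
  the second \<nu> = \<lambda>. The last two assumptions keep (A;q)_n and (e;q)_l away from
  0.\<close>

locale asc_coupling =
  fixes r z :: real and x a b A B :: complex
  assumes r: "0 < r" "r < 1" and z: "0 < z" and x: "x \<noteq> 0" and b: "b \<noteq> 0"
    and a_eq: "a = - of_real z * b"
    and AB: "A = a * b \<and> B = 1 \<or> A = of_real r \<and> B = a * b / of_real r"
    and A_generic: "\<And>n. A * of_real r ^ n \<noteq> 1"
    and e_generic: "\<And>n. of_real r ^ 2 * B / A * of_real r ^ n \<noteq> 1"
begin

abbreviation "q \<equiv> complex_of_real r"
abbreviation "W \<equiv> asc_support r z"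

definition "t = b / B"
definition "e = q\<^sup>2 * B / A"

lemma nq: "norm q < 1" and q_nz: "q \<noteq> 0" and a_nz: "a \<noteq> 0"
  using r z b a_eq by auto

lemma A_nz: "A \<noteq> 0" and B_nz: "B \<noteq> 0" and AB_mult: "A * B = a * b"
  using AB a_nz b q_nz by auto

lemma t_nz: "t \<noteq> 0" using b B_nz by (simp add: t_def)

definition ch :: "nat \<Rightarrow> complex" where "ch n = qpoch q q n * asc_conv q x a b n"

lemma ch_0: "ch 0 = 1" by (simp add: ch_def asc_conv_def[OF nq q_nz])

lemma ch_1: "ch 1 = x + 1 / x - (a + b)"
  using asc_conv_rec(2)[OF nq q_nz x, of a b] by (simp add: ch_def qpoch_def)

lemma ch_rec: "ch (Suc (Suc n)) = (x + 1 / x - (a + b) * q ^ Suc n) * ch (Suc n)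
    - (1 - q ^ Suc n) * (1 - a * b * q ^ n) * ch n"
proof -
  have "ch (Suc (Suc n)) = qpoch q q (Suc n) * ((1 - q ^ Suc (Suc n)) * asc_conv q x a b (Suc (Suc n)))"
    by (simp add: qpoch_Suc ch_def)
  also have "\<dots> = (x + 1 / x - (a + b) * q ^ Suc n) * ch (Suc n) - qpoch q q (Suc n) * ((1 - a * b * q ^ n) * asc_conv q x a b n)"
    unfolding asc_conv_rec(1)[OF nq q_nz x] ch_def by (simp only: right_diff_distrib mult_ac)
  also have "qpoch q q (Suc n) * ((1 - a * b * q ^ n) * asc_conv q x a b n) = (1 - q ^ Suc n) * (1 - a * b * q ^ n) * ch n"
    by (simp add: qpoch_Suc ch_def)
  finally show ?thesis .
qed

text \<open>The recurrence coefficients are bounded in n, so the polynomials grow at most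
  geometrically.\<close>

lemma ch_bound: "\<exists>R\<ge>1. \<forall>n. norm (ch n) \<le> R ^ n"
proof -
  define R where "R = norm (x + 1 / x) + norm (a + b) + 2 * (1 + norm (a * b)) + 1"
  have R: "R \<ge> 1" by (simp add: R_def)
  have q1: "norm q ^ n \<le> 1" for n using r by (simp add: power_le_one)
  have "norm (ch n) \<le> R ^ n" for n
  proof (induction n rule: induct_nat_012)
    case 0 then show ?case by (simp add: ch_0)
  next
    case 1
    have "norm (ch 1) \<le> norm (x + 1 / x) + norm (a + b)" unfolding ch_1 by (rule norm_triangle_ineq4)
    also have "\<dots> \<le> R" by (simp add: R_def)
    finally show ?case by simp
  next
    case (ge2 n)
    have 1: "norm (x + 1 / x - (a + b) * q ^ Suc n) \<le> norm (x + 1 / x) + norm (a + b)"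
    proof -
      have "norm ((a + b) * q ^ Suc n) \<le> norm (a + b) * 1"
        unfolding norm_mult norm_power by (intro mult_left_mono q1) simp
      then show ?thesis using norm_triangle_ineq4[of "x + 1 / x" "(a + b) * q ^ Suc n"] by simp
    qed
    have 2: "norm (1 - q ^ Suc n) \<le> 2"
      using norm_triangle_ineq4[of 1 "q ^ Suc n"] q1[of "Suc n"] by (simp only: norm_power norm_one)
    have 3: "norm (1 - a * b * q ^ n) \<le> 1 + norm (a * b)"
    proof -
      have "norm (a * b * q ^ n) \<le> norm (a * b) * 1"
        unfolding norm_mult[of "a * b"] norm_power by (intro mult_left_mono q1) simp
      then show ?thesis using norm_triangle_ineq4[of 1 "a * b * q ^ n"] by simp
    qed
    have "norm (ch (Suc (Suc n))) \<le> norm ((x + 1 / x - (a + b) * q ^ Suc n) * ch (Suc n)) + norm ((1 - q ^ Suc n) * (1 - a * b * q ^ n) * ch n)"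
      unfolding ch_rec by (rule norm_triangle_ineq4)
    also have "\<dots> \<le> (norm (x + 1 / x) + norm (a + b)) * R ^ Suc n + 2 * (1 + norm (a * b)) * R ^ n"
      unfolding norm_mult[of "x + 1 / x - (a + b) * q ^ Suc n"] norm_mult[of "(1 - q ^ Suc n) * (1 - a * b * q ^ n)"]
        norm_mult[of "1 - q ^ Suc n"]
      by (intro add_mono mult_mono 1 2 3 ge2) (auto simp del: power_Suc)
    also have "\<dots> \<le> (norm (x + 1 / x) + norm (a + b)) * R ^ Suc n + 2 * (1 + norm (a * b)) * R ^ Suc n"
      using R by (intro add_left_mono mult_left_mono power_increasing) auto
    also have "\<dots> \<le> R * R ^ Suc n"
      unfolding distrib_right[symmetric] using R by (intro mult_right_mono) (auto simp: R_def)
    finally show ?case by simp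
  qed
  then show ?thesis using R by blast
qed

text \<open>Dividing by (A;q)_n redistributes the recurrence coefficients to 1 - A q^N and 1 - B
  q^N. In the case A = q this is \<open>asc_conv\<close>.\<close>

definition g :: "int \<Rightarrow> complex" where
  "g n = (if n < 0 then 0 else ch (nat n) / qpoch A q (nat n))"

lemma qpoch_A_nz [simp]: "qpoch A q n \<noteq> 0"
  using A_generic by (auto simp: qpoch_eq_0_iff)

lemma g_neg: "n < 0 \<Longrightarrow> g n = 0" by (simp add: g_def)

lemma g_rec:
  assumes "N \<ge> 0"
  shows "(1 - A * q powi N) * g (N + 1) = (x + 1 / x - (a + b) * q powi N) * g N - (1 - B * q powi N) * g (N - 1)"
proof -
  obtain n where n: "N = int n" using assms nonneg_int_cases by blast
  have An: "1 - A * q ^ n \<noteq> 0" using A_generic[of n] by simp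
  show ?thesis
  proof (cases n)
    case 0
    have "qpoch A q 1 = 1 - A" by (simp add: qpoch_def)
    then show ?thesis using An ch_1 by (simp add: n 0 g_def ch_0)
  next
    case (Suc m)
    \<comment> \<open>This factorisation is the reason for the two alternatives in
      \<open>AB\<close>.\<close>
    have fac: "(1 - q ^ Suc m) * (1 - a * b * q ^ m) = (1 - A * q ^ m) * (1 - B * q ^ Suc m)"
      using AB q_nz by auto
    have nats: "nat (N + 1) = Suc (Suc m)" "nat N = Suc m" "nat (N - 1) = m" "\<not> N + 1 < 0" "\<not> N < 0" "\<not> N - 1 < 0"
      using n Suc by auto
    have Am: "1 - A * q ^ m \<noteq> 0" "1 - A * q ^ Suc m \<noteq> 0" using A_generic[of m] A_generic[of "Suc m"] by auto
    have pN: "q powi N = q ^ Suc m" using n Suc by (simp only: power_int_of_nat)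
    have "(1 - A * q ^ Suc m) * (ch (Suc (Suc m)) / qpoch A q (Suc (Suc m))) = ch (Suc (Suc m)) / qpoch A q (Suc m)"
      using Am by (simp add: qpoch_Suc del: power_Suc)
    also have "\<dots> = (x + 1 / x - (a + b) * q ^ Suc m) * (ch (Suc m) / qpoch A q (Suc m))
       - (1 - A * q ^ m) * (1 - B * q ^ Suc m) * ch m / qpoch A q (Suc m)"
      unfolding ch_rec fac by (simp only: diff_divide_distrib times_divide_eq_right)
    also have "(1 - A * q ^ m) * (1 - B * q ^ Suc m) * ch m / qpoch A q (Suc m) = (1 - B * q ^ Suc m) * (ch m / qpoch A q m)"
      using Am by (simp add: qpoch_Suc del: power_Suc)
    finally show ?thesis by (simp only: pN g_def nats if_False)
  qed
qed

lemma g_bound: "\<exists>C>0. \<exists>R\<ge>1. \<forall>n. norm (g n) \<le> C * R ^ nat n"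
proof -
  obtain R where R: "R \<ge> 1" "\<And>n. norm (ch n) \<le> R ^ n" using ch_bound by auto
  obtain C where C: "C > 0" "\<And>n. norm (1 / qpoch A q n) \<le> C"
    using inverse_qpoch_Bseq[OF nq A_generic] by auto
  have "norm (g n) \<le> C * R ^ nat n" for n
  proof (cases "n < 0")
    case False
    have "norm (g n) = norm (1 / qpoch A q (nat n)) * norm (ch (nat n))"
      using False by (simp add: g_def norm_divide)
    also have "\<dots> \<le> C * R ^ nat n" using C R by (intro mult_mono) auto
    finally show ?thesis .
  qed (use C R in \<open>auto simp: g_def\<close>)
  then show ?thesis using C R by blast
qed

text \<open>1/(q;q)_j continued by 0 to negative j; with this convention \<open>rq_rec\<close> has
  no exceptional index.\<close>

definition rq :: "int \<Rightarrow> complex" where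
  "rq j = (if j < 0 then 0 else 1 / qpoch q q (nat j))"

lemma rq_rec: "rq j = (1 - q powi (j + 1)) * rq (j + 1)"
proof -
  consider "j < -1" | "j = -1" | n where "j = int n"
    by (metis int_one_le_iff_zero_less linorder_less_linear neg_int_cases nonneg_int_cases not_less zle_iff_zadd add.inverse_inverse uminus_int_code(1) zless_iff_Suc_zadd minus_less_iff not_le)
  then show ?thesis
  proof cases
    case 3
    have "1 - q * q ^ n \<noteq> 0" using q_power_neq_1[OF nq, of "Suc n"] by simp
    moreover have "nat (j + 1) = Suc n" "nat j = n" "q powi (j + 1) = q ^ Suc n"
      using 3 power_int_of_nat[of q "Suc n"] by (auto simp: add.commute)
    ultimately show ?thesis using 3 by (simp add: rq_def qpoch_Suc)
  qed (auto simp: rq_def)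
qed

text \<open>For M \<ge> 0 this is 3phi2(q^(-n), 0, X; e, q^(M+1); q, q)/(q;q)_M, a big q-Laguerre
  polynomial. With 1/(q;q)_(M+l) kept inside the sum it also covers the degenerate parameters M <
  0.\<close>

definition H :: "nat \<Rightarrow> complex \<Rightarrow> int \<Rightarrow> complex" where
  "H n X M = (\<Sum>l\<le>n. qpoch (q powi (- int n)) q l * qpoch X q l * rq (M + int l) / (qpoch e q l * qpoch q q l) * q ^ l)"

lemma powi_add_nat: "q powi (M + int l) = q powi M * q ^ l"
  using q_nz by (simp add: power_int_add)

lemma H_lower_0: "H 0 X M = (1 - q powi (M + 1)) * H 0 X (M + 1)"
  using rq_rec[of M] by (simp add: H_def)

text \<open>A termwise identity: \<open>rq_rec\<close> shifts M, and the resulting factor q^(n+1) -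
  q^l lowers n.\<close>

lemma H_lower: "H (Suc n) X M = (1 - q powi (M + int n + 2)) * H (Suc n) X (M + 1)
    - (1 - q ^ Suc n) * q powi (M + 1) * H n X (M + 1)"
proof -
  define Y where "Y l = qpoch X q l / (qpoch e q l * qpoch q q l) * q ^ l" for l
  define P where "P l = qpoch (q powi (- int (Suc n))) q l" for l
  have "qpoch (q powi (- int n)) q (Suc n) = 0" by (rule qpoch_neg_power_eq_0[OF _ q_nz]) simp
  then have "H n X (M + 1) = (\<Sum>l\<le>Suc n. qpoch (q powi (- int n)) q l * rq (M + 1 + int l) * Y l)"
    by (simp add: H_def Y_def mult_ac)
  moreover have "H (Suc n) X (M + 1) = (\<Sum>l\<le>Suc n. P l * rq (M + 1 + int l) * Y l)"
    unfolding H_def Y_def P_def by (intro sum.cong refl) (simp add: mult_ac)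
  moreover have "H (Suc n) X M = (\<Sum>l\<le>Suc n. P l * rq (M + int l) * Y l)"
    unfolding H_def Y_def P_def by (intro sum.cong refl) (simp add: mult_ac)
  moreover have "P l * rq (M + int l) * Y l = (1 - q powi (M + int n + 2)) * (P l * rq (M + 1 + int l) * Y l)
     - (1 - q ^ Suc n) * q powi (M + 1) * (qpoch (q powi (- int n)) q l * rq (M + 1 + int l) * Y l)" for l
  proof -
    define V where "V = q powi (M + 1)"
    have v1: "q powi (M + int n + 2) = V * q ^ Suc n"
      using powi_add_nat[of "M + 1" "Suc n"] by (simp add: V_def add_ac)
    have v2: "rq (M + int l) = (1 - V * q ^ l) * rq (M + 1 + int l)"
      using rq_rec[of "M + int l"] powi_add_nat[of "M + 1" l] by (simp add: V_def add_ac)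
    have v3: "(1 - q ^ Suc n) * qpoch (q powi (- int n)) q l = - (P l * (q ^ Suc n - q ^ l))"
      unfolding P_def qpoch_neg_Suc_step[OF q_nz] by (simp only: mult_minus_left minus_minus)
    have gen: "p * ((1 - V * Ql) * R) * y = (1 - V * Qn) * (p * R * y) - c * V * (u * R * y)"
      if "c * u = - (p * (Qn - Ql))" for p Ql R y Qn c u :: complex
    proof -
      have "c * V * (u * R * y) = (c * u) * (V * R * y)" by simp
      then show ?thesis unfolding that by (simp add: algebra_simps)
    qed
    show ?thesis unfolding v1 v2 V_def[symmetric] by (rule gen[OF v3])
  qed
  ultimately show ?thesis by (simp only: sum_subtractf sum_distrib_left)
qed

text \<open>Also termwise: (1 - Y)(q Y;q)_l = (1 - Y q^l)(Y;q)_l.\<close>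

lemma H_shift: "(1 - Y) * H n (q * Y) M = Y * q powi (- M) * H n Y (M - 1) + (1 - Y * q powi (- M)) * H n Y M"
proof -
  define Z where "Z l = qpoch (q powi (- int n)) q l / (qpoch e q l * qpoch q q l) * q ^ l" for l
  have H: "H n X M = (\<Sum>l\<le>n. Z l * (qpoch X q l * rq (M + int l)))" for X M
    unfolding H_def Z_def by (intro sum.cong refl) (simp add: mult_ac)
  have "(1 - Y) * (Z l * (qpoch (q * Y) q l * rq (M + int l))) =
      Y * q powi (- M) * (Z l * (qpoch Y q l * rq (M - 1 + int l)))
      + (1 - Y * q powi (- M)) * (Z l * (qpoch Y q l * rq (M + int l)))" for l
  proof -
    have 1: "(1 - Y) * qpoch (q * Y) q l = qpoch Y q l * (1 - Y * q ^ l)"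
      using qpoch_Suc[of Y q l] qpoch_Suc'[of Y q l] by (simp add: mult.commute)
    have 2: "rq (M - 1 + int l) = (1 - q powi M * q ^ l) * rq (M + int l)"
      using rq_rec[of "M - 1 + int l"] powi_add_nat[of M l] by (simp add: algebra_simps)
    have 3: "q powi (- M) * q powi M = 1" using q_nz by (simp add: power_int_minus)
    have "(1 - Y) * (Z l * (qpoch (q * Y) q l * rq (M + int l))) = Z l * (((1 - Y) * qpoch (q * Y) q l) * rq (M + int l))"
      by simp
    also have "\<dots> = (1 - Y * q ^ l) * (Z l * (qpoch Y q l * rq (M + int l)))"
      unfolding 1 by simp
    \<comment> \<open>Split into a multiple of 1 - q^(M+l), which lowers M by one, and a
      constant.\<close>
    also have "1 - Y * q ^ l = Y * q powi (- M) * (1 - q powi M * q ^ l) + (1 - Y * q powi (- M))"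
    proof -
      have "Y * q powi (- M) * (q powi M * q ^ l) = Y * q ^ l" using 3 by (metis mult.assoc mult.right_neutral)
      then show ?thesis by (simp add: algebra_simps)
    qed
    finally show ?thesis unfolding 2 by (simp add: algebra_simps)
  qed
  then show ?thesis unfolding H sum_distrib_left sum.distrib[symmetric] by simp
qed

text \<open>Not a termwise identity: the difference of the two sides telescopes, with the summands \<open>T\<close> below.\<close>

lemma H_raise:
  assumes \<kappa>: "\<kappa> * e = X * q"
  shows "H n (X * q) M = (1 - \<kappa>) * H n X M + \<kappa> / q ^ n * (1 - q powi (M + int n + 1)) * H n (X * q) (M + 1)"
proof -
  have enz: "qpoch e q l \<noteq> 0" for l using e_generic by (auto simp: qpoch_eq_0_iff e_def)
  define P where "P l = qpoch (q powi (- int n)) q l" for l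
  define T where "T l = (case l of 0 \<Rightarrow> 0 | Suc j \<Rightarrow>
      \<kappa> * P (Suc j) * qpoch (X * q) q j * rq (M + 1 + int j) / (qpoch e q j * qpoch q q j))" for l
  define V where "V = q powi (M + 1)"
  have Vn: "q powi (M + int n + 1) = V * q ^ n"
    using powi_add_nat[of "M + 1" n] by (simp add: V_def add_ac)
  have rq: "rq (M + int l) = (1 - V * q ^ l) * rq (M + 1 + int l)" for l
    using rq_rec[of "M + int l"] powi_add_nat[of "M + 1" l] by (simp add: V_def add_ac)
  have summand: "P l / (qpoch e q l * qpoch q q l) * q ^ l * (qpoch (X * q) q l * rq (M + int l)
      - (1 - \<kappa>) * (qpoch X q l * rq (M + int l))
      - \<kappa> / q ^ n * (1 - V * q ^ n) * (qpoch (X * q) q l * rq (M + 1 + int l))) = T (Suc l) - T l" for l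
  proof (cases l)
    case 0
    have "P (Suc 0) = 1 - 1 / q ^ n" by (simp add: P_def qpoch_def powi_neg_nat)
    then have T1: "T (Suc 0) = \<kappa> * (1 - 1 / q ^ n) * rq (M + 1)" by (simp add: T_def)
    have k: "\<kappa> / q ^ n * (1 - V * q ^ n) = \<kappa> * (1 / q ^ n) - \<kappa> * V" using q_nz by (simp add: right_diff_distrib)
    have r0: "rq M = (1 - V) * rq (M + 1)" using rq[of 0] by simp
    have T0: "T 0 = 0" by (simp add: T_def)
    show ?thesis unfolding 0 T1 k T0
      by (simp add: P_def r0) (simp add: algebra_simps)
  next
    case (Suc j)
    define D where "D = P l * rq (M + 1 + int l) * qpoch (X * q) q j / (qpoch e q j * qpoch q q j)"
    define L where "L = q ^ j"
    have nz: "1 - e * L \<noteq> 0" "1 - q * L \<noteq> 0"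
      using e_generic[of j] q_power_neq_1[OF nq, of "Suc j"] by (auto simp: L_def e_def)
    have P1: "P (Suc l) = P l * (1 - q * L / q ^ n)"
      by (simp add: P_def qpoch_Suc powi_neg_nat Suc L_def)
    have T1: "T (Suc l) = \<kappa> * (1 - q * L / q ^ n) * (1 - X * q * L) / ((1 - e * L) * (1 - q * L)) * D"
      unfolding T_def D_def by (simp add: P1) (simp add: Suc qpoch_Suc L_def mult_ac)
    have "M + 1 + int j = M + int l" using Suc by simp
    then have rr: "rq (M + 1 + int j) = (1 - V * q * L) * rq (M + 1 + int l)"
      unfolding \<open>M + 1 + int j = M + int l\<close> rq[of l] by (simp add: Suc L_def mult.assoc)
    have "T l = \<kappa> * P l * qpoch (X * q) q j * rq (M + 1 + int j) / (qpoch e q j * qpoch q q j)"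
      by (simp add: T_def Suc)
    then have T0: "T l = \<kappa> * (1 - V * q * L) * D"
      unfolding rr D_def by (simp only: mult_ac times_divide_eq_right times_divide_eq_left)
    have X1: "qpoch (X * q) q l = (1 - X * q * L) * qpoch (X * q) q j"
      by (simp add: Suc qpoch_Suc L_def mult_ac)
    have X0: "qpoch X q l = (1 - X) * qpoch (X * q) q j"
      by (simp add: Suc qpoch_Suc')
    have "P l / (qpoch e q l * qpoch q q l) * q ^ l * (qpoch (X * q) q l * rq (M + int l)
      - (1 - \<kappa>) * (qpoch X q l * rq (M + int l))
      - \<kappa> / q ^ n * (1 - V * q ^ n) * (qpoch (X * q) q l * rq (M + 1 + int l)))
     = q * L * ((1 - X * q * L) * (1 - V * q * L) - (1 - \<kappa>) * ((1 - X) * (1 - V * q * L))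
        - \<kappa> / q ^ n * (1 - V * q ^ n) * (1 - X * q * L)) / ((1 - e * L) * (1 - q * L)) * D"
      unfolding X1 X0 rq[of l] D_def using nz enz[of j]
      by (simp add: Suc qpoch_Suc L_def[symmetric] divide_simps) (simp add: algebra_simps)
    also have "q * L * ((1 - X * q * L) * (1 - V * q * L) - (1 - \<kappa>) * ((1 - X) * (1 - V * q * L))
        - \<kappa> / q ^ n * (1 - V * q ^ n) * (1 - X * q * L))
      = \<kappa> * (1 - q * L / q ^ n) * (1 - X * q * L) - \<kappa> * (1 - V * q * L) * ((1 - e * L) * (1 - q * L))"
    proof -
      define u where "u = 1 / q ^ n"
      have un: "q ^ n * u = 1" using q_nz by (simp add: u_def)
      have d: "\<kappa> / q ^ n = \<kappa> * u" "q * L / q ^ n = q * L * u" by (simp_all add: u_def)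
      have k1: "\<kappa> * u * (1 - V * q ^ n) = \<kappa> * u - \<kappa> * V"
        using un by (simp add: algebra_simps)
      show ?thesis unfolding k1 d using \<kappa> by algebra
    qed
    finally show ?thesis unfolding T1 T0 using nz by (simp add: diff_divide_distrib left_diff_distrib)
  qed
  have "P (Suc n) = 0" unfolding P_def by (rule qpoch_neg_power_eq_0[OF _ q_nz]) simp
  then have Tn: "T (Suc n) = 0" by (simp add: T_def)
  have "(\<Sum>l\<le>n. T (Suc l) - T l) = T (Suc n) - T 0"
    unfolding lessThan_Suc_atMost[symmetric] by (rule sum_lessThan_telescope)
  then have "(\<Sum>l\<le>n. T (Suc l) - T l) = 0" using Tn by (simp add: T_def)
  moreover have "(\<Sum>l\<le>n. T (Suc l) - T l) = H n (X * q) M - (1 - \<kappa>) * H n X M - \<kappa> / q ^ n * (1 - V * q ^ n) * H n (X * q) (M + 1)"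
  proof -
    define Z where "Z l = P l / (qpoch e q l * qpoch q q l) * q ^ l" for l
    have H: "H n X M = (\<Sum>l\<le>n. Z l * (qpoch X q l * rq (M + int l)))" for X M
      unfolding H_def Z_def P_def by (intro sum.cong refl) (simp add: mult_ac)
    have gen: "c * (d - k * f - j * h) = c * d - k * (c * f) - j * (c * h)" for c d k f j h :: complex
      by (simp add: algebra_simps)
    show ?thesis
      unfolding summand[symmetric] H sum_distrib_left sum_subtractf[symmetric] Z_def[symmetric] gen ..
  qed
  ultimately show ?thesis unfolding Vn by (simp add: algebra_simps)
qed

definition GG :: "int \<Rightarrow> nat \<Rightarrow> nat \<Rightarrow> complex" where
  "GG k n m = H n (B * q powi (1 + (k + int m - int n))) (int m - int n)"

text \<open>Up to a factor free of m this is (-i)^m sqrt(hinv m) times the tested component of U at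
  index m; \<open>coupling_sum\<close> makes this precise.\<close>

definition cf :: "int \<Rightarrow> nat \<Rightarrow> nat \<Rightarrow> complex" where
  "cf k n m = (t / q ^ n) ^ m * g (k + int m - int n) * GG k n m"

definition u :: "nat \<Rightarrow> real \<Rightarrow> complex" where
  "u m w = of_real (ascU (- z) r m w)"

definition RS :: "int \<Rightarrow> nat \<Rightarrow> real \<Rightarrow> complex" where
  "RS k n w = (\<Sum>m. cf k n m * u m w)"

lemma rq_bound: "\<exists>K>0. \<forall>j. norm (rq j) \<le> K"
  using inverse_qpoch_q_Bseq[OF nq] by (auto simp: rq_def)

text \<open>While k + m - n is nonnegative the argument \<open>X\<close> stays within norm B, so the
  n + 1 terms are bounded independently of k and m.\<close>

lemma GG_bound: "\<exists>C>0. \<forall>k m. k + int m - int n \<ge> 0 \<longrightarrow> norm (GG k n m) \<le> C"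
proof -
  obtain K where K: "K > 0" "\<And>j. norm (rq j) \<le> K" using rq_bound by blast
  define Z where "Z l = norm (qpoch (q powi (- int n)) q l / (qpoch e q l * qpoch q q l) * q ^ l)" for l
  define C where "C = (\<Sum>l\<le>n. Z l * ((1 + norm B) ^ l * K)) + 1"
  have "norm (GG k n m) \<le> C" if N: "k + int m - int n \<ge> 0" for k m
  proof -
    define X where "X = B * q powi (1 + (k + int m - int n))"
    obtain N where "1 + (k + int m - int n) = int N" using N by (metis add_nonneg_nonneg nonneg_int_cases zero_le_one)
    then have "norm X = norm B * r ^ N" using r by (simp only: X_def norm_mult norm_power power_int_of_nat) simp
    then have X: "norm X \<le> norm B" using r by (simp add: mult_left_le power_le_one)
    have q1: "norm q \<le> 1" using r by simp
    have "norm (GG k n m) \<le> (\<Sum>l\<le>n. norm (qpoch (q powi (- int n)) q l * qpoch X q l * rq (int m - int n + int l) / (qpoch e q l * qpoch q q l) * q ^ l))"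
      unfolding GG_def H_def X_def by (rule norm_sum)
    also have "\<dots> = (\<Sum>l\<le>n. Z l * (norm (qpoch X q l) * norm (rq (int m - int n + int l))))"
      by (intro sum.cong refl) (simp only: Z_def norm_mult norm_divide mult_ac times_divide_eq_right times_divide_eq_left)
    also have "\<dots> \<le> (\<Sum>l\<le>n. Z l * ((1 + norm B) ^ l * K))"
      using K by (intro sum_mono mult_left_mono mult_mono norm_qpoch_le X q1) (auto simp: Z_def)
    finally show ?thesis by (simp add: C_def)
  qed
  moreover have "C > 0" unfolding C_def using K by (intro add_nonneg_pos sum_nonneg) (auto simp: Z_def)
  ultimately show ?thesis by blast
qed

lemma cf_bound: "\<exists>C>0. \<exists>R>0. \<forall>m. norm (cf k n m) \<le> C * R ^ m"
proof -
  obtain C1 where C1: "C1 > 0" "\<And>m. k + int m - int n \<ge> 0 \<Longrightarrow> norm (GG k n m) \<le> C1" using GG_bound by blast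
  obtain C2 R where C2: "C2 > 0" "R \<ge> 1" "\<And>j. norm (g j) \<le> C2 * R ^ nat j" using g_bound by blast
  define s where "s = norm (t / q ^ n)"
  have "norm (cf k n m) \<le> (C1 * C2 * R ^ nat \<bar>k\<bar>) * (s * R) ^ m" for m
  proof (cases "k + int m - int n \<ge> 0")
    case True
    have "norm (cf k n m) = s ^ m * (norm (g (k + int m - int n)) * norm (GG k n m))"
      by (simp add: cf_def s_def norm_mult norm_power)
    also have "\<dots> \<le> s ^ m * ((C2 * R ^ (nat \<bar>k\<bar> + m)) * C1)"
    proof (intro mult_left_mono mult_mono C1 True)
      have "R ^ nat (k + int m - int n) \<le> R ^ (nat \<bar>k\<bar> + m)" using C2 by (intro power_increasing) auto
      then show "norm (g (k + int m - int n)) \<le> C2 * R ^ (nat \<bar>k\<bar> + m)"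
        using C2(1) by (intro order_trans[OF C2(3)] mult_left_mono) auto
    qed (use C1 C2 in \<open>auto simp: s_def\<close>)
    finally show ?thesis by (simp add: power_add power_mult_distrib mult_ac)
  next
    case False
    then have "cf k n m = 0" by (simp add: cf_def g_neg)
    then show ?thesis using C1 C2 by (simp add: s_def)
  qed
  moreover have "C1 * C2 * R ^ nat \<bar>k\<bar> > 0" "s * R > 0" using C1 C2 t_nz q_nz by (auto simp: s_def)
  ultimately show ?thesis by blast
qed

text \<open>On the support the U_m decay faster than any geometric sequence, so geometric growth of
  the coefficients is harmless.\<close>

lemma geometric_times_u_summable:
  assumes c: "\<And>m. norm (c m) \<le> C * R ^ m" and R: "R > 0" and w: "w \<in> W"
  shows "summable (\<lambda>m. norm (c m * u m w))"
proof -
  have C0: "C \<ge> 0" using order_trans[OF norm_ge_zero c[of 0]] by simp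
  obtain D where D: "D > 0" "\<And>m. \<bar>ascU (- z) r m w\<bar> \<le> D * (1 / (2 * R)) ^ m"
    using asc_uniform_bound[OF r z, of "1 / (2 * R)"] R w by auto
  show ?thesis
  proof (rule summable_comparison_test')
    show "summable (\<lambda>m. C * D * (1/2::real) ^ m)" by (intro summable_mult summable_geometric) simp
    fix m
    have "norm (c m * u m w) \<le> (C * R ^ m) * (D * (1 / (2 * R)) ^ m)"
      unfolding norm_mult using c D(2)[of m] C0 R by (intro mult_mono) (auto simp: u_def)
    also have "\<dots> = C * D * (1/2) ^ m" using R by (simp add: power_divide power_mult_distrib)
    finally show "norm (norm (c m * u m w)) \<le> C * D * (1/2) ^ m" by simp
  qed
qed

lemma cf_summable: "w \<in> W \<Longrightarrow> summable (\<lambda>m. norm (cf k n m * u m w))"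
  using cf_bound[of k n] geometric_times_u_summable by blast

lemma RS_sums: "w \<in> W \<Longrightarrow> (\<lambda>m. cf k n m * u m w) sums RS k n w"
  unfolding RS_def by (intro summable_sums summable_norm_cancel[OF cf_summable])

lemma H_eq_0: "H n X (- 1 - int n) = 0"
  unfolding H_def by (rule sum.neutral) (auto simp: rq_def)

text \<open>(1;q)_l kills the terms l > 0, and 1/(q;q)_M = 0 kills the term l = 0.\<close>

lemma H_one: "M < 0 \<Longrightarrow> H n 1 M = 0"
proof -
  assume "M < 0"
  have "qpoch 1 q (Suc j) = 0" for j by (simp add: qpoch_Suc')
  then have "qpoch 1 q l * rq (M + int l) = 0" for l
    using \<open>M < 0\<close> by (cases l) (auto simp: rq_def)
  then have *: "qpoch 1 q l = 0 \<or> rq (M + int l) = 0" for l by (simp only: mult_eq_0_iff)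
  show ?thesis unfolding H_def
  proof (intro sum.neutral ballI)
    fix l
    show "qpoch (q powi - int n) q l * qpoch 1 q l * rq (M + int l) / (qpoch e q l * qpoch q q l) * q ^ l = 0"
      using *[of l] by auto
  qed
qed

text \<open>The bracket is the coefficient of U_m in w times the series, by the recurrence of U. The
  identity combines \<open>g_rec\<close> with \<open>H_raise\<close> and \<open>H_shift\<close>,
  which trade the shift in k for shifts in m.\<close>

lemma cf_rec:
  assumes k: "B = 1 \<Longrightarrow> k \<ge> 0"
  shows "cf (k + 1) n m = (x + 1 / x) * cf k n m
    - b * q powi k / q ^ n * ((if m = 0 then 0 else cf k n (m - 1)) + (1 - of_real z) * q ^ m * cf k n m
         + of_real z * q ^ m * (1 - q ^ Suc m) * cf k n (Suc m))
    - (1 - B * q powi k) * cf (k - 1) n m"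
proof -
  define N where "N = k + int m - int n"
  define M where "M = int m - int n"
  define s where "s = t / q ^ n"
  define X where "X = B * q powi (1 + N)"
  define Y where "Y = B * q powi N"
  define \<kappa> where "\<kappa> = A * q powi N"
  define qk where "qk = q powi k"
  define G0 where "G0 = H n X M"
  define Gk1 where "Gk1 = H n (X * q) M"
  define Gm1 where "Gm1 = H n (X * q) (M + 1)"
  define Gmm where "Gmm = H n Y (M - 1)"
  define Gkm where "Gkm = H n Y M"
  have XY: "X = q * Y" unfolding X_def Y_def using q_nz by (simp add: power_int_add)
  have pN: "q powi N * q ^ n = qk * q ^ m"
    unfolding N_def qk_def using q_nz by (simp add: power_int_add power_int_diff)
  have Xq: "X * q = B * q powi (1 + (N + 1))" unfolding X_def using q_nz by (simp add: power_int_add power2_eq_square)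
  have GG: "GG k n m = G0" "GG (k + 1) n m = Gk1" "GG k n (Suc m) = Gm1" "GG (k - 1) n m = Gkm"
  proof -
    have i: "k + int m - int n = N" "k + 1 + int m - int n = N + 1" "k + int (Suc m) - int n = N + 1"
      "k - 1 + int m - int n = N - 1" "1 + (N - 1) = N" "int m - int n = M" "int (Suc m) - int n = M + 1"
      by (simp_all add: N_def M_def)
    show "GG k n m = G0" "GG (k + 1) n m = Gk1" "GG k n (Suc m) = Gm1" "GG (k - 1) n m = Gkm"
      by (simp_all only: GG_def i G0_def Gk1_def Gm1_def Gkm_def Xq) (simp_all only: X_def Y_def)
  qed
  have snz: "s \<noteq> 0" using t_nz q_nz by (simp add: s_def)
  have prev: "(if m = 0 then 0 else cf k n (m - 1)) = s ^ m / s * g (N - 1) * Gmm"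
  proof (cases m)
    case 0
    then have "M - 1 = - 1 - int n" by (simp add: M_def)
    then have "Gmm = 0" unfolding Gmm_def by (simp only: H_eq_0)
    then show ?thesis using 0 by simp
  next
    case (Suc j)
    have "GG k n j = Gmm" unfolding GG_def Gmm_def Y_def M_def N_def using Suc by (simp add: algebra_simps)
    then show ?thesis using Suc snz by (simp add: cf_def s_def[symmetric] N_def algebra_simps)
  qed
  have "\<kappa> * e = X * q"
  proof -
    have eA: "e * A = q\<^sup>2 * B" using A_nz by (simp add: e_def field_simps)
    have "\<kappa> * e = (e * A) * q powi N" by (simp only: \<kappa>_def mult_ac)
    then show ?thesis unfolding eA XY Y_def power2_eq_square by (simp only: mult_ac)
  qed
  from H_raise[OF this, of n M]
  have id1: "Gk1 = (1 - \<kappa>) * G0 + \<kappa> / q ^ n * (1 - q ^ Suc m) * Gm1"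
  proof -
    have "M + int n + 1 = int (Suc m)" by (simp add: M_def)
    then have "q powi (M + int n + 1) = q ^ Suc m" by (simp only: power_int_of_nat)
    with H_raise[OF \<open>\<kappa> * e = X * q\<close>, of n M] show ?thesis by (simp only: G0_def Gk1_def Gm1_def)
  qed
  have id2: "(1 - Y) * G0 = B * qk * Gmm + (1 - B * qk) * Gkm"
  proof -
    have "Y * q powi (- M) = B * (q powi N * q powi (- M))" by (simp add: Y_def)
    also have "q powi N * q powi (- M) = q powi (N + - M)" using power_int_add[of q N "- M"] q_nz by simp
    also have "N + - M = k" by (simp add: N_def M_def)
    finally have "Y * q powi (- M) = B * qk" by (simp add: qk_def)
    with H_shift[of Y n M] show ?thesis by (simp only: G0_def Gmm_def Gkm_def XY)
  qed
  \<comment> \<open>\<open>g_rec\<close> starts at N = 0. At N = -1 the left side must vanish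
    although g(0) = 1: if B = 1, then X = 1 and \<open>H_one\<close> applies, as M < 0 by k \<ge> 0;
    if A = q, then \<kappa> = 1.\<close>
  have rec: "(1 - \<kappa>) * g (N + 1) * G0 = ((x + 1 / x - (a + b) * q powi N) * g N - (1 - Y) * g (N - 1)) * G0"
  proof -
    consider "N \<ge> 0" | "N = -1" | "N < -1" by linarith
    then show ?thesis
    proof cases
      case 1
      then show ?thesis using g_rec[OF 1] by (simp only: \<kappa>_def Y_def)
    next
      case 2
      have "(1 - \<kappa>) * G0 = 0"
      proof (cases "B = 1")
        case True
        then have "M < 0" using 2 k by (simp add: M_def N_def)
        moreover have "X = 1" using True 2 by (simp add: X_def)
        ultimately show ?thesis by (simp add: G0_def H_one)
      next
        case False
        then have "A = q" using AB by auto
        then show ?thesis using 2 q_nz by (simp add: \<kappa>_def power_int_minus)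
      qed
      then show ?thesis using 2 by (auto simp: g_neg)
    qed (simp add: g_neg)
  qed
  have c1: "b * qk / q ^ n / s = B * qk" using b B_nz q_nz by (simp add: s_def t_def)
  have c2: "b * qk / q ^ n * (1 - of_real z) * q ^ m = (a + b) * q powi N"
    unfolding a_eq using pN q_nz by (simp add: field_simps)
  have c3: "b * qk / q ^ n * (of_real z * q ^ m * s) = - (\<kappa> / q ^ n)"
  proof -
    have "b * qk / q ^ n * (of_real z * q ^ m * s) = - (a * t) * ((qk * q ^ m) / q ^ n) / q ^ n"
      unfolding a_eq s_def by simp
    also have "(qk * q ^ m) / q ^ n = q powi N" unfolding pN[symmetric] using q_nz by simp
    also have "a * t = A" using AB_mult B_nz by (simp add: t_def field_simps)
    finally show ?thesis by (simp add: \<kappa>_def)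
  qed
  have main: "g (N + 1) * Gk1 = (x + 1 / x) * (g N * G0) - (B * qk) * (g (N - 1) * Gmm) - (a + b) * q powi N * (g N * G0)
       + \<kappa> / q ^ n * (1 - q ^ Suc m) * (g (N + 1) * Gm1) - (1 - B * qk) * (g (N - 1) * Gkm)"
  proof -
    have "g (N + 1) * Gk1 = (1 - \<kappa>) * g (N + 1) * G0 + \<kappa> / q ^ n * (1 - q ^ Suc m) * (g (N + 1) * Gm1)"
      unfolding id1 by (simp only: distrib_left mult_ac)
    also have "(1 - \<kappa>) * g (N + 1) * G0 = (x + 1 / x - (a + b) * q powi N) * (g N * G0) - g (N - 1) * ((1 - Y) * G0)"
    proof -
      have "(uu * gg - v * h) * w = uu * (gg * w) - h * (v * w)" for uu gg v h w :: complex
        by (simp add: algebra_simps)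
      then show ?thesis unfolding rec .
    qed
    also have "g (N - 1) * ((1 - Y) * G0) = (B * qk) * (g (N - 1) * Gmm) + (1 - B * qk) * (g (N - 1) * Gkm)"
      unfolding id2 by (simp only: distrib_left mult_ac)
    finally show ?thesis by (simp only: left_diff_distrib[of "x + 1 / x"]) simp
  qed
  have e1: "cf (k + 1) n m = s ^ m * (g (N + 1) * Gk1)"
    unfolding cf_def GG s_def N_def by (simp add: algebra_simps)
  have e2: "cf k n m = s ^ m * (g N * G0)" unfolding cf_def GG s_def N_def by simp
  have e3: "cf k n (Suc m) = s ^ m * s * (g (N + 1) * Gm1)"
    unfolding cf_def GG s_def N_def by (simp add: algebra_simps)
  have e4: "cf (k - 1) n m = s ^ m * (g (N - 1) * Gkm)"
    unfolding cf_def GG s_def N_def by (simp add: algebra_simps)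
  have gen: "sm * GK = mu * (sm * g0) - bq * (sm / s * gm * Gmm + z1 * qm * (sm * g0) + zz * qm * v * (sm * s * g1)) - w * (sm * gkm)"
    if "GK = mu * g0 - c * (gm * Gmm) - d * g0 + h * v * g1 - w * gkm"
       "bq / s = c" "bq * z1 * qm = d" "bq * (zz * qm * s) = - h" for sm GK mu g0 bq gm z1 qm zz v g1 w gkm c d h :: complex
  proof -
    have "h = - (bq * (zz * qm * s))" using that(4) by simp
    then show ?thesis unfolding that(1) that(2)[symmetric] that(3)[symmetric] by (simp add: algebra_simps)
  qed
  show ?thesis unfolding e1 e2 e3 e4 prev qk_def[symmetric] by (rule gen[OF main c1 c2 c3])
qed

text \<open>\<open>cf_rec\<close> summed against U_m; the three parts of the bracket converge
  separately and add up to multiplication by w.\<close>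

lemma RS_three_term:
  assumes k: "B = 1 \<Longrightarrow> k \<ge> 0" and w: "w \<in> W"
  shows "RS (k + 1) n w = (x + 1 / x - b * q powi k / q ^ n * of_real w) * RS k n w - (1 - B * q powi k) * RS (k - 1) n w"
proof -
  define f1 where "f1 m = (if m = 0 then 0 else cf k n (m - 1)) * u m w" for m
  define f2 where "f2 m = (1 - of_real z) * q ^ m * cf k n m * u m w" for m
  define f3 where "f3 m = of_real z * q ^ m * (1 - q ^ Suc m) * cf k n (Suc m) * u m w" for m
  obtain C R where CR: "C > 0" "R > 0" "\<And>m. norm (cf k n m) \<le> C * R ^ m" using cf_bound by blast
  have q1: "norm (q ^ m) \<le> 1" for m unfolding norm_power using r by (intro power_le_one) auto
  have "summable f2"
  proof -
    have "norm ((1 - of_real z) * q ^ m * cf k n m) \<le> (norm (1 - complex_of_real z) * 1 * C) * R ^ m" for m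
      unfolding norm_mult mult.assoc using CR q1 by (intro mult_mono) auto
    from geometric_times_u_summable[OF this CR(2) w] show ?thesis
      unfolding f2_def by (rule summable_norm_cancel)
  qed
  have "summable f3"
  proof -
    have "norm (1 - q ^ Suc m) \<le> 2" for m
      using norm_triangle_ineq4[of 1 "q ^ Suc m"] q1[of "Suc m"] by (simp only: norm_one)
    then have "norm (of_real z * q ^ m * (1 - q ^ Suc m) * cf k n (Suc m)) \<le> norm (complex_of_real z) * 1 * 2 * (C * R ^ Suc m)" for m
      unfolding norm_mult using CR(1,2) CR(3)[of "Suc m"] q1 by (intro mult_mono mult_nonneg_nonneg) auto
    then have "norm (of_real z * q ^ m * (1 - q ^ Suc m) * cf k n (Suc m)) \<le> (norm (complex_of_real z) * 1 * 2 * C * R) * R ^ m" for m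
      by (simp add: mult_ac)
    from geometric_times_u_summable[OF this CR(2) w] show ?thesis
      unfolding f3_def by (rule summable_norm_cancel)
  qed
  have "summable f1"
  proof -
    have "norm (if m = 0 then 0 else cf k n (m - 1)) \<le> (C / R) * R ^ m" for m
      using CR(1,2) CR(3)[of "m - 1"] by (cases m) auto
    from geometric_times_u_summable[OF this CR(2) w] show ?thesis
      unfolding f1_def by (rule summable_norm_cancel)
  qed
  note f = summable_sums[OF \<open>summable f1\<close>] summable_sums[OF \<open>summable f2\<close>] summable_sums[OF \<open>summable f3\<close>]
  have wRS: "of_real w * RS k n w = suminf f1 + suminf f2 + suminf f3"
  proof -
    \<comment> \<open>Shifting f1 down and f3 up by one index collects all terms that carry the same
      coefficient \<open>cf k n m\<close>.\<close>
    have "(\<lambda>m. f1 (Suc m) + f2 m + (case m of 0 \<Rightarrow> 0 | Suc j \<Rightarrow> f3 j)) sums (suminf f1 + suminf f2 + suminf f3)"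
    proof (intro sums_add f(2))
      show "(\<lambda>m. f1 (Suc m)) sums suminf f1"
        using f(1) by (subst sums_Suc_iff) (simp add: f1_def)
      show "(\<lambda>m. case m of 0 \<Rightarrow> 0 | Suc j \<Rightarrow> f3 j) sums suminf f3"
        using sums_Suc_iff[of "\<lambda>m. case m of 0 \<Rightarrow> 0 | Suc j \<Rightarrow> f3 j" "suminf f3"] f(3) by simp
    qed
    moreover have "f1 (Suc m) + f2 m + (case m of 0 \<Rightarrow> 0 | Suc j \<Rightarrow> f3 j) = of_real w * (cf k n m * u m w)" for m
    proof -
      have us: "u (Suc m) w = (of_real w - (1 - of_real z) * q ^ m) * u m w - of_real z * q ^ (m - 1) * (1 - q ^ m) * u (m - 1) w"
        unfolding u_def ascU_rec[of "- z" r m w] by simp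
      show ?thesis
        unfolding f1_def us by (cases m) (simp_all add: f2_def f3_def algebra_simps)
    qed
    ultimately have "(\<lambda>m. of_real w * (cf k n m * u m w)) sums (suminf f1 + suminf f2 + suminf f3)" by simp
    with sums_mult[OF RS_sums[OF w, of k n], of "of_real w"] show ?thesis using sums_unique2 by blast
  qed
  have "(\<lambda>m. (x + 1 / x) * (cf k n m * u m w) - b * q powi k / q ^ n * (f1 m + f2 m + f3 m) - (1 - B * q powi k) * (cf (k - 1) n m * u m w))
     sums ((x + 1 / x) * RS k n w - b * q powi k / q ^ n * (suminf f1 + suminf f2 + suminf f3) - (1 - B * q powi k) * RS (k - 1) n w)"
    by (intro sums_diff sums_mult RS_sums w sums_add f)
  moreover have "(x + 1 / x) * (cf k n m * u m w) - b * q powi k / q ^ n * (f1 m + f2 m + f3 m) - (1 - B * q powi k) * (cf (k - 1) n m * u m w)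
     = cf (k + 1) n m * u m w" for m
  proof -
    have gen: "mu * (c0 * U) - bq * (c1 * U + zq * c0 * U + zq' * c2 * U) - v * (c3 * U) = (mu * c0 - bq * (c1 + zq * c0 + zq' * c2) - v * c3) * U"
      for mu c0 U bq c1 zq zq' c2 v c3 :: complex by (simp add: algebra_simps)
    show ?thesis unfolding f1_def f2_def f3_def gen by (simp only: cf_rec[OF k])
  qed
  ultimately have "(\<lambda>m. cf (k + 1) n m * u m w) sums
     ((x + 1 / x) * RS k n w - b * q powi k / q ^ n * (suminf f1 + suminf f2 + suminf f3) - (1 - B * q powi k) * RS (k - 1) n w)" by simp
  then have "RS (k + 1) n w = (x + 1 / x) * RS k n w - b * q powi k / q ^ n * (of_real w * RS k n w) - (1 - B * q powi k) * RS (k - 1) n w"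
    unfolding wRS using RS_sums[OF w, of "k + 1" n] sums_unique2 by blast
  then show ?thesis by (simp only: left_diff_distrib mult.assoc)
qed

lemma asc_support_mult: "w \<in> W \<Longrightarrow> r * w \<in> W"
  unfolding asc_support_def
proof (elim UnE rangeE)
  fix i assume "w = r ^ i" then show "r * w \<in> range (\<lambda>i. r ^ i) \<union> range (\<lambda>i. - z * r ^ i)"
    by (intro UnI1 range_eqI[of _ _ "Suc i"]) simp
next
  fix i assume "w = - z * r ^ i" then show "r * w \<in> range (\<lambda>i. r ^ i) \<union> range (\<lambda>i. - z * r ^ i)"
    by (intro UnI2 range_eqI[of _ _ "Suc i"]) simp
qed

lemma cf_lower_0: "t * cf (k + 1) 0 m = (1 - q ^ Suc m) * cf k 0 (Suc m)"
proof -
  define X where "X = B * q powi (1 + (k + 1 + int m))"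
  have "H 0 X (int m) = (1 - q ^ Suc m) * H 0 X (int m + 1)"
    using H_lower_0[of X "int m"] power_int_of_nat[of q "Suc m"] by (simp add: add.commute)
  moreover have "GG (k + 1) 0 m = H 0 X (int m)" "GG k 0 (Suc m) = H 0 X (int m + 1)"
    by (simp_all add: GG_def X_def algebra_simps)
  moreover have "cf (k + 1) 0 m = t ^ m * g (k + 1 + int m) * GG (k + 1) 0 m"
    "cf k 0 (Suc m) = t ^ m * t * g (k + 1 + int m) * GG k 0 (Suc m)"
    by (simp_all add: cf_def algebra_simps)
  ultimately show ?thesis by (simp only: mult_ac)
qed

text \<open>This is \<open>H_lower\<close>: raising k while keeping m has the same index in g as
  raising m while keeping k.\<close>

lemma cf_lower: "t / q ^ Suc n * cf (k + 1) (Suc n) m = (1 - q ^ Suc m) * cf k (Suc n) (Suc m)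
   - t / q ^ Suc n * ((1 - q ^ Suc n) / q ^ n) * cf k n m"
proof -
  define N where "N = k + int m - int n"
  define M where "M = int m - int (Suc n)"
  define s where "s = t / q ^ Suc n"
  define X where "X = B * q powi (1 + N)"
  have "int (Suc m) - int (Suc n) = M + 1" "int m - int n = M + 1" "M + int n + 2 = int (Suc m)" by (simp_all add: M_def)
  moreover have "k + 1 + int m - int (Suc n) = N" "k + int (Suc m) - int (Suc n) = N" by (simp_all add: N_def)
  ultimately have GG: "GG (k + 1) (Suc n) m = H (Suc n) X M" "GG k (Suc n) (Suc m) = H (Suc n) X (M + 1)" "GG k n m = H n X (M + 1)"
    and gg: "cf (k + 1) (Suc n) m = s ^ m * g N * H (Suc n) X M" "cf k (Suc n) (Suc m) = s ^ m * s * g N * H (Suc n) X (M + 1)"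
    and pw: "q powi (M + int n + 2) = q ^ Suc m"
    by (simp_all only: GG_def cf_def s_def X_def N_def[symmetric] M_def[symmetric] power_int_of_nat power_Suc2)
  have gg3: "cf k n m = (s * q) ^ m * g N * H n X (M + 1)"
    unfolding cf_def GG N_def[symmetric] s_def using q_nz by simp
  have pw2: "q powi (M + 1) * q ^ n = q ^ m"
  proof -
    have "q powi (M + 1) * q ^ n = q powi (M + 1 + int n)" using powi_add_nat by simp
    also have "M + 1 + int n = int m" by (simp add: M_def)
    finally show ?thesis by (simp only: power_int_of_nat)
  qed
  have "s * cf (k + 1) (Suc n) m = s ^ m * s * g N * ((1 - q ^ Suc m) * H (Suc n) X (M + 1) - (1 - q ^ Suc n) * q powi (M + 1) * H n X (M + 1))"
    unfolding gg H_lower[of n X M] pw by (simp only: mult_ac)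
  also have "\<dots> = (1 - q ^ Suc m) * cf k (Suc n) (Suc m) - s * ((1 - q ^ Suc n) / q ^ n) * cf k n m"
    unfolding gg gg3 power_mult_distrib pw2[symmetric] using q_nz
    by (simp add: right_diff_distrib del: power_Suc)
  finally show ?thesis by (simp only: s_def)
qed

text \<open>Termwise \<open>ascU_qdiff\<close>; the term m = 0 vanishes, which permits the index
  shift.\<close>

lemma RS_qdiff:
  assumes w: "w \<in> W"
  shows "(\<lambda>m. (1 - q ^ Suc m) * cf k n (Suc m) * u m w) sums ((RS k n w - RS k n (r * w)) / of_real w)"
proof -
  have wnz: "w \<noteq> 0" by (rule asc_support_nz[OF r z w])
  have "(\<lambda>m. cf k n m * u m w - cf k n m * u m (r * w)) sums (RS k n w - RS k n (r * w))"
    by (intro sums_diff RS_sums w asc_support_mult)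
  moreover have d: "cf k n m * u m w - cf k n m * u m (r * w) = of_real w * ((1 - q ^ m) * cf k n m * u (m - 1) w)" for m
  proof -
    have "u m w - u m (r * w) = (1 - q ^ m) * of_real w * u (m - 1) w"
      unfolding u_def of_real_diff[symmetric] ascU_qdiff by simp
    then show ?thesis unfolding right_diff_distrib[symmetric] by simp
  qed
  ultimately have "(\<lambda>m. of_real w * ((1 - q ^ m) * cf k n m * u (m - 1) w)) sums (RS k n w - RS k n (r * w))" by simp
  then have "(\<lambda>m. of_real w * ((1 - q ^ Suc m) * cf k n (Suc m) * u (Suc m - 1) w)) sums (RS k n w - RS k n (r * w))"
    by (subst sums_Suc_iff) simp
  then have "(\<lambda>m. of_real w * ((1 - q ^ Suc m) * cf k n (Suc m) * u m w) / of_real w) sums ((RS k n w - RS k n (r * w)) / of_real w)"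
    unfolding diff_Suc_1 by (rule sums_divide)
  then show ?thesis using wnz by simp
qed

lemma RS_lower_0:
  assumes w: "w \<in> W"
  shows "RS k 0 w - RS k 0 (r * w) = t * of_real w * RS (k + 1) 0 w"
proof -
  have "(\<lambda>m. t * (cf (k + 1) 0 m * u m w)) sums (t * RS (k + 1) 0 w)" by (intro sums_mult RS_sums w)
  moreover have "t * (cf (k + 1) 0 m * u m w) = (1 - q ^ Suc m) * cf k 0 (Suc m) * u m w" for m
    unfolding mult.assoc[symmetric] cf_lower_0 ..
  ultimately have "(RS k 0 w - RS k 0 (r * w)) / of_real w = t * RS (k + 1) 0 w"
    using RS_qdiff[OF w, of k 0] sums_unique2 by simp
  then show ?thesis using asc_support_nz[OF r z w] by (simp add: field_simps)
qed

lemma RS_lower: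
  assumes w: "w \<in> W"
  shows "RS k (Suc n) w - RS k (Suc n) (r * w)
    = t * of_real w / q ^ Suc n * (RS (k + 1) (Suc n) w + (1 - q ^ Suc n) / q ^ n * RS k n w)"
proof -
  define s where "s = t / q ^ Suc n"
  define v where "v = (1 - q ^ Suc n) / q ^ n"
  have "(\<lambda>m. s * (cf (k + 1) (Suc n) m * u m w) + s * v * (cf k n m * u m w)) sums (s * RS (k + 1) (Suc n) w + s * v * RS k n w)"
    by (intro sums_add sums_mult RS_sums w)
  moreover have "s * (cf (k + 1) (Suc n) m * u m w) + s * v * (cf k n m * u m w) = (1 - q ^ Suc m) * cf k (Suc n) (Suc m) * u m w" for m
  proof -
    have c: "s * cf (k + 1) (Suc n) m = (1 - q ^ Suc m) * cf k (Suc n) (Suc m) - s * v * cf k n m"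
      unfolding s_def v_def by (rule cf_lower)
    have "s * (cf (k + 1) (Suc n) m * u m w) = (s * cf (k + 1) (Suc n) m) * u m w" by (simp only: mult.assoc)
    then show ?thesis unfolding c by (simp only: left_diff_distrib) simp
  qed
  ultimately have "(\<lambda>m. (1 - q ^ Suc m) * cf k (Suc n) (Suc m) * u m w) sums (s * RS (k + 1) (Suc n) w + s * v * RS k n w)"
    by (simp only:)
  with RS_qdiff[OF w, of k "Suc n"] have "(RS k (Suc n) w - RS k (Suc n) (r * w)) / of_real w = s * RS (k + 1) (Suc n) w + s * v * RS k n w"
    using sums_unique2 by blast
  then have "RS k (Suc n) w - RS k (Suc n) (r * w) = of_real w * (s * RS (k + 1) (Suc n) w + s * v * RS k n w)"
    using asc_support_nz[OF r z w] by (simp add: field_simps)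
  also have "\<dots> = of_real w * s * (RS (k + 1) (Suc n) w + v * RS k n w)" by (simp only: distrib_left mult.assoc)
  finally show ?thesis by (simp add: s_def v_def mult_ac)
qed

end

section \<open>Equations on the lattice\<close>

text \<open>The excluded equalities are the zeros of (-t x y, -t y/x;q)_inf on the lattice y =
  -\<kappa> q^i.\<close>

locale asc_coupling_generic = asc_coupling +
  assumes gen: "\<And>\<kappa> i. \<kappa> \<in> {1, - z} \<Longrightarrow> t * x * of_real \<kappa> * q powi i \<noteq> 1"
    and gen': "\<And>\<kappa> i. \<kappa> \<in> {1, - z} \<Longrightarrow> t / x * of_real \<kappa> * q powi i \<noteq> 1"
begin

text \<open>The polynomial inside c^(\<tau>,\<sigma>), with y only in the third parameter.\<close>

definition pn :: "nat \<Rightarrow> complex \<Rightarrow> complex" where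
  "pn n y = cdqH_poly n x (q / t) (e * t / q) (- t * y) q"

definition rho :: "nat \<Rightarrow> complex" where
  "rho n = (-1) ^ n * q ^ (n * (n - 1) div 2) * qpoch e q n"

text \<open>A lattice point equals -w/r^n for several pairs (n, w). The equation is demanded for all
  of them, and comparing them is what eliminates n.\<close>

definition solves :: "int \<Rightarrow> (real \<Rightarrow> complex) \<Rightarrow> bool" where
  "solves k s \<longleftrightarrow> (\<forall>n. \<forall>w\<in>W. s (- w / r ^ n) * pn n (of_real (- w / r ^ n)) = rho n * RS k n w)"

lemma e_nz: "e \<noteq> 0" using A_nz B_nz q_nz by (simp add: e_def)

lemma et2: "e * t * t = - (q * q / of_real z)"
proof -
  have "e * t * t = q\<^sup>2 * (b * b) / (A * B)" using B_nz by (simp add: e_def t_def power2_eq_square)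
  also have "A * B = - of_real z * (b * b)" unfolding AB_mult a_eq by simp
  finally show ?thesis using b z by (simp add: power2_eq_square)
qed

lemma pn_0 [simp]: "pn 0 y = 1" by (simp add: pn_def cdqH_0[OF nq q_nz])

lemma pn_contiguous: "pn (Suc n) y = pn (Suc n) (q * y) + t * y * (1 - q ^ Suc n) * (1 - e * q ^ n) * pn n (q * y)"
proof -
  have "q / t \<noteq> 0" using q_nz t_nz by simp
  from cdqH_contiguous[OF nq q_nz this, of n x "e * t / q" "- t * y"]
  have c: "pn (Suc n) y - cdqH_poly (Suc n) x (q / t) (e * t / q) (- t * y * q) q
     = - (- t * y) * (1 - q ^ Suc n) * (1 - q / t * (e * t / q) * q ^ n) * cdqH_poly n x (q / t) (e * t / q) (- t * y * q) q"
    by (simp only: pn_def)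
  have 1: "- t * y * q = - t * (q * y)" by simp
  have 2: "q / t * (e * t / q) = e" using q_nz t_nz by simp
  from c show ?thesis unfolding 1 2 pn_def[symmetric] by (simp add: algebra_simps)
qed

lemma rho_Suc: "rho (Suc n) = - (q ^ n) * (1 - e * q ^ n) * rho n"
  unfolding rho_def choose2_Suc power_add by (simp add: qpoch_Suc)

lemma asc_support_point: "\<kappa> \<in> {1, - z} \<Longrightarrow> \<kappa> * r ^ n \<in> W"
  unfolding asc_support_def by auto

text \<open>Here the third parameter is t \<kappa> q^(-n). Its product with q/t for \<kappa> = 1,
  and with e t/q for \<kappa> = -z, is q^(1-n), so \<open>cdqH_truncated_nz\<close> applies and
  genericity excludes zeros of the remaining product.\<close>

lemma pn_top_nz:
  assumes \<kappa>: "\<kappa> \<in> {1, - z}"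
  shows "pn n (of_real (- \<kappa> / r ^ n)) \<noteq> 0"
proof -
  have key: "qpoch (q * X / (t * of_real \<kappa>)) q n \<noteq> 0"
    if "\<And>i. t * inverse X * of_real \<kappa> * q powi i \<noteq> 1" "X \<noteq> 0" for X
  proof -
    have "q * X / (t * of_real \<kappa>) * q ^ j \<noteq> 1" for j
    proof
      assume h: "q * X / (t * of_real \<kappa>) * q ^ j = 1"
      have k0: "complex_of_real \<kappa> \<noteq> 0" using \<kappa> z by auto
      have "t * of_real \<kappa> = q * X * q ^ j" using h t_nz k0 by (simp add: field_simps)
      then have "t * inverse X * of_real \<kappa> = q ^ Suc j" using that(2) by (simp add: field_simps)
      moreover have "q ^ Suc j * q powi (- int (Suc j)) = 1" unfolding powi_neg_nat using q_nz by simp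
      ultimately show False using that(1)[of "- int (Suc j)"] by simp
    qed
    then show ?thesis by (simp add: qpoch_eq_0_iff)
  qed
  have k1: "qpoch (q * x / (t * of_real \<kappa>)) q n \<noteq> 0"
    by (rule key) (use gen'[OF \<kappa>] x in \<open>simp_all add: divide_inverse\<close>)
  have k2: "qpoch (q * inverse x / (t * of_real \<kappa>)) q n \<noteq> 0"
    by (rule key) (use gen[OF \<kappa>] x in simp_all)
  define c where "c = - t * of_real (- \<kappa> / r ^ n)"
  have c: "c = t * of_real \<kappa> / q ^ n" by (simp add: c_def)
  have anz: "q / t \<noteq> 0" "e * t / q \<noteq> 0" using q_nz t_nz e_nz by auto
  show ?thesis
  proof (cases "\<kappa> = 1")
    case True
    have "cdqH_poly n x (q / t) (e * t / q) c q \<noteq> 0"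
      by (rule cdqH_truncated_nz[OF nq q_nz])
         (use k1 k2 anz t_nz q_nz in \<open>simp_all add: c True divide_inverse mult_ac\<close>)
    then show ?thesis unfolding pn_def c_def .
  next
    case False
    then have kz: "\<kappa> = - z" using \<kappa> by simp
    \<comment> \<open>Equivalent to e t^2 z = -q^2; this makes the branch \<kappa> = -z the mirror
      image of \<kappa> = 1 with the first two parameters exchanged.\<close>
    have zt: "e * t / q = q / (t * of_real \<kappa>)"
      using et2 t_nz q_nz z unfolding kz by (simp add: field_simps)
    have "cdqH_poly n x (e * t / q) (q / t) c q \<noteq> 0"
    proof (rule cdqH_truncated_nz[OF nq q_nz])
      show "e * t / q * c * q ^ n = q" unfolding zt c using t_nz q_nz z kz by simp
      show "qpoch (e * t / q * x) q n \<noteq> 0" unfolding zt using k1 by simp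
      show "qpoch (e * t / q / x) q n \<noteq> 0" unfolding zt using k2 by (simp add: divide_inverse mult_ac)
    qed (use anz in simp_all)
    then show ?thesis unfolding pn_def c_def[symmetric] using cdqH_a_b_commute[OF nq q_nz anz x] by simp
  qed
qed

text \<open>Points inside the support take n = 0, where p_0 = 1. A point beyond it takes the top
  point w = \<kappa>, where \<open>pn_top_nz\<close> holds.\<close>

lemma lattice_point:
  assumes \<kappa>: "\<kappa> \<in> {1, - z}"
  obtains n w where "w \<in> W" "- \<kappa> * r powi i = - w / r ^ n" "pn n (of_real (- w / r ^ n)) \<noteq> 0"
proof (cases "i \<ge> 0")
  case True
  then obtain j where j: "i = int j" using nonneg_int_cases by blast
  show ?thesis
  proof (rule that[of "\<kappa> * r ^ j" 0])
    show "\<kappa> * r ^ j \<in> W" by (rule asc_support_point[OF \<kappa>])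
  qed (simp_all add: j)
next
  case False
  then obtain j where j: "i = - int j" by (metis linear nonneg_int_cases minus_minus neg_0_le_iff_le)
  show ?thesis
  proof (rule that[of \<kappa> j])
    show "\<kappa> \<in> W" using asc_support_point[OF \<kappa>, of 0] by simp
    show "- \<kappa> * r powi i = - \<kappa> / r ^ j" by (simp add: j powi_neg_nat)
    show "pn j (of_real (- \<kappa> / r ^ j)) \<noteq> 0" by (rule pn_top_nz[OF \<kappa>])
  qed
qed

text \<open>\<open>RS_lower\<close> brings in the series of index n - 1 and
  \<open>pn_contiguous\<close> the polynomial of index n - 1. The two contributions cancel because r
  y = -w/r^(n-1) satisfies the equation for n - 1 as well.\<close>

lemma lattice_lower:
  fixes i :: int
  assumes \<kappa>: "\<kappa> \<in> {1, - z}" and s: "solves k s" "solves (k + 1) s'"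
  defines "y \<equiv> - \<kappa> * r powi i"
  shows "s (r * y) = s y + t * of_real y * s' y"
proof -
  obtain n w where w: "w \<in> W" and y: "y = - w / r ^ n" and nz: "pn n (of_real (- w / r ^ n)) \<noteq> 0"
    using lattice_point[OF \<kappa>, of i] unfolding y_def by blast
  have sy: "s y * pn n (of_real y) = rho n * RS k n w"
    using s(1) w unfolding solves_def y by blast
  have sy': "s' y * pn n (of_real y) = rho n * RS (k + 1) n w"
    using s(2) w unfolding solves_def y by blast
  have ry: "r * y = - (r * w) / r ^ n" by (simp add: y)
  have sry: "s (r * y) * pn n (q * of_real y) = rho n * RS k n (r * w)"
    using s(1) asc_support_mult[OF w] unfolding solves_def ry of_real_mult[symmetric] by blast
  have wy: "of_real w / q ^ n = - complex_of_real y" using q_nz by (simp add: y)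
  have "s (r * y) * pn n (of_real y) = (s y + t * of_real y * s' y) * pn n (of_real y)"
  proof (cases n)
    case 0
    have "RS k 0 w - RS k 0 (r * w) = - t * of_real y * RS (k + 1) 0 w"
      using RS_lower_0[OF w, of k] by (simp add: y 0)
    then show ?thesis using sy sy' sry by (simp add: 0 rho_def algebra_simps)
  next
    case (Suc n')
    \<comment> \<open>The same point r y in its second representation, with n - 1 in place of n and
      w in place of r w.\<close>
    have ry': "r * y = - w / r ^ n'" using r by (simp add: y Suc)
    have "s (- w / r ^ n') * pn n' (of_real (- w / r ^ n')) = rho n' * RS k n' w"
      using s(1) w unfolding solves_def by blast
    then have sry': "s (r * y) * pn n' (q * of_real y) = rho n' * RS k n' w"
      unfolding ry'[symmetric] by simp
    have low: "RS k n w - RS k n (r * w) = - t * of_real y * (RS (k + 1) n w + (1 - q ^ n) / q ^ n' * RS k n' w)"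
    proof -
      have "t * of_real w / q ^ n = - t * of_real y" using wy by (simp only: times_divide_eq_right[symmetric]) simp
      with RS_lower[OF w, of k n'] show ?thesis by (simp only: Suc)
    qed
    have "s (r * y) * pn n (of_real y) = s (r * y) * pn n (q * of_real y)
        + t * of_real y * (1 - q ^ n) * (1 - e * q ^ n') * (s (r * y) * pn n' (q * of_real y))"
      unfolding Suc pn_contiguous[of n' "of_real y"] by (simp only: distrib_left mult_ac)
    also have "\<dots> = rho n * RS k n (r * w) + t * of_real y * (1 - q ^ n) * (1 - e * q ^ n') * (rho n' * RS k n' w)"
      by (simp only: sry sry')
    also have "(1 - q ^ n) * (1 - e * q ^ n') * (rho n' * RS k n' w) = - (rho n * ((1 - q ^ n) / q ^ n' * RS k n' w))"
      unfolding Suc rho_Suc using q_nz by (simp del: power_Suc)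
    then have "t * of_real y * (1 - q ^ n) * (1 - e * q ^ n') * (rho n' * RS k n' w)
       = t * of_real y * - (rho n * ((1 - q ^ n) / q ^ n' * RS k n' w))"
      by (simp only: mult.assoc)
    also have "rho n * RS k n (r * w) + t * of_real y * - (rho n * ((1 - q ^ n) / q ^ n' * RS k n' w))
       = rho n * RS k n w + t * of_real y * (rho n * RS (k + 1) n w)"
    proof -
      have "RS k n (r * w) = RS k n w + t * of_real y * (RS (k + 1) n w + (1 - q ^ n) / q ^ n' * RS k n' w)"
      proof -
        have "v = u + p * E" if "u - v = - t * of_real y * E" "p = t * of_real y" for u v p E
          using that by (simp add: algebra_simps)
        from this[OF low refl] show ?thesis .
      qed
      then show ?thesis by (simp only:) (simp add: algebra_simps)
    qed
    also have "\<dots> = s y * pn n (of_real y) + t * of_real y * (s' y * pn n (of_real y))"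
      by (simp only: sy sy')
    finally show ?thesis by (simp only: distrib_right mult.assoc)
  qed
  then show ?thesis using nz unfolding y by simp
qed

text \<open>\<open>RS_three_term\<close> at a representation with nonzero polynomial. The
  disjunction lets k = 0 with B = 1 pass without a solution at k = -1, since its coefficient is
  0.\<close>

lemma lattice_three_term:
  fixes i :: int
  assumes \<kappa>: "\<kappa> \<in> {1, - z}" and s: "solves k s" "solves (k + 1) s1" "solves (k - 1) s0 \<or> B * q powi k = 1"
    and k: "B = 1 \<Longrightarrow> k \<ge> 0"
  defines "y \<equiv> - \<kappa> * r powi i"
  shows "s1 y = (x + 1 / x + b * q powi k * of_real y) * s y - (1 - B * q powi k) * s0 y"
proof -
  obtain n w where w: "w \<in> W" and y: "y = - w / r ^ n" and nz: "pn n (of_real (- w / r ^ n)) \<noteq> 0"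
    using lattice_point[OF \<kappa>, of i] unfolding y_def by blast
  have sy: "s y * pn n (of_real y) = rho n * RS k n w"
    using s(1) w unfolding solves_def y by blast
  have sy1: "s1 y * pn n (of_real y) = rho n * RS (k + 1) n w"
    using s(2) w unfolding solves_def y by blast
  have sy0: "(1 - B * q powi k) * (s0 y * pn n (of_real y)) = (1 - B * q powi k) * (rho n * RS (k - 1) n w)"
  proof (cases "B * q powi k = 1")
    case False
    then have "solves (k - 1) s0" using s(3) by blast
    then have "s0 y * pn n (of_real y) = rho n * RS (k - 1) n w" using w unfolding solves_def y by blast
    then show ?thesis by simp
  qed simp
  have wy: "b * q powi k / q ^ n * of_real w = - (b * q powi k * of_real y)" using q_nz by (simp add: y)
  have "RS (k + 1) n w = (x + 1 / x + b * q powi k * of_real y) * RS k n w - (1 - B * q powi k) * RS (k - 1) n w"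
    using RS_three_term[OF k w, of n] unfolding wy by simp
  then have "s1 y * pn n (of_real y) = (x + 1 / x + b * q powi k * of_real y) * (rho n * RS k n w) - (1 - B * q powi k) * (rho n * RS (k - 1) n w)"
    unfolding sy1 by (simp only:) (simp add: algebra_simps)
  also have "\<dots> = ((x + 1 / x + b * q powi k * of_real y) * s y - (1 - B * q powi k) * s0 y) * pn n (of_real y)"
    unfolding sy[symmetric] sy0[symmetric] by (simp only: left_diff_distrib mult.assoc)
  finally show ?thesis using nz unfolding y by simp
qed

lemma solves_top:
  assumes "\<kappa> \<in> {1, - z}" "solves k s"
  shows "s (- \<kappa>) = RS k 0 \<kappa>"
proof -
  have "\<kappa> \<in> W" using asc_support_point[OF assms(1), of 0] by simp
  from assms(2)[unfolded solves_def, rule_format, OF this, of 0]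
  have "s (- \<kappa> / r ^ 0) * pn 0 (of_real (- \<kappa> / r ^ 0)) = rho 0 * RS k 0 \<kappa>" .
  then show ?thesis by (simp add: rho_def)
qed

lemma cf_0: "cf k 0 m = t ^ m / qpoch q q m * g (k + int m)"
  by (simp add: cf_def GG_def H_def rq_def)

lemma RS_top_1: "(\<lambda>m. (t * of_real z) ^ m * q ^ (m * (m - 1) div 2) / qpoch q q m * g (k + int m)) sums RS k 0 1"
proof -
  have "u m 1 = of_real z ^ m * q ^ (m * (m - 1) div 2)" for m
    unfolding u_def ascU_one by simp
  then have "cf k 0 m * u m 1 = (t * of_real z) ^ m * q ^ (m * (m - 1) div 2) / qpoch q q m * g (k + int m)" for m
    by (simp add: cf_0 power_mult_distrib)
  moreover have "(\<lambda>m. cf k 0 m * u m 1) sums RS k 0 1"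
    using asc_support_point[of 1 0] by (intro RS_sums) simp
  ultimately show ?thesis by simp
qed

text \<open>The point -z is (-z) * 1, so \<open>ascU_sym\<close> and \<open>ascU_one\<close> give
  the value of U_m there.\<close>

lemma RS_top_2: "(\<lambda>m. (- t) ^ m * q ^ (m * (m - 1) div 2) / qpoch q q m * g (k + int m)) sums RS k 0 (- z)"
proof -
  have "ascU (- z) r m (- z) = (- z) ^ m * ((1 / z) ^ m * r ^ (m * (m - 1) div 2))" for m
    using ascU_sym[of "- z" r m 1] z ascU_one[of "1 / (- z)" r m] by simp
  moreover have "(- z) ^ m * ((1 / z) ^ m * c) = (-1) ^ m * c" for m c
    using z by (simp add: mult.assoc[symmetric] flip: power_mult_distrib)
  ultimately have "u m (- z) = (- 1) ^ m * q ^ (m * (m - 1) div 2)" for m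
    unfolding u_def by simp
  then have "cf k 0 m * u m (- z) = (- t) ^ m * q ^ (m * (m - 1) div 2) / qpoch q q m * g (k + int m)" for m
    by (simp add: cf_0 power_minus[of t])
  moreover have "(\<lambda>m. cf k 0 m * u m (- z)) sums RS k 0 (- z)"
    using asc_support_point[of "- z" 0] by (intro RS_sums) simp
  ultimately show ?thesis by simp
qed

end

section \<open>A generating sum of Al-Salam-Chihara polynomials\<close>

lemma norm_qpoch_ge_1:
  assumes "0 \<le> r" "p \<le> 0"
  shows "norm (qpoch (complex_of_real p) (of_real r) n) \<ge> 1"
proof (induction n)
  case (Suc n)
  have "p * r ^ n \<le> 0" using assms by (simp add: mult_nonpos_nonneg)
  then have 1: "norm (1 - complex_of_real p * of_real r ^ n) = 1 - p * r ^ n"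
  proof -
    have "1 - complex_of_real p * of_real r ^ n = of_real (1 - p * r ^ n)" by simp
    then show ?thesis using \<open>p * r ^ n \<le> 0\<close> by (simp only: norm_of_real)
  qed
  have "1 * 1 \<le> norm (qpoch (complex_of_real p) (of_real r) n) * norm (1 - complex_of_real p * of_real r ^ n)"
    using Suc \<open>p * r ^ n \<le> 0\<close> unfolding 1 by (intro mult_mono) auto
  then show ?case by (simp add: qpoch_Suc norm_mult)
qed simp

context
  fixes r :: real and x :: complex
  assumes r: "0 < r" "r < 1" and x: "x \<noteq> 0"
begin

private abbreviation "q \<equiv> complex_of_real r"

lemma nq': "norm q < 1" and q_nz': "q \<noteq> 0" using r by auto

text \<open>The bound is uniform in a, because a q^J with J tending to infinity is substituted in
  \<open>asc_N_sums\<close>.\<close>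

lemma asc_conv_bound:
  assumes c: "c \<ge> 0"
  shows "\<exists>C>0. \<exists>R>0. \<forall>a m. norm a \<le> c \<longrightarrow> norm (asc_conv q x a b m) \<le> C * R ^ m"
proof -
  obtain K where K: "K > 0" "\<And>m. norm (1 / qpoch q q m) \<le> K" using inverse_qpoch_q_Bseq[OF nq'] by auto
  define R where "R = (1 + c / norm x) * norm x + (1 + norm b * norm x) / norm x + 1"
  have nx: "norm x > 0" using x by simp
  have R1: "(1 + c / norm x) * norm x \<le> R" "(1 + norm (b * x)) * norm (1 / x) \<le> R" "R > 0"
    using nx c by (auto simp: R_def norm_mult norm_divide intro!: add_nonneg_pos add_nonneg_nonneg)
  have q1: "norm q \<le> 1" using r by simp
  have "norm (asc_conv q x a b m) \<le> K * K * (2 * R) ^ m" if a: "norm a \<le> c" for a m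
  proof -
    have f: "norm (qpoch (a / x) q l * x ^ l / qpoch q q l) \<le> R ^ l * K" for l
    proof -
      have "norm (a / x) \<le> c / norm x" using a by (simp add: norm_divide divide_right_mono)
      then have "norm (qpoch (a / x) q l) * norm x ^ l \<le> (1 + c / norm x) ^ l * norm x ^ l"
        by (intro mult_right_mono norm_qpoch_le q1) auto
      also have "\<dots> = ((1 + c / norm x) * norm x) ^ l" by (simp only: power_mult_distrib)
      also have "\<dots> \<le> R ^ l" using c by (intro power_mono R1) auto
      finally have "norm (qpoch (a / x) q l) * norm x ^ l * norm (1 / qpoch q q l) \<le> R ^ l * K"
        using K R1 by (intro mult_mono) auto
      then show ?thesis by (simp add: norm_mult norm_divide norm_power)
    qed
    have g: "norm (qpoch (b * x) q l * (1 / x) ^ l / qpoch q q l) \<le> R ^ l * K" for l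
    proof -
      have "norm (qpoch (b * x) q l) * norm (1 / x) ^ l \<le> (1 + norm (b * x)) ^ l * norm (1 / x) ^ l"
        by (intro mult_right_mono norm_qpoch_le q1) auto
      also have "\<dots> = ((1 + norm (b * x)) * norm (1 / x)) ^ l" by (simp only: power_mult_distrib)
      also have "\<dots> \<le> R ^ l" by (intro power_mono R1) auto
      finally have "norm (qpoch (b * x) q l) * norm (1 / x) ^ l * norm (1 / qpoch q q l) \<le> R ^ l * K"
        using K R1 by (intro mult_mono) auto
      then show ?thesis by (simp add: norm_mult norm_divide norm_power)
    qed
    have "norm (asc_conv q x a b m) \<le> (\<Sum>l\<le>m. (R ^ l * K) * (R ^ (m - l) * K))"
      unfolding asc_conv_def[OF nq' q_nz']
      by (intro order_trans[OF norm_sum] sum_mono order_trans[OF norm_mult_ineq mult_mono[OF f g]])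
         (use R1 K in auto)
    also have "\<dots> = (\<Sum>l\<le>m. K * K * R ^ m)"
      by (intro sum.cong refl) (simp add: power_add[symmetric] mult_ac)
    also have "\<dots> = (real m + 1) * (K * K * R ^ m)" by simp
    also have "\<dots> \<le> 2 ^ m * (K * K * R ^ m)" using K R1 Suc_le_two_power by (intro mult_right_mono) auto
    finally show ?thesis by (simp add: power_mult_distrib mult_ac)
  qed
  moreover have "K * K > 0" "2 * R > 0" using K R1 by auto
  ultimately show ?thesis by blast
qed

text \<open>Summand of the series at a top point for k = 0 and B = 1. The real p \<le> 0 with a b =
  p in the lemmas bounds the denominators below by 1.\<close>

definition asc_N :: "complex \<Rightarrow> complex \<Rightarrow> nat \<Rightarrow> complex" where
  "asc_N a b m = (- a) ^ m * q ^ (m * (m - 1) div 2) * asc_conv q x a b m / qpoch (a * b) q m"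

lemma asc_N_bound:
  assumes c: "c \<ge> 0"
  shows "\<exists>D>0. \<forall>a p m. norm a \<le> c \<longrightarrow> a * b = of_real p \<longrightarrow> p \<le> 0 \<longrightarrow> norm (asc_N a b m) \<le> D * (1/2) ^ m"
proof -
  obtain C R where CR: "C > 0" "R > 0" "\<And>a m. norm a \<le> c \<Longrightarrow> norm (asc_conv q x a b m) \<le> C * R ^ m"
    using asc_conv_bound[OF c, of b] by blast
  obtain D where D: "D > 0" "\<And>m. (c * R) ^ m * r ^ (m * (m - 1) div 2) \<le> D * (1/2) ^ m"
    using gauss_bound[of r "c * R"] r c CR by auto
  have "norm (asc_N a b m) \<le> (C * D) * (1/2) ^ m" if a: "norm a \<le> c" and p: "a * b = of_real p" "p \<le> 0" for a p m
  proof -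
    have "norm (asc_N a b m) \<le> norm a ^ m * r ^ (m * (m - 1) div 2) * norm (asc_conv q x a b m)"
    proof -
      have "norm (qpoch (a * b) q m) \<ge> 1" unfolding p(1) using norm_qpoch_ge_1[of r p m] p(2) r by simp
      then have "norm (asc_N a b m) \<le> norm ((- a) ^ m * q ^ (m * (m - 1) div 2) * asc_conv q x a b m) / 1"
        unfolding asc_N_def norm_divide by (intro divide_left_mono) auto
      then show ?thesis using r by (simp add: norm_mult norm_power)
    qed
    also have "\<dots> \<le> c ^ m * r ^ (m * (m - 1) div 2) * (C * R ^ m)"
      using a c r CR by (intro mult_mono power_mono CR) auto
    also have "\<dots> = C * ((c * R) ^ m * r ^ (m * (m - 1) div 2))" by (simp add: power_mult_distrib)
    also have "\<dots> \<le> C * (D * (1/2) ^ m)" using CR D by (intro mult_left_mono) auto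
    finally show ?thesis by simp
  qed
  moreover have "C * D > 0" using CR D by simp
  ultimately show ?thesis by blast
qed

lemma asc_N_summable:
  assumes p: "a * b = of_real p" "p \<le> 0"
  shows "summable (asc_N a b)"
proof -
  obtain D where D: "D > 0" "\<And>m. norm (asc_N a b m) \<le> D * (1/2) ^ m"
    using asc_N_bound[of "norm a" b] p by auto
  show ?thesis
    by (rule summable_comparison_test'[where g = "\<lambda>m. D * (1/2) ^ m"])
       (use D in \<open>auto intro!: summable_mult summable_geometric\<close>)
qed

text \<open>Passing from a to a q by the contiguous relation and inserting the recurrence makes the
  difference of the summands telescope, with terms \<open>L\<close> and \<open>K\<close> that tend
  to 0.\<close>

lemma asc_N_step:
  assumes p: "a * b = of_real p" "p \<le> 0"
  shows "(1 - a * b) * suminf (asc_N a b) = (1 - a * x) * (1 - a / x) * suminf (asc_N (a * q) b)"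
proof -
  define h where "h m = asc_conv q x (a * q) b m" for m
  define T where "T m = (- a) ^ m * q ^ (m * (m - 1) div 2) * h m / qpoch (a * b * q) q m" for m
  have pq: "a * q * b = of_real (p * r)" "p * r \<le> 0"
    using p r by (simp_all add: mult_nonpos_nonneg mult.commute mult.left_commute)
  have nz: "1 - a * b * q ^ m \<noteq> 0" "qpoch (a * b * q) q m \<noteq> 0" "qpoch (a * b) q m \<noteq> 0" for m
  proof -
    have 1: "qpoch (a * b) q m \<noteq> 0" for m unfolding p(1) using norm_qpoch_ge_1[of r p m] p(2) r by auto
    then show "qpoch (a * b) q m \<noteq> 0" .
    show "1 - a * b * q ^ m \<noteq> 0" using 1[of "Suc m"] by (simp add: qpoch_Suc)
    show "qpoch (a * b * q) q m \<noteq> 0" using 1[of "Suc m"] by (simp add: qpoch_Suc')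
  qed
  have ab1: "1 - a * b \<noteq> 0" using nz(1)[of 0] by simp
  have qp: "qpoch (a * b) q m = (1 - a * b) * qpoch (a * b * q) q m / (1 - a * b * q ^ m)" for m
    using nz qpoch_Suc[of "a * b" q m] qpoch_Suc'[of "a * b" q m] by (simp add: field_simps)
  have nq_T: "asc_N (a * q) b m = q ^ m * T m" for m
  proof -
    have "(- (a * q)) ^ m = (- a) ^ m * q ^ m" by (simp only: power_mult_distrib[symmetric] mult_minus_left)
    moreover have "a * q * b = a * b * q" by simp
    ultimately show ?thesis unfolding asc_N_def T_def h_def by (simp only:) simp
  qed
  \<comment> \<open>The contiguous relation is available in the second parameter and is carried over
    to the first by symmetry.\<close>
  have cont: "asc_conv q x a b (Suc m) = h (Suc m) - a * h m" for m
    using asc_conv_contiguous[OF nq' q_nz' x, of b a m] asc_conv_commute[OF nq' q_nz' x, of a b]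
      asc_conv_commute[OF nq' q_nz' x, of "a * q" b]
    by (simp add: h_def algebra_simps)
  define L where "L m = (1 - q ^ m) * (1 - a * b * q ^ m) * T m" for m
  define K where "K m = (case m of 0 \<Rightarrow> 0 | Suc j \<Rightarrow> a\<^sup>2 * q ^ j * (1 - q ^ Suc j) * T j)" for m
  define P where "P m = (case m of 0 \<Rightarrow> 0 | Suc j \<Rightarrow> a\<^sup>2 * q ^ j * T j)" for m
  have T_Suc: "T (Suc m) = - a * q ^ m * (h (Suc m) / (1 - a * b * q ^ Suc m)) * ((- a) ^ m * q ^ (m * (m - 1) div 2) / qpoch (a * b * q) q m)" for m
    unfolding T_def choose2_Suc power_add using nz by (simp add: qpoch_Suc mult_ac)
  have N_eq: "(1 - a * b) * asc_N a b m = (1 - a * b * q ^ m) * T m + P m" for m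
  proof (cases m)
    case 0
    then show ?thesis by (simp add: asc_N_def T_def P_def h_def asc_conv_def[OF nq' q_nz'])
  next
    case (Suc j)
    have "(1 - a * b) * asc_N a b m = (1 - a * b) * ((- a) ^ m * q ^ (m * (m - 1) div 2) * h m / qpoch (a * b) q m)
       + (1 - a * b) * (- a * ((- a) ^ m * q ^ (m * (m - 1) div 2) * h j / qpoch (a * b) q m))"
      unfolding asc_N_def Suc cont by (simp add: algebra_simps diff_divide_distrib)
    also have "(1 - a * b) * ((- a) ^ m * q ^ (m * (m - 1) div 2) * h m / qpoch (a * b) q m) = (1 - a * b * q ^ m) * T m"
      unfolding T_def qp using nz ab1 by (simp add: field_simps)
    also have "(1 - a * b) * (- a * ((- a) ^ m * q ^ (m * (m - 1) div 2) * h j / qpoch (a * b) q m)) = P m"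
    proof -
      have "qpoch (a * b) q m = (1 - a * b) * qpoch (a * b * q) q j" unfolding Suc by (rule qpoch_Suc')
      then show ?thesis
        unfolding Suc P_def T_def choose2_Suc power_add using ab1 by (simp add: power2_eq_square)
    qed
    finally show ?thesis .
  qed
  have rec: "L (Suc m) = - a * q ^ m * (x + 1 / x - (a * q + b) * q ^ m) * T m - q ^ m * P m" for m
  proof -
    define w where "w = (- a) ^ m * q ^ (m * (m - 1) div 2) / qpoch (a * b * q) q m"
    have Tm: "T m = w * h m" by (simp add: T_def w_def)
    have "L (Suc m) = - a * q ^ m * ((1 - q ^ Suc m) * h (Suc m)) * w"
      unfolding L_def T_Suc w_def[symmetric] using nz(1)[of "Suc m"] by simp
    also have "\<dots> = - a * q ^ m * (x + 1 / x - (a * q + b) * q ^ m) * T m - q ^ m * P m"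
    proof (cases m)
      case 0
      have "(1 - q) * h 1 = x + 1 / x - (a * q + b)"
        using asc_conv_rec(2)[OF nq' q_nz' x, of "a * q" b] by (simp add: h_def)
      then show ?thesis by (simp add: 0 P_def T_def w_def h_def asc_conv_def[OF nq' q_nz'])
    next
      case (Suc j)
      have "(1 - q ^ Suc m) * h (Suc m) = (x + 1 / x - (a * q + b) * q ^ m) * h m - (1 - a * q * b * q ^ j) * h j"
        unfolding h_def Suc by (rule asc_conv_rec(1)[OF nq' q_nz' x])
      also have "a * q * b * q ^ j = a * b * q ^ m" by (simp add: Suc)
      finally have hh: "(1 - q ^ Suc m) * h (Suc m) = (x + 1 / x - (a * q + b) * q ^ m) * h m - (1 - a * b * q ^ m) * h j" .
      have "(1 - a * b * q ^ m) * w = - a * q ^ j * ((- a) ^ j * q ^ (j * (j - 1) div 2) / qpoch (a * b * q) q j)"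
        unfolding w_def Suc choose2_Suc power_add using nz(1)[of "Suc j"] by (simp add: qpoch_Suc mult_ac)
      then have "(1 - a * b * q ^ m) * w * h j = - a * q ^ j * T j" by (simp add: T_def)
      then have "- a * q ^ m * (- ((1 - a * b * q ^ m) * w * h j)) = - (q ^ m * P m)"
        by (simp add: P_def Suc power2_eq_square)
      then show ?thesis unfolding hh Tm by (simp add: algebra_simps)
    qed
    finally show ?thesis .
  qed
  have K_Suc: "K (Suc m) = a\<^sup>2 * q ^ m * (1 - q ^ Suc m) * T m" for m by (simp add: K_def)
  have K_P: "K m = (1 - q ^ m) * P m" for m by (simp add: K_def P_def split: nat.splits)
  have tele: "(1 - a * b) * asc_N a b m - (1 - a * x) * (1 - a / x) * asc_N (a * q) b m
     = (L m + K m) - (L (Suc m) + K (Suc m))" for m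
  proof -
    have xx: "(1 - a * x) * (1 - a / x) = 1 - a * (x + 1 / x) + a\<^sup>2"
      using x by (simp add: field_simps power2_eq_square)
    have l: "L m = (1 - q ^ m) * (1 - a * b * q ^ m) * T m" by (simp only: L_def)
    show ?thesis unfolding N_eq[of m] nq_T[of m] xx rec[of m] K_Suc[of m] K_P[of m] l
      by (simp add: algebra_simps power2_eq_square)
  qed
  have Ts: "summable T"
  proof -
    have "summable (\<lambda>m. asc_N (a * q) b m)" using asc_N_summable[OF pq] .
    obtain C R where CR: "C > 0" "R > 0" "\<And>a' m. norm a' \<le> norm (a * q) \<Longrightarrow> norm (asc_conv q x a' b m) \<le> C * R ^ m"
      using asc_conv_bound[OF norm_ge_zero, of "a * q" b] by blast
    have "norm ((- a) ^ m * h m / qpoch (a * b * q) q m) \<le> C * (norm a * R) ^ m" for m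
    proof -
      have "norm (qpoch (a * b * q) q m) \<ge> 1"
      proof -
        have "a * b * q = of_real (p * r)" using pq(1) by (simp add: mult_ac)
        then show ?thesis using norm_qpoch_ge_1[of r "p * r" m] pq(2) r by simp
      qed
      then have "norm ((- a) ^ m * h m) / norm (qpoch (a * b * q) q m) \<le> norm ((- a) ^ m * h m) / 1"
        by (intro divide_left_mono) auto
      also have "\<dots> \<le> norm a ^ m * (C * R ^ m)"
        using CR(3)[of "a * q" m] by (simp add: norm_mult norm_power h_def mult_left_mono)
      finally show ?thesis by (simp add: norm_divide power_mult_distrib mult_ac)
    qed
    from summable_gauss[OF nq' this] CR have "summable (\<lambda>m. norm ((- a) ^ m * h m / qpoch (a * b * q) q m * q ^ (m * (m - 1) div 2)))"
      by simp
    then have "summable (\<lambda>m. (- a) ^ m * h m / qpoch (a * b * q) q m * q ^ (m * (m - 1) div 2))"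
      by (rule summable_norm_cancel)
    moreover have "(\<lambda>m. (- a) ^ m * h m / qpoch (a * b * q) q m * q ^ (m * (m - 1) div 2)) = T"
      by (rule ext) (simp add: T_def)
    ultimately show ?thesis by (simp only:)
  qed
  have q0: "(\<lambda>m. q ^ m) \<longlonglongrightarrow> 0" by (rule LIMSEQ_power_zero[OF nq'])
  have T0: "T \<longlonglongrightarrow> 0" by (rule summable_LIMSEQ_zero[OF Ts])
  have L0: "L \<longlonglongrightarrow> (1 - 0) * (1 - a * b * 0) * 0"
    unfolding L_def by (intro tendsto_mult tendsto_diff tendsto_const q0 T0)
  have "(\<lambda>m. K (Suc m)) \<longlonglongrightarrow> a\<^sup>2 * 0 * (1 - 0) * 0"
    unfolding K_Suc by (intro tendsto_mult tendsto_diff tendsto_const q0 T0 LIMSEQ_Suc[OF q0])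
  then have "K \<longlonglongrightarrow> 0" using LIMSEQ_imp_Suc[of K 0] by simp
  then have LK: "(\<lambda>m. L m + K m) \<longlonglongrightarrow> 0" using tendsto_add[OF L0, of K 0] by simp
  have "(\<lambda>m. (L m + K m) - (L (Suc m) + K (Suc m))) sums (L 0 + K 0 - 0)"
    using telescope_sums'[OF LK] by simp
  then have z: "(\<lambda>m. (1 - a * b) * asc_N a b m - (1 - a * x) * (1 - a / x) * asc_N (a * q) b m) sums 0"
    unfolding tele by (simp add: L_def K_def)
  have "(\<lambda>m. (1 - a * b) * asc_N a b m - (1 - a * x) * (1 - a / x) * asc_N (a * q) b m) sums
     ((1 - a * b) * suminf (asc_N a b) - (1 - a * x) * (1 - a / x) * suminf (asc_N (a * q) b))"
    by (intro sums_diff sums_mult summable_sums asc_N_summable[OF p] asc_N_summable[OF pq])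
  from sums_unique2[OF this z] show ?thesis by simp
qed

text \<open>\<open>asc_N_step\<close> is iterated. As a q^J tends to 0 only the term m = 0 survives,
  and the finite products become infinite ones.\<close>

lemma asc_N_sums:
  assumes p: "a * b = of_real p" "p \<le> 0"
  shows "asc_N a b sums (qpoch_inf (a * x) q * qpoch_inf (a / x) q / qpoch_inf (a * b) q)"
proof -
  have pJ: "a * q ^ J * b = of_real (p * r ^ J)" "p * r ^ J \<le> 0" for J
    using p r by (simp_all add: mult_nonpos_nonneg mult_ac)
  have qnz: "qpoch (a * b) q J \<noteq> 0" for J unfolding p(1) using norm_qpoch_ge_1[of r p J] p(2) r by auto
  have iter: "qpoch (a * b) q J * suminf (asc_N a b) = qpoch (a * x) q J * qpoch (a / x) q J * suminf (asc_N (a * q ^ J) b)" for J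
  proof (induction J)
    case (Suc J)
    have "(1 - a * q ^ J * b) * suminf (asc_N (a * q ^ J) b)
        = (1 - a * q ^ J * x) * (1 - a * q ^ J / x) * suminf (asc_N (a * q ^ J * q) b)"
      by (rule asc_N_step[OF pJ])
    moreover have "a * q ^ J * b = a * b * q ^ J" "a * q ^ J * x = a * x * q ^ J" "a * q ^ J / x = a / x * q ^ J"
      "a * q ^ J * q = a * q ^ Suc J" by simp_all
    ultimately have st: "(1 - a * b * q ^ J) * suminf (asc_N (a * q ^ J) b)
        = (1 - a * x * q ^ J) * (1 - a / x * q ^ J) * suminf (asc_N (a * q ^ Suc J) b)"
      by (simp only:)
    have "qpoch (a * b) q (Suc J) * suminf (asc_N a b) = (1 - a * b * q ^ J) * (qpoch (a * b) q J * suminf (asc_N a b))"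
      unfolding qpoch_Suc by (simp only: mult_ac)
    also have "\<dots> = qpoch (a * x) q J * qpoch (a / x) q J * ((1 - a * b * q ^ J) * suminf (asc_N (a * q ^ J) b))"
      unfolding Suc by (simp only: mult_ac)
    also have "\<dots> = qpoch (a * x) q (Suc J) * qpoch (a / x) q (Suc J) * suminf (asc_N (a * q ^ Suc J) b)"
      unfolding st qpoch_Suc by (simp only: mult_ac)
    finally show ?case .
  qed simp
  obtain D where D: "D > 0" "\<And>a' p' m. norm a' \<le> norm a \<Longrightarrow> a' * b = of_real p' \<Longrightarrow> p' \<le> 0 \<Longrightarrow> norm (asc_N a' b m) \<le> D * (1/2) ^ m"
    using asc_N_bound[OF norm_ge_zero, of a b] by blast
  have bd: "norm (asc_N (a * q ^ J) b m) \<le> D * (1/2) ^ m" for J m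
  proof (rule D(2)[OF _ pJ])
    show "norm (a * q ^ J) \<le> norm a" using r by (simp add: norm_mult norm_power mult_left_le power_le_one)
  qed
  \<comment> \<open>Tannery's theorem, with the majorant from \<open>asc_N_bound\<close> independent
    of J.\<close>
  have "(\<lambda>J. suminf (\<lambda>m. asc_N (a * q ^ J) b m)) \<longlonglongrightarrow> suminf (\<lambda>m. if m = 0 then 1 else 0)"
  proof (rule tannerys_theorem[where M = "\<lambda>m. D * (1/2) ^ m", THEN conjunct2, THEN conjunct2])
    fix m
    show "(\<lambda>J. asc_N (a * q ^ J) b m) \<longlonglongrightarrow> (if m = 0 then 1 else 0)"
    proof (cases m)
      case 0
      then show ?thesis by (simp add: asc_N_def asc_conv_def[OF nq' q_nz'])
    next
      case (Suc j)
      obtain C R where CR: "C > 0" "R > 0" "\<And>a' m. norm a' \<le> norm a \<Longrightarrow> norm (asc_conv q x a' b m) \<le> C * R ^ m"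
        using asc_conv_bound[OF norm_ge_zero, of a b] by blast
      have le: "norm (asc_N (a * q ^ J) b m) \<le> (norm a ^ m * (C * R ^ m)) * r ^ J" for J
      proof -
        have an: "norm (a * q ^ J) \<le> norm a" using r by (simp add: norm_mult norm_power mult_left_le power_le_one)
        have "norm (qpoch (complex_of_real (p * r ^ J)) q m) \<ge> 1"
          by (rule norm_qpoch_ge_1) (use r pJ(2) in auto)
        then have "norm (qpoch (a * q ^ J * b) q m) \<ge> 1" unfolding pJ(1) .
        then have "norm (asc_N (a * q ^ J) b m) \<le> norm ((- (a * q ^ J)) ^ m * q ^ (m * (m - 1) div 2) * asc_conv q x (a * q ^ J) b m) / 1"
          unfolding asc_N_def norm_divide by (intro divide_left_mono) auto
        also have "\<dots> = norm a ^ m * norm (asc_conv q x (a * q ^ J) b m) * ((r ^ J) ^ m * r ^ (m * (m - 1) div 2))"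
          using r by (simp add: norm_mult norm_power power_mult_distrib)
        also have "\<dots> \<le> norm a ^ m * (C * R ^ m) * (r ^ J * 1)"
        proof (intro mult_mono CR an)
          have "(r ^ J) ^ m = r ^ J * (r ^ J) ^ j" by (simp add: Suc)
          also have "\<dots> \<le> r ^ J * 1" using r by (intro mult_left_mono power_le_one) auto
          finally show "(r ^ J) ^ m \<le> r ^ J" by simp
        qed (use r CR(1,2) in \<open>simp_all add: power_le_one\<close>)
        finally show ?thesis by simp
      qed
      have lim: "(\<lambda>J. (norm a ^ m * (C * R ^ m)) * r ^ J) \<longlonglongrightarrow> 0"
        using r by (intro tendsto_mult_right_zero LIMSEQ_power_zero) simp
      have "(\<lambda>J. asc_N (a * q ^ J) b m) \<longlonglongrightarrow> 0"
        by (rule Lim_null_comparison[OF always_eventually[OF allI[OF le]] lim])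
      then show ?thesis by (simp add: Suc)
    qed
  next
    show "eventually (\<lambda>(m, J). norm (asc_N (a * q ^ J) b m) \<le> D * (1/2) ^ m) (at_top \<times>\<^sub>F sequentially)"
      using bd by (intro always_eventually) auto
    show "summable (\<lambda>m. D * (1/2::real) ^ m)" by (intro summable_mult summable_geometric) simp
  qed simp
  moreover have "suminf (\<lambda>m. if m = 0 then 1 else 0) = (1::complex)"
    using sums_single[of 0 "\<lambda>_. 1::complex"] by (simp add: sums_iff)
  ultimately have lim1: "(\<lambda>J. qpoch (a * x) q J * qpoch (a / x) q J * suminf (asc_N (a * q ^ J) b)) \<longlonglongrightarrow> qpoch_inf (a * x) q * qpoch_inf (a / x) q * 1"
    by (intro tendsto_mult qpoch_tendsto[OF nq']) simp
  have lim2: "(\<lambda>J. qpoch (a * b) q J * suminf (asc_N a b)) \<longlonglongrightarrow> qpoch_inf (a * b) q * suminf (asc_N a b)"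
    by (intro tendsto_mult qpoch_tendsto[OF nq'] tendsto_const)
  have "qpoch_inf (a * b) q * suminf (asc_N a b) = qpoch_inf (a * x) q * qpoch_inf (a / x) q * 1"
    by (rule LIMSEQ_unique[OF lim2[unfolded iter] lim1])
  moreover have "qpoch_inf (a * b) q \<noteq> 0"
  proof -
    have "qpoch (a * b) q (Suc j) \<noteq> 0" for j by (rule qnz)
    then have "a * b * q ^ j \<noteq> 1" for j by (auto simp: qpoch_Suc)
    then show ?thesis by (simp add: qpoch_inf_eq_0_iff[OF nq'])
  qed
  ultimately have "suminf (asc_N a b) = qpoch_inf (a * x) q * qpoch_inf (a / x) q / qpoch_inf (a * b) q"
    by (simp add: field_simps)
  then show ?thesis using summable_sums[OF asc_N_summable[OF p]] by simp
qed

end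

section \<open>The polynomial solution P_k\<close>

definition P_coeff :: "complex \<Rightarrow> complex \<Rightarrow> complex \<Rightarrow> nat \<Rightarrow> nat \<Rightarrow> complex" where
  "P_coeff q c d k l = (- c) ^ k / q ^ (k * (k - 1) div 2) * (qpoch q q k / (qpoch q q l * qpoch q q (k - l))) * (d / c) ^ l"

lemma int_choose2: "int n * (int n - 1) div 2 = int (n * (n - 1) div 2)"
proof -
  have "int n * (int n - 1) = int (n * (n - 1))" by (cases n) (simp_all add: algebra_simps)
  then show ?thesis by (simp only: zdiv_int of_nat_numeral)
qed

lemma P_fun_eq_sum:
  assumes q: "norm q < 1" "q \<noteq> 0" and c: "c \<noteq> 0"
  shows "P_fun (int k) y c d q = (\<Sum>l\<le>k. P_coeff q c d k l * qpoch (c * y) q l)"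
proof -
  define T where "T l = qpoch (q powi (- int k)) q l * qpoch (c * y) q l / qpoch q q l
      * ((-1) ^ l * q ^ (l * (l - 1) div 2)) powi - 1 * (d * q powi int k / c) ^ l" for l
  have "qhyp [q powi (- int k), c * y] [] q (d * q powi int k / c) = (\<Sum>l. T l)"
    by (simp add: qhyp_def T_def mult.assoc)
  also have "\<dots> = (\<Sum>l\<le>k. T l)"
    using q by (intro suminf_finite) (auto simp: T_def qpoch_neg_power_eq_0)
  finally have h: "qhyp [q powi (- int k), c * y] [] q (d * q powi int k / c) = (\<Sum>l\<le>k. T l)" .
  have T: "T l = qpoch q q k / (qpoch q q l * qpoch q q (k - l)) * (d / c) ^ l * qpoch (c * y) q l" if l: "l \<le> k" for l
  proof -
    define Cl where "Cl = (-1) ^ l * q ^ (l * (l - 1) div 2)"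
    have Cl: "Cl \<noteq> 0" using q by (simp add: Cl_def)
    have nz: "qpoch q q (k - l) \<noteq> 0" by (rule qpoch_q_nz[OF q(1)])
    have 1: "qpoch (q powi (- int k)) q l = Cl * qpoch q q k / (qpoch q q (k - l) * q ^ (k * l))"
      using qpoch_neg_power[OF l q(2)] nz q by (simp add: Cl_def field_simps)
    have 2: "Cl powi - 1 = 1 / Cl" by (simp add: power_int_minus divide_inverse)
    have 3: "(d * q powi int k / c) ^ l = (d / c) ^ l * q ^ (k * l)"
      by (simp add: power_mult_distrib power_divide power_mult)
    show ?thesis unfolding T_def Cl_def[symmetric] 1 2 3 using Cl q by (simp add: mult_ac)
  qed
  have e: "q powi (- (int k * (int k - 1) div 2)) = 1 / q ^ (k * (k - 1) div 2)"
    unfolding int_choose2 by (rule powi_neg_nat)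
  have "P_fun (int k) y c d q = (- c) ^ k * (1 / q ^ (k * (k - 1) div 2)) * (\<Sum>l\<le>k. T l)"
    unfolding P_fun_def h e by simp
  also have "\<dots> = (\<Sum>l\<le>k. P_coeff q c d k l * qpoch (c * y) q l)"
    unfolding sum_distrib_left by (intro sum.cong refl) (simp add: P_coeff_def T mult_ac)
  finally show ?thesis .
qed

text \<open>A q-Pascal rule for the q-binomial coefficients in \<open>P_coeff\<close>; the cases l =
  0 and l = k + 1 have only one of the two neighbours.\<close>

lemma P_coeff_Suc:
  assumes q: "norm q < 1" "q \<noteq> 0" and c: "c \<noteq> 0"
  shows "q ^ k * P_coeff q c d (Suc k) 0 = - c * P_coeff q c d k 0"
    and "l < k \<Longrightarrow> q ^ k * P_coeff q c d (Suc k) (Suc l) = - (d * P_coeff q c d k l + c * q ^ Suc l * P_coeff q c d k (Suc l))"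
    and "q ^ k * P_coeff q c d (Suc k) (Suc k) = - d * P_coeff q c d k k"
proof -
  note nz = qpoch_q_nz[OF q(1)]
  show "q ^ k * P_coeff q c d (Suc k) 0 = - c * P_coeff q c d k 0"
    unfolding P_coeff_def choose2_Suc power_add using nz q by simp
  show "q ^ k * P_coeff q c d (Suc k) (Suc k) = - d * P_coeff q c d k k"
    unfolding P_coeff_def choose2_Suc power_add using nz q c by simp
  assume l: "l < k"
  then have kl: "k - l = Suc (k - Suc l)" by simp
  define C where "C = (- c) ^ k / q ^ (k * (k - 1) div 2) * (d / c) ^ l * (qpoch q q k / (qpoch q q (Suc l) * qpoch q q (k - l)))"
  have qkl: "q ^ Suc l * q ^ (k - l) = q * q ^ k" using l by (simp flip: power_add)
  have f1: "1 - q ^ Suc l \<noteq> 0" "1 - q ^ (k - l) \<noteq> 0"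
    using q_power_neq_1[OF q(1), of "Suc l"] q_power_neq_1[OF q(1), of "k - l"] l by auto
  have s1: "qpoch q q (Suc l) = qpoch q q l * (1 - q ^ Suc l)" by (simp add: qpoch_Suc)
  have s2: "qpoch q q (k - l) = qpoch q q (k - Suc l) * (1 - q ^ (k - l))"
    unfolding kl by (simp add: qpoch_Suc)
  have "P_coeff q c d k l = C * (1 - q ^ Suc l)"
    unfolding P_coeff_def C_def s1 using f1 nz by (simp del: power_Suc)
  moreover have "P_coeff q c d k (Suc l) = C * (1 - q ^ (k - l)) * (d / c)"
    unfolding P_coeff_def C_def s2 using f1 nz by (simp add: mult_ac)
  moreover have "q ^ k * P_coeff q c d (Suc k) (Suc l) = C * (1 - q * q ^ k) * (- d)"
    unfolding P_coeff_def C_def choose2_Suc power_add using nz q c by (simp add: qpoch_Suc mult_ac)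
  moreover have "C * (1 - q * q ^ k) * (- d) = - (d * (C * (1 - q ^ Suc l)) + c * q ^ Suc l * (C * (1 - q ^ (k - l)) * (d / c)))"
  proof -
    have "c * q ^ Suc l * (C * (1 - q ^ (k - l)) * (d / c)) = d * C * (q ^ Suc l - q ^ Suc l * q ^ (k - l))"
      using c by (simp add: algebra_simps del: power_Suc)
    then show ?thesis unfolding qkl by (simp add: algebra_simps)
  qed
  ultimately show "q ^ k * P_coeff q c d (Suc k) (Suc l) = - (d * P_coeff q c d k l + c * q ^ Suc l * P_coeff q c d k (Suc l))"
    by (simp only:)
qed

text \<open>The raising relation of P_k. After division by (c y, d y;q)_inf it takes the form of
  \<open>lattice_lower\<close>.\<close>

lemma P_fun_raise:
  assumes q: "norm q < 1" "q \<noteq> 0" and c: "c \<noteq> 0"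
  shows "(1 - c * y) * (1 - d * y) * P_fun (int k) (q * y) c d q - P_fun (int k) y c d q = q ^ k * y * P_fun (int (Suc k)) y c d q"
proof -
  define p where "p = P_coeff q c d k"
  define \<phi> where "\<phi> l = qpoch (c * y) q l" for l
  have \<phi>_Suc: "\<phi> (Suc l) = \<phi> l - c * y * q ^ l * \<phi> l" for l by (simp add: \<phi>_def qpoch_Suc algebra_simps)
  have sh: "(1 - c * y) * qpoch (c * (q * y)) q l = \<phi> (Suc l)" for l
    by (simp add: \<phi>_def qpoch_Suc' mult_ac)
  have "(1 - c * y) * (1 - d * y) * P_fun (int k) (q * y) c d q = (\<Sum>l\<le>k. p l * ((1 - d * y) * \<phi> (Suc l)))"
    unfolding P_fun_eq_sum[OF assms] sum_distrib_left sh[symmetric] p_def by (intro sum.cong refl) (simp add: mult_ac)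
  moreover have "P_fun (int k) y c d q = (\<Sum>l\<le>k. p l * \<phi> l)"
    unfolding P_fun_eq_sum[OF assms] p_def \<phi>_def ..
  ultimately have "(1 - c * y) * (1 - d * y) * P_fun (int k) (q * y) c d q - P_fun (int k) y c d q
      = (\<Sum>l\<le>k. p l * ((1 - d * y) * \<phi> (Suc l)) - p l * \<phi> l)"
    by (simp only: sum_subtractf)
  also have "\<dots> = (\<Sum>l\<le>k. y * (- (d * p l * \<phi> (Suc l)) - c * q ^ l * p l * \<phi> l))"
  proof (intro sum.cong refl)
    fix l
    have "p l * ((1 - d * y) * \<phi> (Suc l)) - p l * \<phi> l = p l * (\<phi> (Suc l) - \<phi> l) - p l * d * y * \<phi> (Suc l)"
      by (simp add: algebra_simps)
    also have "\<phi> (Suc l) - \<phi> l = - (c * y * q ^ l * \<phi> l)" unfolding \<phi>_Suc by simp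
    finally show "p l * ((1 - d * y) * \<phi> (Suc l)) - p l * \<phi> l = y * (- (d * p l * \<phi> (Suc l)) - c * q ^ l * p l * \<phi> l)"
      by (simp add: algebra_simps)
  qed
  also have "\<dots> = y * ((\<Sum>l\<le>k. - (d * p l * \<phi> (Suc l))) + (\<Sum>l\<le>k. - (c * q ^ l * p l * \<phi> l)))"
    by (simp add: sum_distrib_left[symmetric] sum.distrib[symmetric])
  also have "(\<Sum>l\<le>k. - (d * p l * \<phi> (Suc l))) + (\<Sum>l\<le>k. - (c * q ^ l * p l * \<phi> l)) = (\<Sum>l\<le>Suc k. q ^ k * P_coeff q c d (Suc k) l * \<phi> l)"
  proof (cases k)
    case 0
    then show ?thesis using P_coeff_Suc(1,3)[OF q c, of 0 d] by (simp add: p_def)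
  next
    case (Suc j)
    have "(\<Sum>l\<le>k. - (d * p l * \<phi> (Suc l))) = (\<Sum>l\<le>j. - (d * p l * \<phi> (Suc l))) - d * p k * \<phi> (Suc k)"
      by (simp add: Suc)
    moreover have "(\<Sum>l\<le>k. - (c * q ^ l * p l * \<phi> l)) = - (c * p 0 * \<phi> 0) + (\<Sum>l\<le>j. - (c * q ^ Suc l * p (Suc l) * \<phi> (Suc l)))"
      unfolding Suc by (subst sum.atMost_Suc_shift) simp
    moreover have "(\<Sum>l\<le>Suc k. q ^ k * P_coeff q c d (Suc k) l * \<phi> l) = q ^ k * P_coeff q c d (Suc k) 0 * \<phi> 0
        + (\<Sum>l\<le>j. q ^ k * P_coeff q c d (Suc k) (Suc l) * \<phi> (Suc l)) + q ^ k * P_coeff q c d (Suc k) (Suc k) * \<phi> (Suc k)"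
      unfolding sum.atMost_Suc[of _ k] by (subst Suc, subst sum.atMost_Suc_shift) (simp add: Suc)
    moreover have "(\<Sum>l\<le>j. q ^ k * P_coeff q c d (Suc k) (Suc l) * \<phi> (Suc l)) = (\<Sum>l\<le>j. - (d * p l * \<phi> (Suc l))) + (\<Sum>l\<le>j. - (c * q ^ Suc l * p (Suc l) * \<phi> (Suc l)))"
      unfolding sum.distrib[symmetric]
    proof (intro sum.cong refl)
      fix l assume "l \<in> {..j}"
      then have "l < k" using Suc by simp
      from P_coeff_Suc(2)[OF q c this, of d]
      show "q ^ k * P_coeff q c d (Suc k) (Suc l) * \<phi> (Suc l) = - (d * p l * \<phi> (Suc l)) + - (c * q ^ Suc l * p (Suc l) * \<phi> (Suc l))"
        unfolding p_def by (simp only:) (simp add: algebra_simps)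
    qed
    ultimately show ?thesis unfolding P_coeff_Suc(1,3)[OF q c] p_def[symmetric] by simp
  qed
  also have "y * (\<Sum>l\<le>Suc k. q ^ k * P_coeff q c d (Suc k) l * \<phi> l) = q ^ k * y * P_fun (int (Suc k)) y c d q"
    unfolding P_fun_eq_sum[OF assms] \<phi>_def sum_distrib_left by (intro sum.cong refl) (simp only: mult_ac)
  finally show ?thesis .
qed

context asc_coupling_generic
begin

lemma t_P: "B = 1 \<Longrightarrow> t = b" unfolding t_def by simp

lemma lattice_pochhammer_nz:
  assumes \<kappa>: "\<kappa> \<in> {1, - z}"
  shows "1 + t * x * of_real (- \<kappa> * r powi i) \<noteq> 0" "1 + t / x * of_real (- \<kappa> * r powi i) \<noteq> 0"
    "qpoch_inf (- t * x * of_real (- \<kappa> * r powi i)) q \<noteq> 0" "qpoch_inf (- t / x * of_real (- \<kappa> * r powi i)) q \<noteq> 0"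
proof -
  have g1: "t * x * of_real (\<kappa> * r powi i) \<noteq> 1" "t / x * of_real (\<kappa> * r powi i) \<noteq> 1" for i
    using gen[OF \<kappa>, of i] gen'[OF \<kappa>, of i] by (simp_all add: of_real_power_int mult.assoc)
  have 1: "of_real (- \<kappa> * r powi i) * q ^ j = - complex_of_real (\<kappa> * r powi (i + int j))" for j
    using r by (simp add: power_int_add)
  show "1 + t * x * of_real (- \<kappa> * r powi i) \<noteq> 0" "1 + t / x * of_real (- \<kappa> * r powi i) \<noteq> 0"
    using g1[of i] by simp_all
  show "qpoch_inf (- t * x * of_real (- \<kappa> * r powi i)) q \<noteq> 0" "qpoch_inf (- t / x * of_real (- \<kappa> * r powi i)) q \<noteq> 0"
    unfolding qpoch_inf_eq_0_iff[OF nq] mult.assoc 1 using g1 x by (simp_all add: mult.assoc)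
qed

text \<open>The top series is the generating sum in a for \<kappa> = 1 and in b for \<kappa> = -z.
  The weight products supply the other pair each time, so both branches get the same
  constant.\<close>

lemma P_base_top:
  assumes P: "A = a * b" "B = 1" and p: "a * b = of_real p" "p \<le> 0" and \<kappa>: "\<kappa> \<in> {1, - z}" and s: "solves 0 s"
  shows "s (- \<kappa>) * (qpoch_inf (- b / x * of_real (- \<kappa>)) q * qpoch_inf (- b * x * of_real (- \<kappa>)) q)
    = qpoch_inf (a * x) q * qpoch_inf (a / x) q * (qpoch_inf (b * x) q * qpoch_inf (b / x) q) / qpoch_inf (a * b) q"
proof -
  have g: "g (0 + int m) / qpoch q q m = asc_conv q x a b m / qpoch (a * b) q m" for m
    unfolding g_def ch_def using qpoch_q_nz[OF nq, of m] by (simp add: P(1))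
  consider "\<kappa> = 1" | "\<kappa> = - z" using \<kappa> by blast
  then show ?thesis
  proof cases
    case 1
    have tz: "t * of_real z = - a" using a_eq t_P[OF P(2)] by simp
    have "asc_N r x a b = (\<lambda>m. (t * of_real z) ^ m * q ^ (m * (m - 1) div 2) / qpoch q q m * g (0 + int m))"
    proof
      fix m
      have "(t * of_real z) ^ m * q ^ (m * (m - 1) div 2) / qpoch q q m * g (0 + int m)
         = (- a) ^ m * q ^ (m * (m - 1) div 2) * (g (0 + int m) / qpoch q q m)" unfolding tz by simp
      also have "\<dots> = asc_N r x a b m" unfolding g asc_N_def[OF r x] by simp
      finally show "asc_N r x a b m = (t * of_real z) ^ m * q ^ (m * (m - 1) div 2) / qpoch q q m * g (0 + int m)" by simp
    qed
    with RS_top_1[of 0] asc_N_sums[OF r x p] have "RS 0 0 1 = qpoch_inf (a * x) q * qpoch_inf (a / x) q / qpoch_inf (a * b) q"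
      using sums_unique2 by metis
    then show ?thesis using solves_top[OF \<kappa> s] 1 by simp
  next
    case 2
    have p': "b * a = of_real p" using p by (simp add: mult.commute)
    have "asc_N r x b a = (\<lambda>m. (- t) ^ m * q ^ (m * (m - 1) div 2) / qpoch q q m * g (0 + int m))"
    proof
      fix m
      have "(- t) ^ m * q ^ (m * (m - 1) div 2) / qpoch q q m * g (0 + int m)
         = (- b) ^ m * q ^ (m * (m - 1) div 2) * (g (0 + int m) / qpoch q q m)" unfolding t_P[OF P(2)] by simp
      also have "\<dots> = asc_N r x b a m" unfolding g asc_N_def[OF r x] asc_conv_commute[OF nq q_nz x, of a b] by (simp add: mult.commute)
      finally show "asc_N r x b a m = (- t) ^ m * q ^ (m * (m - 1) div 2) / qpoch q q m * g (0 + int m)" by simp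
    qed
    with RS_top_2[of 0] asc_N_sums[OF r x p' p(2)] have "RS 0 0 (- z) = qpoch_inf (b * x) q * qpoch_inf (b / x) q / qpoch_inf (b * a) q"
      using sums_unique2 by metis
    moreover have "- b / x * of_real (- \<kappa>) = a / x" "- b * x * of_real (- \<kappa>) = a * x"
      unfolding 2 a_eq by simp_all
    ultimately show ?thesis using solves_top[OF \<kappa> s] 2 by (simp add: mult.commute)
  qed
qed

text \<open>At k = 0 the coefficient 1 - B vanishes, and the two lattice relations combine to s_0(r
  y) = (1 - c y)(1 - d y) s_0(y). Hence s_0 times the weight products is constant along a branch.
  The other k follow from \<open>lattice_lower\<close>, matched with
  \<open>P_fun_raise\<close>.\<close>

theorem P_solution:
  assumes P: "A = a * b" "B = 1" and p: "a * b = of_real p" "p \<le> 0" and \<kappa>: "\<kappa> \<in> {1, - z}"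
    and s: "\<And>k. solves (int k) (s k)"
  defines "y \<equiv> \<lambda>i. - \<kappa> * r powi i"
  shows "s k (y i) = qpoch_inf (a * x) q * qpoch_inf (a / x) q * (qpoch_inf (b * x) q * qpoch_inf (b / x) q) / qpoch_inf (a * b) q
     * (q ^ (k * (k - 1) div 2) / b ^ k) * P_fun (int k) (of_real (y i)) (- b / x) (- b * x) q
     / (qpoch_inf (- b / x * of_real (y i)) q * qpoch_inf (- b * x * of_real (y i)) q)"
proof -
  define c d where "c = - b / x" and "d = - b * x"
  define K where "K = qpoch_inf (a * x) q * qpoch_inf (a / x) q * (qpoch_inf (b * x) q * qpoch_inf (b / x) q) / qpoch_inf (a * b) q"
  define D where "D i = qpoch_inf (c * of_real (y i)) q * qpoch_inf (d * of_real (y i)) q" for i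
  have t: "t = b" by (rule t_P[OF P(2)])
  have y_Suc: "y (i + 1) = r * y i" for i using r by (simp add: y_def power_int_add)
  have fnz: "1 - c * of_real (y i) \<noteq> 0" "1 - d * of_real (y i) \<noteq> 0" "D i \<noteq> 0" for i
    using lattice_pochhammer_nz[OF \<kappa>, of i] unfolding t D_def c_def d_def y_def by auto
  have D_Suc: "D i = (1 - c * of_real (y i)) * (1 - d * of_real (y i)) * D (i + 1)" for i
    unfolding D_def y_Suc using qpoch_inf_rec[OF nq, of "c * of_real (y i)"] qpoch_inf_rec[OF nq, of "d * of_real (y i)"]
    by (simp add: mult_ac)
  have base_step: "s 0 (y (i + 1)) * D (i + 1) = s 0 (y i) * D i" for i
  proof -
    have s0: "solves 0 (s 0)" using s[of 0] by simp
    have s1: "solves (0 + 1) (s 1)" using s[of 1] by simp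
    have "s 0 (r * y i) = s 0 (y i) + t * of_real (y i) * s 1 (y i)"
      unfolding y_def by (rule lattice_lower[OF \<kappa> s0 s1])
    then have "s 0 (y (i + 1)) = s 0 (y i) + b * of_real (y i) * s 1 (y i)"
      unfolding y_Suc t .
    also have "s 1 (y i) = (x + 1 / x + b * of_real (y i)) * s 0 (y i)"
      using lattice_three_term[OF \<kappa> s0 s1, of "\<lambda>_. 0" i] P(2) unfolding y_def by simp
    also have "s 0 (y i) + b * of_real (y i) * ((x + 1 / x + b * of_real (y i)) * s 0 (y i))
       = (1 - c * of_real (y i)) * (1 - d * of_real (y i)) * s 0 (y i)"
      unfolding c_def d_def using x by (simp add: field_simps power2_eq_square)
    finally show ?thesis unfolding D_Suc[of i] by simp
  qed
  have base: "s 0 (y i) * D i = K" for i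
  proof -
    have "s 0 (y 0) * D 0 = K"
      using P_base_top[OF P p \<kappa>, of "s 0"] s[of 0] unfolding K_def D_def c_def d_def by (simp add: y_def)
    then show ?thesis
    proof (induction i rule: int_induct[where k = 0])
      case (step1 i) then show ?case using base_step[of i] by simp
    next
      case (step2 i) then show ?case using base_step[of "i - 1"] by simp
    qed
  qed
  have cnz: "c \<noteq> 0" using b x by (simp add: c_def)
  have "s k (y i) * D i = K * (q ^ (k * (k - 1) div 2) / b ^ k) * P_fun (int k) (of_real (y i)) c d q" for k i
  proof (induction k arbitrary: i)
    case 0
    have "P_fun (int 0) (of_real (y i)) c d q = 1"
      unfolding P_fun_eq_sum[OF nq q_nz cnz] by (simp add: P_coeff_def)
    then show ?case using base by simp
  next
    case (Suc k)
    have ynz: "complex_of_real (y i) \<noteq> 0" using \<kappa> r z by (auto simp: y_def)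
    have s1: "solves (int k + 1) (s (Suc k))" using s[of "Suc k"] by (simp add: add.commute)
    have "s k (r * y i) = s k (y i) + t * of_real (y i) * s (Suc k) (y i)"
      unfolding y_def by (rule lattice_lower[OF \<kappa> s[of k] s1])
    then have "s k (y (i + 1)) = s k (y i) + b * of_real (y i) * s (Suc k) (y i)"
      unfolding y_Suc t .
    then have "b * of_real (y i) * (s (Suc k) (y i) * D i) = s k (y (i + 1)) * D i - s k (y i) * D i"
      by (simp add: algebra_simps)
    also have "s k (y (i + 1)) * D i = (1 - c * of_real (y i)) * (1 - d * of_real (y i)) * (s k (y (i + 1)) * D (i + 1))"
      unfolding D_Suc[of i] by simp
    also have "(1 - c * of_real (y i)) * (1 - d * of_real (y i)) * (s k (y (i + 1)) * D (i + 1)) - s k (y i) * D i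
       = K * (q ^ (k * (k - 1) div 2) / b ^ k) * ((1 - c * of_real (y i)) * (1 - d * of_real (y i)) * P_fun (int k) (q * of_real (y i)) c d q
          - P_fun (int k) (of_real (y i)) c d q)"
    proof -
      have "u * (KK * F1) - KK * F2 = KK * (u * F1 - F2)" for u KK F1 F2 :: complex
        by (simp add: algebra_simps)
      then show ?thesis unfolding Suc[of "i + 1"] Suc[of i] unfolding y_Suc of_real_mult .
    qed
    also have "\<dots> = b * of_real (y i) * (K * (q ^ (Suc k * (Suc k - 1) div 2) / b ^ Suc k) * P_fun (int (Suc k)) (of_real (y i)) c d q)"
      unfolding P_fun_raise[OF nq q_nz cnz] choose2_Suc power_add using b by simp
    finally have eq: "b * of_real (y i) * (s (Suc k) (y i) * D i) = b * of_real (y i) * (K * (q ^ (Suc k * (Suc k - 1) div 2) / b ^ Suc k) * P_fun (int (Suc k)) (of_real (y i)) c d q)" .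
    have "b * of_real (y i) \<noteq> 0" using b ynz by simp
    from mult_left_cancel[OF this, THEN iffD1, OF eq] show ?case .
  qed
  from this[of k i] have "s k (y i) = K * (q ^ (k * (k - 1) div 2) / b ^ k) * P_fun (int k) (of_real (y i)) c d q / D i"
    using fnz(3)[of i] nonzero_eq_divide_eq by blast
  then show ?thesis by (simp only: K_def D_def c_def d_def)
qed

end

section \<open>The second solution Q_k as a bilateral convolution\<close>

context
  fixes q x a b :: complex
  assumes q: "norm q < 1" "q \<noteq> 0" and x: "x \<noteq> 0" and a: "a \<noteq> 0" and b: "b \<noteq> 0"
    and bx: "\<And>i::int. b * x * q powi i \<noteq> 1"
begin

text \<open>x^(-j) (b x;q)_j continued to all integers j as a quotient of infinite products.\<close>

definition Bz :: "int \<Rightarrow> complex" where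
  "Bz j = (1 / x) powi j * (qpoch_inf (b * x) q / qpoch_inf (b * x * q powi j) q)"

definition Al :: "int \<Rightarrow> nat \<Rightarrow> complex" where
  "Al i l = qpoch (a * q powi (- i) / x) q l * x ^ l / qpoch q q l"

text \<open>The convolution behind \<open>asc_conv\<close> without the cut-off at negative indices;
  \<open>phi_eq_XX\<close> identifies it with the 1phi1 of Q_k.\<close>

definition XX :: "int \<Rightarrow> int \<Rightarrow> complex" where
  "XX k i = (\<Sum>l. Al i l * Bz (k - int l))"

lemma powi_add1: "q powi (j + 1) = q powi j * q" "q powi (1 + j) = q powi j * q"
  "q powi (j + int n) = q powi j * q ^ n" "q powi (j - int n) = q powi j / q ^ n"
  using q by (simp_all add: power_int_add power_int_diff)

lemma bx_inf_nz: "qpoch_inf (b * x * q powi j) q \<noteq> 0"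
proof -
  have "b * x * q powi j * q ^ n \<noteq> 1" for n
    using bx[of "j + int n"] by (simp add: powi_add1 mult.assoc)
  then show ?thesis by (simp add: qpoch_inf_eq_0_iff[OF q(1)])
qed

lemma Bz_rec: "Bz (j + 1) = (1 / x - b * q powi j) * Bz j"
proof -
  have "qpoch_inf (b * x * q powi j) q = (1 - b * x * q powi j) * qpoch_inf (b * x * q powi (j + 1)) q"
    using qpoch_inf_rec[OF q(1), of "b * x * q powi j"] by (simp add: powi_add1 mult.assoc)
  moreover have "1 - b * x * q powi j \<noteq> 0" using bx[of j] by simp
  moreover have "(1 / x) powi (j + 1) = (1 / x) powi j * (1 / x)" using x by (simp add: power_int_add)
  moreover have "1 / x - b * q powi j = (1 / x) * (1 - b * x * q powi j)" using x by (simp add: field_simps)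
  ultimately show ?thesis unfolding Bz_def by simp
qed

lemma Bz_nz: "Bz j \<noteq> 0"
  using bx_inf_nz[of j] bx_inf_nz[of 0] x by (simp add: Bz_def)

lemma Bz_add: "Bz (j + int m) = Bz j * (qpoch (b * x * q powi j) q m * (1 / x) ^ m)"
proof (induction m)
  case (Suc m)
  have "Bz (j + int (Suc m)) = (1 / x - b * q powi (j + int m)) * Bz (j + int m)"
    using Bz_rec[of "j + int m"] by (simp add: add_ac)
  also have "1 / x - b * q powi (j + int m) = (1 - b * x * q powi j * q ^ m) * (1 / x)"
    using x by (simp add: powi_add1 field_simps)
  finally show ?case unfolding Suc qpoch_Suc by (simp add: mult_ac)
qed simp

lemma Bz_0: "Bz 0 = 1" using bx_inf_nz[of 0] by (simp add: Bz_def)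

text \<open>Solving the first order recurrence downwards produces a Gaussian factor, which makes the
  infinite convolution converge.\<close>

lemma Bz_sub: "Bz (k - int l) = Bz k * ((- (q powi (1 - k)) / b) ^ l * q ^ (l * (l - 1) div 2) / qpoch (q powi (1 - k) / (b * x)) q l)"
  and delta_nz: "q powi (1 - k) / (b * x) * q ^ l \<noteq> 1"
proof -
  define \<delta> where "\<delta> = q powi (1 - k) / (b * x)"
  have nz: "\<delta> * q ^ l \<noteq> 1" for l
  proof
    assume h: "\<delta> * q ^ l = 1"
    have "b * x * q powi (k - 1 - int l) = 1"
    proof -
      have "q powi (1 - k) * q powi (k - 1) = 1" using q by (simp flip: power_int_add)
      then have "q powi (k - 1) = 1 / q powi (1 - k)" using q by (simp add: field_simps)
      then have "b * x * q powi (k - 1 - int l) = 1 / (\<delta> * q ^ l)" using b x by (simp add: \<delta>_def powi_add1)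
      then show ?thesis using h by simp
    qed
    then show False using bx by blast
  qed
  then show "q powi (1 - k) / (b * x) * q ^ l \<noteq> 1" by (simp add: \<delta>_def)
  have qnz: "qpoch \<delta> q l \<noteq> 0" for l using nz by (auto simp: qpoch_eq_0_iff)
  have "Bz (k - int l) = Bz k * ((- (q powi (1 - k)) / b) ^ l * q ^ (l * (l - 1) div 2) / qpoch \<delta> q l)"
  proof (induction l)
    case (Suc l)
    define j where "j = k - int (Suc l)"
    have rec: "Bz (k - int l) = (1 / x - b * q powi j) * Bz j"
      using Bz_rec[of j] by (simp add: j_def)
    have qj: "q powi j * q powi (1 - k) * q ^ l = 1"
    proof -
      have "q powi j * q powi (1 - k) * q ^ l = q powi (j + (1 - k) + int l)"
        unfolding powi_add1(3) using q power_int_add[of q j "1 - k"] by simp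
      also have "j + (1 - k) + int l = 0" by (simp add: j_def)
      finally show ?thesis by simp
    qed
    have gen: "(1 / x - b * Q) * (- P / b * L) = Q * P * L - P / (b * x) * L" for Q P L
      using b x by (simp add: field_simps)
    have "(1 / x - b * q powi j) * (- (q powi (1 - k)) / b * q ^ l) = 1 - \<delta> * q ^ l"
      unfolding gen qj \<delta>_def ..
    then have B1: "Bz (k - int l) * (- (q powi (1 - k)) / b * q ^ l) = Bz j * (1 - \<delta> * q ^ l)"
      unfolding rec by (metis (no_types) mult.assoc mult.commute)
    have dl: "1 - \<delta> * q ^ l \<noteq> 0" using nz[of l] by simp
    have "Bz j = Bz (k - int l) * (- (q powi (1 - k)) / b * q ^ l) / (1 - \<delta> * q ^ l)"
      by (rule iffD2[OF nonzero_eq_divide_eq[OF dl] B1[symmetric]])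
    then show ?case unfolding j_def[symmetric] Suc choose2_Suc power_add using dl qnz[of l] by (simp add: qpoch_Suc mult_ac)
  qed simp
  then show "Bz (k - int l) = Bz k * ((- (q powi (1 - k)) / b) ^ l * q ^ (l * (l - 1) div 2) / qpoch (q powi (1 - k) / (b * x)) q l)"
    by (simp only: \<delta>_def)
qed

text \<open>The power w^l is used with w = 1 for the series itself and with w = 1/q for the boundary
  term in \<open>XX_three_term\<close>.\<close>

lemma XX_summable: "summable (\<lambda>l. norm (Al i l * Bz (k - int l) * w ^ l))"
proof -
  define c where "c = norm (a * q powi (- i) / x)"
  obtain K where K: "K > 0" "\<And>m. norm (1 / qpoch q q m) \<le> K" using inverse_qpoch_q_Bseq[OF q(1)] by auto
  obtain D where D: "D > 0" "\<And>m. norm (1 / qpoch (q powi (1 - k) / (b * x)) q m) \<le> D"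
    using inverse_qpoch_Bseq[OF q(1) delta_nz, of k] by auto
  define \<gamma> where "\<gamma> = - (q powi (1 - k)) / b * w * x"
  have "summable (\<lambda>l. norm ((Bz k * (qpoch (a * q powi (- i) / x) q l * \<gamma> ^ l * (1 / qpoch q q l) * (1 / qpoch (q powi (1 - k) / (b * x)) q l))) * q ^ (l * (l - 1) div 2)))"
  proof (rule summable_gauss[OF q(1), where C = "norm (Bz k) * (K * D)" and R = "(1 + c) * norm \<gamma>"])
    fix l
    have "norm (qpoch (a * q powi (- i) / x) q l) * norm \<gamma> ^ l * norm (1 / qpoch q q l) * norm (1 / qpoch (q powi (1 - k) / (b * x)) q l)
       \<le> (1 + c) ^ l * norm \<gamma> ^ l * K * D"
      using K D q by (intro mult_mono norm_qpoch_le mult_nonneg_nonneg) (auto simp: c_def)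
    then have "norm (Bz k) * (norm (qpoch (a * q powi (- i) / x) q l) * norm \<gamma> ^ l * norm (1 / qpoch q q l) * norm (1 / qpoch (q powi (1 - k) / (b * x)) q l))
       \<le> norm (Bz k) * ((1 + c) ^ l * norm \<gamma> ^ l * K * D)" by (rule mult_left_mono) simp
    then show "norm (Bz k * (qpoch (a * q powi (- i) / x) q l * \<gamma> ^ l * (1 / qpoch q q l) * (1 / qpoch (q powi (1 - k) / (b * x)) q l)))
      \<le> norm (Bz k) * (K * D) * ((1 + c) * norm \<gamma>) ^ l"
      by (simp only: norm_mult norm_power power_mult_distrib mult_ac)
  qed (use K D in \<open>auto simp: c_def\<close>)
  moreover have "(Bz k * (qpoch (a * q powi (- i) / x) q l * \<gamma> ^ l * (1 / qpoch q q l) * (1 / qpoch (q powi (1 - k) / (b * x)) q l))) * q ^ (l * (l - 1) div 2)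
     = Al i l * Bz (k - int l) * w ^ l" for l
    unfolding Al_def Bz_sub[of k l] \<gamma>_def power_mult_distrib by simp
  ultimately show ?thesis by simp
qed

lemma XX_sums: "(\<lambda>l. Al i l * Bz (k - int l)) sums XX k i"
  unfolding XX_def using summable_norm_cancel[OF XX_summable[of i k 1]] by (simp add: summable_sums)

lemma Al_Suc: "(1 - q ^ Suc l) * Al i (Suc l) = (x - a * q powi (- i) * q ^ l) * Al i l"
proof -
  have "1 - q * q ^ l \<noteq> 0" using q_power_neq_1[OF q(1), of "Suc l"] by simp
  then show ?thesis using x qpoch_q_nz[OF q(1)] by (simp add: Al_def qpoch_Suc divide_simps)
qed

text \<open>Raising i changes \<open>Al\<close> at l + 1 by a multiple of \<open>Al\<close> at l,
  which amounts to a shift of k.\<close>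

lemma XX_lower: "XX k (i + 1) = XX k i - a * q powi (- i - 1) * XX (k - 1) i"
proof -
  have A: "Al (i + 1) (Suc l) = Al i (Suc l) - a * q powi (- i - 1) * Al i l" for l
  proof -
    define Y where "Y = a * q powi (- i - 1) / x"
    have e: "- (i + 1) = - i - 1" by simp
    have Yq: "a * q powi (- i) / x = Y * q" using powi_add1(1)[of "- i - 1"] by (simp add: Y_def)
    have Yx: "a * q powi (- i - 1) = Y * x" using x by (simp add: Y_def)
    have nz: "1 - q * q ^ l \<noteq> 0" "qpoch q q l \<noteq> 0"
      using q_power_neq_1[OF q(1), of "Suc l"] qpoch_q_nz[OF q(1)] by auto
    have 1: "Al (i + 1) (Suc l) = (1 - Y) * qpoch (Y * q) q l * x ^ Suc l / qpoch q q (Suc l)"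
      unfolding Al_def e Y_def[symmetric] qpoch_Suc'[of Y] ..
    have 2: "Al i (Suc l) = (1 - Y * q * q ^ l) * qpoch (Y * q) q l * x ^ Suc l / qpoch q q (Suc l)"
      unfolding Al_def Yq qpoch_Suc[of "Y * q"] by (simp only: mult.commute)
    have 3: "Al i l = (1 - q * q ^ l) * qpoch (Y * q) q l * x ^ l / qpoch q q (Suc l)"
      unfolding Al_def Yq using nz by (simp add: qpoch_Suc)
    show ?thesis unfolding 1 2 3 Yx by (simp add: diff_divide_distrib[symmetric]) (simp add: algebra_simps)
  qed
  have A0: "Al (i + 1) 0 = Al i 0" by (simp add: Al_def)
  have "(\<lambda>l. Al i (Suc l) * Bz (k - int (Suc l))) sums (XX k i - Al i 0 * Bz k)"
    using XX_sums[of i k] by (subst sums_Suc_iff) simp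
  moreover have "(\<lambda>l. Al i l * Bz (k - 1 - int l)) sums XX (k - 1) i" by (rule XX_sums)
  ultimately have "(\<lambda>l. Al i (Suc l) * Bz (k - int (Suc l)) - a * q powi (- i - 1) * (Al i l * Bz (k - 1 - int l)))
     sums (XX k i - Al i 0 * Bz k - a * q powi (- i - 1) * XX (k - 1) i)"
    by (intro sums_diff sums_mult)
  moreover have "Al i (Suc l) * Bz (k - int (Suc l)) - a * q powi (- i - 1) * (Al i l * Bz (k - 1 - int l))
     = Al (i + 1) (Suc l) * Bz (k - int (Suc l))" for l
  proof -
    have "k - 1 - int l = k - int (Suc l)" by simp
    then show ?thesis unfolding A by (simp only: left_diff_distrib mult.assoc)
  qed
  ultimately have "(\<lambda>l. Al (i + 1) (Suc l) * Bz (k - int (Suc l))) sums (XX k i - Al i 0 * Bz k - a * q powi (- i - 1) * XX (k - 1) i)"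
    by (simp only:)
  moreover have "(\<lambda>l. Al (i + 1) (Suc l) * Bz (k - int (Suc l))) sums (XX k (i + 1) - Al (i + 1) 0 * Bz k)"
    using XX_sums[of "i + 1" k] by (subst sums_Suc_iff) simp
  ultimately have "XX k (i + 1) - Al (i + 1) 0 * Bz k = XX k i - Al i 0 * Bz k - a * q powi (- i - 1) * XX (k - 1) i"
    using sums_unique2 by blast
  then show ?thesis unfolding A0 by simp
qed

text \<open>The three-term recurrence holds because its summands telescope, with \<open>G\<close> as below.\<close>

lemma XX_three_term: "XX k i - (x + 1 / x) * XX (k - 1) i + XX (k - 2) i
    = - b * q powi (k - 1) * XX (k - 1) i + a * b * q powi (k - i - 2) * XX (k - 2) i"
proof -
  define v where "v = b * q powi (k - 2)"
  define G where "G l = v * q * (1 / q) ^ l * (1 - q ^ l) * Al i l * Bz (k - 1 - int l)" for l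
  have vq: "b * q powi (k - 1) = v * q" using powi_add1(1)[of "k - 2"] by (simp add: v_def)
  have va: "a * b * q powi (k - i - 2) = v * (a * q powi (- i))"
  proof -
    have e: "k - i - 2 = (k - 2) + - i" by simp
    have "q powi (k - i - 2) = q powi (k - 2) * q powi (- i)" unfolding e using q by (intro power_int_add) simp
    then show ?thesis by (simp add: v_def)
  qed
  have summand: "Al i l * Bz (k - int l) - (x + 1 / x) * (Al i l * Bz (k - 1 - int l)) + Al i l * Bz (k - 2 - int l)
     - (- (v * q) * (Al i l * Bz (k - 1 - int l)) + v * (a * q powi (- i)) * (Al i l * Bz (k - 2 - int l))) = G (Suc l) - G l" for l
  proof -
    define u where "u = (1 / q) ^ l"
    have uq: "u * q ^ l = 1" using q by (simp add: u_def power_divide)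
    define b0 where "b0 = Bz (k - 2 - int l)"
    have ql: "b * q powi (k - 2 - int l) = v * u" by (simp add: powi_add1 v_def u_def power_divide)
    have b1: "Bz (k - 1 - int l) = (1 / x - v * u) * b0"
      using Bz_rec[of "k - 2 - int l"] unfolding ql b0_def by (simp add: algebra_simps)
    have "b * q powi (k - 1 - int l) = v * q * u"
      using powi_add1(4)[of "k - 1" l] vq by (simp add: u_def power_divide)
    then have b2: "Bz (k - int l) = (1 / x - v * q * u) * ((1 / x - v * u) * b0)"
      using Bz_rec[of "k - 1 - int l"] unfolding b1 by (simp add: algebra_simps)
    have e: "k - 1 - int (Suc l) = k - 2 - int l" by simp
    have "G (Suc l) = v * u * ((1 - q ^ Suc l) * Al i (Suc l)) * b0"
      unfolding G_def e b0_def u_def using q by simp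
    also have "\<dots> = v * (u * x - a * q powi (- i) * (u * q ^ l)) * Al i l * b0"
      unfolding Al_Suc by (simp add: algebra_simps)
    finally have G1: "G (Suc l) = v * (u * x - a * q powi (- i)) * Al i l * b0" unfolding uq by simp
    have "G l = v * q * (u - u * q ^ l) * Al i l * Bz (k - 1 - int l)"
      unfolding G_def u_def by (simp add: algebra_simps)
    then have G0: "G l = v * q * (u - 1) * Al i l * ((1 / x - v * u) * b0)" unfolding uq b1 .
    define p where "p = 1 / x"
    have px: "p * x = 1" using x by (simp add: p_def)
    have alg: "A * ((p - v * q * u) * ((p - v * u) * b0)) - (x + p) * (A * ((p - v * u) * b0)) + A * b0
      - (- (v * q) * (A * ((p - v * u) * b0)) + v * aq * (A * b0))
      = v * (u * x - aq) * A * b0 - v * q * (u - 1) * A * ((p - v * u) * b0)" for A aq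
    proof -
      have "A * ((p - v * q * u) * ((p - v * u) * b0)) - (x + p) * (A * ((p - v * u) * b0)) + A * b0
      - (- (v * q) * (A * ((p - v * u) * b0)) + v * aq * (A * b0))
      - (v * (u * x - aq) * A * b0 - v * q * (u - 1) * A * ((p - v * u) * b0)) = A * b0 * (1 - p * x)"
        by (simp add: algebra_simps)
      then show ?thesis unfolding px by simp
    qed
    show ?thesis unfolding G1 G0 b1 b2 b0_def[symmetric] p_def[symmetric] by (rule alg)
  qed
  have "G \<longlonglongrightarrow> 0"
  proof -
    have "(\<lambda>l. Al i l * Bz (k - 1 - int l) * (1 / q) ^ l) \<longlonglongrightarrow> 0"
      by (rule summable_LIMSEQ_zero[OF summable_norm_cancel[OF XX_summable]])
    then have "(\<lambda>l. v * q * (1 - q ^ l) * (Al i l * Bz (k - 1 - int l) * (1 / q) ^ l)) \<longlonglongrightarrow> v * q * (1 - 0) * 0"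
      by (intro tendsto_mult tendsto_diff tendsto_const LIMSEQ_power_zero[OF q(1)])
    then show ?thesis unfolding G_def by (simp add: mult_ac)
  qed
  from telescope_sums[OF this] have "(\<lambda>l. G (Suc l) - G l) sums 0" by (simp add: G_def)
  moreover have "(\<lambda>l. Al i l * Bz (k - int l) - (x + 1 / x) * (Al i l * Bz (k - 1 - int l)) + Al i l * Bz (k - 2 - int l)
     - (- (v * q) * (Al i l * Bz (k - 1 - int l)) + v * (a * q powi (- i)) * (Al i l * Bz (k - 2 - int l))))
     sums (XX k i - (x + 1 / x) * XX (k - 1) i + XX (k - 2) i - (- (v * q) * XX (k - 1) i + v * (a * q powi (- i)) * XX (k - 2) i))"
    by (intro sums_add sums_diff sums_mult XX_sums)
  ultimately have "XX k i - (x + 1 / x) * XX (k - 1) i + XX (k - 2) i - (- (v * q) * XX (k - 1) i + v * (a * q powi (- i)) * XX (k - 2) i) = 0"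
    unfolding summand using sums_unique2 by blast
  moreover have "- b * q powi (k - 1) = - (v * q)" using vq by simp
  ultimately show ?thesis unfolding va by simp
qed

text \<open>Coefficients of the series at a top point: there (t z)^m becomes (-q/b)^m, and for the
  other branch (-t)^m becomes the same with a for b.\<close>

definition cm :: "nat \<Rightarrow> complex" where
  "cm m = (- q / b) ^ m * q ^ (m * (m - 1) div 2) / qpoch q q m"

definition rz :: "int \<Rightarrow> complex" where
  "rz j = (if j < 0 then 0 else 1 / qpoch q q (nat j))"

definition bet :: "int \<Rightarrow> complex" where "bet j = Bz j * rz j"

lemma bet_rec: "(1 - q powi (j + 1)) * bet (j + 1) = (1 / x - b * q powi j) * bet j"
proof -
  have "(1 - q powi (j + 1)) * rz (j + 1) = rz j"
  proof (cases "j \<ge> 0")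
    case True
    then obtain n where n: "j = int n" using nonneg_int_cases by blast
    have "1 - q * q ^ n \<noteq> 0" using q_power_neq_1[OF q(1), of "Suc n"] by simp
    moreover have "nat (j + 1) = Suc n" "q powi (j + 1) = q * q ^ n" using n by (auto simp: powi_add1)
    ultimately show ?thesis using n by (simp add: rz_def qpoch_Suc)
  next
    case False
    then show ?thesis by (cases "j = -1") (auto simp: rz_def)
  qed
  then have "(1 - q powi (j + 1)) * (Bz (j + 1) * rz (j + 1)) = Bz (j + 1) * rz j" by (simp add: mult.left_commute)
  then show ?thesis unfolding bet_def Bz_rec by (simp add: mult_ac)
qed

lemma bet_bound: "\<exists>C>0. \<exists>R\<ge>1. \<forall>j. norm (bet j) \<le> C * R ^ nat j"
proof -
  obtain K where K: "K > 0" "\<And>m. norm (1 / qpoch q q m) \<le> K" using inverse_qpoch_q_Bseq[OF q(1)] by auto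
  define R where "R = (1 + norm (b * x)) * norm (1 / x) + 1"
  have "R \<ge> 1" by (simp add: R_def)
  have "norm (bet j) \<le> K * R ^ nat j" for j
  proof (cases "j < 0")
    case False
    then obtain n where n: "j = int n" by (metis nonneg_int_cases not_less)
    have "norm (Bz j) = norm (qpoch (b * x) q n) * norm (1 / x) ^ n"
      using Bz_add[of 0 n] by (simp add: n Bz_0 norm_mult norm_power)
    also have "\<dots> \<le> (1 + norm (b * x)) ^ n * norm (1 / x) ^ n"
      using q by (intro mult_right_mono norm_qpoch_le) auto
    also have "\<dots> = ((1 + norm (b * x)) * norm (1 / x)) ^ n" by (simp only: power_mult_distrib)
    also have "\<dots> \<le> R ^ n" by (intro power_mono) (auto simp: R_def)
    finally have "norm (Bz j) * norm (rz j) \<le> R ^ n * K"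
      using K(1) K(2)[of n] \<open>R \<ge> 1\<close> by (intro mult_mono) (auto simp: rz_def n)
    then show ?thesis by (simp add: bet_def norm_mult n mult.commute)
  qed (use K in \<open>simp add: bet_def rz_def R_def\<close>)
  with K(1) \<open>R \<ge> 1\<close> show ?thesis by blast
qed

lemma cm_times_summable:
  assumes "\<And>m. norm (f m) \<le> C * R ^ m" "C \<ge> 0" "R \<ge> 0"
  shows "summable (\<lambda>m. norm (cm m * f m))"
proof -
  obtain K where K: "K > 0" "\<And>m. norm (1 / qpoch q q m) \<le> K" using inverse_qpoch_q_Bseq[OF q(1)] by auto
  have nqb: "norm (- q / b) = norm (q / b)" by (simp add: norm_divide)
  have "summable (\<lambda>m. norm (((- q / b) ^ m * (1 / qpoch q q m) * f m) * q ^ (m * (m - 1) div 2)))"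
  proof (rule summable_gauss[OF q(1), where C = "K * C" and R = "norm (q / b) * R"])
    fix m
    have "norm (q / b) ^ m * norm (1 / qpoch q q m) * norm (f m) \<le> norm (q / b) ^ m * K * (C * R ^ m)"
      using K assms by (intro mult_mono mult_nonneg_nonneg) auto
    then show "norm ((- q / b) ^ m * (1 / qpoch q q m) * f m) \<le> K * C * (norm (q / b) * R) ^ m"
      by (simp only: norm_mult norm_power nqb power_mult_distrib mult_ac)
  qed (use K assms in auto)
  then show ?thesis by (simp add: cm_def mult_ac)
qed

lemma cm_Suc: "cm m = - b / q ^ Suc m * (1 - q ^ Suc m) * cm (Suc m)"
proof -
  have "1 - q * q ^ m \<noteq> 0" using q_power_neq_1[OF q(1), of "Suc m"] by simp
  then show ?thesis unfolding cm_def choose2_Suc power_add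
    using b q qpoch_q_nz[OF q(1), of m] by (simp add: qpoch_Suc)
qed

lemma bet_shift_bound: "\<exists>C\<ge>0. \<exists>R\<ge>0. \<forall>m. norm (bet (j + int m)) \<le> C * R ^ m"
proof -
  obtain C R where CR: "C > 0" "R \<ge> 1" "\<And>j. norm (bet j) \<le> C * R ^ nat j" using bet_bound by blast
  have "norm (bet (j + int m)) \<le> (C * R ^ nat \<bar>j\<bar>) * R ^ m" for m
  proof -
    have "R ^ nat (j + int m) \<le> R ^ (nat \<bar>j\<bar> + m)" using CR by (intro power_increasing) auto
    then have "C * R ^ nat (j + int m) \<le> C * R ^ (nat \<bar>j\<bar> + m)" using CR by (intro mult_left_mono) auto
    then show ?thesis using CR(3)[of "j + int m"] by (simp add: power_add)
  qed
  moreover have "C * R ^ nat \<bar>j\<bar> \<ge> 0" "R \<ge> 0" using CR by auto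
  ultimately show ?thesis by blast
qed

definition VV :: "int \<Rightarrow> complex" where "VV j = (\<Sum>m. cm m * bet (j + int m))"

lemma VV_summable: "summable (\<lambda>m. norm (cm m * bet (j + int m)))"
proof -
  obtain C R where CR: "C \<ge> 0" "R \<ge> 0" "\<And>m. norm (bet (j + int m)) \<le> C * R ^ m" using bet_shift_bound[of j] by blast
  show ?thesis by (rule cm_times_summable[OF CR(3,1,2)])
qed

lemma VV_sums: "(\<lambda>m. cm m * bet (j + int m)) sums VV j"
  unfolding VV_def by (rule summable_sums[OF summable_norm_cancel[OF VV_summable]])

text \<open>The difference of the two sides telescopes with terms \<open>G\<close>. The recurrence
  is that of \<open>Bz\<close>, so \<open>VV\<close> and \<open>Bz\<close> are proportional.\<close>

lemma VV_rec: "VV (j + 1) = (1 / x - b * q powi j) * VV j"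
proof -
  define G where "G m = (case m of 0 \<Rightarrow> 0 | Suc m' \<Rightarrow> cm m' * ((1 - q powi (j + int m)) * bet (j + int m)))" for m
  define cp where "cp m = (case m of 0 \<Rightarrow> 0 | Suc m' \<Rightarrow> cm m')" for m
  have cp: "cp m = - b / q ^ m * (1 - q ^ m) * cm m" for m
  proof (cases m)
    case (Suc n)
    show ?thesis unfolding cp_def Suc nat.case by (rule cm_Suc)
  next
    case 0
    show ?thesis unfolding cp_def 0 by simp
  qed
  have G: "G m = cp m * ((1 - q powi (j + int m)) * bet (j + int m))" for m
    unfolding G_def cp_def by (cases m) (simp_all only: nat.case mult_zero_left)
  have summand: "(1 / x - b * q powi j) * (cm m * bet (j + int m)) - cp m * bet (j + int m) = G (Suc m) - G m" for m
  proof -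
    define N where "N = q powi (j + int m)"
    have Nq: "N = q powi j * q ^ m" by (simp add: N_def powi_add1)
    have "G (Suc m) = cm m * ((1 - q powi (j + int m + 1)) * bet (j + int m + 1))"
      by (simp add: G_def add_ac)
    also have "\<dots> = cm m * ((1 / x - b * N) * bet (j + int m))" unfolding bet_rec N_def ..
    finally have G1: "G (Suc m) = cm m * ((1 / x - b * N) * bet (j + int m))" .
    have G0: "G m = cp m * ((1 - N) * bet (j + int m))" by (simp add: G N_def)
    have "cp m * N = - (b * q powi j * (1 - q ^ m) * cm m)"
      unfolding cp Nq using q by simp
    then have cN: "cp m * N = - (b * q powi j * cm m) + b * N * cm m"
      unfolding Nq by (simp add: algebra_simps)
    have "G (Suc m) - G m = cm m * (1 / x) * bet (j + int m) - b * N * cm m * bet (j + int m) - cp m * bet (j + int m) + cp m * N * bet (j + int m)"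
      unfolding G1 G0 by (simp add: algebra_simps)
    then show ?thesis unfolding cN by (simp add: algebra_simps)
  qed
  obtain C R where CR: "C \<ge> 0" "R \<ge> 0" "\<And>m. norm (bet (j + 1 + int m)) \<le> C * R ^ m" using bet_shift_bound by blast
  have "summable (\<lambda>m. cm m * bet (j + 1 + int m))"
    by (rule summable_norm_cancel[OF VV_summable])
  then have "(\<lambda>m. cm m * bet (j + 1 + int m)) \<longlonglongrightarrow> 0" by (rule summable_LIMSEQ_zero)
  from tendsto_mult[OF tendsto_diff[OF tendsto_const tendsto_mult[OF tendsto_const LIMSEQ_power_zero[OF q(1)]]] this, of 1 "q powi (j + 1)"]
  have "(\<lambda>m. (1 - q powi (j + 1) * q ^ m) * (cm m * bet (j + 1 + int m))) \<longlonglongrightarrow> 0" by simp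
  moreover have "(1 - q powi (j + 1) * q ^ m) * (cm m * bet (j + 1 + int m)) = G (Suc m)" for m
  proof -
    have "j + int (Suc m) = j + 1 + int m" by simp
    then show ?thesis by (simp only: G_def nat.case powi_add1(3) mult_ac)
  qed
  ultimately have "(\<lambda>m. G (Suc m)) \<longlonglongrightarrow> 0" by (simp only:)
  then have "G \<longlonglongrightarrow> 0" by (rule LIMSEQ_imp_Suc)
  from telescope_sums[OF this] have 0: "(\<lambda>m. G (Suc m) - G m) sums 0" by (simp add: G_def)
  have "(\<lambda>m. cp (Suc m) * bet (j + int (Suc m))) sums VV (j + 1)"
    using VV_sums[of "j + 1"] by (simp add: cp_def add_ac)
  then have "(\<lambda>m. cp m * bet (j + int m)) sums VV (j + 1)"
    by (subst (asm) sums_Suc_iff) (simp add: cp_def)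
  then have "(\<lambda>m. (1 / x - b * q powi j) * (cm m * bet (j + int m)) - cp m * bet (j + int m)) sums ((1 / x - b * q powi j) * VV j - VV (j + 1))"
    by (rule sums_diff[OF sums_mult[OF VV_sums]])
  from sums_unique2[OF this[unfolded summand] 0] show ?thesis by simp
qed

definition vv :: complex where "vv = qpoch_inf (q / (b * x)) q / qpoch_inf q q"

text \<open>The constant of proportionality is found by letting j tend to infinity in VV j / Bz j,
  where Euler's sum appears.\<close>

lemma VV_eq: "VV j = vv * Bz j"
proof -
  have step: "VV (j + 1) / Bz (j + 1) = VV j / Bz j" for j
  proof -
    have "1 / x - b * q powi j \<noteq> 0" using Bz_rec[of j] Bz_nz[of "j + 1"] by auto
    then show ?thesis unfolding VV_rec Bz_rec by simp
  qed
  have const: "VV j / Bz j = VV 0 / Bz 0" for j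
  proof (induction j rule: int_induct[where k = 0])
    case (step1 i) then show ?case using step[of i] by simp
  next
    case (step2 i) then show ?case using step[of "i - 1"] by simp
  qed simp
  obtain K where K: "K > 0" "\<And>m. norm (1 / qpoch q q m) \<le> K" using inverse_qpoch_q_Bseq[OF q(1)] by auto
  define al where "al m J = cm m * (qpoch (b * x * q ^ J) q m * (1 / x) ^ m * (1 / qpoch q q (J + m)))" for m J
  define M where "M m = norm (cm m * (of_real ((1 + norm (b * x)) ^ m * norm (1 / x) ^ m * K)))" for m
  have "VV (int J) / Bz (int J) = suminf (\<lambda>m. al m J)" for J
  proof -
    have "(\<lambda>m. cm m * bet (int J + int m) / Bz (int J)) sums (VV (int J) / Bz (int J))"
      by (intro sums_divide VV_sums)
    moreover have "cm m * bet (int J + int m) / Bz (int J) = al m J" for m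
    proof -
      have "nat (int J + int m) = J + m" by simp
      then show ?thesis unfolding bet_def Bz_add al_def rz_def using Bz_nz[of "int J"] by simp
    qed
    ultimately show ?thesis by (simp add: sums_iff)
  qed
  then have c2: "suminf (\<lambda>m. al m J) = VV 0 / Bz 0" for J using const[of "int J"] by simp
  \<comment> \<open>Tannery's theorem: (b x q^J;q)_m tends to 1 and 1/(q;q)_(J+m) to
    1/(q;q)_inf.\<close>
  have "(\<lambda>J. suminf (\<lambda>m. al m J)) \<longlonglongrightarrow> suminf (\<lambda>m. cm m * (1 * (1 / x) ^ m * (1 / qpoch_inf q q)))"
  proof (rule tannerys_theorem[where M = M, THEN conjunct2, THEN conjunct2])
    fix m
    have "(\<lambda>J. b * x * q ^ J) \<longlonglongrightarrow> 0" by (rule tendsto_mult_right_zero[OF LIMSEQ_power_zero[OF q(1)]])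
    then have "(\<lambda>J. qpoch (b * x * q ^ J) q m) \<longlonglongrightarrow> qpoch 0 q m" by (rule tendsto_qpoch)
    then have 1: "(\<lambda>J. qpoch (b * x * q ^ J) q m) \<longlonglongrightarrow> 1" by simp
    have 2: "(\<lambda>J. 1 / qpoch q q (J + m)) \<longlonglongrightarrow> 1 / qpoch_inf q q"
      by (rule tendsto_divide[OF tendsto_const LIMSEQ_ignore_initial_segment[OF qpoch_tendsto[OF q(1)]] qpoch_inf_q_nz[OF q(1)]])
    show "(\<lambda>J. al m J) \<longlonglongrightarrow> cm m * (1 * (1 / x) ^ m * (1 / qpoch_inf q q))"
      unfolding al_def by (rule tendsto_mult[OF tendsto_const tendsto_mult[OF tendsto_mult[OF 1 tendsto_const] 2]])
  next
    have "norm (al m J) \<le> M m" for m J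
    proof -
      have bq: "norm (b * x * q ^ J) \<le> norm (b * x)"
        using q by (simp add: norm_mult norm_power mult_left_le power_le_one)
      have "norm (qpoch (b * x * q ^ J) q m) * norm (1 / x) ^ m * norm (1 / qpoch q q (J + m)) \<le> (1 + norm (b * x)) ^ m * norm (1 / x) ^ m * K"
        using K q by (intro mult_mono norm_qpoch_le bq mult_nonneg_nonneg) auto
      then have "norm (cm m) * (norm (qpoch (b * x * q ^ J) q m) * norm (1 / x) ^ m * norm (1 / qpoch q q (J + m))) \<le> norm (cm m) * ((1 + norm (b * x)) ^ m * norm (1 / x) ^ m * K)"
        by (rule mult_left_mono) simp
      then show ?thesis using K unfolding al_def M_def norm_mult norm_power norm_of_real by simp
    qed
    then show "eventually (\<lambda>(m, J). norm (al m J) \<le> M m) (at_top \<times>\<^sub>F sequentially)"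
      by (intro always_eventually) auto
    show "summable M" unfolding M_def
    proof (rule cm_times_summable[where C = K and R = "(1 + norm (b * x)) * norm (1 / x)"])
      fix m show "norm (complex_of_real ((1 + norm (b * x)) ^ m * norm (1 / x) ^ m * K)) \<le> K * ((1 + norm (b * x)) * norm (1 / x)) ^ m"
        unfolding norm_of_real power_mult_distrib using K by (simp add: abs_mult power_abs mult_ac)
    qed (use K in auto)
  qed simp
  then have "(\<lambda>J::nat. VV 0 / Bz 0) \<longlonglongrightarrow> suminf (\<lambda>m. cm m * (1 * (1 / x) ^ m * (1 / qpoch_inf q q)))"
    by (simp only: c2)
  then have L: "VV 0 / Bz 0 = suminf (\<lambda>m. cm m * (1 * (1 / x) ^ m * (1 / qpoch_inf q q)))"
    by (simp only: LIMSEQ_const_iff)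
  have vv_s: "(\<lambda>m. cm m * (1 * (1 / x) ^ m * (1 / qpoch_inf q q))) sums vv"
  proof -
    have "(\<lambda>m. (- (q / (b * x))) ^ m * q ^ (m * (m - 1) div 2) / qpoch q q m / qpoch_inf q q) sums vv"
      unfolding vv_def by (intro sums_divide euler_sums[OF q(1)])
    moreover have "(- (q / (b * x))) ^ m * q ^ (m * (m - 1) div 2) / qpoch q q m / qpoch_inf q q = cm m * (1 * (1 / x) ^ m * (1 / qpoch_inf q q))" for m
    proof -
      have "- (q / (b * x)) = (- q / b) * (1 / x)" by simp
      then have "(- (q / (b * x))) ^ m = (- q / b) ^ m * (1 / x) ^ m" by (simp only: power_mult_distrib)
      then show ?thesis unfolding cm_def by (simp only: mult_1 times_divide_eq_right times_divide_eq_left divide_divide_eq_left mult_ac mult_1_right)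
    qed
    ultimately show ?thesis by (simp only:)
  qed
  have "VV 0 / Bz 0 = vv" unfolding L using sums_unique[OF vv_s] by (rule sym)
  then have "VV j / Bz j = vv" using const[of j] by (simp only:)
  then show ?thesis using Bz_nz[of j] nonzero_divide_eq_eq by blast
qed

definition cv :: "int \<Rightarrow> complex" where "cv n = (if n < 0 then 0 else asc_conv q x a b (nat n))"

lemma cv_eq: "cv n = (\<Sum>l\<le>N. Al 0 l * bet (n - int l))" if "nat n \<le> N" for n N
proof (cases "n < 0")
  case True
  then show ?thesis by (simp add: cv_def bet_def rz_def)
next
  case False
  then obtain p where p: "n = int p" by (metis nonneg_int_cases not_less)
  have "cv n = (\<Sum>l\<le>p. Al 0 l * bet (n - int l))"
  proof -
    have "bet (int p - int l) = qpoch (b * x) q (p - l) * (1 / x) ^ (p - l) / qpoch q q (p - l)" if "l \<le> p" for l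
    proof -
      have e: "int p - int l = 0 + int (p - l)" using that by simp
      show ?thesis unfolding e bet_def rz_def Bz_add Bz_0 by simp
    qed
    then show ?thesis by (simp add: cv_def p asc_conv_def[OF q] Al_def)
  qed
  also have "\<dots> = (\<Sum>l\<le>N. Al 0 l * bet (n - int l))"
    using that p by (intro sum.mono_neutral_left) (auto simp: bet_def rz_def)
  finally show ?thesis .
qed

text \<open>\<open>cv\<close> is expanded as a convolution and the order of summation exchanged; the
  inner sum over m is then \<open>VV\<close>, a multiple of \<open>Bz\<close>. Thus the cut-off
  factor in \<open>bet\<close> disappears and the bilateral \<open>XX\<close> emerges.\<close>

lemma top_sums: "(\<lambda>m. cm m * cv (k + int m)) sums (vv * XX k 0)"
proof -
  define F where "F = (\<lambda>(m, l). cm m * (Al 0 l * bet (k + int m - int l)))"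
  obtain C1 R1 where C1: "C1 > 0" "R1 \<ge> 1" "\<And>j. norm (bet j) \<le> C1 * R1 ^ nat j" using bet_bound by blast
  obtain K where K: "K > 0" "\<And>m. norm (1 / qpoch q q m) \<le> K" using inverse_qpoch_q_Bseq[OF q(1)] by auto
  define R2 where "R2 = (1 + norm (a / x)) * norm x + 1"
  have Al_b: "norm (Al 0 l) \<le> K * R2 ^ l" for l
  proof -
    have "norm (qpoch (a / x) q l) * norm x ^ l \<le> (1 + norm (a / x)) ^ l * norm x ^ l"
      using q by (intro mult_right_mono norm_qpoch_le) auto
    also have "\<dots> = ((1 + norm (a / x)) * norm x) ^ l" by (simp only: power_mult_distrib)
    also have "\<dots> \<le> R2 ^ l" by (intro power_mono) (auto simp: R2_def)
    finally have "norm (qpoch (a / x) q l) * norm x ^ l * norm (1 / qpoch q q l) \<le> R2 ^ l * K"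
      using K by (intro mult_mono) (auto simp: R2_def)
    then show ?thesis by (simp add: Al_def norm_mult norm_divide norm_power mult.commute)
  qed
  define R where "R = R1 * R2"
  have R: "R1 \<le> R" "R2 \<le> R" "R \<ge> 1"
  proof -
    have "R2 \<ge> 1" by (simp add: R2_def)
    then show "R1 \<le> R" "R2 \<le> R" "R \<ge> 1" using C1(2) mult_mono[of 1 R1 1 R2] mult_mono[of R1 R1 1 R2] mult_mono[of 1 R1 R2 R2]
      by (auto simp: R_def)
  qed
  have inner0: "bet (k + int m - int l) = 0" if "l > nat \<bar>k\<bar> + m" for m l
    using that by (simp add: bet_def rz_def)
  have term_b: "norm (Al 0 l * bet (k + int m - int l)) \<le> K * C1 * R ^ (2 * (nat \<bar>k\<bar> + m))" if l: "l \<le> nat \<bar>k\<bar> + m" for m l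
  proof -
    have "R2 ^ l \<le> R ^ l" using R by (intro power_mono) (auto simp: R2_def)
    also have "\<dots> \<le> R ^ (nat \<bar>k\<bar> + m)" using R l by (intro power_increasing) auto
    finally have 1: "norm (Al 0 l) \<le> K * R ^ (nat \<bar>k\<bar> + m)" using K by (intro order_trans[OF Al_b] mult_left_mono) auto
    have "R1 ^ nat (k + int m - int l) \<le> R ^ nat (k + int m - int l)" using R C1 by (intro power_mono) auto
    also have "\<dots> \<le> R ^ (nat \<bar>k\<bar> + m)" using R by (intro power_increasing) auto
    finally have 2: "norm (bet (k + int m - int l)) \<le> C1 * R ^ (nat \<bar>k\<bar> + m)" using C1 by (intro order_trans[OF C1(3)] mult_left_mono) auto
    have "norm (Al 0 l) * norm (bet (k + int m - int l)) \<le> (K * R ^ (nat \<bar>k\<bar> + m)) * (C1 * R ^ (nat \<bar>k\<bar> + m))"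
      using 1 2 K R by (intro mult_mono) auto
    also have "\<dots> = K * C1 * R ^ (2 * (nat \<bar>k\<bar> + m))" by (simp only: mult_2 power_add mult_ac)
    finally show ?thesis by (simp add: norm_mult)
  qed
  \<comment> \<open>For fixed m the double series has finitely many terms, so absolute convergence
    needs only a bound on the row sums.\<close>
  have fin: "((\<lambda>l. norm (F (m, l))) has_sum (\<Sum>l\<le>nat \<bar>k\<bar> + m. norm (F (m, l)))) UNIV" for m
    by (rule has_sum_finite_neutralI) (auto simp: F_def inner0)
  have outer: "summable (\<lambda>m. norm (\<Sum>l\<le>nat \<bar>k\<bar> + m. norm (F (m, l))))"
  proof (rule summable_comparison_test')
    define f where "f m = complex_of_real ((real (nat \<bar>k\<bar> + m) + 1) * (K * C1 * R ^ (2 * (nat \<bar>k\<bar> + m))))" for m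
    have "norm (f m) \<le> (2 ^ nat \<bar>k\<bar> * (K * C1 * R ^ (2 * nat \<bar>k\<bar>))) * (2 * R ^ 2) ^ m" for m
    proof -
      have "(real (nat \<bar>k\<bar> + m) + 1) * (K * C1 * R ^ (2 * (nat \<bar>k\<bar> + m))) \<le> 2 ^ (nat \<bar>k\<bar> + m) * (K * C1 * R ^ (2 * (nat \<bar>k\<bar> + m)))"
        using K C1 R by (intro mult_right_mono Suc_le_two_power) auto
      also have "\<dots> = (2 ^ nat \<bar>k\<bar> * (K * C1 * R ^ (2 * nat \<bar>k\<bar>))) * (2 * R ^ 2) ^ m"
      proof -
        have "R ^ (2 * (nat \<bar>k\<bar> + m)) = R ^ (2 * nat \<bar>k\<bar>) * (R\<^sup>2) ^ m"
          by (simp add: power_add distrib_left power_mult)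
        then show ?thesis by (simp only: power_add power_mult_distrib mult_ac)
      qed
      finally show ?thesis unfolding f_def norm_of_real using K C1 R by (simp add: abs_mult)
    qed
    from cm_times_summable[OF this] show "summable (\<lambda>m. norm (cm m * f m))" using K C1 R by auto
    fix m
    have "(\<Sum>l\<le>nat \<bar>k\<bar> + m. norm (F (m, l))) \<le> (\<Sum>l\<le>nat \<bar>k\<bar> + m. norm (cm m) * (K * C1 * R ^ (2 * (nat \<bar>k\<bar> + m))))"
    proof (rule sum_mono)
      fix l assume "l \<in> {..nat \<bar>k\<bar> + m}"
      then have "norm (Al 0 l * bet (k + int m - int l)) \<le> K * C1 * R ^ (2 * (nat \<bar>k\<bar> + m))" using term_b by simp
      then show "norm (F (m, l)) \<le> norm (cm m) * (K * C1 * R ^ (2 * (nat \<bar>k\<bar> + m)))"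
        unfolding F_def prod.case norm_mult[of "cm m"] by (rule mult_left_mono) simp
    qed
    also have "\<dots> = norm (cm m * f m)"
      unfolding f_def norm_mult norm_of_real using K C1 R by (simp add: abs_mult algebra_simps)
    finally show "norm (norm (\<Sum>l\<le>nat \<bar>k\<bar> + m. norm (F (m, l)))) \<le> norm (cm m * f m)"
      by (simp add: sum_nonneg)
  qed
  have F_abs: "(\<lambda>p. norm (F p)) summable_on (UNIV \<times> UNIV)"
    unfolding Infinite_Sum.abs_summable_on_Sigma_iff
  proof (intro conjI ballI)
    fix m :: nat
    show "(\<lambda>l. norm (F (m, l))) summable_on UNIV" using has_sum_imp_summable[OF fin[of m]] .
  next
    have "infsum (\<lambda>l. norm (F (m, l))) UNIV = (\<Sum>l\<le>nat \<bar>k\<bar> + m. norm (F (m, l)))" for m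
      by (rule infsumI[OF fin])
    then show "(\<lambda>m. norm (infsum (\<lambda>l. norm (F (m, l))) UNIV)) summable_on UNIV"
      using norm_summable_imp_summable_on[of "\<lambda>m. norm (\<Sum>l\<le>nat \<bar>k\<bar> + m. norm (F (m, l)))"] outer by simp
  qed
  then have Fs: "(\<lambda>(m, l). cm m * (Al 0 l * bet (k + int m - int l))) summable_on UNIV \<times> UNIV"
    using abs_summable_summable unfolding F_def by blast
  have inner1: "infsum (\<lambda>l. cm m * (Al 0 l * bet (k + int m - int l))) UNIV = cm m * cv (k + int m)" for m
  proof (rule infsumI)
    have "cm m * cv (k + int m) = (\<Sum>l\<le>nat \<bar>k\<bar> + m. cm m * (Al 0 l * bet (k + int m - int l)))"
      unfolding sum_distrib_left[symmetric] by (subst cv_eq[of _ "nat \<bar>k\<bar> + m"]) auto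
    then show "((\<lambda>l. cm m * (Al 0 l * bet (k + int m - int l))) has_sum cm m * cv (k + int m)) UNIV"
      by (intro has_sum_finite_neutralI[where B = "{..nat \<bar>k\<bar> + m}"]) (auto simp: inner0)
  qed
  have inner2: "infsum (\<lambda>m. cm m * (Al 0 l * bet (k + int m - int l))) UNIV = vv * (Al 0 l * Bz (k - int l))" for l
  proof (rule infsumI, rule norm_summable_imp_has_sum)
    have eq: "cm m * (Al 0 l * bet (k + int m - int l)) = Al 0 l * (cm m * bet (k - int l + int m))" for m
      by (simp add: algebra_simps)
    show "summable (\<lambda>m. norm (cm m * (Al 0 l * bet (k + int m - int l))))"
      unfolding eq norm_mult[of "Al 0 l"] by (intro summable_mult VV_summable)
    have "(\<lambda>m. Al 0 l * (cm m * bet (k - int l + int m))) sums (Al 0 l * VV (k - int l))"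
      by (intro sums_mult VV_sums)
    then show "(\<lambda>m. cm m * (Al 0 l * bet (k + int m - int l))) sums (vv * (Al 0 l * Bz (k - int l)))"
      unfolding eq VV_eq by (simp add: mult_ac)
  qed
  have "infsum (\<lambda>m. cm m * cv (k + int m)) UNIV = infsum (\<lambda>l. vv * (Al 0 l * Bz (k - int l))) UNIV"
    using infsum_swap_banach[OF Fs] unfolding inner1 inner2 .
  also have "\<dots> = vv * XX k 0"
  proof (rule infsumI, rule norm_summable_imp_has_sum)
    show "summable (\<lambda>l. norm (vv * (Al 0 l * Bz (k - int l))))"
      unfolding norm_mult[of vv] using XX_summable[of 0 k 1] by (intro summable_mult) simp
    show "(\<lambda>l. vv * (Al 0 l * Bz (k - int l))) sums (vv * XX k 0)" by (intro sums_mult XX_sums)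
  qed
  finally have inf: "infsum (\<lambda>m. cm m * cv (k + int m)) UNIV = vv * XX k 0" .
  have "(\<lambda>m. infsum (\<lambda>l. cm m * (Al 0 l * bet (k + int m - int l))) UNIV) summable_on UNIV"
    by (rule summable_on_Sigma_banach[OF Fs])
  then have "(\<lambda>m. cm m * cv (k + int m)) summable_on UNIV" unfolding inner1 .
  then have "((\<lambda>m. cm m * cv (k + int m)) has_sum (vv * XX k 0)) UNIV" using has_sum_infsum inf by metis
  then show ?thesis by (rule has_sum_imp_sums)
qed

text \<open>The candidate at the lattice point with exponent i. The prefactor is chosen so that
  \<open>XX_lower\<close> and \<open>XX_three_term\<close> become the two lattice relations.\<close>

definition EE :: "int \<Rightarrow> int \<Rightarrow> complex" where
  "EE k i = vv * ((- 1 / a) powi i * q powi (i * (i + 1) div 2) * XX (k + i) i)"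

lemma int_triangle_Suc: "(i + 1) * (i + 1 + 1) div 2 = i * (i + 1) div 2 + (i + 1)" for i :: int
proof -
  have "(i + 1) * (i + 1 + 1) = i * (i + 1) + (i + 1) * 2" by (simp add: algebra_simps)
  then show ?thesis by (simp only: div_mult_self3) simp
qed

lemma EE_lower: "EE k (i + 1) = EE k i - q powi (i + 1) / a * EE (k + 1) i"
proof -
  define p where "p = q powi (i + 1)"
  have p: "p \<noteq> 0" "q powi (- i - 1) = 1 / p"
  proof -
    show "p \<noteq> 0" using q by (simp add: p_def)
    have "- i - 1 = - (i + 1)" by simp
    then show "q powi (- i - 1) = 1 / p" unfolding p_def by (simp only: power_int_minus_divide)
  qed
  have e1: "q powi ((i + 1) * (i + 1 + 1) div 2) = q powi (i * (i + 1) div 2) * p"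
    unfolding int_triangle_Suc p_def using q by (intro power_int_add) simp
  have e2: "(- 1 / a) powi (i + 1) = (- 1 / a) powi i * (- 1 / a)" using a by (simp add: power_int_add)
  have ks: "k + (i + 1) = k + 1 + i" by simp
  have "k + 1 + i - 1 = k + i" by simp
  then have X: "XX (k + 1 + i) (i + 1) = XX (k + 1 + i) i - a * (1 / p) * XX (k + i) i"
    using XX_lower[of "k + 1 + i" i] unfolding p(2) by (simp only:)
  have gen: "V * (M * (- 1 / a) * (T * p) * (X1 - a * (1 / p) * X0)) = V * (M * T * X0) - p / a * (V * (M * T * X1))" for V M T X1 X0
    using p(1) a by (simp add: field_simps)
  show ?thesis
    unfolding EE_def e1 e2 ks p_def[symmetric] X gen ..
qed

lemma EE_three_term: "EE (k + 1) i = (x + 1 / x - b * q powi (k + i)) * EE k i - (1 - a * b * q powi (k - 1)) * EE (k - 1) i"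
proof -
  have ks: "k + i + 1 - 1 = k + i" "k + i + 1 - 2 = k - 1 + i" "k + i + 1 - i - 2 = k - 1" "k + i + 1 = k + 1 + i" by simp_all
  have "XX (k + 1 + i) i = (x + 1 / x) * XX (k + i) i - XX (k - 1 + i) i - b * q powi (k + i) * XX (k + i) i + a * b * q powi (k - 1) * XX (k - 1 + i) i"
    using XX_three_term[of "k + i + 1" i] unfolding ks by (simp add: algebra_simps)
  then have X: "XX (k + 1 + i) i = (x + 1 / x - b * q powi (k + i)) * XX (k + i) i - (1 - a * b * q powi (k - 1)) * XX (k - 1 + i) i"
    by (simp only: left_diff_distrib mult_1_left) simp
  have gen: "V * (MT * (u * X0 - v * X1)) = u * (V * (MT * X0)) - v * (V * (MT * X1))" for V MT u v X0 X1 :: complex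
    by (simp add: algebra_simps)
  show ?thesis unfolding EE_def X gen ..
qed

text \<open>Upwards in i the first relation determines everything. Downwards, a difference vanishing
  at i satisfies D_k = Y D_(k+1) at i - 1, and the three-term relation then gives (1 - Y x)(1 - Y/x)
  D = 0, where the factors are nonzero by genericity.\<close>

lemma EE_unique:
  fixes S :: "int \<Rightarrow> int \<Rightarrow> complex"
  assumes S0: "\<And>k. S k 0 = vv * XX k 0"
    and S1: "\<And>k i. S k (i + 1) = S k i - q powi (i + 1) / a * S (k + 1) i"
    and S2: "\<And>k i. S (k + 1) i = (x + 1 / x - b * q powi (k + i)) * S k i - (1 - a * b * q powi (k - 1)) * S (k - 1) i"
    and nz: "\<And>i. q powi (i + 1) / a * x \<noteq> 1" "\<And>i. q powi (i + 1) / a / x \<noteq> 1"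
  shows "S k i = EE k i"
proof -
  define D where "D k i = S k i - EE k i" for k i
  have D1: "D k (i + 1) = D k i - q powi (i + 1) / a * D (k + 1) i" for k i
    unfolding D_def S1 EE_lower by (simp add: algebra_simps)
  have D2: "D (k + 1) i = (x + 1 / x - b * q powi (k + i)) * D k i - (1 - a * b * q powi (k - 1)) * D (k - 1) i" for k i
    unfolding D_def S2[of k] EE_three_term[of k] by (simp add: algebra_simps)
  have "\<forall>k. D k i = 0"
  proof (induction i rule: int_induct[where k = 0])
    case base
    show ?case unfolding D_def S0 EE_def by simp
  next
    case (step1 i)
    then show ?case unfolding D1 by simp
  next
    case (step2 i)
    define Y where "Y = q powi i / a"
    have bk: "D k (i - 1) = Y * D (k + 1) (i - 1)" for k
      using D1[of k "i - 1"] step2(2) by (simp add: Y_def)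
    show ?case
    proof
      fix k
      define F where "F = D (k + 1) (i - 1)"
      have F0: "D k (i - 1) = Y * F" using bk[of k] by (simp add: F_def)
      have F1: "D (k - 1) (i - 1) = Y * (Y * F)" using bk[of "k - 1"] F0 by simp
      \<comment> \<open>With this the terms containing b cancel, leaving a relation in x and Y
        alone.\<close>
      have e1: "b * q powi (k + (i - 1)) * Y = a * b * q powi (k - 1) * Y * Y"
      proof -
        have "k + (i - 1) = (k - 1) + i" by simp
        then have "q powi (k + (i - 1)) = q powi (k - 1) * q powi i" using q power_int_add[of q "k - 1" i] by (simp only:) simp
        then show ?thesis using a by (simp add: Y_def)
      qed
      have e2: "F = (x + 1 / x - b * q powi (k + (i - 1))) * (Y * F) - (1 - a * b * q powi (k - 1)) * (Y * (Y * F))"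
        using D2[of k "i - 1"] unfolding F0 F1 F_def[symmetric] .
      have gen: "(x + 1 / x - u) * (Y * F) - (1 - v) * (Y * (Y * F)) = (x + 1 / x) * (Y * F) - Y * (Y * F) - (u * Y - v * Y * Y) * F" for u v
        by (simp add: algebra_simps)
      have "F = (x + 1 / x) * (Y * F) - Y * (Y * F)" using e2 unfolding gen e1 by simp
      then have "(1 - Y * x) * (1 - Y / x) * F = 0" using x by (simp add: field_simps)
      moreover have "1 - Y * x \<noteq> 0" "1 - Y / x \<noteq> 0" using nz[of "i - 1"] by (auto simp: Y_def)
      ultimately have "F = 0" by (simp only: mult_eq_0_iff) simp
      then show "D k (i - 1) = 0" using F0 by simp
    qed
  qed
  then show ?thesis by (simp add: D_def)
qed

lemma qtheta_reflect: "u \<noteq> 0 \<Longrightarrow> qtheta (q / u) q = qtheta u q"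
  using q by (simp add: qtheta_def mult.commute)

lemma qtheta_shift_int: "qtheta (u * q powi (- i)) q = (- u) powi i / q powi (i * (i + 1) div 2) * qtheta u q" if u: "u \<noteq> 0"
proof -
  have step: "qtheta (u * q powi (- (i + 1))) q = - (u * q powi (- (i + 1))) * qtheta (u * q powi (- i)) q" for i
  proof -
    have "u * q powi (- (i + 1)) = u * q powi (- i) / q" using q power_int_diff[of q "- i" 1] by simp
    then show ?thesis using qtheta_shift[OF q(1), of "u * q powi (- i)"] q u by simp
  qed
  define R where "R i = (- u) powi i / q powi (i * (i + 1) div 2)" for i
  have Rnz: "R i \<noteq> 0" for i using q u by (simp add: R_def)
  have R: "R (i + 1) = - (u * q powi (- (i + 1))) * R i" for i
  proof -
    have "q powi ((i + 1) * (i + 1 + 1) div 2) = q powi (i * (i + 1) div 2) * q powi (i + 1)"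
      unfolding int_triangle_Suc using q by (intro power_int_add) simp
    moreover have "(- u) powi (i + 1) = (- u) powi i * (- u)" using u by (simp add: power_int_add)
    ultimately show ?thesis unfolding R_def power_int_minus_divide by (simp add: mult_ac)
  qed
  have "qtheta (u * q powi (- i)) q = R i * qtheta u q"
  proof (induction i rule: int_induct[where k = 0])
    case base
    show ?case by (simp add: R_def)
  next
    case (step1 i)
    show ?case unfolding step R step1 by (simp only: mult.assoc)
  next
    case (step2 i)
    define v where "v = - (u * q powi (- i))"
    have "v \<noteq> 0" using q u by (simp add: v_def)
    have e: "i - 1 + 1 = i" by simp
    have "v * qtheta (u * q powi (- (i - 1))) q = R i * qtheta u q"
      unfolding v_def step[of "i - 1", unfolded e, symmetric] by (rule step2(2))
    also have "\<dots> = v * (R (i - 1) * qtheta u q)"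
      unfolding v_def R[of "i - 1", unfolded e] by (simp only: mult.assoc)
    finally show ?case using \<open>v \<noteq> 0\<close> mult_left_cancel by blast
  qed
  then show ?thesis by (simp only: R_def)
qed

text \<open>\<open>Bz_sub\<close> turns the convolution into the hypergeometric series term by
  term.\<close>

lemma phi_eq_XX: "qhyp [a * q powi (- i) / x] [q powi (1 - k) / (b * x)] q (x * q powi (1 - k) / b) = XX k i / Bz k"
proof -
  have "(\<lambda>l. Al i l * Bz (k - int l) / Bz k) sums (XX k i / Bz k)"
    by (rule sums_divide[OF XX_sums])
  moreover have "Al i l * Bz (k - int l) / Bz k
     = (\<Prod>a\<leftarrow>[a * q powi (- i) / x]. qpoch a q l) / (qpoch q q l * (\<Prod>b\<leftarrow>[q powi (1 - k) / (b * x)]. qpoch b q l))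
      * ((-1) ^ l * q ^ (l * (l - 1) div 2)) powi (1 + int (length [q powi (1 - k) / (b * x)]) - int (length [a * q powi (- i) / x])) * (x * q powi (1 - k) / b) ^ l" for l
  proof -
    have "(x * q powi (1 - k) / b) ^ l * (-1) ^ l = x ^ l * (- (q powi (1 - k)) / b) ^ l"
      by (simp only: power_mult_distrib[symmetric]) simp
    then show ?thesis unfolding Bz_sub Al_def using Bz_nz[of k]
      by (simp add: mult_ac)
  qed
  ultimately show ?thesis unfolding qhyp_def by (simp only: sums_iff)
qed

text \<open>The products at q/(d y) and d y form a theta function, and shifting it by i steps
  produces the powers of a and q in the prefactor of \<open>EE\<close>.\<close>

lemma Q_fun_eq_EE:
  fixes t y c d zm zp :: complex and i k :: int
  assumes t: "t \<noteq> 0" and d: "d = - t / x"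
    and cy: "c * y = q powi (i + 1) * x / a" and dy: "d * y = q powi (i + 1) / (a * x)"
    and th: "qtheta (d * zm) q * qtheta (d * zp) q = qtheta (q / (a * x)) q * qtheta (q / (b * x)) q"
    and dzz: "d * zm * zp * q powi (- k) / y = q powi (1 - (k + i)) / (b * x)"
    and czz: "c * zm * zp * q powi (- k) / y = x * q powi (1 - (k + i)) / b"
    and qk: "q powi (k + 1) * y / (d * zm * zp) = b * x * q powi (k + i)"
    and nz1: "\<And>j. x / a * q powi j \<noteq> 1" and nz2: "\<And>j. a * x * q powi j \<noteq> 1"
  shows "Q_fun k y c d zm zp q / (qpoch_inf (c * y) q * qpoch_inf (d * y) q)
    = t powi k * q powi (- (k * (k + 1) div 2)) * qpoch_inf q q * EE k i"
proof -
  have inf_nz: "qpoch_inf (u * q powi j) q \<noteq> 0" if "\<And>j::int. u * q powi j \<noteq> 1" for u j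
  proof -
    have "u * q powi j * q ^ n \<noteq> 1" for n
      using that[of "j + int n"] by (simp add: powi_add1 mult.assoc)
    then show ?thesis by (simp add: qpoch_inf_eq_0_iff[OF q(1)])
  qed
  define T where "T = q powi (i * (i + 1) div 2)"
  have Tnz: "T \<noteq> 0" using q by (simp add: T_def)
  have cyn: "qpoch_inf (c * y) q \<noteq> 0" using inf_nz[OF nz1, of "i + 1"] unfolding cy by (simp add: mult.commute)
  have qcy: "q / (c * y) = a * q powi (- i) / x"
    unfolding cy using q a x by (simp add: power_int_add power_int_minus field_simps)
  have qdy: "q / (d * y) = a * x * q powi (- i)"
    unfolding dy using q a x by (simp add: power_int_add power_int_minus field_simps)
  have ynz: "d * y \<noteq> 0" unfolding dy using q a x by simp
  have thdy: "qpoch_inf (q / (d * y)) q * qpoch_inf (d * y) q = (- (a * x)) powi i / T * qtheta (a * x) q"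
  proof -
    have "qpoch_inf (q / (d * y)) q * qpoch_inf (d * y) q = qtheta (d * y) q" by (simp add: qtheta_def mult.commute)
    also have "\<dots> = qtheta (q / (d * y)) q" using qtheta_reflect[OF ynz] by simp
    also have "\<dots> = (- (a * x)) powi i / T * qtheta (a * x) q"
      unfolding qdy T_def using a x by (intro qtheta_shift_int) simp
    finally show ?thesis .
  qed
  have thax: "qtheta (a * x) q \<noteq> 0"
  proof -
    have "qpoch_inf (a * x) q \<noteq> 0" using inf_nz[OF nz2, of 0] by simp
    moreover have "qpoch_inf (q / (a * x)) q \<noteq> 0"
    proof -
      have "q / (a * x) * q ^ n \<noteq> 1" for n
      proof
        assume h: "q / (a * x) * q ^ n = 1"
        have "a * x * q powi (- int (Suc n)) = 1"
          using h a x q unfolding powi_neg_nat by (simp add: field_simps)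
        then show False using nz2 by blast
      qed
      then show ?thesis by (subst qpoch_inf_eq_0_iff[OF q(1)]) blast
    qed
    ultimately show ?thesis by (simp add: qtheta_def)
  qed
  have th': "qtheta (d * zm) q * qtheta (d * zp) q = qtheta (a * x) q * (qpoch_inf (b * x) q * qpoch_inf (q / (b * x)) q)"
    unfolding th using qtheta_reflect[of "a * x"] qtheta_reflect[of "b * x"] a b x q by (simp add: qtheta_def)
  have bxk: "qpoch_inf (b * x * q powi (k + i)) q \<noteq> 0" by (rule bx_inf_nz)
  have bx0: "qpoch_inf (b * x) q \<noteq> 0" using bx_inf_nz[of 0] by simp
  have Bz: "XX (k + i) i / Bz (k + i) = XX (k + i) i * x powi (k + i) * qpoch_inf (b * x * q powi (k + i)) q / qpoch_inf (b * x) q"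
    unfolding Bz_def by (simp add: power_int_one_over)
  have md: "(- d) powi k = t powi k / x powi k" unfolding d by (simp add: power_int_divide_distrib)
  have xk: "x powi (k + i) = x powi k * x powi i" using x by (simp add: power_int_add)
  have ax: "(- (a * x)) powi i = 1 / (- 1 / a) powi i * x powi i"
  proof -
    have "- (a * x) = (1 / (- 1 / a)) * x" using a by simp
    then show ?thesis by (simp only: power_int_mult_distrib power_int_divide_distrib power_int_1_left)
  qed
  define mi where "mi = (- 1 / a) powi i"
  have minz: "mi \<noteq> 0" using a by (simp add: mi_def)
  have xnz: "x powi k \<noteq> 0" "x powi i \<noteq> 0" using x by auto
  \<comment> \<open>A pure identity of fractions with the special functions as variables; the theta
    shift enters as its first premise.\<close>
  have gen: "tk / X * Q * (CY * (TH * (BX * QB)) / (QDY * BXK)) * (XXk * (X * I) * BXK / BX) / (CY * DY)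
      = tk * Q * QI * (QB / QI * (M * TT * XXk))"
    if "QDY * DY = 1 / M * I / TT * TH" "CY \<noteq> 0" "BX \<noteq> 0" "BXK \<noteq> 0" "TH \<noteq> 0" "M \<noteq> 0" "TT \<noteq> 0" "I \<noteq> 0" "X \<noteq> 0" "QI \<noteq> 0"
    for tk X Q CY TH BX QB QDY BXK XXk I DY QI M TT :: complex
  proof -
    have "tk / X * Q * (CY * (TH * (BX * QB)) / (QDY * BXK)) * (XXk * (X * I) * BXK / BX) / (CY * DY)
      = tk * Q * TH * QB * XXk * I / (QDY * DY)" using that by simp
    also have "\<dots> = tk * Q * QB * XXk * M * TT" unfolding that(1) using that by simp
    finally show ?thesis using that by simp
  qed
  have "Q_fun k y c d zm zp q = t powi k / x powi k * q powi (- (k * (k + 1) div 2))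
    * (qpoch_inf (c * y) q * (qtheta (a * x) q * (qpoch_inf (b * x) q * qpoch_inf (q / (b * x)) q)) / (qpoch_inf (q / (d * y)) q * qpoch_inf (b * x * q powi (k + i)) q))
    * (XX (k + i) i * (x powi k * x powi i) * qpoch_inf (b * x * q powi (k + i)) q / qpoch_inf (b * x) q)"
    unfolding Q_fun_def md th' qk qcy dzz czz phi_eq_XX Bz xk ..
  then show ?thesis
    unfolding EE_def vv_def T_def[symmetric] mi_def[symmetric]
    by (simp only:, intro gen thdy[unfolded ax, folded mi_def] cyn bx0 bxk thax minz Tnz xnz qpoch_inf_q_nz[OF q(1)])
qed

end

context asc_coupling_generic
begin

text \<open>Both lattice relations and the top values agree with those of \<open>EE\<close>, so
  \<open>EE_unique\<close> applies.\<close>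

lemma Q_solution:
  fixes s :: "int \<Rightarrow> real \<Rightarrow> complex" and i :: int
  assumes Q: "A = q" "B = a * b / q" and B1: "B \<noteq> 1" and \<kappa>: "\<kappa> \<in> {1, - z}"
    and s: "\<And>k. solves k (s k)"
  defines "y \<equiv> complex_of_real (- \<kappa> * r powi i)"
  shows "s k (- \<kappa> * r powi i) * (t powi k * q powi (- (k * (k + 1) div 2)) * qpoch_inf q q)
    = Q_fun k y (- t * x) (- t / x) (- 1) (of_real z) q / (qpoch_inf (- t * x * y) q * qpoch_inf (- t / x * y) q)"
proof -
  have t: "t = q / a" unfolding t_def unfolding Q(2) using b a_nz q_nz by simp
  have zb: "t * of_real z = - q / b" unfolding t a_eq using b z by simp
  have tx: "t * of_real \<kappa>' * x * q powi j \<noteq> 1" "t * of_real \<kappa>' / x * q powi j \<noteq> 1" if "\<kappa>' \<in> {1, - z}" for \<kappa>' j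
    using gen[OF that, of j] gen'[OF that, of j] by (simp_all add: mult_ac)
  have tk: "t * of_real (1 :: real) = q / a" "t * of_real (- z) = q / b" using t zb by simp_all
  have q_powi_Suc: "q powi (j + 1) = q powi j * q" for j using q_nz by (simp add: power_int_add)
    have sh: "q powi (j + 1) / u * v = q / u * v * q powi j" "q powi (j + 1) / u / v = q / u / v * q powi j" for j u v
      by (simp_all add: q_powi_Suc)
    have n1: "q / u * x * q powi j \<noteq> 1" "q / u / x * q powi j \<noteq> 1" if "u \<in> {a, b}" for u j
      using that tx[of 1 j] tx[of "- z" j] unfolding tk by auto
    have inv: "u * x * q powi j \<noteq> 1" if "u \<in> {a, b}" for u j
    proof
      assume h: "u * x * q powi j = 1"
      have u: "u \<noteq> 0" using that a_nz b by auto
      have "q / u / x * q powi (- j - 1) = 1 / (u * x * q powi j)"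
      proof -
        have "q powi (- j - 1) = q powi (- (j + 1))" by simp
        also have "\<dots> = 1 / (q powi j * q)" unfolding power_int_minus_divide q_powi_Suc ..
        finally have e: "q powi (- j - 1) = 1 / (q powi j * q)" .
        show ?thesis unfolding e using u x q_nz by simp
      qed
      then show False using n1(2)[OF that, of "- j - 1"] h by simp
    qed
  have inva: "a * x * q powi j \<noteq> 1" and invb: "b * x * q powi j \<noteq> 1" for j using inv by blast+
  have g: "g n = cv q x a b n" for n
    unfolding g_def ch_def cv_def[OF nq q_nz x a_nz b invb] unfolding Q(1) using qpoch_q_nz[OF nq] by simp
  \<comment> \<open>Both branches at once: (a', b') is (a, b) for \<kappa> = 1 and (b, a) for
    \<kappa> = -z, and then t \<kappa> = q/a' and b \<kappa> = b'.\<close>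
  have main: "s k (- \<kappa> * r powi i) * (t powi k * q powi (- (k * (k + 1) div 2)) * qpoch_inf q q)
    = Q_fun k y (- t * x) (- t / x) (- 1) (of_real z) q / (qpoch_inf (- t * x * y) q * qpoch_inf (- t / x * y) q)"
    if a': "a' \<noteq> 0" and b': "b' \<noteq> 0" and ab: "a' * b' = a * b" "t * of_real \<kappa> = q / a'" "b * of_real \<kappa> = b'"
      and ab2: "a' = a \<and> b' = b \<or> a' = b \<and> b' = a"
      and top: "\<And>k. RS k 0 \<kappa> = vv q x b' * XX q x a' b' k 0"
    for a' b'
  proof -
    have uab: "a' \<in> {a, b}" "b' \<in> {a, b}" using ab2 by auto
    note ctx = nq q_nz x a' b' inv[OF uab(2)]
    define y' where "y' i = - \<kappa> * r powi i" for i :: int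
    have y'q: "of_real (y' i) = - of_real \<kappa> * q powi i" for i by (simp add: y'_def)
    have ty: "t * of_real (y' i) = - (q powi (i + 1) / a')" for i
    proof -
      have "t * of_real (y' i) = - (t * of_real \<kappa>) * q powi i" unfolding y'q by simp
      then show ?thesis unfolding ab(2) q_powi_Suc by simp
    qed
    have y'S: "y' (i + 1) = r * y' i" for i using r by (simp add: y'_def power_int_add)
    have S: "s k (y' i) = EE q x a' b' k i" for k i
    proof (rule EE_unique[OF ctx])
      show "s k (y' 0) = vv q x b' * XX q x a' b' k 0" for k
        using solves_top[OF \<kappa> s[of k]] top[of k] by (simp add: y'_def)
    next
      fix k i
      have "s k (r * y' i) = s k (y' i) + t * of_real (y' i) * s (k + 1) (y' i)"
        unfolding y'_def by (rule lattice_lower[OF \<kappa> s s])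
      then show "s k (y' (i + 1)) = s k (y' i) - q powi (i + 1) / a' * s (k + 1) (y' i)"
        unfolding y'S ty by simp
    next
      fix k i
      have 1: "b * q powi k * of_real (y' i) = - (b' * q powi (k + i))"
        unfolding y'q ab(3)[symmetric] using q_nz by (simp add: power_int_add)
      have 2: "B * q powi k = a' * b' * q powi (k - 1)"
        unfolding Q ab using q_nz by (simp add: power_int_diff)
      have "s (k + 1) (y' i) = (x + 1 / x + b * q powi k * of_real (y' i)) * s k (y' i) - (1 - B * q powi k) * s (k - 1) (y' i)"
        unfolding y'_def by (rule lattice_three_term[OF \<kappa> s s disjI1[OF s]]) (use B1 in simp)
      then show "s (k + 1) (y' i) = (x + 1 / x - b' * q powi (k + i)) * s k (y' i) - (1 - a' * b' * q powi (k - 1)) * s (k - 1) (y' i)"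
        unfolding 1 2 by simp
    next
      show "q powi (i + 1) / a' * x \<noteq> 1" "q powi (i + 1) / a' / x \<noteq> 1" for i
        unfolding sh using n1[OF uab(1), of i] by auto
    qed
    have yy: "y = of_real (y' i)" by (simp add: y_def y'_def)
    have ynz: "y \<noteq> 0" unfolding yy y'q using \<kappa> z q_nz by auto
    have ty1: "t * y = - (q powi (i + 1) / a')" unfolding yy by (rule ty)
    define P where "P = q powi (k + i)"
    have Pnz: "P \<noteq> 0" using q_nz by (simp add: P_def)
    have P1: "q powi (1 - (k + i)) = q / P" "q powi (- k) = q powi i / P" "q powi (k + 1) * q powi i = P * q" "q powi (i + 1) = q powi i * q"
      using q_nz by (simp_all add: P_def power_int_diff power_int_add power_int_minus field_simps)
    have qi: "q powi i \<noteq> 0" using q_nz by simp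
    have zab: "of_real z * (t * t) = - (q * q / (a' * b'))"
    proof -
      have "of_real z * (t * t) = (t * of_real z) * t" by simp
      also have "\<dots> = (- q / b) * t" by (simp only: zb)
      finally show ?thesis unfolding ab(1) t by (simp add: mult.commute)
    qed
    have tyq: "y = - (q powi i * q / (a' * t))" using ty1 t_nz a' unfolding P1 by (simp add: field_simps)
    have zt: "of_real z = - (q * q / (a' * b' * (t * t)))" using zab t_nz a' b' by (simp add: field_simps)
    have "Q_fun k y (- t * x) (- t / x) (- 1) (of_real z) q / (qpoch_inf (- t * x * y) q * qpoch_inf (- t / x * y) q)
      = t powi k * q powi (- (k * (k + 1) div 2)) * qpoch_inf q q * EE q x a' b' k i"
    proof (rule Q_fun_eq_EE[OF ctx])
      show "- t * x * y = q powi (i + 1) * x / a'" "- t / x * y = q powi (i + 1) / (a' * x)"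
        using ty1 by (simp_all add: mult.commute mult.left_commute)
      have "- t / x * (- 1) = q / (a * x)" unfolding t by simp
      moreover have "- t / x * of_real z = q / (b * x)"
      proof -
        have "- t / x * of_real z = - (t * of_real z) / x" by simp
        then show ?thesis unfolding zb by simp
      qed
      ultimately show "qtheta (- t / x * - 1) q * qtheta (- t / x * complex_of_real z) q = qtheta (q / (a' * x)) q * qtheta (q / (b' * x)) q"
        using ab2 by (auto simp: mult.commute)
      show "- t / x * - 1 * of_real z * q powi - k / y = q powi (1 - (k + i)) / (b' * x)"
        unfolding zt tyq P1 using t_nz a' b' x q_nz qi Pnz by (simp add: field_simps)
      show "- t * x * - 1 * of_real z * q powi - k / y = x * q powi (1 - (k + i)) / b'"
        unfolding zt tyq P1 using t_nz a' b' x q_nz qi Pnz by (simp add: field_simps)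
      have e: "q powi (k + 1) * y = - (P * q * q / (a' * t))"
        unfolding tyq P1(3)[symmetric] by simp
      show "q powi (k + 1) * y / (- t / x * - 1 * of_real z) = b' * x * q powi (k + i)"
        unfolding e zt P_def[symmetric] using t_nz a' b' x q_nz by (simp add: field_simps)
      show "x / a' * q powi j \<noteq> 1" for j
      proof -
        have "q / a' * x * q powi (j - 1) = x / a' * q powi j" using q_nz by (simp add: power_int_diff)
        then show ?thesis using n1(1)[OF uab(1), of "j - 1"] by (simp only: not_False_eq_True)
      qed
      show "a' * x * q powi j \<noteq> 1" for j by (rule inv[OF uab(1)])
    qed (use t_nz in simp_all)
    then show ?thesis unfolding S[unfolded y'_def] by (simp only: mult.commute)
  qed
  consider "\<kappa> = 1" | "\<kappa> = - z" using \<kappa> by auto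
  then show ?thesis
  proof cases
    case 1
    show ?thesis
    proof (rule main[of a b])
      fix k
      have "(t * of_real z) ^ m * q ^ (m * (m - 1) div 2) / qpoch q q m * g (k + int m) = cm q b m * cv q x a b (k + int m)" for m
        unfolding zb g cm_def[OF nq q_nz x a_nz b invb] ..
      then have "(\<lambda>m. cm q b m * cv q x a b (k + int m)) sums RS k 0 1" using RS_top_1[of k] by (simp only:)
      moreover have "(\<lambda>m. cm q b m * cv q x a b (k + int m)) sums (vv q x b * XX q x a b k 0)"
        by (rule top_sums[OF nq q_nz x a_nz b invb])
      ultimately show "RS k 0 \<kappa> = vv q x b * XX q x a b k 0" unfolding 1 by (rule sums_unique2)
    qed (use a_nz b tk 1 in auto)
  next
    case 2
    show ?thesis
    proof (rule main[of b a])
      fix k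
      have gc: "g n = cv q x b a n" for n
        by (simp add: g cv_def[OF nq q_nz x a_nz b invb] cv_def[OF nq q_nz x b a_nz inva] asc_conv_commute[OF nq q_nz x, of a b])
      have mt: "- t = - q / a" unfolding t by simp
      have "(- t) ^ m * q ^ (m * (m - 1) div 2) / qpoch q q m * g (k + int m) = cm q a m * cv q x b a (k + int m)" for m
        unfolding mt gc cm_def[OF nq q_nz x b a_nz inva] ..
      then have "(\<lambda>m. cm q a m * cv q x b a (k + int m)) sums RS k 0 (- z)" using RS_top_2[of k] by (simp only:)
      moreover have "(\<lambda>m. cm q a m * cv q x b a (k + int m)) sums (vv q x a * XX q x b a k 0)"
        by (rule top_sums[OF nq q_nz x b a_nz inva])
      ultimately show "RS k 0 \<kappa> = vv q x a * XX q x b a k 0" unfolding 2 by (rule sums_unique2)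
    qed (use a_nz b tk 2 a_eq in auto)
  qed
qed

end

section \<open>Inversion of the expansion\<close>

lemma infsum_single:
  fixes f :: "'a \<Rightarrow> complex"
  assumes "\<And>n. n \<noteq> n0 \<Longrightarrow> f n = 0"
  shows "infsum f UNIV = f n0"
  by (rule infsumI, rule has_sum_finite_neutralI[where B = "{n0}"]) (use assms in auto)

lemma l2_inner_tensor_e_vec: "l2_inner (tensor u w) (tensor v (e_vec m)) = l2_inner u v * w m"
proof -
  define F where "F = (\<lambda>p. tensor u w p * cnj (tensor v (e_vec m) p))"
  have "infsum F UNIV = infsum F ((\<lambda>i. (i, m)) ` UNIV)"
    by (rule infsum_cong_neutral) (auto simp: F_def tensor_def e_vec_def split: if_splits)
  also have "\<dots> = infsum (\<lambda>i. u i * cnj (v i) * w m) UNIV"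
    by (subst infsum_reindex) (auto simp: inj_on_def F_def tensor_def e_vec_def o_def mult_ac intro!: infsum_cong)
  also have "\<dots> = l2_inner u v * w m" unfolding infsum_cmult_left' l2_inner_def ..
  finally show ?thesis by (simp add: l2_inner_def F_def)
qed

context
  fixes q :: real
  assumes q: "0 < q" "q < 1"
begin

text \<open>The basis points are the negatives of the support points in base q^2, which accounts for
  the minus signs from here on.\<close>

lemma half_lattice_eq: "half_lattice q \<kappa> = uminus ` asc_support (q\<^sup>2) (q powr (2 * \<kappa>))"
  unfolding half_lattice_def asc_support_def by (simp add: image_Un image_image power_mult)

lemma r_bounds: "0 < q\<^sup>2" "q\<^sup>2 < 1" "0 < q powr (2 * \<kappa>)"
  using q by (auto simp: power_less_one_iff)

abbreviation "wt \<kappa> \<equiv> asc_weight (q\<^sup>2) (q powr (2 * \<kappa>))"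
abbreviation "hi \<kappa> \<equiv> asc_hinv (q\<^sup>2) (q powr (2 * \<kappa>))"
abbreviation "UU \<kappa> \<equiv> ascU (- (q powr (2 * \<kappa>))) (q\<^sup>2)"
abbreviation "WW \<kappa> \<equiv> asc_support (q\<^sup>2) (q powr (2 * \<kappa>))"

lemma asc_sum_squares: "w \<in> WW \<kappa> \<Longrightarrow> (\<lambda>m. hi \<kappa> m * (UU \<kappa> m w * UU \<kappa> m w)) sums (\<Sum>m. hi \<kappa> m * (UU \<kappa> m w)\<^sup>2)"
  using summable_sums[OF summable_norm_cancel[OF asc_products_summable[OF r_bounds]]]
  by (simp add: power2_eq_square)

text \<open>The weight times a nonnegative sum is 1; no inspection of the infinite products is
  needed.\<close>

lemma wt_pos: assumes "w \<in> WW \<kappa>" shows "wt \<kappa> w > 0"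
proof -
  have "(\<Sum>m. hi \<kappa> m * (UU \<kappa> m w)\<^sup>2) \<ge> 0"
    using asc_sum_squares[OF assms] asc_hinv_pos[OF r_bounds, of \<kappa>]
    by (intro suminf_nonneg) (auto simp: sums_iff power2_eq_square less_imp_le)
  moreover have "wt \<kappa> w * (\<Sum>m. hi \<kappa> m * (UU \<kappa> m w)\<^sup>2) = 1"
    by (rule asc_weight_norm[OF r_bounds assms])
  ultimately show ?thesis using mult_nonpos_nonneg[of "wt \<kappa> w" "\<Sum>m. hi \<kappa> m * (UU \<kappa> m w)\<^sup>2"] by linarith
qed

lemma m_coeff_eq:
  assumes "w \<in> WW \<kappa>"
  shows "m_coeff q \<kappa> (- w) m = \<i> ^ m * of_real (sqrt (wt \<kappa> w * hi \<kappa> m) * UU \<kappa> m w)"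
proof -
  have w: "w \<noteq> 0" using asc_support_nz[OF r_bounds assms] .
  have e: "m * (m - 1) = 2 * (m * (m - 1) div 2)" proof -
    have "even (m * (m - 1))" by (cases m) auto
    then show ?thesis by (rule dvd_mult_div_cancel[symmetric])
  qed
  have 1: "inverse q ^ (m * (m - 1)) = 1 / (q\<^sup>2) ^ (m * (m - 1) div 2)"
  proof -
    have "q ^ (m * (m - 1)) = (q\<^sup>2) ^ (m * (m - 1) div 2)" unfolding power_mult[symmetric] using e by simp
    then show ?thesis unfolding power_inverse by (simp only: inverse_eq_divide)
  qed
  have 2: "q powr (2 * \<kappa> * real m) = (q powr (2 * \<kappa>)) ^ m"
    using q by (simp add: powr_powr[symmetric] powr_realpow)
  have 3: "- w * q powr (2 - 2 * \<kappa>) = - q\<^sup>2 * w / q powr (2 * \<kappa>)"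
    using q by (simp add: powr_diff)
  have 4: "al_salam_carlitz m (- (q powr (2 * \<kappa>))) (- (- w)) (q\<^sup>2) = UU \<kappa> m w"
    using al_salam_carlitz_eq_ascU[OF r_bounds(1,2)] w r_bounds(3)[of \<kappa>] by simp
  have gen: "1 / T * \<bar>- w\<bar> * (F * G) / (Z * P * QI * TH) = \<bar>w\<bar> * (F * G) / (QI * TH) * (1 / (Z * T * P))" for T F G Z P QI TH :: real
    by simp
  show ?thesis unfolding m_coeff_def 1 2 3 4 gen asc_weight_def asc_hinv_def by simp
qed

lemma v_vec_eq:
  assumes "w \<in> WW \<kappa>"
  shows "v_vec q \<kappa> (- w) m = \<i> ^ m * of_real (sqrt (wt \<kappa> w * hi \<kappa> m) * UU \<kappa> m w)"
  using m_coeff_eq[OF assms] assms by (simp add: v_vec_def half_lattice_eq)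

text \<open>The phases i^m cancel, and the sum over m is the orthogonality in the points w:
  \<open>asc_orthogonal\<close> off the diagonal, \<open>asc_weight_norm\<close> on it.\<close>

lemma v_vec_inner:
  assumes w: "w \<in> WW \<kappa>" and w': "w' \<in> WW \<kappa>"
  shows "l2_inner (v_vec q \<kappa> (- w)) (v_vec q \<kappa> (- w')) = (if w = w' then 1 else 0)"
proof -
  have i: "\<i> ^ m * cnj (\<i> ^ m) = 1" for m
    unfolding complex_cnj_power power_mult_distrib[symmetric] by simp
  have "v_vec q \<kappa> (- w) m * cnj (v_vec q \<kappa> (- w') m)
    = of_real (sqrt (wt \<kappa> w * wt \<kappa> w') * (hi \<kappa> m * (UU \<kappa> m w * UU \<kappa> m w')))" for m
  proof -
    have "hi \<kappa> m > 0" by (rule asc_hinv_pos[OF r_bounds])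
    then have "sqrt (wt \<kappa> w * hi \<kappa> m) * sqrt (wt \<kappa> w' * hi \<kappa> m) = sqrt (wt \<kappa> w * wt \<kappa> w') * hi \<kappa> m"
      by (simp add: real_sqrt_mult)
    note e = this
    have "sqrt (wt \<kappa> w * hi \<kappa> m) * UU \<kappa> m w * (sqrt (wt \<kappa> w' * hi \<kappa> m) * UU \<kappa> m w')
      = (sqrt (wt \<kappa> w * hi \<kappa> m) * sqrt (wt \<kappa> w' * hi \<kappa> m)) * (UU \<kappa> m w * UU \<kappa> m w')"
      by (simp only: mult_ac)
    also have "\<dots> = sqrt (wt \<kappa> w * wt \<kappa> w') * (hi \<kappa> m * (UU \<kappa> m w * UU \<kappa> m w'))"
      unfolding e by (simp only: mult.assoc)
    finally have "sqrt (wt \<kappa> w * hi \<kappa> m) * UU \<kappa> m w * (sqrt (wt \<kappa> w' * hi \<kappa> m) * UU \<kappa> m w') = sqrt (wt \<kappa> w * wt \<kappa> w') * (hi \<kappa> m * (UU \<kappa> m w * UU \<kappa> m w'))" .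
    moreover have "J * of_real X * (cnj J * of_real Y) = (J * cnj J) * of_real (X * Y)" for J X Y
      by simp
    ultimately show ?thesis
      unfolding v_vec_eq[OF w] v_vec_eq[OF w'] complex_cnj_mult complex_cnj_complex_of_real by (simp only: i mult_1_left)
  qed
  moreover have "((\<lambda>m. hi \<kappa> m * (UU \<kappa> m w * UU \<kappa> m w')) has_sum (if w = w' then 1 / wt \<kappa> w else 0)) UNIV"
  proof (rule norm_summable_imp_has_sum)
    show "summable (\<lambda>m. norm (hi \<kappa> m * (UU \<kappa> m w * UU \<kappa> m w')))"
      by (rule asc_products_summable[OF r_bounds w' w])
    show "(\<lambda>m. hi \<kappa> m * (UU \<kappa> m w * UU \<kappa> m w')) sums (if w = w' then 1 / wt \<kappa> w else 0)"
    proof (cases "w = w'")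
      case True
      have "(\<Sum>m. hi \<kappa> m * (UU \<kappa> m w)\<^sup>2) = 1 / wt \<kappa> w"
        using asc_weight_norm[OF r_bounds w] wt_pos[OF w] by (simp add: field_simps)
      then show ?thesis using asc_sum_squares[OF w] True by simp
    next
      case False
      then show ?thesis using asc_orthogonal[OF r_bounds w' w] by simp
    qed
  qed
  from has_sum_of_real[OF has_sum_cmult_right[OF this, of "sqrt (wt \<kappa> w * wt \<kappa> w')"], where 'a = complex]
  have "((\<lambda>m. complex_of_real (sqrt (wt \<kappa> w * wt \<kappa> w') * (hi \<kappa> m * (UU \<kappa> m w * UU \<kappa> m w')))) has_sum
     of_real (sqrt (wt \<kappa> w * wt \<kappa> w') * (if w = w' then 1 / wt \<kappa> w else 0))) UNIV" .
  moreover have "sqrt (wt \<kappa> w * wt \<kappa> w') * (if w = w' then 1 / wt \<kappa> w else 0) = (if w = w' then 1 else 0)"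
    using wt_pos[OF w] wt_pos[OF w'] by (auto simp: abs_of_pos)
  ultimately show ?thesis unfolding l2_inner_def by (simp add: infsumI)
qed

text \<open>The sign distinguishes -1 from q^(2 \<tau>), and strict monotonicity determines the
  exponent.\<close>

lemma lattice_sign_power:
  assumes "l1 \<in> {- 1, q powr (2 * \<tau>)}" "l2 \<in> {- 1, q powr (2 * \<tau>)}" "l1 * q powi i = l2 * q powi j"
  shows "l1 = l2 \<and> i = j"
proof -
  have qp: "q powi i > 0" "q powi j > 0" "q powr (2 * \<tau>) > 0" using q by auto
  have inj: "i = j" if "q powi i = q powi j"
    using that q by (metis linorder_neqE_linordered_idom power_int_strict_decreasing order_less_irrefl)
  have "sgn l1 = sgn l2"
    using arg_cong[OF assms(3), of sgn] by (simp only: sgn_mult sgn_pos[OF qp(1)] sgn_pos[OF qp(2)] mult_1_right)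
  then have "l1 = l2" using assms(1,2) qp by (auto simp: sgn_if split: if_splits)
  then show ?thesis using assms qp inj by auto
qed

lemma half_lattice_point:
  "l \<in> {- 1, q powr (2 * \<tau>)} \<Longrightarrow> l * q ^ (2 * n) \<in> half_lattice q \<tau>"
  by (auto simp: half_lattice_def)

lemma powi_double: "q powi (2 * int n) = q ^ (2 * n)"
proof -
  have "2 * int n = int (2 * n)" by simp
  then show ?thesis by (simp only: power_int_of_nat)
qed

lemma v_vec_inner_lattice:
  assumes l: "l \<in> {- 1, q powr (2 * \<tau>)}" and l': "l' \<in> {- 1, q powr (2 * \<tau>)}"
  shows "l2_inner (v_vec q \<tau> (l * q powi (2 * j))) (v_vec q \<tau> (l' * q ^ (2 * n))) = (if l = l' \<and> j = int n then 1 else 0)"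
proof (cases "l * q powi (2 * j) \<in> half_lattice q \<tau>")
  case True
  obtain w where w: "w \<in> WW \<tau>" "l * q powi (2 * j) = - w" using True unfolding half_lattice_eq by auto
  obtain w' where w': "w' \<in> WW \<tau>" "l' * q ^ (2 * n) = - w'" using half_lattice_point[OF l'] unfolding half_lattice_eq by auto
  have "w = w' \<longleftrightarrow> l * q powi (2 * j) = l' * q powi (2 * int n)" unfolding powi_double w(2) w'(2) by simp
  also have "\<dots> \<longleftrightarrow> l = l' \<and> j = int n" using lattice_sign_power[OF l l', of "2 * j" "2 * int n"] by auto
  finally show ?thesis using v_vec_inner[OF w(1) w'(1)] w w' by simp
next
  case False
  have "\<not> (l = l' \<and> j = int n)"
  proof
    assume "l = l' \<and> j = int n"
    then have "l * q powi (2 * j) = l' * q ^ (2 * n)" by (simp only: powi_double)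
    then show False using False half_lattice_point[OF l'] by simp
  qed
  then show ?thesis using False by (simp add: l2_inner_def v_vec_def)
qed

lemma V_ts_test:
  assumes "lam \<in> {- 1, q powr (2 * \<tau>)}" "l' \<in> {- 1, q powr (2 * \<tau>)}"
  shows "V_ts q \<tau> \<sigma> lam x y (tensor (v_vec q \<tau> (l' * q ^ (2 * n))) (e_vec m))
    = (if lam = l' then c_ts q \<tau> \<sigma> x lam n y * v_vec q \<sigma> (y * q ^ (2 * n)) m else 0)"
proof -
  have 1: "l2_inner (v_vec q \<tau> (lam * q ^ (2 * n'))) (v_vec q \<tau> (l' * q ^ (2 * n))) = (if lam = l' \<and> n' = n then 1 else 0)" for n'
    using v_vec_inner_lattice[OF assms, of "int n'" n] by (simp only: powi_double of_nat_eq_iff)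
  show ?thesis unfolding V_ts_def l2_inner_tensor_e_vec 1 by (subst infsum_single[of n]) auto
qed

text \<open>The second tensor factor forces the summation index to be m, the first then forces j + m
  = n.\<close>

lemma V_inf_test:
  assumes "\<xi> \<in> {- 1, q powr (2 * \<tau>)}" "l' \<in> {- 1, q powr (2 * \<tau>)}"
  shows "V_inf q \<tau> X \<xi> j (tensor (v_vec q \<tau> (l' * q ^ (2 * n))) (e_vec m))
    = (if \<xi> = l' \<and> j + int m = int n then c_inf q \<tau> X \<xi> j m else 0)"
proof -
  have e: "\<xi> * q powi (2 * j) * q ^ (2 * n') = \<xi> * q powi (2 * (j + int n'))" for n'
  proof -
    have "2 * (j + int n') = 2 * j + int (2 * n')" by simp
    then show ?thesis using q power_int_add[of q "2 * j" "int (2 * n')"] unfolding power_int_of_nat by simp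
  qed
  show ?thesis unfolding V_inf_def l2_inner_tensor_e_vec e v_vec_inner_lattice[OF assms]
    by (subst infsum_single[of m]) (auto simp: e_vec_def)
qed

text \<open>In the double series for U only the index k + m - n survives the test, and it
  contributes only when nonnegative.\<close>

definition UB :: "real \<Rightarrow> real \<Rightarrow> real \<Rightarrow> complex \<Rightarrow> real \<Rightarrow> int \<Rightarrow> nat \<Rightarrow> nat \<Rightarrow> complex" where
  "UB \<tau> \<sigma> \<nu> x \<xi> k n m = (if k + int m - int n < 0 then 0
     else m_ts q \<tau> \<sigma> x \<nu> (nat (k + int m - int n)) * c_inf q \<tau> (\<nu> * q ^ (2 * nat (k + int m - int n))) \<xi> (int n - int m) m)"

lemma U_ts_test:
  assumes "\<xi> \<in> {- 1, q powr (2 * \<tau>)}" "l' \<in> {- 1, q powr (2 * \<tau>)}"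
  shows "U_ts q \<tau> \<sigma> \<nu> x \<xi> k (tensor (v_vec q \<tau> (l' * q ^ (2 * n))) (e_vec m))
    = (if \<xi> = l' then UB \<tau> \<sigma> \<nu> x \<xi> k n m else 0)"
proof (cases "k + int m - int n < 0")
  case True
  then have "k - int n' + int m \<noteq> int n" for n' by simp
  then show ?thesis using True unfolding U_ts_def V_inf_test[OF assms] UB_def by simp
next
  case False
  define N where "N = nat (k + int m - int n)"
  have N: "k - int n' + int m = int n \<longleftrightarrow> n' = N" for n' using False by (auto simp: N_def)
  have kN: "k - int N = int n - int m" using False by (simp add: N_def)
  show ?thesis unfolding U_ts_def V_inf_test[OF assms] N
    by (subst infsum_single[of N]) (use False in \<open>auto simp: UB_def kN N_def[symmetric]\<close>)
qed

text \<open>After testing, the sum over y runs over -w/q^(2n) with w in the support, since the other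
  basis vectors are 0 by convention. The expansion in U_m(w) is then inverted at w = v.\<close>

lemma coupling_inversion:
  fixes n :: nat and k :: int
  assumes S: "is_coupling_coefficients q \<tau> \<sigma> x S"
    and \<nu>: "\<nu> \<in> {- 1, q powr (2 * \<tau>)}" and \<xi>: "\<xi> \<in> {- 1, q powr (2 * \<tau>)}" and lam: "lam \<in> {- 1, q powr (2 * \<tau>)}"
    and v: "v \<in> WW \<sigma>"
  defines "B m \<equiv> if \<xi> = lam then UB \<tau> \<sigma> \<nu> x \<xi> k n m else 0"
  shows "(\<lambda>m. of_real (sqrt (wt \<sigma> v) * sqrt (hi \<sigma> m) * UU \<sigma> m v) * ((- \<i>) ^ m * B m))
    sums (S (- v / q ^ (2 * n)) (\<xi> * q powi (2 * k)) \<nu> lam * c_ts q \<tau> \<sigma> x lam n (- v / q ^ (2 * n)))"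
proof -
  define G where "G y = S y (\<xi> * q powi (2 * k)) \<nu> lam * c_ts q \<tau> \<sigma> x lam n y" for y
  have 1: "((\<lambda>y. G y * v_vec q \<sigma> (y * q ^ (2 * n)) m) has_sum B m) (lattice q \<sigma>)" for m
  proof -
    have "((\<lambda>y. \<Sum>l\<in>{-1, q powr (2 * \<tau>)}.
             S y (\<xi> * q powi (2 * k)) \<nu> l * V_ts q \<tau> \<sigma> l x y (tensor (v_vec q \<tau> (lam * q ^ (2 * n))) (e_vec m)))
         has_sum U_ts q \<tau> \<sigma> \<nu> x \<xi> k (tensor (v_vec q \<tau> (lam * q ^ (2 * n))) (e_vec m))) (lattice q \<sigma>)"
      using S \<nu> \<xi> half_lattice_point[OF lam, of n] unfolding is_coupling_coefficients_def by blast
    moreover have "(\<Sum>l\<in>{-1, q powr (2 * \<tau>)}.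
             S y (\<xi> * q powi (2 * k)) \<nu> l * V_ts q \<tau> \<sigma> l x y (tensor (v_vec q \<tau> (lam * q ^ (2 * n))) (e_vec m)))
        = G y * v_vec q \<sigma> (y * q ^ (2 * n)) m" for y
    proof -
      have "(\<Sum>l\<in>{-1, q powr (2 * \<tau>)}.
             S y (\<xi> * q powi (2 * k)) \<nu> l * V_ts q \<tau> \<sigma> l x y (tensor (v_vec q \<tau> (lam * q ^ (2 * n))) (e_vec m)))
        = (\<Sum>l\<in>{-1, q powr (2 * \<tau>)}. if l = lam then G y * v_vec q \<sigma> (y * q ^ (2 * n)) m else 0)"
        by (intro sum.cong refl) (auto simp: V_ts_test[OF _ lam] G_def)
      also have "\<dots> = G y * v_vec q \<sigma> (y * q ^ (2 * n)) m"
        using lam by (subst sum.delta) auto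
      finally show ?thesis .
    qed
    ultimately show ?thesis unfolding U_ts_test[OF \<xi> lam] B_def by (simp only:)
  qed
  define h where "h w = - w / q ^ (2 * n)" for w :: real
  \<comment> \<open>The root of the weight comes from the normalisation of \<open>v_vec\<close>; a
    second root multiplies the inverted series to make \<open>asc_weight_norm\<close>
    applicable.\<close>
  define f where "f w = G (h w) * of_real (sqrt (wt \<sigma> w))" for w
  have hq: "h w * q ^ (2 * n) = - w" for w using q by (simp add: h_def)
  have inj: "inj_on h (WW \<sigma>)" using q by (auto simp: inj_on_def h_def)
  have hlat: "h ` WW \<sigma> \<subseteq> lattice q \<sigma>"
  proof -
    have "- (q ^ (2 * i)) / q ^ (2 * n) = - (q powi (2 * (int i - int n)))" for i
    proof -
      have "2 * (int i - int n) = int (2 * i) - int (2 * n)" by simp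
      then show ?thesis using q power_int_diff[of q "int (2 * i)" "int (2 * n)"] unfolding power_int_of_nat by simp
    qed
    moreover have "q ^ (2 * i) / q ^ (2 * n) = q powi (2 * (int i - int n))" for i
      using calculation[of i] by simp
    moreover have "- (q powi (2 * j)) \<in> lattice q \<sigma>" "q powr (2 * \<sigma>) * q powi (2 * j) \<in> lattice q \<sigma>" for j
      by (auto simp: lattice_def)
    ultimately have "- (q ^ (2 * i)) / q ^ (2 * n) \<in> lattice q \<sigma>" "q powr (2 * \<sigma>) * (q ^ (2 * i) / q ^ (2 * n)) \<in> lattice q \<sigma>" for i
      by (simp_all only:)
    moreover have "h ((q\<^sup>2) ^ i) = - (q ^ (2 * i)) / q ^ (2 * n)" "h (- (q powr (2 * \<sigma>)) * (q\<^sup>2) ^ i) = q powr (2 * \<sigma>) * (q ^ (2 * i) / q ^ (2 * n))" for i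
      unfolding h_def power_mult by simp_all
    ultimately show ?thesis unfolding asc_support_def by auto
  qed
  have f: "((\<lambda>w. f w * of_real (UU \<sigma> m w)) has_sum ((- \<i>) ^ m * B m / of_real (sqrt (hi \<sigma> m)))) (WW \<sigma>)" for m
  proof -
    have hpos: "hi \<sigma> m > 0" by (rule asc_hinv_pos[OF r_bounds])
    have "((\<lambda>y. G y * v_vec q \<sigma> (y * q ^ (2 * n)) m) has_sum B m) (h ` WW \<sigma>)"
    proof (rule has_sum_cong_neutral[THEN iffD1, OF _ _ _ 1[of m]])
      fix y assume y: "y \<in> lattice q \<sigma> - h ` WW \<sigma>"
      have "y * q ^ (2 * n) \<notin> half_lattice q \<sigma>"
      proof
        assume "y * q ^ (2 * n) \<in> half_lattice q \<sigma>"
        then obtain w where "w \<in> WW \<sigma>" "y * q ^ (2 * n) = - w" unfolding half_lattice_eq by auto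
        then have "y = h w" using q by (simp add: h_def field_simps)
        then show False using y \<open>w \<in> WW \<sigma>\<close> by blast
      qed
      then show "G y * v_vec q \<sigma> (y * q ^ (2 * n)) m = 0" by (simp add: v_vec_def)
    qed (use hlat in auto)
    then have "((\<lambda>w. G (h w) * v_vec q \<sigma> (- w) m) has_sum B m) (WW \<sigma>)"
      unfolding has_sum_reindex[OF inj] o_def hq .
    from has_sum_cmult_right[OF this, of "(- \<i>) ^ m / of_real (sqrt (hi \<sigma> m))"]
    have "((\<lambda>w. (- \<i>) ^ m / of_real (sqrt (hi \<sigma> m)) * (G (h w) * v_vec q \<sigma> (- w) m)) has_sum ((- \<i>) ^ m * B m / of_real (sqrt (hi \<sigma> m)))) (WW \<sigma>)"
      by simp
    moreover have "(- \<i>) ^ m / of_real (sqrt (hi \<sigma> m)) * (G (h w) * v_vec q \<sigma> (- w) m) = f w * of_real (UU \<sigma> m w)" if "w \<in> WW \<sigma>" for w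
    proof -
      have i: "(- \<i>) ^ m * \<i> ^ m = 1" unfolding power_mult_distrib[symmetric] by simp
      have gen: "I1 / s * (g * (I2 * (w' * s * u))) = (I1 * I2) * (g * w' * u)" if "s \<noteq> 0" for I1 I2 s g w' u :: complex
        using that by simp
      have "of_real (sqrt (hi \<sigma> m)) \<noteq> (0 :: complex)" using hpos by simp
      from gen[OF this] show ?thesis unfolding v_vec_eq[OF that] real_sqrt_mult of_real_mult f_def by (simp only: i mult_1_left)
    qed
    ultimately show ?thesis by (subst has_sum_cong[where g = "\<lambda>w. (- \<i>) ^ m / of_real (sqrt (hi \<sigma> m)) * (G (h w) * v_vec q \<sigma> (- w) m)"]) auto
  qed
  have wp: "wt \<sigma> v > 0" by (rule wt_pos[OF v])
  have "of_real (sqrt (wt \<sigma> v)) * of_real (hi \<sigma> m * UU \<sigma> m v) * ((- \<i>) ^ m * B m / of_real (sqrt (hi \<sigma> m)))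
    = of_real (sqrt (wt \<sigma> v) * sqrt (hi \<sigma> m) * UU \<sigma> m v) * ((- \<i>) ^ m * B m)" for m
  proof -
    have hpos: "hi \<sigma> m > 0" by (rule asc_hinv_pos[OF r_bounds])
    have "sqrt (hi \<sigma> m) * sqrt (hi \<sigma> m) = hi \<sigma> m" using hpos by simp
    then have e: "complex_of_real (hi \<sigma> m) = of_real (sqrt (hi \<sigma> m)) * of_real (sqrt (hi \<sigma> m))"
      by (simp only: of_real_mult[symmetric])
    have nz: "of_real (sqrt (hi \<sigma> m)) \<noteq> (0 :: complex)" using hpos by simp
    have gen: "w * (s * s * u) * (X / s) = w * s * u * X" if "s \<noteq> 0" for w s u X :: complex
      using that by simp
    show ?thesis unfolding of_real_mult e by (rule gen[OF nz])
  qed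
  moreover have "(\<lambda>m. of_real (sqrt (wt \<sigma> v)) * (of_real (hi \<sigma> m * UU \<sigma> m v) * ((- \<i>) ^ m * B m / of_real (sqrt (hi \<sigma> m)))))
     sums (of_real (sqrt (wt \<sigma> v)) * (f v * of_real (\<Sum>m. hi \<sigma> m * (UU \<sigma> m v)\<^sup>2)))"
    by (rule sums_mult[OF asc_inversion[OF r_bounds f v]])
  moreover have "of_real (sqrt (wt \<sigma> v)) * (f v * of_real (\<Sum>m. hi \<sigma> m * (UU \<sigma> m v)\<^sup>2)) = G (h v)"
  proof -
    have "sqrt (wt \<sigma> v) * sqrt (wt \<sigma> v) = wt \<sigma> v" using wp by simp
    then have "sqrt (wt \<sigma> v) * (sqrt (wt \<sigma> v) * (\<Sum>m. hi \<sigma> m * (UU \<sigma> m v)\<^sup>2)) = 1"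
      unfolding mult.assoc[symmetric] by (simp only: asc_weight_norm[OF r_bounds v])
    from arg_cong[OF this, of complex_of_real] have "complex_of_real (sqrt (wt \<sigma> v)) * (of_real (sqrt (wt \<sigma> v)) * of_real (\<Sum>m. hi \<sigma> m * (UU \<sigma> m v)\<^sup>2)) = 1"
      by (simp only: of_real_mult of_real_1)
    moreover have "s * (g * s * u) = g * (s * (s * u))" for s g u :: complex by simp
    ultimately show ?thesis unfolding f_def by (simp only: mult_1_right)
  qed
  ultimately show ?thesis unfolding G_def h_def by (simp only: mult.assoc)
qed

end

section \<open>Coefficients of the test expansion\<close>

lemma powr_half_eq_sqrt: "0 < y \<Longrightarrow> y powr (- (u / 2)) = sqrt (y powr (- u))"
  by (simp add: powr_half_sqrt[symmetric] powr_powr)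

definition bql_sum :: "nat \<Rightarrow> real \<Rightarrow> real \<Rightarrow> real \<Rightarrow> real \<Rightarrow> real" where
  "bql_sum n X c d r = (\<Sum>l\<le>n. qpoch (r powi (- int n)) r l * qpoch X r l / (qpoch r r l * qpoch (c * r) r l * qpoch (d * r) r l) * r ^ l)"

text \<open>The square of the whole prefactor of \<open>L_bar\<close>, its powers included;
  comparisons below are made between squares.\<close>

definition bql_norm :: "nat \<Rightarrow> real \<Rightarrow> real \<Rightarrow> real \<Rightarrow> real \<Rightarrow> real" where
  "bql_norm n X c d r = \<bar>X\<bar> * (qpoch_inf (X / c) r * qpoch_inf (X / d) r * qpoch_inf (c * r) r * qpoch_inf (d * r) r)
       * (qpoch (c * r) r n * qpoch (d * r) r n)
     / (\<bar>c * r\<bar> * (qpoch_inf r r * qpoch_inf X r) * qtheta (d / c) r * qpoch r r n) / ((- (c * d * r\<^sup>2)) ^ n * r ^ (n * (n - 1) div 2))"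

text \<open>For c d < 0 the base of the half-integral power is positive, so the power is a square
  root and merges with the rest.\<close>

lemma L_bar_eq:
  assumes r: "0 < r" "r < 1" and cd: "c * d < 0"
  shows "L_bar n X c d r = sqrt (bql_norm n X c d r) * bql_sum n X c d r"
proof -
  define Y where "Y = - (c * d * r\<^sup>2)"
  have Y: "Y > 0" using r cd by (simp add: Y_def mult_neg_pos)
  have 1: "Y powr (- (real n / 2)) = sqrt (1 / Y ^ n)"
    unfolding powr_half_eq_sqrt[OF Y] unfolding powr_minus powr_realpow[OF Y] by (simp add: inverse_eq_divide)
  have "real (n * (n - 1) div 2) = real n * (real n - 1) / 2"
  proof -
    have "even (n * (n - 1))" by (cases n) auto
    then have "real (n * (n - 1) div 2) = real (n * (n - 1)) / 2" using real_of_nat_div[of 2 "n * (n - 1)"] by (simp only: of_nat_numeral)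
    then show ?thesis by (cases n) (auto simp: algebra_simps)
  qed
  then have e: "real n * (real n - 1) / 4 = real (n * (n - 1) div 2) / 2" by simp
  have 2: "r powr (- (real n * (real n - 1) / 4)) = sqrt (1 / r ^ (n * (n - 1) div 2))"
    unfolding e powr_half_eq_sqrt[OF r(1)] unfolding powr_minus powr_realpow[OF r(1)] by (simp add: inverse_eq_divide)
  have 0: "qpoch 0 r l = 1" for l by (simp add: qpoch_def)
  have 3: "big_q_laguerre n X c d r = bql_sum n X c d r"
  proof -
    have "big_q_laguerre n X c d r = (\<Sum>l. qpoch (r powi (- int n)) r l * qpoch X r l / (qpoch r r l * qpoch (c * r) r l * qpoch (d * r) r l) * r ^ l)"
      unfolding big_q_laguerre_def qhyp_def by (simp add: 0 mult.assoc)
    also have "\<dots> = bql_sum n X c d r"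
      unfolding bql_sum_def by (rule suminf_finite) (use r in \<open>auto simp: qpoch_neg_power_eq_0\<close>)
    finally show ?thesis .
  qed
  have gen: "sqrt (1 / y) * sqrt (1 / t) * sqrt (F / G) = sqrt (F / G / (y * t))" for y t F G
    by (simp flip: real_sqrt_mult)
  show ?thesis unfolding L_bar_def 3 bql_norm_def Y_def[symmetric] 1 2 gen ..
qed

text \<open>Only |c r| and the theta function are not visibly symmetric; \<theta>(1/u) =
  -\<theta>(u)/u balances them, as d/c < 0.\<close>

lemma L_bar_commute:
  assumes r: "0 < r" "r < 1" and cd: "c * d < 0"
  shows "L_bar n X c d r = L_bar n X d c r"
proof -
  have c: "c \<noteq> 0" "d \<noteq> 0" using cd by auto
  have th: "qtheta (1 / u) r = - (qtheta u r) / u" if "u \<noteq> 0" for u :: real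
  proof -
    have nr: "norm r < 1" using r by simp
    have "qtheta (1 / u) r = (1 - 1 / u) * qpoch_inf (r / u) r * qpoch_inf (r * u) r"
      unfolding qtheta_def using qpoch_inf_rec[OF nr, of "1 / u"] that by (simp add: mult.commute)
    moreover have "qtheta u r = (1 - u) * qpoch_inf (r * u) r * qpoch_inf (r / u) r"
      unfolding qtheta_def using qpoch_inf_rec[OF nr, of u] by (simp add: mult.commute)
    ultimately show ?thesis using that by (simp add: field_simps)
  qed
  have e: "\<bar>d * r\<bar> * K * qtheta (c / d) r * L = \<bar>c * r\<bar> * K * qtheta (d / c) r * L" for K L
  proof -
    have "qtheta (c / d) r = - (qtheta (d / c) r) / (d / c)"
      using th[of "d / c"] c by simp
    also have "\<dots> = \<bar>c\<bar> / \<bar>d\<bar> * qtheta (d / c) r"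
      using c cd by (cases "c > 0") (auto simp: abs_if mult_less_0_iff)
    finally show ?thesis using c by (simp add: abs_mult)
  qed
  have dc: "d * c < 0" using cd by (simp add: mult.commute)
  have gen: "x * (a * b * c' * d') * (e' * f) / g / h = x * (b * a * d' * c') * (f * e') / g / h" for x a b c' d' e' f g h :: real
    by (simp add: mult_ac)
  have "bql_norm n X c d r = bql_norm n X d c r"
    unfolding bql_norm_def e[of "qpoch_inf r r * qpoch_inf X r" "qpoch r r n"] mult.commute[of d c] by (rule gen)
  moreover have "bql_sum n X c d r = bql_sum n X d c r"
    unfolding bql_sum_def by (intro sum.cong refl) (simp add: mult_ac)
  ultimately show ?thesis by (simp add: L_bar_eq[OF r cd] L_bar_eq[OF r dc])
qed

definition rqr :: "real \<Rightarrow> int \<Rightarrow> real" where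
  "rqr r j = (if j < 0 then 0 else 1 / qpoch r r (nat j))"

definition HHr :: "real \<Rightarrow> real \<Rightarrow> nat \<Rightarrow> real \<Rightarrow> int \<Rightarrow> real" where
  "HHr r e n X M = (\<Sum>l\<le>n. qpoch (r powi (- int n)) r l * qpoch X r l * rqr r (M + int l) / (qpoch e r l * qpoch r r l) * r ^ l)"

context
  fixes r z \<beta> B A t W :: real
  assumes r: "0 < r" "r < 1" and z: "0 < z" and \<beta>: "0 < \<beta>"
    and A: "A = - r * B / \<beta>" and t2: "t * t = r / (z * \<beta>)" and B: "B = 1 \<or> B = - \<beta>"
begin

text \<open>Square of the m-independent factor between the tested coefficients and
  \<open>cf\<close>; W stands for the weight of m^(\<tau>,\<sigma>).\<close>

definition coup_sq :: "int \<Rightarrow> nat \<Rightarrow> real" where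
  "coup_sq k n = \<bar>B\<bar> * r powi k * qpoch_inf (B * r powi (1 + k)) r * (qpoch_inf A r)\<^sup>2 * qpoch_inf (- \<beta> * r) r * qpoch (- \<beta> * r) r n * W
     / (qpoch r r n * qtheta (- \<beta>) r) * (r ^ (n * n) / (r ^ n)\<^sup>2)"

lemma nr: "norm r < 1" using r by simp

lemma A_less: "A < 1"
proof -
  have "r / \<beta> > 0" using r \<beta> by simp
  then have "- (r / \<beta>) < 1" by linarith
  moreover have "A = - (r / \<beta>) \<or> A = r" using B A \<beta> by auto
  ultimately show ?thesis using r by auto
qed

lemma pos:
  "qpoch A r n > 0" "qpoch (- \<beta> * r) r n > 0" "qpoch r r n > 0" "qpoch_inf r r > 0" "qpoch_inf (- \<beta> * r) r > 0"
  "qtheta (- \<beta>) r > 0" "qpoch_inf (B * r ^ Suc N) r > 0"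
proof -
  have b: "- \<beta> * r < 1" "- \<beta> < 1" "r / - \<beta> < 1" proof -
    have "\<beta> * r > 0" "r / \<beta> > 0" using \<beta> r by simp_all
    then show "- \<beta> * r < 1" "- \<beta> < 1" "r / - \<beta> < 1" using \<beta> by simp_all
  qed
  have c: "B * r ^ Suc N < 1" using B \<beta> r power_Suc_less_one[OF r, of N] by (auto intro: less_trans[OF mult_neg_pos])
  show "qpoch A r n > 0" "qpoch (- \<beta> * r) r n > 0" "qpoch r r n > 0" "qpoch_inf r r > 0" "qpoch_inf (- \<beta> * r) r > 0"
    "qtheta (- \<beta>) r > 0" "qpoch_inf (B * r ^ Suc N) r > 0"
    unfolding qtheta_def using r b c A_less by (auto intro!: qpoch_pos qpoch_inf_pos mult_pos_pos)
qed

text \<open>Trivial for B = 1; for B = -\<beta> it uses A = r, and the two products trade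
  places.\<close>

lemma AB_prod: "qpoch_inf (r ^ (N + 1)) r * qpoch_inf (A * B * r ^ N) r = qpoch_inf (B * r ^ Suc N) r * qpoch_inf (A * r ^ N) r"
proof -
  consider "B = 1" | "B = - \<beta>" using B by auto
  then show ?thesis
  proof cases
    case 2
    have "A = r" unfolding A 2 using \<beta> by simp
    then show ?thesis by (simp add: mult_ac)
  qed simp
qed

lemma A_split: "qpoch_inf (A * r ^ N) r = qpoch_inf A r / qpoch A r N"
  using qpoch_inf_split[OF nr, of A N] pos(1)[of N] by simp

lemma r_split: "qpoch_inf (r ^ M * r) r = qpoch_inf r r / qpoch r r M" "qpoch (r ^ M * r) r n = qpoch r r (M + n) / qpoch r r M"
  using qpoch_inf_split[OF nr, of r M] qpoch_add[of r r M n] pos(3)[of M] by (simp_all add: mult.commute)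

lemma e_split: "qpoch_inf (- \<beta> * r ^ M * r) r = qpoch_inf (- \<beta> * r) r / qpoch (- \<beta> * r) r M"
    "qpoch (- \<beta> * r ^ M * r) r n = qpoch (- \<beta> * r) r (M + n) / qpoch (- \<beta> * r) r M"
proof -
  have e: "- \<beta> * r ^ M * r = - \<beta> * r * r ^ M" by simp
  show "qpoch_inf (- \<beta> * r ^ M * r) r = qpoch_inf (- \<beta> * r) r / qpoch (- \<beta> * r) r M"
    unfolding e qpoch_inf_split[OF nr, of "- \<beta> * r" M] using pos(2)[of M] by simp
  show "qpoch (- \<beta> * r ^ M * r) r n = qpoch (- \<beta> * r) r (M + n) / qpoch (- \<beta> * r) r M"
    unfolding e qpoch_add using pos(2)[of M] by simp
qed

lemma tri: "r ^ ((n + M) * (n + M - 1) div 2) = r ^ (n * (n - 1) div 2) * r ^ (M * (M - 1) div 2) * (r ^ M) ^ n"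
proof -
  have "(n + M) * (n + M - 1) div 2 = n * (n - 1) div 2 + M * (M - 1) div 2 + M * n"
  proof -
    have "even (M * (M - 1))" by (cases M) auto
    then have 1: "M * (M - 1) div 2 * 2 + M = M * (M - 1) + M" by simp
    have 2: "M * (M - 1) + M = M * M" by (cases M) auto
    have 3: "(n + M) * M = M * n + M * M" by (simp add: algebra_simps)
    have "(n + M) * (n + M - 1) div 2 + M * (M - 1) div 2 + M = n * (n - 1) div 2 + (M * n + M * M)"
      using choose2_diff[of M "n + M"] unfolding 3 by (simp only: add_diff_cancel_right' le_add2)
    then show ?thesis using 1 unfolding 2 by linarith
  qed
  then show ?thesis by (simp only: power_add power_mult)
qed

lemma sq_tri: "r ^ (n * n) = (r ^ (n * (n - 1) div 2))\<^sup>2 * r ^ n"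
proof -
  have "even (n * (n - 1))" by (cases n) auto
  then have "n * (n - 1) div 2 * 2 + n = n * (n - 1) + n" by simp
  also have "\<dots> = n * n" by (cases n) auto
  finally show ?thesis by (metis power_add power_mult)
qed

lemma tri_Suc: "r ^ (M * (M + 1) div 2) = r ^ (M * (M - 1) div 2) * r ^ M"
proof -
  have "M * (M + 1) div 2 = M * (M - 1) div 2 + M" using choose2_Suc[of M] by (simp add: mult.commute)
  then show ?thesis by (simp only: power_add)
qed

lemma t_power: "(\<bar>t\<bar> ^ m)\<^sup>2 = r ^ m / (z ^ m * \<beta> ^ m)"
proof -
  have "(\<bar>t\<bar> ^ m)\<^sup>2 = (t * t) ^ m" by (simp add: power2_eq_square flip: power_mult_distrib)
  then show ?thesis unfolding t2 by (simp add: power_divide power_mult_distrib)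
qed

text \<open>The case of degenerate big q-Laguerre parameters, m = n + M. All products are reduced to
  base values by the splitting lemmas, which leaves the identity of fractions
  \<open>gen\<close>.\<close>

lemma coup_sq_gt:
  assumes N: "int N = k + int M"
  shows "bql_norm n (B * r ^ Suc N) (r ^ M) (- \<beta>) r * (asc_hinv r z (n + M) * (W * (qpoch_inf (r ^ (N + 1)) r * qpoch_inf (A * B * r ^ N) r)))
    = coup_sq k n * (\<bar>t\<bar> ^ (n + M) / (r ^ n) ^ (n + M) / (qpoch r r M * qpoch A r N))\<^sup>2"
proof -
  have rN: "r ^ N = r powi k * r ^ M"
    using r power_int_add[of r k "int M"] unfolding N[symmetric] by simp
  have 1: "B * r ^ Suc N / r ^ M = B * r powi (1 + k)" unfolding power_Suc rN using r by (simp add: power_int_add)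
  have 2: "B * r ^ Suc N / - \<beta> = A * r ^ N" unfolding A by simp
  have 3: "qtheta (- \<beta> / r ^ M) r = \<beta> ^ M / (r ^ (M * (M - 1) div 2) * r ^ M) * qtheta (- \<beta>) r"
    using qtheta_shift_power[OF nr, of "- \<beta>" M] r \<beta> unfolding tri_Suc by simp
  have 4: "(- (r ^ M * - \<beta> * r\<^sup>2)) ^ n = \<beta> ^ n * (r ^ M) ^ n * (r ^ n)\<^sup>2"
    by (simp add: power_mult_distrib power_mult[symmetric] mult_ac)
  have 5: "\<bar>B * r ^ Suc N\<bar> = \<bar>B\<bar> * (r * (r powi k * r ^ M))" "\<bar>r ^ M * r\<bar> = r ^ M * r"
    unfolding power_Suc rN using r by (simp_all add: abs_mult)
  have 6: "(r ^ n) ^ (n + M) = (r ^ (n * (n - 1) div 2))\<^sup>2 * r ^ n * (r ^ M) ^ n"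
    unfolding power_add power_mult[symmetric] sq_tri by (simp add: mult.commute)
  have 7: "(x / y / w)\<^sup>2 = x\<^sup>2 / (y * w)\<^sup>2" for x y w :: real by (simp add: power_divide power_mult_distrib)
  have Mn: "M + n = n + M" by simp
  have gen: "AB * (rr * (al * ze)) * (Bk * (Ai / AN) * (Qi / qM) * ei) * (qm / qM * en) / (ze * rr * (Qi * BN) * (bM / (TM * ze) * th) * qn) / (bn * X * eta\<^sup>2 * Tn)
     * (1 / (zn * zM * (Tn * TM * X) * qm) * (WW * (BN * (Ai / AN))))
     = AB * al * Bk * Ai\<^sup>2 * ei * en * WW / (qn * th) * (Tn\<^sup>2 * eta / eta\<^sup>2) * (eta * ze / (zn * zM * (bn * bM)) / (Tn\<^sup>2 * eta * X * (qM * AN))\<^sup>2)"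
    if "rr \<noteq> 0" "ze \<noteq> 0" "AN \<noteq> 0" "Qi \<noteq> 0" "qM \<noteq> 0" "qm \<noteq> 0" "BN \<noteq> 0" "TM \<noteq> 0" "th \<noteq> 0" "qn \<noteq> 0" "bn \<noteq> 0" "bM \<noteq> 0" "X \<noteq> 0" "eta \<noteq> 0" "Tn \<noteq> 0" "zn \<noteq> 0" "zM \<noteq> 0"
    for AB rr al ze Bk Ai AN Qi qM ei qm en BN bM TM th qn bn X eta Tn zn zM WW :: real
    using that by (simp add: field_simps power2_eq_square)
  show ?thesis
    unfolding bql_norm_def asc_hinv_def coup_sq_def 1 2 3 4 5 AB_prod A_split r_split Mn tri 7 t_power 6 sq_tri power_add[of r n M] power_add[of z n M] power_add[of \<beta> n M]
    by (rule gen) (use r z \<beta> pos(1)[of N] pos(3,4,6) pos(7)[of N] in \<open>auto simp: less_imp_neq[THEN not_sym]\<close>)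
qed

lemma neg_power_sq: "(qpoch (r powi (- int (m + M))) r M)\<^sup>2 = (r ^ (M * (M - 1) div 2) * qpoch r r (m + M) / (qpoch r r m * ((r ^ M) ^ m * ((r ^ (M * (M - 1) div 2))\<^sup>2 * r ^ M))))\<^sup>2"
proof -
  have e: "r ^ ((m + M) * M) = (r ^ M) ^ m * ((r ^ (M * (M - 1) div 2))\<^sup>2 * r ^ M)"
    unfolding sq_tri[symmetric] by (simp add: power_add power_mult[symmetric] algebra_simps)
  have "qpoch (r powi (- int (m + M))) r M * (qpoch r r m * r ^ ((m + M) * M)) = (-1) ^ M * (r ^ (M * (M - 1) div 2) * qpoch r r (m + M))"
    using qpoch_neg_power[of M "m + M" r] r by (simp add: mult.assoc)
  then have X: "qpoch (r powi (- int (m + M))) r M = (-1) ^ M * (r ^ (M * (M - 1) div 2) * qpoch r r (m + M) / (qpoch r r m * r ^ ((m + M) * M)))"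
    using pos(3)[of m] r by (simp add: eq_divide_eq)
  have "((-1) ^ M * y)\<^sup>2 = y\<^sup>2" for y :: real by (simp add: power_mult_distrib flip: power_mult)
  then show ?thesis unfolding X e .
qed

text \<open>The case n = m + M. Here \<open>cP\<close> is the prefactor that \<open>HHr_le\<close>
  produces when the vanishing first M terms are skipped.\<close>

lemma coup_sq_le:
  defines "cP m M N \<equiv> qpoch (r powi (- int (m + M))) r M * qpoch (B * r ^ Suc N) r M * r ^ M / (qpoch (- \<beta> * r) r M * qpoch r r M)"
  shows "bql_norm m (B * r ^ Suc (N + M)) (r ^ M) (- \<beta> * r ^ M) r * (asc_hinv r z m * (W * (qpoch_inf (r ^ (N + 1)) r * qpoch_inf (A * B * r ^ N) r)))
    = coup_sq (int (N + M)) (m + M) * (\<bar>t\<bar> ^ m / (r ^ (m + M)) ^ m * (cP m M N) / qpoch A r N)\<^sup>2"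
proof -
  have 1: "B * r ^ Suc (N + M) / r ^ M = B * r ^ Suc N" using r by (simp add: power_add)
  have 2: "B * r ^ Suc (N + M) / (- \<beta> * r ^ M) = A * r ^ N" unfolding A using r by (simp add: power_add)
  have 3: "- \<beta> * r ^ M / r ^ M = - \<beta>" using r by simp
  have 4: "(- (r ^ M * (- \<beta> * r ^ M) * r\<^sup>2)) ^ m = \<beta> ^ m * ((r ^ M) ^ m)\<^sup>2 * (r ^ m)\<^sup>2"
    by (simp add: power_mult_distrib power_mult[symmetric] power2_eq_square mult_ac)
  have 5: "\<bar>B * r ^ Suc (N + M)\<bar> = \<bar>B\<bar> * (r * (r ^ N * r ^ M))" "\<bar>r ^ M * r\<bar> = r ^ M * r"
    using r by (simp_all add: abs_mult power_add)
  have 6: "(r ^ m * r ^ M) ^ m = (r ^ (m * (m - 1) div 2))\<^sup>2 * r ^ m * (r ^ M) ^ m"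
    unfolding sq_tri[symmetric] by (simp only: power_mult_distrib power_mult)
  have 7: "r ^ ((m + M) * (m + M)) = (r ^ (m * (m - 1) div 2))\<^sup>2 * r ^ m * ((r ^ M) ^ m)\<^sup>2 * ((r ^ (M * (M - 1) div 2))\<^sup>2 * r ^ M)"
  proof -
    have "(m + M) * (m + M) = m * m + M * m * 2 + M * M" by (simp add: algebra_simps)
    then show ?thesis unfolding sq_tri[symmetric] by (simp only: power_add power_mult)
  qed
  have 8: "(x / y * (p * bm * ze / (eM * qM)) / AN)\<^sup>2 = x\<^sup>2 / y\<^sup>2 * (p\<^sup>2 * bm\<^sup>2 * ze\<^sup>2 / (eM * qM)\<^sup>2) / AN\<^sup>2" for x y p bm ze eM qM AN :: real
    by (simp add: power_divide power_mult_distrib)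
  have 9: "r powi int (N + M) = r ^ N * r ^ M" "r powi (1 + int (N + M)) = r ^ Suc (N + M)"
  proof -
    show "r powi int (N + M) = r ^ N * r ^ M" unfolding power_int_of_nat power_add ..
    have "1 + int (N + M) = int (Suc (N + M))" by simp
    then show "r powi (1 + int (N + M)) = r ^ Suc (N + M)" by (simp only: power_int_of_nat)
  qed
  have 10: "qpoch_inf (B * r ^ Suc N) r = qpoch (B * r ^ Suc N) r M * qpoch_inf (B * r ^ Suc (N + M)) r"
  proof -
    have "B * r ^ Suc N * r ^ M = B * r ^ Suc (N + M)" by (simp add: power_add)
    then show ?thesis using qpoch_inf_split[OF nr, of "B * r ^ Suc N" M] by (simp only:)
  qed
  have Mm: "M + m = m + M" by simp
  have gen: "AB * (rr * (nu * ze)) * (BM * Bk * (Ai / AN) * (Qi / qM) * (ei / eM)) * (qn / qM * (en / eM)) / (ze * rr * (Qi * Bk) * th * qm) / (bm * X\<^sup>2 * mu\<^sup>2 * Tm)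
     * (1 / (zm * Tm * qm) * (WW * (BM * Bk * (Ai / AN))))
     = AB * (nu * ze) * Bk * Ai\<^sup>2 * ei * en * WW / (qn * th) * (Tm\<^sup>2 * mu * X\<^sup>2 * (TM\<^sup>2 * ze) / (mu * ze)\<^sup>2) * (mu / (zm * bm) / (Tm\<^sup>2 * mu * X)\<^sup>2 * ((TM * qn / (qm * (X * (TM\<^sup>2 * ze))))\<^sup>2 * BM\<^sup>2 * ze\<^sup>2 / (eM * qM)\<^sup>2) / AN\<^sup>2)"
    if "rr \<noteq> 0" "ze \<noteq> 0" "AN \<noteq> 0" "Qi \<noteq> 0" "qM \<noteq> 0" "qm \<noteq> 0" "Bk \<noteq> 0" "TM \<noteq> 0" "th \<noteq> 0" "qn \<noteq> 0" "bm \<noteq> 0" "eM \<noteq> 0" "X \<noteq> 0" "mu \<noteq> 0" "Tm \<noteq> 0" "zm \<noteq> 0"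
    for AB rr nu ze BM Bk Ai AN Qi qM ei eM qn en th qm bm X mu Tm zm WW TM :: real
    using that by (simp add: field_simps power2_eq_square)
  show ?thesis
    unfolding cP_def bql_norm_def asc_hinv_def coup_sq_def 1 2 3 4 5 AB_prod 10 A_split r_split e_split Mm 7 8 t_power 6 9 neg_power_sq power_add[of r m M]
    by (rule gen) (use r z \<beta> pos(1)[of N] pos(2)[of M] pos(3,4,6) pos(7)[of "N + M"] in \<open>auto simp: less_imp_neq[THEN not_sym]\<close>)
qed

lemma HHr_gt: "HHr r (- \<beta> * r) n X (int M) = bql_sum n X (r ^ M) (- \<beta>) r / qpoch r r M"
  unfolding HHr_def bql_sum_def sum_divide_distrib
proof (intro sum.cong refl)
  fix l
  have "nat (int M + int l) = M + l" by simp
  then have "rqr r (int M + int l) = 1 / (qpoch r r M * qpoch (r ^ M * r) r l)"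
    using qpoch_add[of r r M l] by (simp add: rqr_def mult.commute)
  then show "qpoch (r powi - int n) r l * qpoch X r l * rqr r (int M + int l) / (qpoch (- \<beta> * r) r l * qpoch r r l) * r ^ l
    = qpoch (r powi - int n) r l * qpoch X r l / (qpoch r r l * qpoch (r ^ M * r) r l * qpoch (- \<beta> * r) r l) * r ^ l / qpoch r r M"
    by (simp add: mult_ac)
qed

text \<open>Since 1/(r;r)_(l-M) is 0 for l < M, the sum starts at l = M; reindexing by M gives a big
  q-Laguerre sum of degree m.\<close>

lemma HHr_le: "HHr r (- \<beta> * r) (m + M) (B * r ^ Suc N) (- int M)
   = qpoch (r powi (- int (m + M))) r M * qpoch (B * r ^ Suc N) r M * r ^ M / (qpoch (- \<beta> * r) r M * qpoch r r M) * bql_sum m (B * r ^ Suc (N + M)) (r ^ M) (- \<beta> * r ^ M) r"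
proof -
  define f where "f l = qpoch (r powi (- int (m + M))) r l * qpoch (B * r ^ Suc N) r l * rqr r (- int M + int l) / (qpoch (- \<beta> * r) r l * qpoch r r l) * r ^ l" for l
  have "HHr r (- \<beta> * r) (m + M) (B * r ^ Suc N) (- int M) = (\<Sum>l\<le>m + M. f l)" unfolding HHr_def f_def ..
  also have "\<dots> = (\<Sum>l\<in>{M..m + M}. f l)"
    by (rule sum.mono_neutral_right) (auto simp: f_def rqr_def)
  also have "\<dots> = (\<Sum>l\<le>m. f (M + l))"
    by (rule sum.reindex_bij_witness[of _ "\<lambda>l. M + l" "\<lambda>l. l - M"]) auto
  also have "\<dots> = (\<Sum>l\<le>m. qpoch (r powi (- int (m + M))) r M * qpoch (B * r ^ Suc N) r M * r ^ M / (qpoch (- \<beta> * r) r M * qpoch r r M) *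
      (qpoch (r powi (- int m)) r l * qpoch (B * r ^ Suc (N + M)) r l / (qpoch r r l * qpoch (r ^ M * r) r l * qpoch (- \<beta> * r ^ M * r) r l) * r ^ l))"
  proof (intro sum.cong refl)
    fix l
    have 1: "r powi (- int (m + M)) * r ^ M = r powi (- int m)" unfolding powi_neg_nat using r by (simp add: power_add)
    have 2: "B * r ^ Suc N * r ^ M = B * r ^ Suc (N + M)" by (simp add: power_add)
    have 3: "- \<beta> * r * r ^ M = - \<beta> * r ^ M * r" "r * r ^ M = r ^ M * r" by simp_all
    have 4: "rqr r (- int M + int (M + l)) = 1 / qpoch r r l" by (simp add: rqr_def)
    show "f (M + l) = qpoch (r powi (- int (m + M))) r M * qpoch (B * r ^ Suc N) r M * r ^ M / (qpoch (- \<beta> * r) r M * qpoch r r M) *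
      (qpoch (r powi (- int m)) r l * qpoch (B * r ^ Suc (N + M)) r l / (qpoch r r l * qpoch (r ^ M * r) r l * qpoch (- \<beta> * r ^ M * r) r l) * r ^ l)"
      unfolding f_def qpoch_add 1 2 3 4 power_add by (simp add: mult_ac)
  qed
  finally show ?thesis unfolding bql_sum_def sum_distrib_left[symmetric] .
qed

text \<open>The squares agree by \<open>coup_sq_le\<close> and \<open>coup_sq_gt\<close>, so only
  signs remain: (-1)^M from (r^(-n);r)_M if m \<le> n, and (-1)^(m-n) from the reading of the
  degenerate \<open>L_bar\<close> otherwise. Together with the sign of t^m each becomes (-1)^n
  sg^m.\<close>

lemma coupling_coefficient_identity:
  fixes k :: int and n m N :: nat and sg :: real
  assumes N: "int N = k + int m - int n" and sg: "sg = 1 \<or> sg = - 1" "t = - sg * \<bar>t\<bar>"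
  defines "D \<equiv> (if m \<le> n then L_bar m (B * r ^ Suc (N + (n - m))) (r ^ (n - m)) (- \<beta> * r ^ (n - m)) r
      else (- 1) ^ (m - n) * L_bar n (B * r ^ Suc N) (r ^ (m - n)) (- \<beta>) r)"
  shows "sg ^ m * D * (sqrt (asc_hinv r z m) * sqrt (W * (qpoch_inf (r ^ (N + 1)) r * qpoch_inf (A * B * r ^ N) r))) * qpoch A r N
    = (- 1) ^ n * sqrt (coup_sq k n) * ((t / r ^ n) ^ m * HHr r (- \<beta> * r) n (B * r ^ Suc N) (int m - int n))"
proof (cases "m \<le> n")
  case True
  define M where "M = n - m"
  have n: "n = m + M" using True by (simp add: M_def)
  have k: "k = int (N + M)" using N n by simp
  define p where "p = qpoch (r powi (- int (m + M))) r M"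
  define c where "c = qpoch (B * r ^ Suc N) r M * r ^ M / (qpoch (- \<beta> * r) r M * qpoch r r M)"
  define F where "F = bql_sum m (B * r ^ Suc (N + M)) (r ^ M) (- \<beta> * r ^ M) r"
  have cd: "r ^ M * (- \<beta> * r ^ M) < 0" using r \<beta> by (simp add: mult_pos_pos)
  have D: "D = sqrt (bql_norm m (B * r ^ Suc (N + M)) (r ^ M) (- \<beta> * r ^ M) r) * F"
    unfolding D_def M_def[symmetric] F_def if_P[OF True] by (rule L_bar_eq[OF r cd])
  have cpos: "c \<ge> 0"
  proof -
    have "B * r ^ Suc N < 1" using B \<beta> r power_Suc_less_one[OF r, of N] by (auto intro: less_trans[OF mult_neg_pos])
    then show ?thesis unfolding c_def using qpoch_pos[OF r] pos(2)[of M] pos(3)[of M] r by (intro divide_nonneg_pos mult_nonneg_nonneg mult_pos_pos) (auto simp: less_imp_le)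
  qed
  \<comment> \<open>The reversal formula exhibits p as (-1)^M times a positive number.\<close>
  have psgn: "\<bar>p\<bar> = (-1) ^ M * p"
  proof -
    have "p * (qpoch r r m * r ^ ((m + M) * M)) = (-1) ^ M * (r ^ (M * (M - 1) div 2) * qpoch r r (m + M))"
      using qpoch_neg_power[of M "m + M" r] r by (simp add: mult.assoc p_def)
    then have "(-1) ^ M * p * (qpoch r r m * r ^ ((m + M) * M)) = r ^ (M * (M - 1) div 2) * qpoch r r (m + M)"
      by (simp add: mult.assoc)
    moreover have "qpoch r r m * r ^ ((m + M) * M) > 0" "r ^ (M * (M - 1) div 2) * qpoch r r (m + M) > 0"
      using pos(3) r by simp_all
    ultimately have "(-1) ^ M * p > 0" by (metis zero_less_mult_pos2)
    then show ?thesis by (cases "even M") auto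
  qed
  have "sqrt (bql_norm m (B * r ^ Suc (N + M)) (r ^ M) (- \<beta> * r ^ M) r) * (sqrt (asc_hinv r z m) * sqrt (W * (qpoch_inf (r ^ (N + 1)) r * qpoch_inf (A * B * r ^ N) r)))
     = sqrt (coup_sq k n) * \<bar>\<bar>t\<bar> ^ m / (r ^ n) ^ m * (p * c) / qpoch A r N\<bar>"
    using arg_cong[OF coup_sq_le[of m N M], of sqrt] unfolding k n
    by (simp only: real_sqrt_mult real_sqrt_abs p_def c_def times_divide_eq_right mult.assoc)
  also have "\<bar>\<bar>t\<bar> ^ m / (r ^ n) ^ m * (p * c) / qpoch A r N\<bar> = \<bar>t\<bar> ^ m / (r ^ n) ^ m * ((-1) ^ M * p * c) / qpoch A r N"
    unfolding abs_divide abs_mult psgn using cpos pos(1)[of N] r by (simp add: abs_of_nonneg)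
  finally have main: "sqrt (bql_norm m (B * r ^ Suc (N + M)) (r ^ M) (- \<beta> * r ^ M) r) * (sqrt (asc_hinv r z m) * sqrt (W * (qpoch_inf (r ^ (N + 1)) r * qpoch_inf (A * B * r ^ N) r)))
     = sqrt (coup_sq k n) * (\<bar>t\<bar> ^ m / (r ^ n) ^ m * ((-1) ^ M * p * c) / qpoch A r N)" .
  have H: "HHr r (- \<beta> * r) n (B * r ^ Suc N) (int m - int n) = p * c * F"
  proof -
    have "int m - int n = - int M" unfolding n by simp
    then show ?thesis unfolding n using HHr_le[of m M N] by (simp add: p_def c_def F_def)
  qed
  have tm: "(t / r ^ n) ^ m = (-1) ^ m * sg ^ m * (\<bar>t\<bar> ^ m / (r ^ n) ^ m)"
  proof -
    have "(t / r ^ n) ^ m = ((-1) * sg * (\<bar>t\<bar> / r ^ n)) ^ m" by (subst sg(2)) simp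
    then show ?thesis by (simp only: power_mult_distrib power_divide)
  qed
  have sgn: "(-1 :: real) ^ n * (-1) ^ m = (-1) ^ M"
    unfolding n power_add by (simp flip: power_mult_distrib add: mult_ac)
  have gen: "s * (g * F) * h * A' = sn * K * (sm * s * T * (p * c * F))"
    if "g * h = K * (T * (sM * p * c) / A')" "sn * sm = sM" "A' \<noteq> 0" for s g F h A' sn K sm T p c sM :: real
  proof -
    have "s * (g * F) * h * A' = (g * h) * (s * F * A')" by simp
    then show ?thesis unfolding that(1) that(2)[symmetric] using that(3) by (simp add: mult_ac)
  qed
  show ?thesis unfolding D H tm
    by (rule gen[OF main sgn]) (use pos(1)[of N] in simp)
next
  case False
  define M where "M = m - n"
  have m: "m = n + M" using False by (simp add: M_def)
  have k: "int N = k + int M" using N m by simp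
  define F where "F = bql_sum n (B * r ^ Suc N) (r ^ M) (- \<beta>) r"
  have cd: "r ^ M * (- \<beta>) < 0" using r \<beta> by simp
  have D: "D = (-1) ^ M * (sqrt (bql_norm n (B * r ^ Suc N) (r ^ M) (- \<beta>) r) * F)"
    unfolding D_def M_def[symmetric] F_def if_not_P[OF False] by (simp only: L_bar_eq[OF r cd])
  have "sqrt (bql_norm n (B * r ^ Suc N) (r ^ M) (- \<beta>) r) * (sqrt (asc_hinv r z m) * sqrt (W * (qpoch_inf (r ^ (N + 1)) r * qpoch_inf (A * B * r ^ N) r)))
     = sqrt (coup_sq k n) * \<bar>\<bar>t\<bar> ^ m / (r ^ n) ^ m / (qpoch r r M * qpoch A r N)\<bar>"
    using arg_cong[OF coup_sq_gt[OF k, of n], of sqrt] unfolding m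
    by (simp only: real_sqrt_mult real_sqrt_abs)
  also have "\<bar>\<bar>t\<bar> ^ m / (r ^ n) ^ m / (qpoch r r M * qpoch A r N)\<bar> = \<bar>t\<bar> ^ m / (r ^ n) ^ m / (qpoch r r M * qpoch A r N)"
    using pos(1)[of N] pos(3)[of M] r by (simp add: abs_of_nonneg abs_mult)
  finally have main: "sqrt (bql_norm n (B * r ^ Suc N) (r ^ M) (- \<beta>) r) * (sqrt (asc_hinv r z m) * sqrt (W * (qpoch_inf (r ^ (N + 1)) r * qpoch_inf (A * B * r ^ N) r)))
     = sqrt (coup_sq k n) * (\<bar>t\<bar> ^ m / (r ^ n) ^ m / (qpoch r r M * qpoch A r N))" .
  have H: "HHr r (- \<beta> * r) n (B * r ^ Suc N) (int m - int n) = F / qpoch r r M"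
  proof -
    have "int m - int n = int M" unfolding m by simp
    then show ?thesis using HHr_gt[of n _ M] by (simp add: F_def)
  qed
  have tm: "(t / r ^ n) ^ m = (-1) ^ m * sg ^ m * (\<bar>t\<bar> ^ m / (r ^ n) ^ m)"
  proof -
    have "(t / r ^ n) ^ m = ((-1) * sg * (\<bar>t\<bar> / r ^ n)) ^ m" by (subst sg(2)) simp
    then show ?thesis by (simp only: power_mult_distrib power_divide)
  qed
  have sgn: "(-1 :: real) ^ n * (-1) ^ m = (-1) ^ M"
    unfolding m power_add by (simp flip: power_mult_distrib mult.assoc)
  have gen: "s * (sM * (g * F)) * h * A' = sn * K * (sm * s * T * (F / qM))"
    if "g * h = K * (T / (qM * A'))" "sn * sm = sM" "A' \<noteq> 0" for s g F h A' sn K sm T qM sM :: real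
  proof -
    have "s * (sM * (g * F)) * h * A' = (g * h) * (s * sM * F * A')" by simp
    then show ?thesis unfolding that(1) that(2)[symmetric] using that(3) by (simp add: mult_ac)
  qed
  show ?thesis unfolding D H tm
    by (rule gen[OF main sgn]) (use pos(1)[of N] in simp)
qed

end

section \<open>The parameters of the coupling problem\<close>

context
  fixes q0 \<tau> \<sigma> \<nu> lam rr zz :: real and x :: complex
  assumes q0: "0 < q0" "q0 < 1" and x1: "norm x = 1"
    and g1: "x = 1 \<Longrightarrow> \<nexists>n::int. \<tau> - \<sigma> = 2 * of_int n + 1"
    and g2: "x = -1 \<Longrightarrow> \<nexists>n::int. \<tau> + \<sigma> = 2 * of_int n + 1"
    and lam: "lam \<in> {-1, q0 powr (2 * \<tau>)}" and nu: "\<nu> \<in> {-1, q0 powr (2 * \<tau>)}"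
    and rr_def: "rr = q0\<^sup>2" and zz_def: "zz = q0 powr (2 * \<sigma>)"
begin

text \<open>Equal to q^(-2 \<tau>) for \<lambda> = -1 and to q^(2 \<tau>) for \<lambda> = q^(2
  \<tau>); -bt is the other big q-Laguerre parameter besides the power of the base.\<close>

definition "bt = lam\<^sup>2 / q0 powr (2 * \<tau>)"
definition "br = \<nu> * q0 powr (1 - \<sigma> - \<tau>)"
definition "ar = - zz * br"
definition "Br = (if \<nu> \<noteq> lam then 1 else - bt)"
definition "Ar = - rr * Br / bt"
text \<open>Chosen so that the third parameter of c^(\<tau>,\<sigma>) is -tr y; the first two are
  then rr/tr and -bt tr.\<close>

definition "tr = - (q0 powr (1 + \<tau> - \<sigma>) / lam)"

lemma rr: "0 < rr" "rr < 1" "\<bar>rr\<bar> < 1" and zz: "0 < zz"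
  using q0 by (auto simp: rr_def zz_def power_less_one_iff)

lemma rr_nz [simp]: "rr \<noteq> 0" using rr by simp

lemma powrs:
  "q0 powr (2 * \<tau>) = (q0 powr \<tau>)\<^sup>2" "zz = (q0 powr \<sigma>)\<^sup>2" "q0 powr (1 - \<sigma> - \<tau>) = q0 / (q0 powr \<sigma> * q0 powr \<tau>)"
  "q0 powr (1 - \<tau> - \<sigma>) = q0 / (q0 powr \<sigma> * q0 powr \<tau>)"
  "q0 powr (1 + \<tau> - \<sigma>) = q0 * q0 powr \<tau> / q0 powr \<sigma>" "q0 powr (\<sigma> - \<tau> + 1) = q0 * q0 powr \<sigma> / q0 powr \<tau>"
  "q0 powr (1 - \<tau> + \<sigma>) = q0 * q0 powr \<sigma> / q0 powr \<tau>"
  "q0 powr (- 2 * \<tau>) = 1 / (q0 powr \<tau>)\<^sup>2" "q0 powr (2 - 2 * \<tau>) = q0\<^sup>2 / (q0 powr \<tau>)\<^sup>2"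
proof -
  have 2: "q0 powr (2 * u) = (q0 powr u)\<^sup>2" for u
    using powr_add[of q0 u u] by (simp add: power2_eq_square)
  show "q0 powr (2 * \<tau>) = (q0 powr \<tau>)\<^sup>2" "zz = (q0 powr \<sigma>)\<^sup>2" unfolding zz_def by (rule 2)+
  have "q0 powr (- 2 * \<tau>) = 1 / q0 powr (2 * \<tau>)" using powr_minus_divide[of q0 "2 * \<tau>"] by simp
  then show "q0 powr (- 2 * \<tau>) = 1 / (q0 powr \<tau>)\<^sup>2" unfolding 2 .
  have "q0 powr (2 - 2 * \<tau>) = q0 powr 2 / q0 powr (2 * \<tau>)" by (rule powr_diff)
  then show "q0 powr (2 - 2 * \<tau>) = q0\<^sup>2 / (q0 powr \<tau>)\<^sup>2" unfolding 2 using q0 by simp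
qed (use q0 in \<open>simp_all add: powr_diff powr_add mult.commute\<close>)

lemma PR: "q0 powr \<tau> > 0" "q0 powr \<sigma> > 0" using q0 by simp_all

lemma lam_cases: obtains "lam = - 1" | "lam = (q0 powr \<tau>)\<^sup>2"
  using lam unfolding powrs by auto

lemma nu_lam: "(if \<nu> \<noteq> lam then \<nu> * lam = - ((q0 powr \<tau>)\<^sup>2) else \<nu> * lam = lam\<^sup>2)"
  using lam nu unfolding powrs by (auto simp: power2_eq_square)

lemma lam_nz: "lam \<noteq> 0" "\<nu> \<noteq> 0" using lam nu PR unfolding powrs by auto

lemma bt_pos: "bt > 0" using lam_nz q0 by (simp add: bt_def)

lemma tr_sq: "tr * tr = rr / (zz * bt)"
  unfolding tr_def bt_def rr_def powrs using PR lam_nz by (simp add: field_simps power2_eq_square)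

lemma tr_nz: "tr \<noteq> 0" using lam_nz q0 by (simp add: tr_def)

lemma Br_cases: "Br = 1 \<or> Br = - bt" and Br_nz: "Br \<noteq> 0" using bt_pos by (auto simp: Br_def)

text \<open>For \<nu> \<noteq> \<lambda> the product \<nu> \<lambda> is -q^(2 \<tau>), otherwise it
  is \<lambda>^2. This one formula spares case distinctions in \<open>tr_eq\<close> and
  \<open>ab_eq\<close>.\<close>

lemma minus_nu_lam: "- (\<nu> * lam / (q0 powr \<tau>)\<^sup>2) = Br"
proof -
  have "(q0 powr \<tau>)\<^sup>2 \<noteq> 0" using PR by simp
  then show ?thesis using nu_lam unfolding Br_def bt_def powrs by (auto split: if_splits)
qed

lemma tr_eq: "tr * Br = br"
proof -
  have "tr * Br = q0 * q0 powr \<tau> / q0 powr \<sigma> / lam * (\<nu> * lam / (q0 powr \<tau>)\<^sup>2)"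
    unfolding minus_nu_lam[symmetric] tr_def powrs by simp
  also have "\<dots> = br" unfolding br_def powrs using PR lam_nz by (simp add: field_simps power2_eq_square)
  finally show ?thesis .
qed

lemma ab_eq: "ar * br = Ar * Br"
proof -
  have "ar * br = - zz * (tr * tr) * (Br * Br)" unfolding ar_def tr_eq[symmetric] by simp
  also have "\<dots> = Ar * Br" unfolding tr_sq Ar_def using zz bt_pos by (simp add: field_simps)
  finally show ?thesis .
qed

lemma P_params: "\<nu> \<noteq> lam \<Longrightarrow> Br = 1 \<and> Ar = ar * br \<and> tr = br"
  using ab_eq tr_eq by (simp add: Br_def)

lemma Q_params: "\<nu> = lam \<Longrightarrow> Br = - bt \<and> Ar = rr \<and> Br = ar * br / rr"
proof -
  assume e: "\<nu> = lam"
  have B: "Br = - bt" unfolding Br_def using e by simp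
  have A: "Ar = rr" unfolding Ar_def B using bt_pos by simp
  have "ar * br = rr * Br" using ab_eq unfolding A .
  then have "Br = ar * br / rr" using rr(1) by (simp add: eq_divide_eq mult.commute)
  with A B show ?thesis by blast
qed

lemma a'_eq: "- lam * q0 powr (1 - \<tau> + \<sigma>) = rr / tr" and b'_eq: "lam * q0 powr (1 - \<tau> - \<sigma>) = - bt * tr"
  unfolding tr_def bt_def rr_def powrs using PR lam_nz q0 by (simp_all add: field_simps power2_eq_square)

lemma b'_eq2: "- bt * tr = rr / (tr * - zz)"
proof -
  have "- bt * tr * (tr * - zz) = rr" using tr_sq bt_pos zz by (simp add: field_simps)
  then show ?thesis using tr_nz zz by (simp add: eq_divide_eq)
qed

lemma lt1: "A < 1 \<Longrightarrow> 0 \<le> u \<Longrightarrow> u \<le> 1 \<Longrightarrow> A * u < (1 :: real)"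
  by (cases "A \<le> 0") (auto intro: le_less_trans[OF mult_nonpos_nonneg] le_less_trans[OF mult_left_le])

lemma Ar_less: "Ar < 1" by (rule A_less[OF rr(1,2) zz bt_pos Ar_def tr_sq Br_cases])

lemma loc0: "asc_coupling rr zz x (of_real ar) (of_real br) (of_real Ar) (of_real Br)"
proof unfold_locales
  show "0 < rr" "rr < 1" "0 < zz" by (rule rr zz)+
  show "x \<noteq> 0" using x1 by auto
  show "complex_of_real br \<noteq> 0" using lam_nz q0 by (simp add: br_def)
  show "complex_of_real ar = - complex_of_real zz * complex_of_real br" by (simp add: ar_def)
  show "complex_of_real Ar = of_real ar * of_real br \<and> complex_of_real Br = 1 \<or> complex_of_real Ar = of_real rr \<and> complex_of_real Br = of_real ar * of_real br / of_real rr"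
  proof (cases "\<nu> = lam")
    case True
    have "Ar = rr" "Br = ar * br / rr" using Q_params[OF True] by blast+
    then have "complex_of_real Ar = of_real rr" "complex_of_real Br = of_real (ar * br / rr)" by (simp_all only:)
    then show ?thesis by (simp only: of_real_mult of_real_divide) simp
  next
    case False
    have "Ar = ar * br" "Br = 1" using P_params[OF False] by blast+
    then have "complex_of_real Ar = of_real (ar * br)" "complex_of_real Br = 1" by (simp_all only: of_real_1)
    then show ?thesis by (simp only: of_real_mult) simp
  qed
  show "complex_of_real Ar * of_real rr ^ n \<noteq> 1" for n
  proof -
    have "Ar * rr ^ n < 1" using rr by (intro lt1 Ar_less) (auto simp: power_le_one)
    then show ?thesis by (metis of_real_mult of_real_power of_real_eq_1_iff less_irrefl)
  qed
  show "(complex_of_real rr)\<^sup>2 * of_real Br / of_real Ar * of_real rr ^ n \<noteq> 1" for n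
  proof -
    have "rr\<^sup>2 * Br / Ar * rr ^ n = - (bt * rr * rr ^ n)"
      unfolding Ar_def using Br_nz bt_pos rr q0 by (simp add: field_simps power2_eq_square)
    moreover have "bt * rr * rr ^ n > 0" using bt_pos rr by simp
    ultimately have "rr\<^sup>2 * Br / Ar * rr ^ n \<noteq> 1" by linarith
    then show ?thesis by (metis of_real_mult of_real_power of_real_divide of_real_eq_1_iff)
  qed
qed

interpretation L0: asc_coupling rr zz x "of_real ar" "of_real br" "of_real Ar" "of_real Br" by (rule loc0)

lemma t_eq: "L0.t = of_real tr" and e_eq: "L0.e = of_real (- bt * rr)"
proof -
  have "tr = br / Br" using tr_eq Br_nz by (simp add: field_simps)
  then show "L0.t = of_real tr" unfolding L0.t_def by simp
  have "rr\<^sup>2 * Br / Ar = - bt * rr" unfolding Ar_def using Br_nz bt_pos q0 by (simp add: field_simps power2_eq_square)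
  then have "complex_of_real (rr\<^sup>2 * Br / Ar) = of_real (- bt * rr)" by (simp only:)
  then show "L0.e = of_real (- bt * rr)" unfolding L0.e_def by simp
qed

text \<open>Comparing signs and exponents, tr \<kappa> r^i = 1 forces \<tau> - \<sigma> to be an odd
  integer, and tr \<kappa> r^i = -1 forces \<tau> + \<sigma> to be one. The hypotheses on x exclude
  just these coincidences.\<close>

lemma lattice_units:
  assumes \<kappa>: "\<kappa> \<in> {1, - zz}"
  shows "tr * \<kappa> * rr powi i = 1 \<Longrightarrow> x \<noteq> 1" "tr * \<kappa> * rr powi i = - 1 \<Longrightarrow> x \<noteq> - 1"
proof -
  have ri: "rr powi i = q0 powr (2 * of_int i)"
  proof -
    have "q0 powr (2 * of_int i) = (q0 powr 2) powr of_int i" by (simp add: powr_powr)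
    then show ?thesis unfolding rr_def using q0 by (simp add: powr_real_of_int')
  qed
  have e0: "e = 0" if "q0 powr e = 1" for e
  proof -
    have "e * ln q0 = 0" using arg_cong[OF that, of ln] q0 by (simp add: ln_powr)
    moreover have "ln q0 < 0" using q0 by simp
    ultimately show ?thesis by simp
  qed
  have n1: "x \<noteq> 1" if "\<tau> - \<sigma> = 2 * of_int n + 1" for n :: int using g1 that by blast
  have n2: "x \<noteq> - 1" if "\<tau> + \<sigma> = 2 * of_int n + 1" for n :: int using g2 that by blast
  have pw: "q0 powr u * q0 powr (2 * of_int i) = q0 powr (u + 2 * of_int i)" "q0 powr u * zz * q0 powr (2 * of_int i) = q0 powr (u + 2 * \<sigma> + 2 * of_int i)" for u
    by (simp_all add: powr_add zz_def)
  have pp: "q0 powr u > 0" for u using q0 by simp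
  have le: "lam = - 1 \<or> lam = q0 powr (2 * \<tau>)" using lam by auto
  have tr1: "lam = - 1 \<Longrightarrow> tr = q0 powr (1 + \<tau> - \<sigma>)" unfolding tr_def by simp
  have tr2: "lam = q0 powr (2 * \<tau>) \<Longrightarrow> tr = - (q0 powr (1 - \<tau> - \<sigma>))"
  proof -
    assume l: "lam = q0 powr (2 * \<tau>)"
    have "q0 powr (1 + \<tau> - \<sigma>) / q0 powr (2 * \<tau>) = q0 powr (1 - \<tau> - \<sigma>)"
      unfolding powr_diff[symmetric] by (rule arg_cong[of _ _ "\<lambda>u. q0 powr u"]) simp
    then show ?thesis unfolding tr_def unfolding l by simp
  qed
  have c1: "tr * 1 * rr powi i = q0 powr (1 + \<tau> - \<sigma> + 2 * of_int i)" "tr * - zz * rr powi i = - (q0 powr (1 + \<tau> - \<sigma> + 2 * \<sigma> + 2 * of_int i))" if "lam = - 1"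
    unfolding ri tr1[OF that] using pw(1)[of "1 + \<tau> - \<sigma>"] pw(2)[of "1 + \<tau> - \<sigma>"] by (simp_all only: mult_1_right mult_minus_right mult_minus_left minus_minus)
  have c2: "tr * 1 * rr powi i = - (q0 powr (1 - \<tau> - \<sigma> + 2 * of_int i))" "tr * - zz * rr powi i = q0 powr (1 - \<tau> - \<sigma> + 2 * \<sigma> + 2 * of_int i)" if "lam = q0 powr (2 * \<tau>)"
    unfolding ri tr2[OF that] using pw(1)[of "1 - \<tau> - \<sigma>"] pw(2)[of "1 - \<tau> - \<sigma>"] by (simp_all only: mult_1_right mult_minus_right mult_minus_left minus_minus)
  have np: "- (q0 powr u) \<noteq> 1" "q0 powr u \<noteq> - 1" for u using pp[of u] by linarith+
  show "x \<noteq> 1" if h: "tr * \<kappa> * rr powi i = 1"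
    using le
  proof
    assume l: "lam = - 1"
    have "\<kappa> = 1" using \<kappa> h c1(2)[OF l] np by auto
    then have "1 + \<tau> - \<sigma> + 2 * of_int i = 0" using h c1(1)[OF l] e0 by simp
    then show ?thesis by (intro n1[of "- i - 1"]) simp
  next
    assume l: "lam = q0 powr (2 * \<tau>)"
    have "\<kappa> = - zz" using \<kappa> h c2(1)[OF l] np by auto
    then have "1 - \<tau> - \<sigma> + 2 * \<sigma> + 2 * of_int i = 0" using h c2(2)[OF l] e0 by simp
    then show ?thesis by (intro n1[of i]) simp
  qed
  show "x \<noteq> - 1" if h: "tr * \<kappa> * rr powi i = - 1"
    using le
  proof
    assume l: "lam = - 1"
    have "\<kappa> = - zz" using \<kappa> h c1(1)[OF l] np by auto
    then have "1 + \<tau> - \<sigma> + 2 * \<sigma> + 2 * of_int i = 0" using h c1(2)[OF l] e0 by simp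
    then show ?thesis by (intro n2[of "- i - 1"]) simp
  next
    assume l: "lam = q0 powr (2 * \<tau>)"
    have "\<kappa> = 1" using \<kappa> h c2(2)[OF l] np by auto
    then have "1 - \<tau> - \<sigma> + 2 * of_int i = 0" using h c2(1)[OF l] e0 by simp
    then show ?thesis by (intro n2[of i]) simp
  qed
qed

text \<open>A real number times a point of the unit circle can equal 1 only if both are 1 or both
  are -1.\<close>

lemma unit_real:
  assumes \<kappa>: "\<kappa> \<in> {1, - zz}"
  shows "of_real (tr * \<kappa> * rr powi i) * x \<noteq> 1" "of_real (tr * \<kappa> * rr powi i) / x \<noteq> 1"
proof -
  define u where "u = tr * \<kappa> * rr powi i"
  have nz: "x \<noteq> 0" using x1 by auto
  have nu1: "norm (of_real u * x) = \<bar>u\<bar>" "norm (of_real u / x) = \<bar>u\<bar>" using x1 by (simp_all add: norm_mult norm_divide)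
  have k: "False" if h: "of_real u * x = 1 \<or> of_real u / x = 1"
  proof -
    have "\<bar>u\<bar> = 1" using h nu1 by auto
    then consider "u = 1" | "u = - 1" by linarith
    then show False
    proof cases
      case 1
      have "x = 1" using h nz unfolding 1 by (auto simp: divide_eq_eq)
      then show False using lattice_units(1)[OF \<kappa>, of i] 1 unfolding u_def by blast
    next
      case 2
      have "- x = 1 \<or> - 1 = x" using h nonzero_divide_eq_eq[OF nz, of "of_real u" 1] unfolding 2 by simp
      then have "x = - 1" by (metis add.inverse_inverse)
      then show False using lattice_units(2)[OF \<kappa>, of i] 2 unfolding u_def by blast
    qed
  qed
  show "of_real (tr * \<kappa> * rr powi i) * x \<noteq> 1" "of_real (tr * \<kappa> * rr powi i) / x \<noteq> 1" using k by (auto simp: u_def)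
qed

lemma loc: "asc_coupling_generic rr zz x (of_real ar) (of_real br) (of_real Ar) (of_real Br)"
proof (rule asc_coupling_generic.intro[OF loc0 asc_coupling_generic_axioms.intro])
  fix \<kappa> :: real and i :: int assume \<kappa>: "\<kappa> \<in> {1, - zz}"
  show "L0.t * x * complex_of_real \<kappa> * complex_of_real rr powi i \<noteq> 1"
    using unit_real(1)[OF \<kappa>, of i] unfolding t_eq by (simp add: mult_ac)
  show "L0.t / x * complex_of_real \<kappa> * complex_of_real rr powi i \<noteq> 1"
    using unit_real(2)[OF \<kappa>, of i] unfolding t_eq by (simp add: mult_ac)
qed

interpretation L: asc_coupling_generic rr zz x "of_real ar" "of_real br" "of_real Ar" "of_real Br" by (rule loc)

text \<open>Since the conjugate of x is 1/x, this real number is (c x, c/x;rr)_inf for real c; hence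
  all weights become real and nonnegative.\<close>

definition nn :: "real \<Rightarrow> real" where "nn c = (norm (qpoch_inf (of_real c * x) (of_real rr)))\<^sup>2"

lemma cnj_x: "cnj x = 1 / x"
proof -
  have "x * cnj x = 1" using complex_norm_square[of x] x1 by simp
  then show ?thesis using x1 by (metis nonzero_eq_divide_eq mult.commute norm_zero zero_neq_one)
qed

lemma nn_eq: "qpoch_inf (of_real c * x) (of_real rr) * qpoch_inf (of_real c / x) (of_real rr) = of_real (nn c)"
proof -
  have "cnj (qpoch_inf (of_real c * x) (of_real rr)) = qpoch_inf (of_real c / x) (of_real rr)"
    using cnj_qpoch_inf[OF L0.nq, of "of_real c * x"] by (simp add: cnj_x)
  then show ?thesis unfolding nn_def complex_norm_square by simp
qed

lemma nn_pos_iff: "nn c > 0 \<longleftrightarrow> (\<forall>n. of_real c * x * of_real rr ^ n \<noteq> 1)"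
  unfolding nn_def using qpoch_inf_eq_0_iff[OF L0.nq, of "of_real c * x"] by auto

lemma nn_lattice: "\<kappa> \<in> {1, - zz} \<Longrightarrow> nn (tr * \<kappa> * rr powi i) > 0"
proof -
  assume \<kappa>: "\<kappa> \<in> {1, - zz}"
  have "of_real (tr * \<kappa> * rr powi i) * x * of_real rr ^ n \<noteq> 1" for n
  proof -
    have "tr * \<kappa> * rr powi (i + int n) = tr * \<kappa> * rr powi i * rr ^ n" using q0 by (simp add: power_int_add)
    then have "of_real (tr * \<kappa> * rr powi (i + int n)) * x = of_real (tr * \<kappa> * rr powi i) * x * of_real rr ^ n" by (simp only:) (simp only: of_real_mult of_real_power mult_ac)
    then show ?thesis using unit_real(1)[OF \<kappa>, of "i + int n"] by (simp only: not_False_eq_True)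
  qed
  then show ?thesis by (simp only: nn_pos_iff) simp
qed

text \<open>A zero of the product would be a resonance at a negative exponent, after taking
  reciprocals.\<close>

lemma nn_dual: "\<kappa> \<in> {1, - zz} \<Longrightarrow> nn (rr / (tr * \<kappa>)) > 0"
proof -
  assume \<kappa>: "\<kappa> \<in> {1, - zz}"
  have "of_real (rr / (tr * \<kappa>)) * x * of_real rr ^ n \<noteq> 1" for n
  proof
    assume h: "of_real (rr / (tr * \<kappa>)) * x * of_real rr ^ n = 1"
    have nz: "x \<noteq> 0" "tr * \<kappa> \<noteq> 0" "rr ^ Suc n \<noteq> 0" using x1 tr_nz \<kappa> zz q0 by auto
    have "of_real (tr * \<kappa> * rr powi (- int (Suc n))) / x = 1 / (of_real (rr / (tr * \<kappa>)) * x * of_real rr ^ n)"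
      unfolding powi_neg_nat using nz by (simp add: field_simps)
    then show False using h unit_real(2)[OF \<kappa>, of "- int (Suc n)"] by simp
  qed
  then show ?thesis by (simp only: nn_pos_iff) simp
qed

text \<open>For \<nu> = \<lambda> the parameters ar, br are rr/tr and -bt tr; otherwise they are -zz
  tr and tr. Either way they are covered by \<open>nn_dual\<close> or
  \<open>nn_lattice\<close>.\<close>

lemma om_pos: "nn ar > 0" "nn br > 0" "nn (rr / tr) > 0" "nn (- bt * tr) > 0"
proof -
  show 1: "nn (rr / tr) > 0" using nn_dual[of 1] by simp
  show 2: "nn (- bt * tr) > 0" unfolding b'_eq2 by (rule nn_dual) simp
  show "nn ar > 0" "nn br > 0"
  proof (atomize (full), cases "\<nu> = lam")
    case True
    have b: "br = - bt * tr" using tr_eq unfolding Q_params[OF True, THEN conjunct1] by (simp add: mult.commute)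
    have "ar = zz * bt * (tr * tr) / tr" unfolding ar_def b using tr_nz by simp
    then have "ar = rr / tr" unfolding tr_sq using zz bt_pos by simp
    then show "0 < nn ar \<and> 0 < nn br" using 1 2 b by simp
  next
    case False
    have b: "br = tr * 1 * rr powi 0" "ar = tr * - zz * rr powi 0" using P_params[OF False] by (simp_all add: ar_def)
    show "0 < nn ar \<and> 0 < nn br" unfolding b using nn_lattice by blast
  qed
qed

text \<open>Off x^2 = 1 the numerator is a squared modulus and 1 - \<mu>_x^2 = (Im x)^2, so the root
  is |Im x|, which is nonzero.\<close>

lemma weight_factor_pos: "\<exists>w>0. weight_factor x (of_real rr) = of_real w"
proof (cases "x\<^sup>2 = 1")
  case True
  then show ?thesis unfolding weight_factor_def by (auto intro: exI[of _ 1])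
next
  case False
  have "inverse (x\<^sup>2) = cnj (x\<^sup>2)" by (simp add: cnj_x power_one_over inverse_eq_divide)
  then have 1: "qpoch_inf (x\<^sup>2) (of_real rr) * qpoch_inf (inverse (x\<^sup>2)) (of_real rr) = of_real ((norm (qpoch_inf (x\<^sup>2) (complex_of_real rr)))\<^sup>2)"
    using cnj_qpoch_inf[OF L0.nq, of "x\<^sup>2"] unfolding complex_norm_square by simp
  have 2: "qpoch_inf (x\<^sup>2) (complex_of_real rr) \<noteq> 0"
  proof
    assume "qpoch_inf (x\<^sup>2) (complex_of_real rr) = 0"
    then obtain j where j: "x\<^sup>2 * of_real rr ^ j = 1" unfolding qpoch_inf_eq_0_iff[OF L0.nq] by blast
    have "norm (x\<^sup>2 * of_real rr ^ j) = rr ^ j" using x1 rr by (simp add: norm_mult norm_power)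
    then have "rr ^ j = 1" unfolding j by simp
    show False
    proof (cases j)
      case 0
      then show False using j False by simp
    next
      case (Suc m)
      then show False using \<open>rr ^ j = 1\<close> power_Suc_less_one[OF rr(1,2), of m] by simp
    qed
  qed
  have im: "Im x \<noteq> 0"
  proof
    assume i: "Im x = 0"
    then have "(Re x)\<^sup>2 = 1" using cmod_power2[of x] x1 by simp
    moreover have "x = of_real (Re x)" using i by (simp add: complex_eq_iff)
    ultimately show False using False by (metis of_real_1 of_real_power)
  qed
  have "x + inverse x = x + cnj x" by (simp add: cnj_x inverse_eq_divide)
  also have "\<dots> = of_real (2 * Re x)" by (rule complex_add_cnj)
  finally have "1 - ((x + inverse x) / 2)\<^sup>2 = of_real (1 - (Re x)\<^sup>2)" by simp
  also have "1 - (Re x)\<^sup>2 = (Im x)\<^sup>2"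
  proof -
    have "(Re x)\<^sup>2 + (Im x)\<^sup>2 = 1" using cmod_power2[of x] x1 by simp
    then show ?thesis by simp
  qed
  finally have 3: "csqrt (1 - ((x + inverse x) / 2)\<^sup>2) = of_real \<bar>Im x\<bar>"
    using of_real_sqrt[of "(Im x)\<^sup>2"] by simp
  have "weight_factor x (of_real rr) = of_real ((norm (qpoch_inf (x\<^sup>2) (complex_of_real rr)))\<^sup>2 / (2 * pi * \<bar>Im x\<bar>))"
    unfolding weight_factor_def if_not_P[OF False] 1 3 by simp
  moreover have "(norm (qpoch_inf (x\<^sup>2) (complex_of_real rr)))\<^sup>2 / (2 * pi * \<bar>Im x\<bar>) > 0"
    using 2 im by simp
  ultimately show ?thesis by blast
qed

definition w0 :: real where "w0 = (SOME w. w > 0 \<and> weight_factor x (of_real rr) = of_real w)"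

lemma w0: "w0 > 0" "weight_factor x (of_real rr) = of_real w0"
proof -
  have "\<exists>w. w > 0 \<and> weight_factor x (of_real rr) = of_real w" using weight_factor_pos by blast
  from someI_ex[OF this] show "w0 > 0" "weight_factor x (of_real rr) = of_real w0" unfolding w0_def by auto
qed

definition Wc :: real where "Wc = w0 / (nn ar * nn br)"

lemmas coupling_params = rr(1,2) zz bt_pos Ar_def tr_sq Br_cases

lemma qinf: "qpoch_inf (complex_of_real u) (of_real rr) = of_real (qpoch_inf u rr)"
  by (rule qpoch_inf_of_real[OF rr(3)])

lemma m_ts_eq: "m_ts q0 \<tau> \<sigma> x \<nu> N = of_real (sqrt (Wc * (qpoch_inf (rr ^ (N + 1)) rr * qpoch_inf (Ar * Br * rr ^ N) rr))) * L0.ch N"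
proof -
  have a: "- \<nu> * q0 powr (\<sigma> - \<tau> + 1) = ar"
    unfolding ar_def br_def unfolding powrs using PR by (simp add: field_simps power2_eq_square)
  have z1: "qpoch_inf (0 :: complex) (of_real rr) = 1" using qpoch_inf_zero_left[OF L0.nq] by simp
  define X where "X = Wc * (qpoch_inf (rr ^ (N + 1)) rr * qpoch_inf (Ar * Br * rr ^ N) rr)"
  have X0: "X \<ge> 0"
  proof -
    have b0: "br \<noteq> 0" using lam_nz q0 by (simp add: br_def)
    have "0 < br * br" using b0 not_real_square_gt_zero[of br] by blast
    then have "0 < zz * (br * br)" by (rule mult_pos_pos[OF zz])
    moreover have "ar * br = - (zz * (br * br))" unfolding ar_def by simp
    ultimately have "ar * br < 0" by linarith
    then have "Ar * Br * rr ^ N < 1" unfolding ab_eq[symmetric] using rr by (simp add: less_trans[OF mult_neg_pos])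
    moreover have "rr ^ (N + 1) < 1" using power_Suc_less_one[OF rr(1,2), of N] by simp
    ultimately have "qpoch_inf (rr ^ (N + 1)) rr > 0" "qpoch_inf (Ar * Br * rr ^ N) rr > 0"
      using qpoch_inf_pos[OF rr(1,2)] by blast+
    then show ?thesis unfolding X_def Wc_def using w0 om_pos by simp
  qed
  have "cdqH_weight x (of_real ar) (of_real br) 0 (of_real rr)
            * (qpoch_inf (of_real rr ^ (N + 1)) (of_real rr) * qpoch_inf (of_real ar * of_real br * of_real rr ^ N) (of_real rr)
               * qpoch_inf (of_real ar * 0 * of_real rr ^ N) (of_real rr) * qpoch_inf (of_real br * 0 * of_real rr ^ N) (of_real rr)) = of_real X"
  proof -
    have e1: "complex_of_real ar * of_real br * of_real rr ^ N = of_real (Ar * Br * rr ^ N)" unfolding ab_eq[symmetric] by simp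
    have e2: "complex_of_real rr ^ (N + 1) = of_real (rr ^ (N + 1))" by simp
    show ?thesis
      unfolding cdqH_weight_def nn_eq w0(2) mult_zero_left mult_zero_right div_0 z1 X_def Wc_def e1 e2
      unfolding qinf mult_1_right by simp
  qed
  moreover have "cdqH_poly N x (of_real ar) (of_real br) 0 (of_real rr) = L0.ch N"
    unfolding L0.ch_def using cdqH_0_eq_conv[OF L0.nq L0.q_nz, of "of_real ar" x] L0.a_nz L0.x by simp
  ultimately show ?thesis
    unfolding m_ts_def q_bar_def p_bar_def a br_def[symmetric] rr_def[symmetric] X_def[symmetric] using of_real_sqrt[OF X0] by simp
qed

definition psi :: "real \<Rightarrow> real" where "psi y = nn (- tr * y)"

lemma theta_z_pos: "qtheta (- zz) rr > 0"
proof -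
  have "rr / zz > 0" using rr zz by simp
  then have "rr / - zz < 1" by simp
  moreover have "- zz < 1" using zz by linarith
  ultimately show ?thesis unfolding qtheta_def using rr by (intro mult_pos_pos qpoch_inf_pos) auto
qed

text \<open>Positivity is inherited from the weight by dividing out its other, positive
  factors.\<close>

lemma wt_factor_pos: "v \<in> asc_support rr zz \<Longrightarrow> qpoch_inf (rr * v) rr * qpoch_inf (- rr * v / zz) rr > 0"
proof -
  assume v: "v \<in> asc_support rr zz"
  have "qpoch_inf rr rr > 0" "qtheta (- zz) rr > 0"
    using theta_z_pos qpoch_inf_pos[OF rr(1,2) rr(2)] by simp_all
  moreover have "asc_weight rr zz v > 0" by (rule wt_pos[OF q0, where \<kappa> = \<sigma> and w = v, folded rr_def zz_def, OF v])
  moreover have "\<bar>v\<bar> > 0" using asc_support_nz[OF rr(1,2) zz v] by simp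
  ultimately have W: "0 < asc_weight rr zz v * (qpoch_inf rr rr * qtheta (- zz) rr)" "\<bar>v\<bar> > 0" and D0: "qpoch_inf rr rr * qtheta (- zz) rr \<noteq> 0"
    by simp_all
  have gen: "X / D * D = X" if "D \<noteq> 0" for X D :: real using that by simp
  have "asc_weight rr zz v * (qpoch_inf rr rr * qtheta (- zz) rr) = \<bar>v\<bar> * (qpoch_inf (rr * v) rr * qpoch_inf (- rr * v / zz) rr)"
    unfolding asc_weight_def by (rule gen[OF D0])
  then have "0 < \<bar>v\<bar> * (qpoch_inf (rr * v) rr * qpoch_inf (- rr * v / zz) rr)" using W(1) by (simp only:)
  then show ?thesis using W(2) by (rule zero_less_mult_pos)
qed

lemma psi_lattice: "\<kappa> \<in> {1, - zz} \<Longrightarrow> psi (- \<kappa> * rr powi i) > 0"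
proof -
  assume \<kappa>: "\<kappa> \<in> {1, - zz}"
  have e: "- tr * (- \<kappa> * rr powi i) = tr * \<kappa> * rr powi i" by simp
  show ?thesis unfolding psi_def e by (rule nn_lattice[OF \<kappa>])
qed

lemma psi_point: "v \<in> asc_support rr zz \<Longrightarrow> psi (- v / rr ^ n) > 0"
proof -
  assume "v \<in> asc_support rr zz"
  then have "(\<exists>j. v = 1 * rr ^ j) \<or> (\<exists>j. v = - zz * rr ^ j)" unfolding asc_support_def by auto
  then obtain \<kappa> j where k: "\<kappa> \<in> {1, - zz}" "v = \<kappa> * rr ^ j" by blast
  have "- v / rr ^ n = - \<kappa> * rr powi (int j - int n)" unfolding k using q0 by (simp add: power_int_diff)
  then show ?thesis using psi_lattice[OF k(1)] by (simp only:)
qed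

text \<open>The radicand of \<open>p_bar\<close> in \<open>c_ts\<close>, with every factor
  real.\<close>

definition dd :: "nat \<Rightarrow> real \<Rightarrow> real" where
  "dd n v = w0 / (nn (rr / tr) * nn (- bt * tr) * psi (- v / rr ^ n)) * (qpoch_inf (rr ^ (n + 1)) rr * qpoch_inf (- bt * rr * rr ^ n) rr * (qpoch_inf (rr * v) rr * qpoch_inf (- rr * v / zz) rr))"

lemma dd_pos: "v \<in> asc_support rr zz \<Longrightarrow> dd n v > 0"
proof -
  assume v: "v \<in> asc_support rr zz"
  have "- (bt * rr * rr ^ n) < 1" using bt_pos rr by (smt (verit) mult_pos_pos zero_less_power)
  then have H1: "qpoch_inf (- bt * rr * rr ^ n) rr > 0" using rr by (intro qpoch_inf_pos) auto
  have H2: "qpoch_inf (rr ^ (n + 1)) rr > 0"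
    using power_Suc_less_one[OF rr(1,2), of n] rr by (intro qpoch_inf_pos) auto
  show ?thesis unfolding dd_def
    by (rule mult_pos_pos[OF divide_pos_pos[OF w0(1) mult_pos_pos[OF mult_pos_pos[OF om_pos(3,4)] psi_point[OF v]]] mult_pos_pos[OF mult_pos_pos[OF H2 H1] wt_factor_pos[OF v]]])
qed

lemma c_ts_eq:
  assumes v: "v \<in> asc_support rr zz"
  shows "c_ts q0 \<tau> \<sigma> x lam n (- v / rr ^ n) = of_real (sqrt (dd n v)) * L.pn n (of_real (- v / rr ^ n))"
proof -
  define y where "y = - v / rr ^ n"
  have yv: "y * rr ^ n = - v" using q0 by (simp add: y_def)
  have c': "y * q0 powr (1 + \<tau> - \<sigma>) / lam = - tr * y" by (simp add: tr_def)
  have e1: "rr / tr * (- bt * tr) * rr ^ n = - bt * rr * rr ^ n" using tr_nz by simp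
  have e2: "rr / tr * (- tr * y) * rr ^ n = rr * v"
  proof -
    have "rr / tr * (- tr * y) * rr ^ n = - rr * (y * rr ^ n)" using tr_nz by simp
    then show ?thesis unfolding yv by simp
  qed
  have e3: "- bt * tr * (- tr * y) * rr ^ n = - rr * v / zz"
  proof -
    have "- bt * tr * (- tr * y) * rr ^ n = bt * (tr * tr) * (y * rr ^ n)" by simp
    then show ?thesis unfolding yv tr_sq using bt_pos by simp
  qed
  have "cdqH_weight x (of_real (rr / tr)) (of_real (- bt * tr)) (of_real (- tr * y)) (of_real rr)
            * (qpoch_inf (of_real rr ^ (n + 1)) (of_real rr) * qpoch_inf (of_real (rr / tr) * of_real (- bt * tr) * of_real rr ^ n) (of_real rr)
               * qpoch_inf (of_real (rr / tr) * of_real (- tr * y) * of_real rr ^ n) (of_real rr) * qpoch_inf (of_real (- bt * tr) * of_real (- tr * y) * of_real rr ^ n) (of_real rr)) = of_real (dd n v)"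
    unfolding cdqH_weight_def nn_eq w0(2) dd_def y_def[symmetric] psi_def
    unfolding of_real_mult[symmetric] of_real_power[symmetric] e1 e2 e3 qinf of_real_divide[symmetric] by (simp add: mult.assoc)
  moreover have "L.pn n (of_real y) = cdqH_poly n x (of_real (rr / tr)) (of_real (- bt * tr)) (of_real (- tr * y)) (of_real rr)"
    unfolding L.pn_def t_eq e_eq using q0 by simp
  moreover have "complex_of_real (sqrt (dd n v)) = csqrt (of_real (dd n v))" using of_real_sqrt[of "dd n v"] dd_pos[OF v, of n] by simp
  ultimately show ?thesis unfolding c_ts_def p_bar_def a'_eq b'_eq y_def[symmetric] c' rr_def[symmetric] by simp
qed

lemma c_ts_nz: "v \<in> asc_support rr zz \<Longrightarrow> L.pn n (of_real (- v / rr ^ n)) \<noteq> 0 \<Longrightarrow> c_ts q0 \<tau> \<sigma> x lam n (- v / rr ^ n) \<noteq> 0"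
  unfolding c_ts_eq using dd_pos[of v n] by simp

text \<open>In terms of Br and bt the two values of \<lambda> give the same parameters, up to their
  order when m \<le> n.\<close>

lemma c_inf_eq:
  assumes N: "int N = k + int m - int n"
  shows "c_inf q0 \<tau> (\<nu> * q0 ^ (2 * N)) lam (int n - int m) m = (of_real (sgn lam) * \<i>) ^ m * of_real
    (if m \<le> n then L_bar m (Br * rr ^ Suc (N + (n - m))) (rr ^ (n - m)) (- bt * rr ^ (n - m)) rr
      else (- 1) ^ (m - n) * L_bar n (Br * rr ^ Suc N) (rr ^ (m - n)) (- bt) rr)"
proof -
  define P where "P = (q0 powr \<tau>)\<^sup>2"
  have P: "P > 0" using PR by (simp add: P_def)
  have q2N: "q0 ^ (2 * i) = rr ^ i" for i by (simp add: power_mult rr_def)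
  have BrP: "\<nu> * lam = - (Br * P)" using minus_nu_lam P by (simp add: P_def field_simps)
  have btP: "bt = lam\<^sup>2 / P" by (simp add: bt_def powrs P_def)
  have p1: "q0 powr (2 - 2 * \<tau>) = rr / P" "q0 powr (- 2 * \<tau>) = 1 / P" unfolding powrs P_def rr_def by (rule refl)+
  have sg: "sgn (lam * q0 powi (2 * (int n - int m))) = sgn lam" using q0 by (simp add: sgn_mult)
  show ?thesis
  proof (cases "m \<le> n")
    case True
    define M where "M = n - m"
    have j: "int n - int m = int M" using True by (simp add: M_def)
    have c: "int n - int m \<ge> 0" using True by simp
    have Y: "q0 powi (2 * int M) = rr ^ M" unfolding q2N[symmetric] by (rule powi_double[OF q0])
    have cd: "rr ^ M * (- bt * rr ^ M) < 0" using rr bt_pos by (simp add: mult_pos_pos)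
    have X: "- (\<nu> * rr ^ N) * (lam * rr ^ M) * (rr / P) = Br * rr ^ Suc (N + M)"
    proof -
      have "- (\<nu> * rr ^ N) * (lam * rr ^ M) * (rr / P) = - (\<nu> * lam) * (rr ^ N * rr ^ M * rr / P)" by simp
      also have "\<dots> = Br * rr ^ Suc (N + M)" unfolding BrP using P by (simp add: power_add)
      finally show ?thesis .
    qed
    \<comment> \<open>For \<lambda> = q^(2 \<tau>) the power of the base is the second parameter, so
      the two are exchanged by \<open>L_bar_commute\<close>.\<close>
    have "L_bar m (Br * rr ^ Suc (N + M)) (- (lam * rr ^ M)) (lam * rr ^ M * (1 / P)) rr = L_bar m (Br * rr ^ Suc (N + M)) (rr ^ M) (- bt * rr ^ M) rr"
    proof (rule lam_cases)
      assume "lam = - 1"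
      then show ?thesis unfolding btP by simp
    next
      assume "lam = (q0 powr \<tau>)\<^sup>2"
      then have l: "lam = P" by (simp add: P_def)
      have "- (lam * rr ^ M) = - bt * rr ^ M" "lam * rr ^ M * (1 / P) = rr ^ M" unfolding btP unfolding l using P by (simp_all add: power2_eq_square)
      then show ?thesis by (simp only: L_bar_commute[OF rr(1,2) cd])
    qed
    then show ?thesis unfolding c_inf_def Let_def sg if_P[OF True] if_P[OF c] rr_def[symmetric] unfolding j Y q2N p1 X M_def[symmetric] by simp
  next
    case False
    define M where "M = m - n"
    have M: "int n - int m = - int M" "M > 0" using False by (auto simp: M_def)
    have mM: "int m + (int n - int m) = int n" by simp
    have X: "- lam * (\<nu> * rr ^ N) * (rr / P) = Br * rr ^ Suc N"
    proof -
      have "- lam * (\<nu> * rr ^ N) * (rr / P) = - (\<nu> * lam) * (rr ^ N * rr / P)" by simp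
      also have "\<dots> = Br * rr ^ Suc N" unfolding BrP using P by simp
      finally show ?thesis .
    qed
    have pm: "(- 1 :: real) powi (- int M) = (- 1) ^ M" unfolding powi_neg_nat by (cases "even M") auto
    have Y: "q0 powi (- 2 * - int M) = rr ^ M"
    proof -
      have "- 2 * - int M = 2 * int M" by simp
      then show ?thesis unfolding q2N[symmetric] using powi_double[OF q0, of M] by (simp only:)
    qed
    have d: "- (lam\<^sup>2) * (1 / P) = - bt" by (simp add: btP)
    have c: "\<not> int n - int m \<ge> 0" "\<not> int m < - (int n - int m)" using False by auto
    show ?thesis unfolding c_inf_def Let_def sg if_not_P[OF False] if_not_P[OF c(1)] if_not_P[OF c(2)] mM rr_def[symmetric]
      unfolding M(1) pm Y q2N p1 X d M_def[symmetric] by simp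
  qed
qed

lemma HHr_of_real: "L0.H n (of_real X) M = of_real (HHr rr (- bt * rr) n X M)"
proof -
  have P: "qpoch (complex_of_real rr powi (- int n)) (of_real rr) l = of_real (qpoch (rr powi (- int n)) rr l)" for l
    using qpoch_of_real[of "rr powi (- int n)" rr l] by simp
  have rq: "L0.rq j = of_real (rqr rr j)" for j by (simp add: L0.rq_def rqr_def qpoch_of_real)
  show ?thesis unfolding L0.H_def HHr_def e_eq of_real_sum P qpoch_of_real rq
    by (intro sum.cong refl) simp
qed

text \<open>The inverted series has, up to one constant, the summands of \<open>RS\<close>; the
  phase (-i)^m cancels the i^m of \<open>c_inf\<close>.\<close>

lemma coupling_sum:
  assumes S: "is_coupling_coefficients q0 \<tau> \<sigma> x S" and v: "v \<in> asc_support rr zz"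
  shows "S (- v / rr ^ n) (lam * q0 powi (2 * k)) \<nu> lam * c_ts q0 \<tau> \<sigma> x lam n (- v / rr ^ n)
    = of_real (sqrt (asc_weight rr zz v) * ((- 1) ^ n * sqrt (coup_sq rr bt Br Ar Wc k n))) * L0.RS k n v"
proof -
  have q2: "q0 ^ (2 * n) = rr ^ n" by (simp add: power_mult rr_def)
  have tm: "of_real (sqrt (asc_weight rr zz v) * sqrt (asc_hinv rr zz m) * ascU (- zz) rr m v) * ((- \<i>) ^ m * (if lam = lam then UB q0 \<tau> \<sigma> \<nu> x lam k n m else 0))
     = of_real (sqrt (asc_weight rr zz v) * ((- 1) ^ n * sqrt (coup_sq rr bt Br Ar Wc k n))) * (L0.cf k n m * L0.u m v)" for m
  proof (cases "k + int m - int n < 0")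
    case True
    then show ?thesis by (simp add: UB_def[OF q0] L0.cf_def L0.g_neg)
  next
    case False
    define N where "N = nat (k + int m - int n)"
    have N: "int N = k + int m - int n" using False by (simp add: N_def)
    define D where "D = (if m \<le> n then L_bar m (Br * rr ^ Suc (N + (n - m))) (rr ^ (n - m)) (- bt * rr ^ (n - m)) rr
      else (- 1) ^ (m - n) * L_bar n (Br * rr ^ Suc N) (rr ^ (m - n)) (- bt) rr)"
    define sq where "sq = sqrt (Wc * (qpoch_inf (rr ^ (N + 1)) rr * qpoch_inf (Ar * Br * rr ^ N) rr))"
    have UB: "UB q0 \<tau> \<sigma> \<nu> x lam k n m = of_real sq * L0.ch N * ((of_real (sgn lam) * \<i>) ^ m * of_real D)"
      unfolding UB_def[OF q0] N_def[symmetric] if_not_P[OF False] m_ts_eq c_inf_eq[OF N] D_def sq_def ..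
    have sg: "sgn lam = 1 \<or> sgn lam = - 1" "tr = - sgn lam * \<bar>tr\<bar>"
    proof -
      show "sgn lam = 1 \<or> sgn lam = - 1" using lam_nz by (auto simp: sgn_if)
      have "q0 powr (1 + \<tau> - \<sigma>) > 0" using q0 by simp
      then show "tr = - sgn lam * \<bar>tr\<bar>" using lam_nz unfolding tr_def by (cases "lam > 0") (auto simp: abs_if divide_less_0_iff zero_less_divide_iff)
    qed
    have id: "sgn lam ^ m * D * (sqrt (asc_hinv rr zz m) * sq) * qpoch Ar rr N
      = (- 1) ^ n * sqrt (coup_sq rr bt Br Ar Wc k n) * ((tr / rr ^ n) ^ m * HHr rr (- bt * rr) n (Br * rr ^ Suc N) (int m - int n))"
      unfolding D_def sq_def by (rule coupling_coefficient_identity[OF coupling_params N sg])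
    have i: "(- \<i>) ^ m * \<i> ^ m = 1" unfolding power_mult_distrib[symmetric] by simp
    have An: "qpoch Ar rr N \<noteq> 0" using pos(1)[OF coupling_params, of N] by simp
    have cf: "L0.cf k n m = of_real ((tr / rr ^ n) ^ m * HHr rr (- bt * rr) n (Br * rr ^ Suc N) (int m - int n)) * (L0.ch N / of_real (qpoch Ar rr N))"
    proof -
      have "1 + (k + int m - int n) = int (Suc N)" using N by simp
      then have "complex_of_real Br * of_real rr powi (1 + (k + int m - int n)) = of_real (Br * rr ^ Suc N)"
        by (simp only: power_int_of_nat of_real_mult of_real_power)
      then have "L0.GG k n m = of_real (HHr rr (- bt * rr) n (Br * rr ^ Suc N) (int m - int n))"
        unfolding L0.GG_def by (simp only: HHr_of_real)
      moreover have "L0.g (k + int m - int n) = L0.ch N / of_real (qpoch Ar rr N)"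
        unfolding N[symmetric] by (simp add: L0.g_def qpoch_of_real)
      moreover have "(complex_of_real tr / of_real rr ^ n) ^ m = of_real ((tr / rr ^ n) ^ m)" by simp
      ultimately show ?thesis unfolding L0.cf_def t_eq by (simp only: of_real_mult mult_ac)
    qed
    have idc: "complex_of_real (sgn lam) ^ m * of_real D * (of_real (sqrt (asc_hinv rr zz m)) * of_real sq) * of_real (qpoch Ar rr N)
      = of_real ((- 1) ^ n * sqrt (coup_sq rr bt Br Ar Wc k n)) * of_real ((tr / rr ^ n) ^ m * HHr rr (- bt * rr) n (Br * rr ^ Suc N) (int m - int n))"
      using arg_cong[OF id, of complex_of_real] by (simp only: of_real_mult of_real_power)
    \<comment> \<open>Complex factors are collected around the real identity \<open>idc\<close>,
      which is inserted as a whole.\<close>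
    have gen: "w * h * uu * (mi * (s * c * ((sg * ii) ^ m * dd'))) = w * K * (HH * (c / A') * uu)"
      if "sg ^ m * dd' * (h * s) * A' = K * HH" "mi * ii ^ m = 1" "A' \<noteq> 0" for w h uu mi s c sg ii dd' K HH A' :: complex
    proof -
      have "w * h * uu * (mi * (s * c * ((sg * ii) ^ m * dd'))) = (mi * ii ^ m) * w * uu * c * (sg ^ m * dd' * (h * s))"
        by (simp add: power_mult_distrib mult_ac)
      also have "sg ^ m * dd' * (h * s) = K * HH / A'" using that by (simp add: eq_divide_eq)
      finally show ?thesis unfolding that(2) by simp
    qed
    have "complex_of_real (qpoch Ar rr N) \<noteq> 0" using An by simp
    from gen[OF idc i this] show ?thesis unfolding cf L0.u_def UB if_P[OF refl] by (simp only: of_real_mult)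
  qed
  have "(\<lambda>m. of_real (sqrt (asc_weight rr zz v) * ((- 1) ^ n * sqrt (coup_sq rr bt Br Ar Wc k n))) * (L0.cf k n m * L0.u m v)) sums
     (of_real (sqrt (asc_weight rr zz v) * ((- 1) ^ n * sqrt (coup_sq rr bt Br Ar Wc k n))) * L0.RS k n v)"
    by (rule sums_mult[OF L0.RS_sums[OF v]])
  from sums_unique2[OF coupling_inversion[OF q0 S nu lam lam, where v = v and n = n and k = k, folded rr_def zz_def, OF v, unfolded tm q2] this] show ?thesis .
qed

text \<open>The n-independent part of the quotient of the normalisations of U and V; dividing S by
  it and by sqrt(|y| psi y) yields a family in the sense of \<open>solves\<close>.\<close>

definition Cc :: "int \<Rightarrow> real" where
  "Cc k = sqrt (nn (rr / tr) * nn (- bt * tr) / (nn ar * nn br) * \<bar>Br\<bar> * rr powi k * qpoch_inf (Br * rr powi (1 + k)) rr * (qpoch_inf Ar rr)\<^sup>2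
     / ((qpoch_inf rr rr)\<^sup>2 * qtheta (- zz) rr * qtheta (- bt) rr))"

lemma coupling_solves:
  assumes S: "is_coupling_coefficients q0 \<tau> \<sigma> x S" and C: "Cc k > 0"
  shows "L.solves k (\<lambda>y. S y (lam * q0 powi (2 * k)) \<nu> lam / of_real (sqrt (\<bar>y\<bar> * psi y) * Cc k))"
  unfolding L.solves_def
proof (intro allI ballI)
  fix n v assume v: "v \<in> asc_support rr zz"
  define y where "y = - v / rr ^ n"
  define Tn where "Tn = rr ^ (n * (n - 1) div 2)"
  define en where "en = qpoch (- bt * rr) rr n"
  have en: "en > 0" unfolding en_def by (rule pos(2)[OF coupling_params])
  have Tn: "Tn > 0" using rr by (simp add: Tn_def)
  have y0: "\<bar>y\<bar> > 0" "psi y > 0" using asc_support_nz[OF rr(1,2) zz v] psi_point[OF v, of n] rr by (auto simp: y_def)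
  have vy: "\<bar>v\<bar> = \<bar>y\<bar> * rr ^ n" using rr by (simp add: y_def abs_mult)
  \<comment> \<open>The squared form of the claim on constants. The dependence on n reduces to (Tn
    en)^2, which is rho n squared.\<close>
  have key: "asc_weight rr zz v * coup_sq rr bt Br Ar Wc k n = (\<bar>y\<bar> * psi y) * (Cc k)\<^sup>2 * (Tn * en)\<^sup>2 * dd n v"
  proof -
    define X where "X = nn (rr / tr) * nn (- bt * tr) / (nn ar * nn br) * \<bar>Br\<bar> * rr powi k * qpoch_inf (Br * rr powi (1 + k)) rr * (qpoch_inf Ar rr)\<^sup>2
     / ((qpoch_inf rr rr)\<^sup>2 * qtheta (- zz) rr * qtheta (- bt) rr)"
    have "X > 0" using C unfolding Cc_def X_def[symmetric] by simp
    then have C2: "(Cc k)\<^sup>2 = X" unfolding Cc_def X_def[symmetric] by simp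
    have n2: "rr ^ (n * n) = Tn\<^sup>2 * rr ^ n" unfolding Tn_def by (rule sq_tri[OF coupling_params])
    have i1: "qpoch_inf (rr ^ (n + 1)) rr = qpoch_inf rr rr / qpoch rr rr n" using r_split(1)[OF coupling_params, of n] by (simp add: mult.commute)
    have i2: "qpoch_inf (- bt * rr * rr ^ n) rr = qpoch_inf (- bt * rr) rr / en"
      using e_split(1)[OF coupling_params, of n] unfolding en_def by (simp only: mult.assoc mult.commute[of "rr ^ n"])
    have gen: "ay * eta * pv / (Qi * thz) * (aB * rk * Bk * A2 * ei * en' * (w / om) / (qn * thb) * (T2 * eta / eta\<^sup>2))
       = (ay * ps) * (om' * om'' / om * aB * rk * Bk * A2 / (Qi\<^sup>2 * thz * thb)) * (T2 * en'\<^sup>2) * (w / (om' * om'' * ps) * (Qi / qn * (ei / en') * pv))"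
      if "eta \<noteq> 0" "Qi \<noteq> 0" "thz \<noteq> 0" "om \<noteq> 0" "qn \<noteq> 0" "thb \<noteq> 0" "om' \<noteq> 0" "om'' \<noteq> 0" "ps \<noteq> 0" "en' \<noteq> 0"
      for ay eta pv Qi thz aB rk Bk A2 ei en' w om qn thb T2 om' om'' ps :: real
      using that by (simp add: field_simps power2_eq_square)
    show ?thesis
      unfolding C2 X_def asc_weight_def coup_sq_def[OF coupling_params] dd_def y_def[symmetric] vy n2 i1 i2 Wc_def en_def[symmetric] power_mult_distrib
      by (rule gen) (use rr y0 en om_pos pos(3,4,6)[OF coupling_params] theta_z_pos in \<open>auto simp: less_imp_neq[THEN not_sym]\<close>)
  qed
  have "sqrt (asc_weight rr zz v) * sqrt (coup_sq rr bt Br Ar Wc k n) = sqrt (\<bar>y\<bar> * psi y) * Cc k * (Tn * en) * sqrt (dd n v)"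
    using arg_cong[OF key, of sqrt] C Tn en by (simp only: real_sqrt_mult real_sqrt_abs abs_mult abs_of_pos)
  then have e1: "complex_of_real (sqrt (asc_weight rr zz v) * ((- 1) ^ n * sqrt (coup_sq rr bt Br Ar Wc k n)))
     = of_real (sqrt (\<bar>y\<bar> * psi y) * Cc k) * of_real ((- 1) ^ n * (Tn * en)) * of_real (sqrt (dd n v))"
    unfolding of_real_mult[symmetric] by (intro arg_cong[of _ _ complex_of_real]) (simp only: mult_ac)
  have rho: "L.rho n = of_real ((- 1) ^ n * (Tn * en))"
    unfolding L.rho_def e_eq Tn_def en_def qpoch_of_real by simp
  have nz: "complex_of_real (sqrt (dd n v)) \<noteq> 0" "complex_of_real (sqrt (\<bar>y\<bar> * psi y) * Cc k) \<noteq> 0"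
    using dd_pos[OF v, of n] y0 C by auto
  have gen: "s / f * p = h * R" if "s * (d * p) = f * h * d * R" "d \<noteq> 0" "f \<noteq> 0" for s f p h R d :: complex
  proof -
    have "d * (s * p) = d * (f * h * R)" using that(1) by (simp add: mult_ac)
    from mult_left_cancel[OF that(2), THEN iffD1, OF this] have "s * p = f * h * R" .
    then show ?thesis using that(3) by (simp add: field_simps)
  qed
  show "S (- v / rr ^ n) (lam * q0 powi (2 * k)) \<nu> lam / of_real (sqrt (\<bar>- v / rr ^ n\<bar> * psi (- v / rr ^ n)) * Cc k) * L.pn n (of_real (- v / rr ^ n)) = L.rho n * L0.RS k n v"
    unfolding y_def[symmetric] rho
    by (rule gen[OF _ nz]) (use coupling_sum[OF S v, of n k, unfolded c_ts_eq[OF v], unfolded y_def[symmetric] e1] in \<open>simp only: mult.assoc\<close>)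
qed

lemma unit_dual:
  assumes \<kappa>: "\<kappa> \<in> {1, - zz}"
  shows "of_real (rr / (tr * \<kappa>)) * x * of_real rr powi j \<noteq> 1"
proof
  assume h: "of_real (rr / (tr * \<kappa>)) * x * of_real rr powi j = 1"
  have nz: "x \<noteq> 0" "tr * \<kappa> \<noteq> 0" using x1 tr_nz \<kappa> zz by auto
  have "rr powi (- j - 1) = 1 / (rr * rr powi j)"
  proof -
    have "- j - 1 = - (1 + j)" by simp
    then have "rr powi (- j - 1) = 1 / rr powi (1 + j)" by (simp only: power_int_minus_divide)
    then show ?thesis using power_int_add[of rr 1 j] by simp
  qed
  then have "of_real (tr * \<kappa> * rr powi (- j - 1)) / x = 1 / (of_real (rr / (tr * \<kappa>)) * x * of_real rr powi j)"
    using nz by simp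
  then show False using h unit_real(2)[OF \<kappa>, of "- j - 1"] by simp
qed

text \<open>Vectors belonging to \<xi> and \<lambda> are orthogonal, so the inverted series is 0;
  c^(\<tau>,\<sigma>) is nonzero for the representation of y that is chosen.\<close>

lemma coupling_zero:
  assumes S: "is_coupling_coefficients q0 \<tau> \<sigma> x S" and \<xi>: "\<xi> \<in> {-1, q0 powr (2 * \<tau>)}" "\<xi> \<noteq> lam" and \<kappa>: "\<kappa> \<in> {1, - zz}"
  shows "S (- \<kappa> * rr powi i) (\<xi> * q0 powi (2 * k)) \<nu> lam = 0"
proof -
  obtain n w where w: "w \<in> asc_support rr zz" "- \<kappa> * rr powi i = - w / rr ^ n" "L.pn n (of_real (- w / rr ^ n)) \<noteq> 0"
    using L.lattice_point[OF \<kappa>, of i] by blast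
  have q2: "q0 ^ (2 * n) = rr ^ n" by (simp add: power_mult rr_def)
  have z: "of_real c * ((- \<i>) ^ m * (if \<xi> = lam then u else 0)) = 0" for c m u using \<xi>(2) by simp
  note ci = coupling_inversion[OF q0 S nu \<xi>(1) lam, where v = w and n = n and k = k, folded rr_def zz_def, OF w(1), unfolded q2 z]
  have "S (- w / rr ^ n) (\<xi> * q0 powi (2 * k)) \<nu> lam * c_ts q0 \<tau> \<sigma> x lam n (- w / rr ^ n) = 0"
    by (rule sums_unique2[OF ci sums_zero])
  then show ?thesis using c_ts_nz[OF w(1,3)] unfolding w(2) by simp
qed

text \<open>For B = 1 and k < 0 the product (r^(1+k);r)_inf in \<open>coup_sq\<close> has the factor
  0.\<close>

lemma coupling_zero_neg:
  assumes S: "is_coupling_coefficients q0 \<tau> \<sigma> x S" and ne: "\<nu> \<noteq> lam" and k: "k < 0" and \<kappa>: "\<kappa> \<in> {1, - zz}"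
  shows "S (- \<kappa> * rr powi i) (lam * q0 powi (2 * k)) \<nu> lam = 0"
proof -
  obtain n w where w: "w \<in> asc_support rr zz" "- \<kappa> * rr powi i = - w / rr ^ n" "L.pn n (of_real (- w / rr ^ n)) \<noteq> 0"
    using L.lattice_point[OF \<kappa>, of i] by blast
  have B: "Br = 1" using P_params[OF ne] by blast
  have "rr powi (1 + k) * rr ^ nat (- 1 - k) = 1"
  proof -
    have "rr powi (1 + k) * rr ^ nat (- 1 - k) = rr powi (1 + k + int (nat (- 1 - k)))"
      unfolding power_int_of_nat[symmetric] by (rule power_int_add[symmetric]) simp
    also have "1 + k + int (nat (- 1 - k)) = 0" using k by simp
    finally show ?thesis by (simp only: power_int_0_right)
  qed
  then have "qpoch_inf (Br * rr powi (1 + k)) rr = 0"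
    unfolding B mult_1_left using qpoch_inf_eq_0_iff[OF nr[OF coupling_params], of "rr powi (1 + k)"] by blast
  then have c0: "coup_sq rr bt Br Ar Wc k n = 0" unfolding coup_sq_def[OF coupling_params] by simp
  have "S (- w / rr ^ n) (lam * q0 powi (2 * k)) \<nu> lam * c_ts q0 \<tau> \<sigma> x lam n (- w / rr ^ n) = 0"
    using coupling_sum[OF S w(1), of n k] unfolding c0 by simp
  then show ?thesis using c_ts_nz[OF w(1,3)] unfolding w(2) by simp
qed

lemma Br_powi_less:
  assumes "\<nu> \<noteq> lam \<Longrightarrow> k \<ge> 0"
  shows "Br * rr powi (1 + k) < 1"
proof (cases "\<nu> = lam")
  case True
  have "bt * rr powi (1 + k) > 0" using bt_pos rr by simp
  then show ?thesis unfolding Q_params[OF True, THEN conjunct1] by simp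
next
  case False
  then obtain j where j: "k = int j" using assms nonneg_int_cases by blast
  have "1 + int j = int (Suc j)" by simp
  then have "rr powi (1 + k) = rr ^ Suc j" unfolding j by (simp only: power_int_of_nat)
  then show ?thesis unfolding P_params[OF False, THEN conjunct1] using power_Suc_less_one[OF rr(1,2), of j] by simp
qed

lemma Cc_sq:
  assumes "\<nu> \<noteq> lam \<Longrightarrow> k \<ge> 0"
  shows "Cc k > 0" "(Cc k)\<^sup>2 = nn (rr / tr) * nn (- bt * tr) / (nn ar * nn br) * \<bar>Br\<bar> * rr powi k * qpoch_inf (Br * rr powi (1 + k)) rr * (qpoch_inf Ar rr)\<^sup>2
     / ((qpoch_inf rr rr)\<^sup>2 * qtheta (- zz) rr * qtheta (- bt) rr)"
proof -
  define X where "X = nn (rr / tr) * nn (- bt * tr) / (nn ar * nn br) * \<bar>Br\<bar> * rr powi k * qpoch_inf (Br * rr powi (1 + k)) rr * (qpoch_inf Ar rr)\<^sup>2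
     / ((qpoch_inf rr rr)\<^sup>2 * qtheta (- zz) rr * qtheta (- bt) rr)"
  have "qpoch_inf (Br * rr powi (1 + k)) rr > 0" "qpoch_inf Ar rr > 0"
    using qpoch_inf_pos[OF rr(1,2)] Br_powi_less[OF assms] Ar_less by blast+
  moreover have "rr powi k > 0" "\<bar>Br\<bar> > 0" using rr Br_nz by simp_all
  ultimately have "X > 0" unfolding X_def using om_pos pos(4,6)[OF coupling_params] theta_z_pos by simp
  then show "Cc k > 0" "(Cc k)\<^sup>2 = nn (rr / tr) * nn (- bt * tr) / (nn ar * nn br) * \<bar>Br\<bar> * rr powi k * qpoch_inf (Br * rr powi (1 + k)) rr * (qpoch_inf Ar rr)\<^sup>2
     / ((qpoch_inf rr rr)\<^sup>2 * qtheta (- zz) rr * qtheta (- bt) rr)"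
    unfolding X_def[symmetric] Cc_def by simp_all
qed

lemma theta_prod:
  assumes "c \<noteq> 0"
  shows "qtheta (of_real c / x) (of_real rr) * qtheta (of_real c * x) (of_real rr) = of_real (nn c * nn (rr / c))"
proof -
  have e: "of_real rr / (of_real c / x) = of_real (rr / c) * x" "of_real rr / (of_real c * x) = of_real (rr / c) / x"
    by simp_all
  have gen: "(A * B) * (C * D) = (C * A) * (B * D)" for A B C D :: complex by simp
  show ?thesis unfolding qtheta_def e gen nn_eq by simp
qed

lemma qtheta_of_real: "qtheta (complex_of_real u) (of_real rr) = of_real (qtheta u rr)"
proof -
  have e: "complex_of_real rr / of_real u = of_real (rr / u)" by simp
  show ?thesis unfolding qtheta_def e qinf by simp
qed

lemma theta_inv: "u \<noteq> 0 \<Longrightarrow> qtheta (1 / u) rr = - (qtheta u rr) / u"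
proof -
  assume u: "u \<noteq> 0"
  have nr: "norm rr < 1" using rr by simp
  have "qtheta (1 / u) rr = (1 - 1 / u) * qpoch_inf (rr / u) rr * qpoch_inf (rr * u) rr"
    unfolding qtheta_def using qpoch_inf_rec[OF nr, of "1 / u"] u by (simp add: mult.commute)
  moreover have "qtheta u rr = (1 - u) * qpoch_inf (rr * u) rr * qpoch_inf (rr / u) rr"
    unfolding qtheta_def using qpoch_inf_rec[OF nr, of u] by (simp add: mult.commute)
  ultimately show ?thesis using u by (simp add: field_simps)
qed

lemma theta_refl: "u \<noteq> 0 \<Longrightarrow> qtheta (rr / u) rr = qtheta u rr"
  unfolding qtheta_def by (simp add: mult.commute)

text \<open>Here G is the constant found by solving the relations and h the norm in the formula; G^2
  h = 1 says that they agree.\<close>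

lemma sqrt_match:
  assumes "(p :: real) > 0" "G > 0" "G\<^sup>2 * h = 1"
  shows "sqrt (y * p) * G / p = sqrt (y / p / h)"
proof -
  have "h \<noteq> 0" using assms(3) by auto
  then have h: "1 / h = G\<^sup>2" using assms(3) by (simp add: field_simps)
  have "y / p / h = y / p * (1 / h)" by simp
  also have "\<dots> = y * p * (G / p)\<^sup>2" unfolding h using assms by (simp add: field_simps power2_eq_square)
  finally have "sqrt (y / p / h) = sqrt (y * p) * sqrt ((G / p)\<^sup>2)" by (simp only: real_sqrt_mult)
  also have "sqrt ((G / p)\<^sup>2) = G / p" using assms by simp
  finally show ?thesis by simp
qed

text \<open>\<open>P_solution\<close> gives S up to a constant. It remains to check that its square
  is 1/hP; its sign comes from br^k, which has the sign of \<nu>^k.\<close>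

lemma coupling_P:
  fixes k :: nat and i :: int
  assumes S: "is_coupling_coefficients q0 \<tau> \<sigma> x S" and ne: "\<nu> \<noteq> lam" and \<kappa>: "\<kappa> \<in> {1, - zz}"
  defines "y \<equiv> - \<kappa> * rr powi i"
    and "c \<equiv> - complex_of_real (\<nu> * q0 powr (1 - \<tau> - \<sigma>)) / x" and "d \<equiv> - complex_of_real \<nu> * x * complex_of_real (q0 powr (1 - \<tau> - \<sigma>))"
  shows "S y (lam * q0 powi (2 * int k)) \<nu> lam = of_real (sgn \<nu>) powi int k
    * csqrt (of_real \<bar>y\<bar> * w_fun (of_real y) c d (of_real rr) / hP (int k) c d (- 1) (of_real zz) (of_real rr))
    * P_fun (int k) (of_real y) c d (of_real rr)"
proof -
  have P: "Br = 1" "Ar = ar * br" "tr = br" using P_params[OF ne] by blast+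
  have brnz: "br \<noteq> 0" "ar \<noteq> 0" using lam_nz q0 zz by (auto simp: br_def ar_def)
  have pp: "q0 powr (1 - \<tau> - \<sigma>) = q0 powr (1 - \<sigma> - \<tau>)" unfolding powrs ..
  have c: "c = - of_real br / x" and d: "d = - of_real br * x"
    unfolding c_def d_def br_def pp by simp_all
  define s where "s = (\<lambda>(k::nat) y. S y (lam * q0 powi (2 * int k)) \<nu> lam / of_real (sqrt (\<bar>y\<bar> * psi y) * Cc (int k)))"
  have C: "Cc (int k) > 0" for k by (rule Cc_sq(1)) simp
  have sol: "L.solves (int k) (s k)" for k unfolding s_def by (rule coupling_solves[OF S C])
  have nab: "ar * br \<le> 0"
  proof -
    have "ar * br = - (zz * (br * br))" by (simp add: ar_def)
    moreover have "zz * (br * br) \<ge> 0" using zz by simp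
    ultimately show ?thesis by linarith
  qed
  have hA: "complex_of_real Ar = of_real ar * of_real br" unfolding P(2) by simp
  have hB: "complex_of_real Br = 1" unfolding P(1) by simp
  have hp: "complex_of_real ar * of_real br = of_real (ar * br)" by simp
  define p where "p = psi y"
  have p: "p > 0" unfolding p_def y_def by (rule psi_lattice[OF \<kappa>])
  have den: "qpoch_inf (- of_real br / x * of_real y) (of_real rr) * qpoch_inf (- of_real br * x * of_real y) (of_real rr) = of_real p"
  proof -
    have e: "- of_real br / x * of_real y = of_real (- tr * y) / x" "- of_real br * x * of_real y = of_real (- tr * y) * x"
      unfolding P(3) by simp_all
    show ?thesis unfolding e p_def psi_def nn_eq[symmetric] by (rule mult.commute)
  qed
  define Ks where "Ks = nn ar * nn br / qpoch_inf Ar rr"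
  define T where "T = rr ^ (k * (k - 1) div 2)"
  have E: "s k y = of_real (Ks * (T / br ^ k) / p) * P_fun (int k) (of_real y) c d (of_real rr)"
  proof -
    have "s k y = qpoch_inf (of_real ar * x) (of_real rr) * qpoch_inf (of_real ar / x) (of_real rr) * (qpoch_inf (of_real br * x) (of_real rr) * qpoch_inf (of_real br / x) (of_real rr)) / qpoch_inf (of_real ar * of_real br) (of_real rr)
     * (of_real rr ^ (k * (k - 1) div 2) / of_real br ^ k) * P_fun (int k) (of_real y) (- of_real br / x) (- of_real br * x) (of_real rr)
     / (qpoch_inf (- of_real br / x * of_real y) (of_real rr) * qpoch_inf (- of_real br * x * of_real y) (of_real rr))"
      unfolding y_def by (rule L.P_solution[OF hA hB hp nab \<kappa> sol])
    then show ?thesis unfolding nn_eq den hA[symmetric] unfolding qinf c[symmetric] d[symmetric] Ks_def T_def by simp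
  qed
  define h where "h = qtheta (- zz) rr * qpoch rr rr k * (br * br) ^ k / (T\<^sup>2 * rr ^ k) * (qpoch_inf rr rr * qtheta (- bt) rr) / (nn ar * nn br * nn (rr / tr) * nn (- bt * tr))"
  have hPh: "hP (int k) c d (- 1) (of_real zz) (of_real rr) = of_real h"
  proof -
    have xnz: "x \<noteq> 0" using x1 by auto
    have cd: "c * d = of_real (br * br)" unfolding c d using xnz by simp
    have th1: "qtheta (c * - 1) (of_real rr) * qtheta (d * - 1) (of_real rr) = of_real (nn br * nn (rr / tr))"
      using theta_prod[OF brnz(1)] unfolding c d P(3) by simp
    have "rr / ar = rr / (tr * - zz)" unfolding P(3) ar_def by (simp add: mult.commute)
    \<comment> \<open>This turns the theta functions at zz into the parameters of
      c^(\<tau>,\<sigma>), so that their product cancels against Cc.\<close>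
    then have e: "rr / ar = - bt * tr" unfolding b'_eq2 .
    have th2: "qtheta (c * of_real zz) (of_real rr) * qtheta (d * of_real zz) (of_real rr) = of_real (nn ar * nn (- bt * tr))"
    proof -
      have "c * of_real zz = of_real ar / x" "d * of_real zz = of_real ar * x" unfolding c d ar_def by simp_all
      then show ?thesis using theta_prod[OF brnz(2)] unfolding e by (simp only:)
    qed
    have th3: "qtheta (c * d * - 1 * of_real zz) (of_real rr) = of_real (qtheta (- bt) rr)"
    proof -
      have "Ar = rr / (- bt)" unfolding Ar_def P(1) by simp
      then have "qtheta Ar rr = qtheta (- bt) rr" using theta_refl[of "- bt"] bt_pos by simp
      moreover have "c * d * - 1 * of_real zz = of_real Ar" unfolding cd P(2) ar_def by simp
      ultimately show ?thesis by (simp only: qtheta_of_real)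
    qed
    have th4: "qtheta (- 1 / of_real zz) (complex_of_real rr) = of_real (qtheta (- zz) rr / zz)"
    proof -
      have "qtheta (1 / (- zz)) rr = qtheta (- zz) rr / zz" using theta_inv[of "- zz"] zz by simp
      moreover have "- 1 / complex_of_real zz = of_real (1 / (- zz))" by simp
      ultimately show ?thesis by (simp only: qtheta_of_real)
    qed
    have sq: "complex_of_real rr powi (- ((int k)\<^sup>2)) = of_real (1 / (T\<^sup>2 * rr ^ k))"
    proof -
      have "(int k)\<^sup>2 = int (k * k)" by (simp add: power2_eq_square)
      then show ?thesis unfolding T_def sq_tri[OF coupling_params, symmetric] by (simp only: powi_neg_nat) simp
    qed
    have "hP (int k) c d (- 1) (of_real zz) (of_real rr) = of_real zz * qpoch (of_real rr) (of_real rr) k * of_real (br * br) ^ k * of_real (1 / (T\<^sup>2 * rr ^ k))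
       * (qpoch_inf (of_real rr) (of_real rr) * (of_real (qtheta (- zz) rr / zz) * of_real (qtheta (- bt) rr)) / (of_real (nn br * nn (rr / tr)) * of_real (nn ar * nn (- bt * tr))))"
      unfolding hP_def th1[symmetric] th2[symmetric] th3 th4 sq unfolding cd by (simp add: mult_ac)
    also have "\<dots> = of_real (zz * qpoch rr rr k * (br * br) ^ k * (1 / (T\<^sup>2 * rr ^ k)) * (qpoch_inf rr rr * (qtheta (- zz) rr / zz * qtheta (- bt) rr) / ((nn br * nn (rr / tr)) * (nn ar * nn (- bt * tr)))))"
      unfolding qpoch_of_real qinf by simp
    also have "zz * qpoch rr rr k * (br * br) ^ k * (1 / (T\<^sup>2 * rr ^ k)) * (qpoch_inf rr rr * (qtheta (- zz) rr / zz * qtheta (- bt) rr) / ((nn br * nn (rr / tr)) * (nn ar * nn (- bt * tr)))) = h"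
      unfolding h_def using zz by (simp add: mult_ac)
    finally show ?thesis .
  qed
  define G where "G = Cc (int k) * Ks * (T / \<bar>br\<bar> ^ k)"
  have Aip: "qpoch_inf Ar rr > 0" using qpoch_inf_pos[OF rr(1,2) Ar_less] .
  have Tp: "T > 0" using rr by (simp add: T_def)
  have Gp: "G > 0" unfolding G_def Ks_def using C[of k] om_pos Aip Tp brnz by simp
  have Gh: "G\<^sup>2 * h = 1"
  proof -
    have b2: "(\<bar>br\<bar> ^ k)\<^sup>2 = (br * br) ^ k" by (simp add: power_mult_distrib power2_eq_square flip: power_mult_distrib)
    have i1: "qpoch_inf (Br * rr powi (1 + int k)) rr = qpoch_inf rr rr / qpoch rr rr k"
    proof -
      have "1 + int k = int (Suc k)" by simp
      then have "Br * rr powi (1 + int k) = rr ^ k * rr" unfolding P(1) by (simp only: power_int_of_nat) simp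
      then show ?thesis using r_split(1)[OF coupling_params, of k] by (simp only:)
    qed
    have gen: "(a3 * a4 / (a1 * a2) * 1 * rk * (Qi / qk) * Ai\<^sup>2 / (Qi\<^sup>2 * tz * tb)) * (a1 * a2 / Ai)\<^sup>2 * (T'\<^sup>2 / bk) * (tz * qk * bk / (T'\<^sup>2 * rk) * (Qi * tb) / (a1 * a2 * a3 * a4)) = 1"
      if "a1 \<noteq> 0" "a2 \<noteq> 0" "a3 \<noteq> 0" "a4 \<noteq> 0" "rk \<noteq> 0" "Qi \<noteq> 0" "qk \<noteq> 0" "Ai \<noteq> 0" "tz \<noteq> 0" "tb \<noteq> 0" "T' \<noteq> 0" "bk \<noteq> 0"
      for a1 a2 a3 a4 rk Qi qk Ai tz tb T' bk :: real
      using that by (simp add: field_simps power2_eq_square)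
    have C2: "(Cc (int k))\<^sup>2 = nn (rr / tr) * nn (- bt * tr) / (nn ar * nn br) * 1 * rr ^ k * (qpoch_inf rr rr / qpoch rr rr k) * (qpoch_inf Ar rr)\<^sup>2
      / ((qpoch_inf rr rr)\<^sup>2 * qtheta (- zz) rr * qtheta (- bt) rr)"
      using Cc_sq(2)[of "int k"] unfolding i1 by (simp add: P(1))
    show ?thesis
      unfolding G_def h_def Ks_def power_mult_distrib[of _ _ 2] power_divide[of T "\<bar>br\<bar> ^ k" 2] b2 C2
      by (rule gen) (use om_pos rr Aip Tp brnz pos(3,4,6)[OF coupling_params] theta_z_pos in \<open>auto simp: less_imp_neq[THEN not_sym]\<close>)
  qed
  have hpos: "h > 0"
  proof -
    have "G\<^sup>2 > 0" using Gp by simp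
    then show ?thesis using Gh by (metis zero_less_mult_pos zero_less_one)
  qed
  have w: "of_real \<bar>y\<bar> * w_fun (of_real y) c d (of_real rr) / of_real h = complex_of_real (\<bar>y\<bar> / p / h)"
    unfolding w_fun_def c d den by simp
  have cs: "csqrt (of_real \<bar>y\<bar> * w_fun (of_real y) c d (of_real rr) / of_real h) = of_real (sqrt (\<bar>y\<bar> / p / h))"
    unfolding w using of_real_sqrt[of "\<bar>y\<bar> / p / h"] p hpos by simp
  have sgb: "br ^ k = sgn \<nu> ^ k * \<bar>br\<bar> ^ k"
  proof -
    have "br = sgn \<nu> * \<bar>br\<bar>" using q0 unfolding br_def by (simp add: abs_mult mult_sgn_abs flip: mult.assoc)
    then have "br ^ k = (sgn \<nu> * \<bar>br\<bar>) ^ k" by simp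
    then show ?thesis unfolding power_mult_distrib .
  qed
  have sg1: "sgn \<nu> ^ k * sgn \<nu> ^ k = 1" unfolding power_mult_distrib[symmetric] using lam_nz by (simp add: sgn_if)
  have rl: "sqrt (\<bar>y\<bar> * p) * Cc (int k) * (Ks * (T / br ^ k) / p) = sgn \<nu> ^ k * sqrt (\<bar>y\<bar> / p / h)"
  proof -
    have s0: "sgn \<nu> \<noteq> 0" using lam_nz by (simp add: sgn_if)
    have snz: "sgn \<nu> ^ k \<noteq> 0" using s0 by simp
    have inv: "1 / sgn \<nu> ^ k = sgn \<nu> ^ k" using sg1 snz by (simp add: divide_eq_eq)
    have "sqrt (\<bar>y\<bar> * p) * Cc (int k) * (Ks * (T / br ^ k) / p) = (1 / sgn \<nu> ^ k) * (sqrt (\<bar>y\<bar> * p) * G / p)"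
      unfolding G_def sgb by simp
    then show ?thesis unfolding inv sqrt_match[OF p Gp Gh] .
  qed
  have nzf: "complex_of_real (sqrt (\<bar>y\<bar> * p) * Cc (int k)) \<noteq> 0"
    using p C[of k] \<kappa> zz by (auto simp: y_def)
  have "S y (lam * q0 powi (2 * int k)) \<nu> lam = of_real (sqrt (\<bar>y\<bar> * p) * Cc (int k)) * s k y"
    unfolding s_def p_def[symmetric] using nzf by simp
  also have "\<dots> = of_real (sqrt (\<bar>y\<bar> * p) * Cc (int k) * (Ks * (T / br ^ k) / p)) * P_fun (int k) (of_real y) c d (of_real rr)"
    unfolding E of_real_mult by (simp only: mult.assoc)
  also have "\<dots> = of_real (sgn \<nu>) powi int k * of_real (sqrt (\<bar>y\<bar> / p / h)) * P_fun (int k) (of_real y) c d (of_real rr)"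
    unfolding rl by simp
  finally show ?thesis unfolding hPh cs .
qed

text \<open>\<open>Q_solution\<close> determines S after division by tr^k. Since tr =
  -q^(1+\<tau>-\<sigma>)/\<nu>, the sign is (- sgn \<nu>)^k; the modulus is matched with hQ by
  \<open>Gh\<close>.\<close>

lemma coupling_Q:
  fixes k i :: int
  assumes S: "is_coupling_coefficients q0 \<tau> \<sigma> x S" and e: "\<nu> = lam" and \<kappa>: "\<kappa> \<in> {1, - zz}"
  defines "y \<equiv> - \<kappa> * rr powi i"
    and "c \<equiv> x * complex_of_real (q0 powr (1 + \<tau> - \<sigma>) / \<nu>)" and "d \<equiv> complex_of_real (q0 powr (1 + \<tau> - \<sigma>)) / (complex_of_real \<nu> * x)"
  shows "S y (lam * q0 powi (2 * k)) \<nu> lam = of_real (- sgn \<nu>) powi k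
    * csqrt (of_real \<bar>y\<bar> * w_fun (of_real y) c d (of_real rr) / hQ k c d (- 1) (of_real zz) (of_real rr))
    * Q_fun k (of_real y) c d (- 1) (of_real zz) (of_real rr)"
proof -
  have Q: "Br = - bt" "Ar = rr" "Br = ar * br / rr" using Q_params[OF e] by blast+
  have trn: "tr = - (q0 powr (1 + \<tau> - \<sigma>) / \<nu>)" unfolding tr_def using e by simp
  have c: "c = - of_real tr * x" and d: "d = - of_real tr / x"
    unfolding c_def d_def trn by simp_all
  define s where "s = (\<lambda>(k::int) y. S y (lam * q0 powi (2 * k)) \<nu> lam / of_real (sqrt (\<bar>y\<bar> * psi y) * Cc k))"
  have C: "Cc k > 0" for k by (rule Cc_sq(1)) (use e in simp)
  have sol: "L.solves k (s k)" for k unfolding s_def by (rule coupling_solves[OF S C])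
  have hA: "complex_of_real Ar = of_real rr" unfolding Q(2) ..
  have hB: "complex_of_real Br = of_real ar * of_real br / of_real rr" using arg_cong[OF Q(3), of complex_of_real] by simp
  have hB1: "complex_of_real Br \<noteq> 1"
  proof
    assume "complex_of_real Br = 1"
    then have "Br = 1" by simp
    then show False using Q(1) bt_pos by linarith
  qed
  define p where "p = psi y"
  have p: "p > 0" unfolding p_def y_def by (rule psi_lattice[OF \<kappa>])
  have den: "qpoch_inf (c * of_real y) (of_real rr) * qpoch_inf (d * of_real y) (of_real rr) = of_real p"
  proof -
    have e1: "c * of_real y = of_real (- tr * y) * x" "d * of_real y = of_real (- tr * y) / x" unfolding c d by simp_all
    show ?thesis unfolding e1 p_def psi_def nn_eq ..
  qed
  define R where "R = rr powi (- (k * (k + 1) div 2))"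
  have Rp: "R > 0" using rr by (simp add: R_def)
  have E: "s k y * of_real (tr powi k * R * qpoch_inf rr rr) = Q_fun k (of_real y) c d (- 1) (of_real zz) (of_real rr) / of_real p"
  proof -
    have "s k y * (of_real tr powi k * of_real rr powi (- (k * (k + 1) div 2)) * qpoch_inf (of_real rr) (of_real rr)) = Q_fun k (of_real y) c d (- 1) (of_real zz) (of_real rr) / (qpoch_inf (c * of_real y) (of_real rr) * qpoch_inf (d * of_real y) (of_real rr))"
      using L.Q_solution[OF hA hB hB1 \<kappa> sol, of k i] unfolding t_eq c d y_def .
    then show ?thesis unfolding den qinf R_def by simp
  qed
  define X where "X = qpoch_inf (- (rr powi (- k) / bt)) rr"
  define h where "h = zz * zz powi (- k) * R * X * (qpoch_inf rr rr)\<^sup>2 * (qtheta (- zz) rr / zz)"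
  have hQh: "hQ k c d (- 1) (of_real zz) (of_real rr) = of_real h"
  proof -
    have xnz: "x \<noteq> 0" using x1 by auto
    have th4: "qtheta (- 1 / of_real zz) (complex_of_real rr) = of_real (qtheta (- zz) rr / zz)"
    proof -
      have "qtheta (1 / (- zz)) rr = qtheta (- zz) rr / zz" using theta_inv[of "- zz"] zz by simp
      moreover have "- 1 / complex_of_real zz = of_real (1 / (- zz))" by simp
      ultimately show ?thesis by (simp only: qtheta_of_real)
    qed
    have "c * d * - 1 * of_real zz * of_real rr powi (- k - 1) = of_real (- (rr powi (- k) / bt))"
    proof -
      have "c * d * - 1 * of_real zz * of_real rr powi (- k - 1) = of_real (- (tr * tr) * zz * rr powi (- k - 1))"
        unfolding c d using xnz by simp
      also have "- (tr * tr) * zz * rr powi (- k - 1) = - (rr powi (- k) / bt)"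
        unfolding tr_sq power_int_diff[OF disjI1[OF rr_nz]] using zz bt_pos by (simp add: field_simps)
      finally show ?thesis .
    qed
    then have "hQ k c d (- 1) (of_real zz) (of_real rr) = of_real zz * (- (- 1 * of_real zz)) powi (- k) * of_real rr powi (- (k * (k + 1) div 2)) * of_real X * (of_real (qpoch_inf rr rr))\<^sup>2 * of_real (qtheta (- zz) rr / zz)"
      unfolding hQ_def th4 X_def by (simp only: qinf)
    then show ?thesis unfolding h_def R_def by simp
  qed
  define G where "G = Cc k / (\<bar>tr\<bar> powi k * R * qpoch_inf rr rr)"
  have Qi: "qpoch_inf rr rr > 0" by (rule pos(4)[OF coupling_params])
  have tp: "\<bar>tr\<bar> powi k > 0" using tr_nz by simp
  have Gp: "G > 0" unfolding G_def using C[of k] tp Rp Qi by simp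
  have om: "nn (rr / tr) * nn (- bt * tr) / (nn ar * nn br) = 1"
  proof -
    have b: "br = - bt * tr" using tr_eq unfolding Q(1) by (simp add: mult.commute)
    have "ar = zz * bt * (tr * tr) / tr" unfolding ar_def b using tr_nz by simp
    then have "ar = rr / tr" unfolding tr_sq using zz bt_pos by simp
    then show ?thesis using b om_pos by (simp add: mult_ac)
  qed
  \<comment> \<open>The product in hQ and the one in Cc form the theta function at u rr^(-k) with u
    = -1/bt; shifting by k and inverting u brings it to \<theta>(-bt).\<close>
  have XB: "X * qpoch_inf (Br * rr powi (1 + k)) rr * bt powi k * bt = qtheta (- bt) rr * R"
  proof -
    have bxne: "of_real br * x * of_real rr powi j \<noteq> 1" for j
    proof -
      have "br = rr / (tr * - zz)" using tr_eq unfolding Q(1) b'_eq2[symmetric] by (simp add: mult.commute)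
      then show ?thesis using unit_dual[of "- zz" j] by simp
    qed
    define u where "u = - 1 / bt"
    have unz: "u \<noteq> 0" using bt_pos by (simp add: u_def)
    have a1: "- (rr powi (- k) / bt) = u * rr powi (- k)" by (simp add: u_def)
    have a2: "Br * rr powi (1 + k) = rr / (u * rr powi (- k))"
      unfolding Q(1) u_def using bt_pos power_int_add[of rr 1 k] by (simp add: power_int_minus field_simps)
    have "X * qpoch_inf (Br * rr powi (1 + k)) rr = qtheta (u * rr powi (- k)) rr"
      unfolding X_def a1 a2 qtheta_def ..
    also have "\<dots> = (- u) powi k / rr powi (k * (k + 1) div 2) * qtheta u rr"
    proof -
      have "complex_of_real (qtheta (u * rr powi (- k)) rr) = qtheta (of_real u * of_real rr powi (- k)) (of_real rr)"
        unfolding qtheta_of_real[symmetric] by simp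
      also have "\<dots> = (- of_real u) powi k / of_real rr powi (k * (k + 1) div 2) * qtheta (of_real u) (of_real rr)"
        by (rule qtheta_shift_int[OF L0.nq L0.q_nz L0.x L0.a_nz L0.b bxne]) (use unz in simp)
      also have "\<dots> = of_real ((- u) powi k / rr powi (k * (k + 1) div 2) * qtheta u rr)"
        unfolding qtheta_of_real by simp
      finally show ?thesis by (simp only: of_real_eq_iff)
    qed
    also have "(- u) powi k = 1 / bt powi k" unfolding u_def by (simp add: power_int_one_over)
    also have "qtheta u rr = qtheta (- bt) rr / bt" unfolding u_def using theta_inv[of "- bt"] bt_pos by simp
    finally show ?thesis unfolding R_def power_int_minus using bt_pos by (simp add: field_simps)
  qed
  have Gh: "G\<^sup>2 * h = 1"
  proof -
    have t2k: "(\<bar>tr\<bar> powi k)\<^sup>2 = rr powi k / (zz powi k * bt powi k)"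
    proof -
      have "(\<bar>tr\<bar> powi k)\<^sup>2 = (tr * tr) powi k" by (simp add: power2_eq_square flip: power_int_mult_distrib)
      then show ?thesis unfolding tr_sq by (simp add: power_int_divide_distrib power_int_mult_distrib)
    qed
    define Bi where "Bi = qpoch_inf (Br * rr powi (1 + k)) rr"
    have Xe: "X * Bi * (bt powi k * bt) = qtheta (- bt) rr * R" using XB unfolding Bi_def by (simp only: mult.assoc)
    have C2: "(Cc k)\<^sup>2 = bt * rr powi k * Bi / (qtheta (- zz) rr * qtheta (- bt) rr)"
    proof -
      have "\<nu> \<noteq> lam \<Longrightarrow> k \<ge> 0" using e by blast
      from Cc_sq(2)[of k, OF this] have "(Cc k)\<^sup>2 = 1 * \<bar>Br\<bar> * rr powi k * Bi * (qpoch_inf rr rr)\<^sup>2 / ((qpoch_inf rr rr)\<^sup>2 * qtheta (- zz) rr * qtheta (- bt) rr)"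
        unfolding om Bi_def[symmetric] Q(2) .
      moreover have "\<bar>Br\<bar> = bt" unfolding Q(1) using bt_pos by simp
      moreover have "1 * b * w * B' * Q'\<^sup>2 / (Q'\<^sup>2 * u * v) = b * w * B' / (u * v)" if "Q' \<noteq> 0" for b w B' Q' u v :: real
        using that by simp
      moreover have "qpoch_inf rr rr \<noteq> 0" using Qi by simp
      ultimately show ?thesis by (simp only:)
    qed
    have gen: "b * rk * B' / (tz * tb) / (rk / (zk * bk) * R'\<^sup>2 * Qi'\<^sup>2) * (z' * (1 / zk) * R' * X' * Qi'\<^sup>2 * (tz / z')) = X' * B' * (bk * b) / (tb * R')"
      if "rk \<noteq> 0" "tz \<noteq> 0" "tb \<noteq> 0" "zk \<noteq> 0" "bk \<noteq> 0" "R' \<noteq> 0" "Qi' \<noteq> 0" "z' \<noteq> 0" for b rk B' tz tb zk bk R' Qi' z' X' :: real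
      using that by (simp add: field_simps power2_eq_square)
    have zk: "zz powi (- k) = 1 / zz powi k" by (simp add: power_int_minus_divide)
    have "G\<^sup>2 * h = X * Bi * (bt powi k * bt) / (qtheta (- bt) rr * R)"
      unfolding G_def h_def power_divide power_mult_distrib t2k C2 zk
      by (rule gen) (use rr zz bt_pos Rp Qi theta_z_pos pos(6)[OF coupling_params] in \<open>auto simp: less_imp_neq[THEN not_sym]\<close>)
    then show ?thesis unfolding Xe using Rp pos(6)[OF coupling_params] by simp
  qed
  have hpos: "h > 0"
  proof -
    have "G\<^sup>2 > 0" using Gp by simp
    then show ?thesis using Gh by (metis zero_less_mult_pos zero_less_one)
  qed
  have w: "of_real \<bar>y\<bar> * w_fun (of_real y) c d (of_real rr) / of_real h = complex_of_real (\<bar>y\<bar> / p / h)"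
    unfolding w_fun_def den by simp
  have cs: "csqrt (of_real \<bar>y\<bar> * w_fun (of_real y) c d (of_real rr) / of_real h) = of_real (sqrt (\<bar>y\<bar> / p / h))"
    unfolding w using of_real_sqrt[of "\<bar>y\<bar> / p / h"] p hpos by simp
  have sgt: "tr powi k = (- sgn \<nu>) powi k * \<bar>tr\<bar> powi k"
  proof -
    have "q0 powr (1 + \<tau> - \<sigma>) > 0" using q0 by simp
    then have "- sgn \<nu> * \<bar>tr\<bar> = tr" using lam_nz unfolding trn by (cases "\<nu> > 0") (auto simp: abs_if divide_less_0_iff zero_less_divide_iff)
    then show ?thesis unfolding power_int_mult_distrib[symmetric] by simp
  qed
  have sg1: "(- sgn \<nu>) powi k * (- sgn \<nu>) powi k = 1"
    unfolding power_int_mult_distrib[symmetric] using lam_nz by (simp add: sgn_if)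
  have nzf: "complex_of_real (sqrt (\<bar>y\<bar> * p) * Cc k) \<noteq> 0" "complex_of_real (tr powi k * R * qpoch_inf rr rr) \<noteq> 0"
    using p C[of k] \<kappa> zz tr_nz Rp Qi by (auto simp: y_def)
  have rl: "sqrt (\<bar>y\<bar> * p) * Cc k / (tr powi k * R * qpoch_inf rr rr) / p = (- sgn \<nu>) powi k * sqrt (\<bar>y\<bar> / p / h)"
  proof -
    have s0: "sgn \<nu> \<noteq> 0" using lam_nz by (simp add: sgn_if)
    have snz: "(- sgn \<nu>) powi k \<noteq> 0" using s0 by simp
    have inv: "1 / (- sgn \<nu>) powi k = (- sgn \<nu>) powi k" using sg1 snz by (simp only: divide_eq_eq if_False) simp
    have "sqrt (\<bar>y\<bar> * p) * Cc k / (tr powi k * R * qpoch_inf rr rr) / p = (1 / (- sgn \<nu>) powi k) * (sqrt (\<bar>y\<bar> * p) * G / p)"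
      unfolding G_def sgt by (simp only: divide_divide_eq_left times_divide_eq_right times_divide_eq_left mult_ac mult_1_left mult_1_right)
    then show ?thesis unfolding inv sqrt_match[OF p Gp Gh] .
  qed
  have sE: "s k y = Q_fun k (of_real y) c d (- 1) (of_real zz) (of_real rr) / of_real p / of_real (tr powi k * R * qpoch_inf rr rr)"
    by (rule iffD2[OF nonzero_eq_divide_eq[OF nzf(2)] E])
  have "S y (lam * q0 powi (2 * k)) \<nu> lam = of_real (sqrt (\<bar>y\<bar> * p) * Cc k) * s k y"
    unfolding s_def p_def[symmetric] using nzf(1) by simp
  also have "\<dots> = of_real (sqrt (\<bar>y\<bar> * p) * Cc k / (tr powi k * R * qpoch_inf rr rr) / p) * Q_fun k (of_real y) c d (- 1) (of_real zz) (of_real rr)"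
  proof -
    have "f * (Q' / p' / g) = f / g / p' * Q'" for f Q' p' g :: complex by simp
    then show ?thesis unfolding sE of_real_divide[of _ p] of_real_divide[of _ "tr powi k * R * qpoch_inf rr rr"] .
  qed
  also have "\<dots> = of_real (- sgn \<nu>) powi k * of_real (sqrt (\<bar>y\<bar> / p / h)) * Q_fun k (of_real y) c d (- 1) (of_real zz) (of_real rr)"
    unfolding rl by simp
  finally show ?thesis unfolding hQh cs .
qed

end

text \<open>The conditions at x = 1 and x = -1 exclude the parameters for which a denominator of the
  weights in c^(\<tau>,\<sigma>) can vanish on the lattice. In the case \<nu> = \<lambda> the sign
  factor is (- sgn \<nu>)^k, the sign of \<open>tr powi k\<close> in
  \<open>coupling_Q\<close>.\<close>

theorem theorem5p4:
  fixes q \<tau> \<sigma> y lam \<nu> \<xi> :: real and x :: complex and k :: int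
    and S :: "real \<Rightarrow> real \<Rightarrow> real \<Rightarrow> real \<Rightarrow> complex"
  assumes "0 < q" and "q < 1"
    and "norm x = 1"
    and "x = 1 \<Longrightarrow> \<nexists>n::int. \<tau> - \<sigma> = 2 * of_int n + 1"
    and "x = -1 \<Longrightarrow> \<nexists>n::int. \<tau> + \<sigma> = 2 * of_int n + 1"
    and "y \<in> lattice q \<sigma>"
    and "lam \<in> {-1, q powr (2 * \<tau>)}" and "\<nu> \<in> {-1, q powr (2 * \<tau>)}" and "\<xi> \<in> {-1, q powr (2 * \<tau>)}"
    and "is_coupling_coefficients q \<tau> \<sigma> x S"
  shows "(\<xi> \<noteq> lam \<longrightarrow> S y (\<xi> * q powi (2 * k)) \<nu> lam = 0) \<and>
    (\<xi> = lam \<longrightarrow> S y (\<xi> * q powi (2 * k)) \<nu> lam =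
      (if \<nu> \<noteq> lam then
         (let c = - complex_of_real (\<nu> * q powr (1 - \<tau> - \<sigma>)) / x;
              d = - complex_of_real \<nu> * x * complex_of_real (q powr (1 - \<tau> - \<sigma>));
              zm = -1; zp = complex_of_real (q powr (2 * \<sigma>)); q2 = complex_of_real (q\<^sup>2)
          in complex_of_real (sgn \<nu>) powi k
             * csqrt (complex_of_real \<bar>y\<bar> * w_fun (complex_of_real y) c d q2 / hP k c d zm zp q2)
             * P_fun k (complex_of_real y) c d q2)
       else
         (let c = x * complex_of_real (q powr (1 + \<tau> - \<sigma>) / \<nu>);
              d = complex_of_real (q powr (1 + \<tau> - \<sigma>)) / (complex_of_real \<nu> * x);
              zm = -1; zp = complex_of_real (q powr (2 * \<sigma>)); q2 = complex_of_real (q\<^sup>2)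
          in complex_of_real (- sgn \<nu>) powi k
             * csqrt (complex_of_real \<bar>y\<bar> * w_fun (complex_of_real y) c d q2 / hQ k c d zm zp q2)
             * Q_fun k (complex_of_real y) c d zm zp q2)))"
proof -
  have e: "q powi (2 * n) = q\<^sup>2 powi n" for n by (simp add: power_int_mult)
  \<comment> \<open>Every lattice point is written as -\<kappa> q^(2i) with \<kappa> in {1, -q^(2
    \<sigma>)}, the form used in the lattice relations.\<close>
  have "(\<exists>n. y = - 1 * q\<^sup>2 powi n) \<or> (\<exists>n. y = - (- (q powr (2 * \<sigma>))) * q\<^sup>2 powi n)"
    using assms(6) unfolding lattice_def e by auto
  then obtain \<kappa> i where k: "\<kappa> \<in> {1, - (q powr (2 * \<sigma>))}" "y = - \<kappa> * q\<^sup>2 powi i" by blast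
  show ?thesis
  proof (intro conjI impI)
    assume ne: "\<xi> \<noteq> lam"
    show "S y (\<xi> * q powi (2 * k)) \<nu> lam = 0"
      unfolding k(2) by (rule coupling_zero) (rule assms refl ne k | assumption)+
  next
    assume e: "\<xi> = lam"
    show "S y (\<xi> * q powi (2 * k)) \<nu> lam =
      (if \<nu> \<noteq> lam then
         (let c = - complex_of_real (\<nu> * q powr (1 - \<tau> - \<sigma>)) / x;
              d = - complex_of_real \<nu> * x * complex_of_real (q powr (1 - \<tau> - \<sigma>));
              zm = -1; zp = complex_of_real (q powr (2 * \<sigma>)); q2 = complex_of_real (q\<^sup>2)
          in complex_of_real (sgn \<nu>) powi k
             * csqrt (complex_of_real \<bar>y\<bar> * w_fun (complex_of_real y) c d q2 / hP k c d zm zp q2)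
             * P_fun k (complex_of_real y) c d q2)
       else
         (let c = x * complex_of_real (q powr (1 + \<tau> - \<sigma>) / \<nu>);
              d = complex_of_real (q powr (1 + \<tau> - \<sigma>)) / (complex_of_real \<nu> * x);
              zm = -1; zp = complex_of_real (q powr (2 * \<sigma>)); q2 = complex_of_real (q\<^sup>2)
          in complex_of_real (- sgn \<nu>) powi k
             * csqrt (complex_of_real \<bar>y\<bar> * w_fun (complex_of_real y) c d q2 / hQ k c d zm zp q2)
             * Q_fun k (complex_of_real y) c d zm zp q2))"
    proof (cases "\<nu> = lam")
      case True
      then have nn: "\<not> \<nu> \<noteq> lam" by simp
      show ?thesis unfolding e if_not_P[OF nn] Let_def k(2)
        by (rule coupling_Q) (rule assms refl True k | assumption)+
    next
      case False
      show ?thesis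
      proof (cases "k < 0")
        case neg: True
        have 0: "S y (lam * q powi (2 * k)) \<nu> lam = 0"
          unfolding k(2) by (rule coupling_zero_neg) (rule assms refl False neg k | assumption)+
        show ?thesis unfolding e 0 if_P[OF False] Let_def P_fun_def if_P[OF neg] mult_zero_right ..
      next
        case nonneg: False
        then obtain j where j: "k = int j" using nonneg_int_cases[of k] by auto
        show ?thesis unfolding e if_P[OF False] Let_def k(2) j
          by (rule coupling_P) (rule assms refl False k | assumption)+
      qed
    qed
  qed
qed

end
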